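(* Let $f:\mathbb{P}^2\dashrightarrow\mathbb{P}^2$ be a dominant rational map with equal algebraic and topological degrees $d(f)=\lambda_2(f)\ge 2$. Then there is a countable union $Z$ of proper algebraic subsets of $\mathrm{Aut}(\mathbb{P}^2)$ such that for every $T\in\mathrm{Aut}(\mathbb{P}^2)\setminus Z$, the map $f_T:=T\circ f$ is algebraically stable (so $\lambda_1(f_T)=\lambda_2(f_T)$), and there is no $f_T$-invariant singular holomorphic foliation of $\mathbb{P}^2$.
   Context: A dominant rational map $f=[f_1:f_2:f_3]$ of $\mathbb{P}^2$ has algebraic degree $d(f)$ = common degree of the homogeneous polynomials $f_j$ (no common nonconstant factor), topological degree $\lambda_2(f)$ = number of preimages of a generic point, first dynamical degree $\lambda_1(f)=\lim_n d(f^n)^{1/n}$. $f$ is algebraically stable if $d(f^n)=d(f)^n$ for all $n\ge 1$. $f_T:=T\circ f$ for $T\in\mathrm{Aut}(\mathbb{P}^2)\cong PGL_3(\mathbb{C})$. A singular holomorphic foliation $\mathcal F$ is $f$-invariant if $f^*\mathcal F=\mathcal F$. *)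

theory Defs
  imports "HOL-Analysis.Analysis"
begin

text \<open>Polynomial functions over the complex numbers in finitely many variables
  (indexed by a finite type). Since C is infinite, polynomial functions
  correspond bijectively to polynomials.\<close>

definition hompoly :: "nat \<Rightarrow> (('i::finite \<Rightarrow> complex) \<Rightarrow> complex) \<Rightarrow> bool" where
  "hompoly k P \<longleftrightarrow> (\<exists>c :: ('i \<Rightarrow> nat) \<Rightarrow> complex. \<forall>x.
     P x = (\<Sum>e\<in>{e. sum e UNIV = k}. c e * (\<Prod>i\<in>UNIV. x i ^ e i)))"

definition polyfun :: "(('i::finite \<Rightarrow> complex) \<Rightarrow> complex) \<Rightarrow> bool" where
  "polyfun P \<longleftrightarrow> (\<exists>N. \<exists>c :: ('i \<Rightarrow> nat) \<Rightarrow> complex. \<forall>x.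
     P x = (\<Sum>e\<in>{e. sum e UNIV \<le> N}. c e * (\<Prod>i\<in>UNIV. x i ^ e i)))"

definition hpoly3 :: "nat \<Rightarrow> (complex^3 \<Rightarrow> complex) \<Rightarrow> bool" where
  "hpoly3 k p \<longleftrightarrow> hompoly k (\<lambda>v::3 \<Rightarrow> complex. p (vec_lambda v))"

definition polyfun3 :: "(complex^3 \<Rightarrow> complex) \<Rightarrow> bool" where
  "polyfun3 p \<longleftrightarrow> polyfun (\<lambda>v::3 \<Rightarrow> complex. p (vec_lambda v))"

definition mhpoly :: "nat \<Rightarrow> (complex^3^3 \<Rightarrow> complex) \<Rightarrow> bool" where
  "mhpoly k P \<longleftrightarrow> hompoly k (\<lambda>v::(3 \<times> 3) \<Rightarrow> complex. P (\<chi> i j. v (i, j)))"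

text \<open>A rational self-map of P^2 is represented by a triple F = (F_1,F_2,F_3) of
  homogeneous polynomials of a common degree k, not all identically zero.\<close>
definition ratmap :: "nat \<Rightarrow> (complex^3 \<Rightarrow> complex^3) \<Rightarrow> bool" where
  "ratmap k F \<longleftrightarrow> (\<forall>j. hpoly3 k (\<lambda>x. F x $ j)) \<and> (\<exists>x. F x \<noteq> 0)"

definition common_factor :: "(complex^3 \<Rightarrow> complex^3) \<Rightarrow> bool" where
  "common_factor F \<longleftrightarrow> (\<exists>g. polyfun3 g \<and> \<not> (\<exists>c. \<forall>x. g x = c) \<and>
     (\<forall>j. \<exists>h. polyfun3 h \<and> (\<forall>x. F x $ j = g x * h x)))"

definition reduced :: "(complex^3 \<Rightarrow> complex^3) \<Rightarrow> bool" where
  "reduced F \<longleftrightarrow> \<not> common_factor F"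

text \<open>Two triples are proportional (define the same rational map / the same
  1-form up to a rational factor).\<close>
definition proportional :: "(complex^3 \<Rightarrow> complex^3) \<Rightarrow> (complex^3 \<Rightarrow> complex^3) \<Rightarrow> bool" where
  "proportional F G \<longleftrightarrow> (\<forall>x i j. F x $ i * G x $ j = F x $ j * G x $ i)"

definition alg_deg :: "(complex^3 \<Rightarrow> complex^3) \<Rightarrow> nat" where
  "alg_deg F = (THE d. \<exists>G. ratmap d G \<and> reduced G \<and> proportional F G)"

definition dominant :: "(complex^3 \<Rightarrow> complex^3) \<Rightarrow> bool" where
  "dominant F \<longleftrightarrow> \<not> (\<exists>k h. hpoly3 k h \<and> (\<exists>x. h x \<noteq> 0) \<and> (\<forall>x. h (F x) = 0))"

definition proj_cls :: "complex^3 \<Rightarrow> (complex^3) set" where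
  "proj_cls x = {c *s x | c. c \<noteq> 0}"

text \<open>Preimages of [p] in P^2 minus the indeterminacy set.\<close>
definition preim :: "(complex^3 \<Rightarrow> complex^3) \<Rightarrow> complex^3 \<Rightarrow> (complex^3) set set" where
  "preim F p = {proj_cls x | x. x \<noteq> 0 \<and> F x \<noteq> 0 \<and> proj_cls (F x) = proj_cls p}"

definition topdeg :: "(complex^3 \<Rightarrow> complex^3) \<Rightarrow> nat" where
  "topdeg F = (THE n. \<exists>k h. hpoly3 k h \<and> (\<exists>x. h x \<noteq> 0) \<and>
      (\<forall>p. p \<noteq> 0 \<and> h p \<noteq> 0 \<longrightarrow> card (preim F p) = n))"

definition alg_stable :: "(complex^3 \<Rightarrow> complex^3) \<Rightarrow> bool" where
  "alg_stable F \<longleftrightarrow> (\<forall>n\<ge>1. alg_deg (F ^^ n) = alg_deg F ^ n)"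

definition dyn_deg1 :: "(complex^3 \<Rightarrow> complex^3) \<Rightarrow> real" where
  "dyn_deg1 F = lim (\<lambda>n. real (alg_deg (F ^^ n)) powr (1 / real n))"

definition pd :: "3 \<Rightarrow> (complex^3 \<Rightarrow> complex) \<Rightarrow> complex^3 \<Rightarrow> complex" where
  "pd j p x = deriv (\<lambda>t. p (x + axis j t)) 0"

text \<open>A singular holomorphic foliation of P^2 (of degree k-1) is given by a
  homogeneous polynomial 1-form w = A dx + B dy + C dz on C^3 with A,B,C homogeneous
  of degree k \<ge> 1, not all zero, without common factor (singular set of codim 2),
  satisfying the Euler condition xA + yB + zC = 0.\<close>
definition foliation_form :: "(complex^3 \<Rightarrow> complex^3) \<Rightarrow> bool" where
  "foliation_form w \<longleftrightarrow> (\<exists>k\<ge>1. ratmap k w) \<and> reduced w \<and>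
     (\<forall>x. (\<Sum>i\<in>UNIV. x $ i * w x $ i) = 0)"

definition pullback :: "(complex^3 \<Rightarrow> complex^3) \<Rightarrow> (complex^3 \<Rightarrow> complex^3) \<Rightarrow> complex^3 \<Rightarrow> complex^3" where
  "pullback F w = (\<lambda>x. \<chi> j. \<Sum>i\<in>UNIV. w (F x) $ i * pd j (\<lambda>y. F y $ i) x)"

text \<open>F^* (foliation of w) = foliation of w  iff  F^* w is nonzero and F^* w \<and> w = 0.\<close>
definition invariant_foliation :: "(complex^3 \<Rightarrow> complex^3) \<Rightarrow> (complex^3 \<Rightarrow> complex^3) \<Rightarrow> bool" where
  "invariant_foliation F w \<longleftrightarrow> (\<exists>x. pullback F w x \<noteq> 0) \<and> proportional (pullback F w) w"

end

theory Submission
  imports Defs "HOL-Computational_Algebra.Polynomial_Factorial" "HOL-Computational_Algebra.Field_as_Ring"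
    "HOL-Computational_Algebra.Fundamental_Theorem_Algebra"
begin

text \<open>
  Algebraic stability: \<open>F\<close> contracts only finitely many curves, to points \<open>b\<close>, and the iterates of
  \<open>M \<circ> F\<close> stay reduced, hence of degree \<open>d ^ n\<close>, as long as no orbit of a point \<open>M b\<close> meets the
  indeterminacy set. This excludes countably many hypersurfaces of matrices \<open>M\<close>, proper ones since for
  \<open>M\<close> of rank one every orbit is constant. Composing with \<open>M\<close> does not change the topological degree.

  Foliations: if \<open>w\<close> is invariant then \<open>(M \<circ> F)\<^sup>* w = \<phi> w\<close>, where all prime factors of \<open>\<phi>\<close> divide the
  Jacobian of \<open>F\<close>; up to scalars there are thus only countably many \<open>\<phi>\<close>. For a fixed \<open>\<phi>\<close> and a fixed
  degree of \<open>w\<close> the matrices \<open>M\<close> admitting such a \<open>w\<close> lie in an algebraic set, by the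
  Popov-Belevitch-Hautus criterion for eigenvectors. If that set contained every \<open>M\<close>, one could choose
  \<open>M\<close> such that \<open>M \<circ> F\<close> has a generic point as a fixed point with unipotent differential; letting the
  differential tend to the identity, \<open>\<phi>\<close> would divide the pull-backs of two different pencils of lines.
  Then \<open>F\<close> would be linear, which contradicts \<open>d \<ge> 2\<close>.
\<close>

subsection \<open>Homogeneous polynomial functions\<close>

text \<open>Two points shape the argument. First, the existence of an eigenvector has to become a
  condition on \<open>M\<close> alone, while its eigenvalue varies with \<open>M\<close> and the
  cofactor is known only up to a scalar. \<open>bad_matrix\<close> therefore quantifies over the
  scalar \<open>c\<close>, and the Hautus test removes it again. The resulting forms in the entries
  of \<open>M\<close> are proper as soon as they are nonzero at one matrix, invertible or not,
  because \<open>det\<close> is a nonzero form as well. Second, a limit of invariant forms can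
  vanish or lose its invariance. In a frame where the fixed point is \<open>axis 3 1\<close>, the
  map is a shear composed with a map \<open>G\<close> that does not depend on \<open>t\<close>. The
  pair \<open>a = shear^* w\<close>, \<open>b = c w\<close> satisfies
  \<open>G^* a = \<psi> b\<close>, an equation without \<open>t\<close>, and normalizing the pair
  jointly makes it converge along a subsequence. In the affine chart the shear is \<open>t\<close>
  times a Jordan block, and \<open>t\<close> tends to 0: the factor \<open>t\<close> leaves a single
  jet in the limit, and the Jordan block reduces that jet to a combination of two pencils of lines,
  up to monomial factors. Varying the frame isolates one pencil.\<close>

abbreviation monom_fun :: "('i::finite \<Rightarrow> nat) \<Rightarrow> ('i \<Rightarrow> complex) \<Rightarrow> complex" where
  "monom_fun e x \<equiv> \<Prod>i\<in>UNIV. x i ^ e i"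

lemma finite_exponents_eq: "finite {e :: 'i::finite \<Rightarrow> nat. sum e UNIV = k}"
proof -
  have "{e :: 'i \<Rightarrow> nat. sum e UNIV = k} \<subseteq> Pi\<^sub>E UNIV (\<lambda>_. {..k})"
    by (auto simp: PiE_UNIV_domain intro!: member_le_sum)
  then show ?thesis
    by (rule finite_subset) (simp add: finite_PiE)
qed

lemma finite_exponents_le: "finite {e :: 'i::finite \<Rightarrow> nat. sum e UNIV \<le> k}"
proof -
  have "{e :: 'i \<Rightarrow> nat. sum e UNIV \<le> k} = (\<Union>j\<in>{..k}. {e. sum e UNIV = j})" by auto
  then show ?thesis by (simp add: finite_exponents_eq)
qed

text \<open>The exponents \<open>E a\<close> may repeat; grouping equal ones gives the coefficients
  that the definition asks for. The closure properties below then only have to exhibit some sum of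
  monomials.\<close>

lemma hompoly_sum_mono:
  fixes E :: "'a \<Rightarrow> ('i::finite \<Rightarrow> nat)"
  assumes "finite A" "\<And>a. a \<in> A \<Longrightarrow> sum (E a) UNIV = k"
    and "\<And>x. P x = (\<Sum>a\<in>A. c a * monom_fun (E a) x)"
  shows "hompoly k P"
  unfolding hompoly_def
proof (intro exI allI)
  fix x
  have "P x = (\<Sum>e\<in>{e. sum e UNIV = k}. \<Sum>a\<in>{a\<in>A. E a = e}. c a * monom_fun (E a) x)"
    unfolding assms(3)
    by (rule sum.group[symmetric]) (use assms finite_exponents_eq in auto)
  also have "\<dots> = (\<Sum>e\<in>{e. sum e UNIV = k}. (\<Sum>a\<in>{a\<in>A. E a = e}. c a) * monom_fun e x)"
    by (intro sum.cong refl) (auto simp: sum_distrib_right intro!: sum.cong)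
  finally show "P x = (\<Sum>e\<in>{e. sum e UNIV = k}. (\<Sum>a\<in>{a\<in>A. E a = e}. c a) * monom_fun e x)" .
qed

lemma hompoly_zero: "hompoly k (\<lambda>x::'i::finite \<Rightarrow> complex. 0)"
  by (rule hompoly_sum_mono[where A="{}"]) auto

lemma hompoly_const: "hompoly 0 (\<lambda>x::'i::finite \<Rightarrow> complex. a)"
  by (rule hompoly_sum_mono[where A="{()}" and E="\<lambda>_ _. 0" and c="\<lambda>_. a"]) auto

lemma hompoly_var: "hompoly 1 (\<lambda>x::'i::finite \<Rightarrow> complex. x i)"
proof (rule hompoly_sum_mono[where A="{()}" and E="\<lambda>_ j. if j = i then 1 else 0" and c="\<lambda>_. 1"])
  fix x :: "'i \<Rightarrow> complex"
  have "(\<Prod>j\<in>UNIV. x j ^ (if j = i then 1 else 0)) = (\<Prod>j\<in>UNIV. (if j = i then x j else 1))"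
    by (intro prod.cong) auto
  then show "x i = (\<Sum>a\<in>{()}. 1 * monom_fun (\<lambda>j. if j = i then 1 else 0) x)"
    by simp
qed auto

lemma hompoly_scale:
  assumes "hompoly k P" shows "hompoly k (\<lambda>x. a * P x)"
proof -
  obtain c where c: "\<And>x. P x = (\<Sum>e\<in>{e. sum e UNIV = k}. c e * monom_fun e x)"
    using assms unfolding hompoly_def by blast
  show ?thesis
    by (rule hompoly_sum_mono[where A="{e. sum e UNIV = k}" and E=id and c="\<lambda>e. a * c e"])
      (auto simp: finite_exponents_eq c sum_distrib_left mult.assoc)
qed

lemma hompoly_add:
  assumes "hompoly k P" "hompoly k Q" shows "hompoly k (\<lambda>x. P x + Q x)"
proof -
  obtain c where c: "\<And>x. P x = (\<Sum>e\<in>{e. sum e UNIV = k}. c e * monom_fun e x)"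
    using assms unfolding hompoly_def by blast
  obtain d where d: "\<And>x. Q x = (\<Sum>e\<in>{e. sum e UNIV = k}. d e * monom_fun e x)"
    using assms unfolding hompoly_def by blast
  show ?thesis
    by (rule hompoly_sum_mono[where A="{e. sum e UNIV = k}" and E=id and c="\<lambda>e. c e + d e"])
      (auto simp: finite_exponents_eq c d sum.distrib distrib_right)
qed

lemma hompoly_mult:
  assumes "hompoly k P" "hompoly l Q" shows "hompoly (k + l) (\<lambda>x. P x * Q x)"
proof -
  obtain c where c: "\<And>x. P x = (\<Sum>e\<in>{e. sum e UNIV = k}. c e * monom_fun e x)"
    using assms unfolding hompoly_def by blast
  obtain d where d: "\<And>x. Q x = (\<Sum>e\<in>{e. sum e UNIV = l}. d e * monom_fun e x)"
    using assms unfolding hompoly_def by blast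
  show ?thesis
  proof (rule hompoly_sum_mono[where A="{e. sum e UNIV = k} \<times> {e. sum e UNIV = l}"
        and E="\<lambda>(e,f) i. e i + f i" and c="\<lambda>(e,f). c e * d f"])
    show "P x * Q x = (\<Sum>a\<in>{e. sum e UNIV = k} \<times> {e. sum e UNIV = l}.
            (case a of (e, f) \<Rightarrow> c e * d f) * monom_fun (case a of (e, f) \<Rightarrow> \<lambda>i. e i + f i) x)" for x
      unfolding c d sum_product sum.cartesian_product
      by (intro sum.cong refl) (auto simp: power_add prod.distrib algebra_simps)
  qed (auto simp: finite_exponents_eq sum.distrib)
qed

lemma hompoly_sum:
  assumes "\<And>a. a \<in> A \<Longrightarrow> hompoly k (P a)" shows "hompoly k (\<lambda>x. \<Sum>a\<in>A. P a x)"
  using assms by (induction A rule: infinite_finite_induct) (auto intro: hompoly_zero hompoly_add)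

lemma hompoly_power:
  assumes "hompoly k P" shows "hompoly (k * n) (\<lambda>x. P x ^ n)"
proof (induction n)
  case (Suc n)
  from hompoly_mult[OF assms this] show ?case by (simp add: algebra_simps)
qed (simp add: hompoly_const)

lemma hompoly_prod:
  assumes "\<And>a. a \<in> A \<Longrightarrow> hompoly (k a) (P a)" shows "hompoly (\<Sum>a\<in>A. k a) (\<lambda>x. \<Prod>a\<in>A. P a x)"
  using assms by (induction A rule: infinite_finite_induct) (auto intro: hompoly_const hompoly_mult)

lemma hompoly_homogeneous:
  assumes "hompoly k P" shows "P (\<lambda>i. t * x i) = t ^ k * P x"
proof -
  obtain c where c: "\<And>x. P x = (\<Sum>e\<in>{e. sum e UNIV = k}. c e * monom_fun e x)"
    using assms unfolding hompoly_def by blast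
  show ?thesis unfolding c sum_distrib_left
    by (intro sum.cong refl) (auto simp: power_mult_distrib prod.distrib algebra_simps power_sum[symmetric])
qed

lemma hompoly_compose:
  assumes P: "hompoly k P" and g: "\<And>i. hompoly n (\<lambda>x. g x i)"
  shows "hompoly (k * n) (\<lambda>x. P (g x))"
proof -
  obtain c where c: "\<And>x. P x = (\<Sum>e\<in>{e. sum e UNIV = k}. c e * monom_fun e x)"
    using assms unfolding hompoly_def by blast
  have "hompoly (k * n) (\<lambda>x. c e * monom_fun e (g x))" if "sum e UNIV = k" for e
  proof -
    have "hompoly (\<Sum>i\<in>UNIV. n * e i) (\<lambda>x. monom_fun e (g x))"
      by (intro hompoly_prod hompoly_power g)
    also have "(\<Sum>i\<in>UNIV. n * e i) = k * n"
      using that by (simp add: sum_distrib_left[symmetric])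
    finally show ?thesis by (rule hompoly_scale)
  qed
  then show ?thesis unfolding c by (intro hompoly_sum) auto
qed

lemma polyfun_iff_hompolys:
  "polyfun P \<longleftrightarrow> (\<exists>N p. (\<forall>i. hompoly i (p i)) \<and> (\<forall>x. P x = (\<Sum>i\<le>N. p i x)))"
proof
  assume "polyfun P"
  then obtain N c where c: "\<And>x. P x = (\<Sum>e\<in>{e. sum e UNIV \<le> N}. c e * monom_fun e x)"
    unfolding polyfun_def by blast
  let ?p = "\<lambda>i x. \<Sum>e\<in>{e. sum e UNIV = i}. c e * monom_fun e x"
  have "P x = (\<Sum>i\<le>N. ?p i x)" for x
  proof -
    have "P x = (\<Sum>i\<le>N. \<Sum>e\<in>{e\<in>{e. sum e UNIV \<le> N}. sum e UNIV = i}. c e * monom_fun e x)"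
      unfolding c by (rule sum.group[symmetric]) (auto simp: finite_exponents_le)
    also have "\<dots> = (\<Sum>i\<le>N. ?p i x)" by (intro sum.cong refl) auto
    finally show ?thesis .
  qed
  moreover have "hompoly i (?p i)" for i unfolding hompoly_def by blast
  ultimately show "\<exists>N p. (\<forall>i. hompoly i (p i)) \<and> (\<forall>x. P x = (\<Sum>i\<le>N. p i x))"
    by (intro exI[of _ N] exI[of _ ?p]) blast
next
  assume "\<exists>N p. (\<forall>i. hompoly i (p i)) \<and> (\<forall>x. P x = (\<Sum>i\<le>N. p i x))"
  then obtain N p where p: "\<And>i. hompoly i (p i)" "\<And>x. P x = (\<Sum>i\<le>N. p i x)" by blast
  from p(1) have "\<forall>i. \<exists>c. \<forall>x. p i x = (\<Sum>e\<in>{e. sum e UNIV = i}. c e * monom_fun e x)"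
    unfolding hompoly_def by blast
  from choice[OF this] obtain c
    where c: "\<And>i x. p i x = (\<Sum>e\<in>{e. sum e UNIV = i}. c i e * monom_fun e x)" by blast
  have "P x = (\<Sum>e\<in>{e. sum e UNIV \<le> N}. c (sum e UNIV) e * monom_fun e x)" for x
  proof -
    have "(\<Sum>e\<in>{e. sum e UNIV \<le> N}. c (sum e UNIV) e * monom_fun e x)
        = (\<Sum>i\<le>N. \<Sum>e\<in>{e\<in>{e. sum e UNIV \<le> N}. sum e UNIV = i}. c (sum e UNIV) e * monom_fun e x)"
      by (rule sum.group[symmetric]) (auto simp: finite_exponents_le)
    also have "\<dots> = (\<Sum>i\<le>N. p i x)" unfolding c by (intro sum.cong refl) auto
    finally show ?thesis using p by simp
  qed
  then show "polyfun P" unfolding polyfun_def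
    by (intro exI[of _ N] exI[of _ "\<lambda>e. c (sum e UNIV) e"]) blast
qed

section \<open>Forms and polynomial functions on C^3, forms on matrices\<close>

lemma hpoly3_homogeneous: "hpoly3 k p \<Longrightarrow> p (t *s x) = t ^ k * p x"
  unfolding hpoly3_def using hompoly_homogeneous[of k "\<lambda>v. p (vec_lambda v)" t "vec_nth x"]
  by (simp add: vector_scalar_mult_def)

lemma vec_nth_vec_lambda: "vec_nth (vec_lambda v) = v"
  by (simp add: fun_eq_iff)

lemma polyfun3_iff_hpoly3s:
  "polyfun3 P \<longleftrightarrow> (\<exists>N p. (\<forall>i. hpoly3 i (p i)) \<and> (\<forall>x. P x = (\<Sum>i\<le>N. p i x)))"
proof -
  have "polyfun3 P \<longleftrightarrow> (\<exists>N p. (\<forall>i. hompoly i (p i)) \<and> (\<forall>x. P (vec_lambda x) = (\<Sum>i\<le>N. p i x)))"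
    unfolding polyfun3_def polyfun_iff_hompolys ..
  also have "\<dots> \<longleftrightarrow> (\<exists>N p. (\<forall>i. hpoly3 i (p i)) \<and> (\<forall>x. P x = (\<Sum>i\<le>N. p i x)))"
  proof safe
    fix N p
    assume p: "\<forall>i. hompoly i (p i)" and P: "\<forall>x. P (vec_lambda x) = (\<Sum>i\<le>N. p i x)"
    have "P x = (\<Sum>i\<le>N. p i (vec_nth x))" for x
      using P[rule_format, of "vec_nth x"] by simp
    moreover have "hpoly3 i (\<lambda>x. p i (vec_nth x))" for i
      using p by (simp add: hpoly3_def vec_nth_vec_lambda)
    ultimately show "\<exists>N p. (\<forall>i. hpoly3 i (p i)) \<and> (\<forall>x. P x = (\<Sum>i\<le>N. p i x))"
      by (intro exI[of _ N] exI[of _ "\<lambda>i x. p i (vec_nth x)"]) blast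
  next
    fix N p assume "\<forall>i. hpoly3 i (p i)" "\<forall>x. P x = (\<Sum>i\<le>N. p i x)"
    then show "\<exists>N p. (\<forall>i. hompoly i (p i)) \<and> (\<forall>x. P (vec_lambda x) = (\<Sum>i\<le>N. p i x))"
      by (intro exI[of _ N] exI[of _ "\<lambda>i x. p i (vec_lambda x)"]) (auto simp: hpoly3_def)
  qed
  finally show ?thesis .
qed

lemma hpoly3_zero: "hpoly3 k (\<lambda>x. 0)" by (simp add: hpoly3_def hompoly_zero)
lemma hpoly3_const: "hpoly3 0 (\<lambda>x. a)" by (simp add: hpoly3_def hompoly_const)
lemma hpoly3_coord: "hpoly3 1 (\<lambda>x. x $ i)" by (simp add: hpoly3_def hompoly_var[unfolded One_nat_def])
lemma hpoly3_scale: "hpoly3 k p \<Longrightarrow> hpoly3 k (\<lambda>x. a * p x)" by (simp add: hpoly3_def hompoly_scale)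
lemma hpoly3_add: "hpoly3 k p \<Longrightarrow> hpoly3 k q \<Longrightarrow> hpoly3 k (\<lambda>x. p x + q x)"
  by (simp add: hpoly3_def hompoly_add)
lemma hpoly3_diff: "hpoly3 k p \<Longrightarrow> hpoly3 k q \<Longrightarrow> hpoly3 k (\<lambda>x. p x - q x)"
  using hpoly3_add[of k p "\<lambda>x. (-1) * q x"] hpoly3_scale[of k q "-1"] by simp
lemma hpoly3_mult: "hpoly3 k p \<Longrightarrow> hpoly3 l q \<Longrightarrow> hpoly3 (k + l) (\<lambda>x. p x * q x)"
  by (simp add: hpoly3_def hompoly_mult)
lemma hpoly3_sum: "(\<And>a. a \<in> A \<Longrightarrow> hpoly3 k (P a)) \<Longrightarrow> hpoly3 k (\<lambda>x. \<Sum>a\<in>A. P a x)"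
  by (simp add: hpoly3_def hompoly_sum)
lemma hpoly3_power: "hpoly3 k p \<Longrightarrow> hpoly3 (k * n) (\<lambda>x. p x ^ n)"
  by (simp add: hpoly3_def hompoly_power)
lemma hpoly3_compose:
  assumes "hpoly3 k p" "\<And>i. hpoly3 n (\<lambda>x. g x $ i)"
  shows "hpoly3 (k * n) (\<lambda>x. p (g x))"
  using hompoly_compose[of k "\<lambda>v. p (vec_lambda v)" n "\<lambda>v. vec_nth (g (vec_lambda v))"] assms
  by (simp add: hpoly3_def)

lemma mhpoly_const: "mhpoly 0 (\<lambda>x. a)" by (simp add: mhpoly_def hompoly_const)
lemma mhpoly_coord: "mhpoly 1 (\<lambda>M. M $ i $ j)" by (simp add: mhpoly_def hompoly_var[unfolded One_nat_def])
lemma mhpoly_scale: "mhpoly k p \<Longrightarrow> mhpoly k (\<lambda>x. a * p x)" by (simp add: mhpoly_def hompoly_scale)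
lemma mhpoly_add: "mhpoly k p \<Longrightarrow> mhpoly k q \<Longrightarrow> mhpoly k (\<lambda>x. p x + q x)"
  by (simp add: mhpoly_def hompoly_add)
lemma mhpoly_diff: "mhpoly k p \<Longrightarrow> mhpoly k q \<Longrightarrow> mhpoly k (\<lambda>x. p x - q x)"
  using mhpoly_add[of k p "\<lambda>x. (-1) * q x"] mhpoly_scale[of k q "-1"] by simp
lemma mhpoly_mult: "mhpoly k p \<Longrightarrow> mhpoly l q \<Longrightarrow> mhpoly (k + l) (\<lambda>x. p x * q x)"
  by (simp add: mhpoly_def hompoly_mult)
lemma mhpoly_sum: "(\<And>a. a \<in> A \<Longrightarrow> mhpoly k (P a)) \<Longrightarrow> mhpoly k (\<lambda>x. \<Sum>a\<in>A. P a x)"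
  by (simp add: mhpoly_def hompoly_sum)
lemma mhpoly_compose_hpoly3:
  assumes "hpoly3 k p" "\<And>i. mhpoly n (\<lambda>M. g M $ i)"
  shows "mhpoly (k * n) (\<lambda>M. p (g M))"
  using hompoly_compose[of k "\<lambda>v. p (vec_lambda v)" n "\<lambda>v. vec_nth (g (\<chi> i j. v (i, j)))"] assms
  by (simp add: mhpoly_def hpoly3_def)
lemma polyfun3_hpoly3: "hpoly3 k p \<Longrightarrow> polyfun3 p"
  unfolding polyfun3_iff_hpoly3s
  by (intro exI[of _ k] exI[of _ "\<lambda>i. if i = k then p else (\<lambda>_. 0)"])
    (auto simp: hpoly3_zero if_distrib[of "\<lambda>f. f _"] cong: if_cong)

lemma polyfun3_const: "polyfun3 (\<lambda>x. a)" using polyfun3_hpoly3 hpoly3_const .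
lemma polyfun3_coord: "polyfun3 (\<lambda>x. x $ i)" using polyfun3_hpoly3 hpoly3_coord .

lemma sum_hpoly3_extend:
  fixes p :: "nat \<Rightarrow> complex^3 \<Rightarrow> complex"
  assumes "\<And>x. P x = (\<Sum>i\<le>N. p i x)" "N \<le> N'"
  shows "P x = (\<Sum>i\<le>N'. (if i \<le> N then p i else (\<lambda>_. 0)) x)"
proof -
  have "(\<Sum>i\<le>N'. (if i \<le> N then p i else (\<lambda>_. 0)) x) = (\<Sum>i\<le>N. (if i \<le> N then p i else (\<lambda>_. 0)) x)"
    by (rule sum.mono_neutral_right) (use assms in auto)
  then show ?thesis using assms by simp
qed

lemma polyfun3_add:
  assumes "polyfun3 P" "polyfun3 Q" shows "polyfun3 (\<lambda>x. P x + Q x)"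
proof -
  obtain N p where p: "\<And>i. hpoly3 i (p i)" "\<And>x. P x = (\<Sum>i\<le>N. p i x)"
    using assms(1) unfolding polyfun3_iff_hpoly3s by blast
  obtain N' q where q: "\<And>i. hpoly3 i (q i)" "\<And>x. Q x = (\<Sum>i\<le>N'. q i x)"
    using assms(2) unfolding polyfun3_iff_hpoly3s by blast
  let ?r = "\<lambda>i x. (if i \<le> N then p i else (\<lambda>_. 0)) x + (if i \<le> N' then q i else (\<lambda>_. 0)) x"
  have "P x + Q x = (\<Sum>i\<le>max N N'. ?r i x)" for x
  proof -
    have "P x = (\<Sum>i\<le>max N N'. (if i \<le> N then p i else (\<lambda>_. 0)) x)"
      by (rule sum_hpoly3_extend) (auto simp: p)
    moreover have "Q x = (\<Sum>i\<le>max N N'. (if i \<le> N' then q i else (\<lambda>_. 0)) x)"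
      by (rule sum_hpoly3_extend) (auto simp: q)
    ultimately show ?thesis by (simp add: sum.distrib)
  qed
  moreover have "hpoly3 i (?r i)" for i
    by (rule hpoly3_add) (auto simp: p q hpoly3_zero)
  ultimately show ?thesis unfolding polyfun3_iff_hpoly3s
    by (intro exI[of _ "max N N'"] exI[of _ ?r]) blast
qed

lemma polyfun3_sum: "(\<And>a. a \<in> A \<Longrightarrow> polyfun3 (P a)) \<Longrightarrow> polyfun3 (\<lambda>x. \<Sum>a\<in>A. P a x)"
  by (induction A rule: infinite_finite_induct) (auto intro: polyfun3_const polyfun3_add)

lemma polyfun3_mult:
  assumes "polyfun3 P" "polyfun3 Q" shows "polyfun3 (\<lambda>x. P x * Q x)"
proof -
  obtain N p where p: "\<And>i. hpoly3 i (p i)" "\<And>x. P x = (\<Sum>i\<le>N. p i x)"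
    using assms(1) unfolding polyfun3_iff_hpoly3s by blast
  obtain N' q where q: "\<And>i. hpoly3 i (q i)" "\<And>x. Q x = (\<Sum>i\<le>N'. q i x)"
    using assms(2) unfolding polyfun3_iff_hpoly3s by blast
  have "polyfun3 (\<lambda>x. \<Sum>i\<le>N. \<Sum>j\<le>N'. p i x * q j x)"
    by (intro polyfun3_sum, rule polyfun3_hpoly3[OF hpoly3_mult[OF p(1) q(1)]])
  then show ?thesis by (simp add: p q sum_product)
qed

lemma polyfun3_scale: "polyfun3 P \<Longrightarrow> polyfun3 (\<lambda>x. a * P x)"
  by (rule polyfun3_mult[OF polyfun3_const])
lemma polyfun3_uminus: "polyfun3 P \<Longrightarrow> polyfun3 (\<lambda>x. - P x)"
  using polyfun3_scale[of P "-1"] by simp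
lemma polyfun3_diff: "polyfun3 P \<Longrightarrow> polyfun3 Q \<Longrightarrow> polyfun3 (\<lambda>x. P x - Q x)"
  using polyfun3_add[OF _ polyfun3_uminus] by simp
lemma polyfun3_power: "polyfun3 P \<Longrightarrow> polyfun3 (\<lambda>x. P x ^ n)"
  by (induction n) (auto intro: polyfun3_const polyfun3_mult)
lemma polyfun3_prod: "(\<And>a. a \<in> A \<Longrightarrow> polyfun3 (P a)) \<Longrightarrow> polyfun3 (\<lambda>x. \<Prod>a\<in>A. P a x)"
  by (induction A rule: infinite_finite_induct) (auto intro: polyfun3_const polyfun3_mult)

lemmas polyfun3_intros = polyfun3_const polyfun3_coord polyfun3_add polyfun3_mult polyfun3_uminus
  polyfun3_diff polyfun3_power polyfun3_sum polyfun3_prod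

text \<open>Existential statements about polynomial functions (derivatives, restrictions to lines,
  preimages under \<open>ev\<close>) follow from this without handling coefficients. The proof
  carries \<open>polyfun3\<close> along with \<open>Q\<close>, since the sum and product cases may
  assume it.\<close>

lemma polyfun3_induct [consumes 1, case_names const coord add mult]:
  assumes "polyfun3 P"
    and const: "\<And>a. Q (\<lambda>x. a)" and coord: "\<And>i. Q (\<lambda>x. x $ i)"
    and add: "\<And>p q. polyfun3 p \<Longrightarrow> polyfun3 q \<Longrightarrow> Q p \<Longrightarrow> Q q \<Longrightarrow> Q (\<lambda>x. p x + q x)"
    and mult: "\<And>p q. polyfun3 p \<Longrightarrow> polyfun3 q \<Longrightarrow> Q p \<Longrightarrow> Q q \<Longrightarrow> Q (\<lambda>x. p x * q x)"
  shows "Q P"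
proof -
  let ?R = "\<lambda>p. polyfun3 p \<and> Q p"
  obtain N c where c: "\<And>v. P (vec_lambda v) = (\<Sum>e\<in>{e. sum e UNIV \<le> N}. c e * monom_fun e v)"
    using assms(1) unfolding polyfun3_def polyfun_def by blast
  have Rp: "?R (\<lambda>x. (x $ i) ^ n)" for i n
    by (induction n) (auto intro: polyfun3_intros const coord mult)
  have Rm: "?R (\<lambda>x. \<Prod>i\<in>A. (x $ i) ^ e i)" for A :: "3 set" and e
    by (induction A rule: infinite_finite_induct)
      (use Rp in \<open>auto intro!: polyfun3_intros const coord mult\<close>)
  have Rs: "?R (\<lambda>x. \<Sum>e\<in>A. c e * (\<Prod>i\<in>UNIV. (x $ i) ^ e i))" for A
  proof (induction A rule: infinite_finite_induct)
    case (insert e A)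
    have "?R (\<lambda>x. c e * (\<Prod>i\<in>UNIV. (x $ i) ^ e i))"
      using Rm[where A=UNIV and e=e] by (auto intro!: polyfun3_intros const mult)
    with insert show ?case by (auto intro!: polyfun3_intros add)
  qed (auto intro: polyfun3_intros const)
  have "P = (\<lambda>x. \<Sum>e\<in>{e. sum e UNIV \<le> N}. c e * (\<Prod>i\<in>UNIV. (x $ i) ^ e i))"
  proof
    fix x show "P x = (\<Sum>e\<in>{e. sum e UNIV \<le> N}. c e * (\<Prod>i\<in>UNIV. (x $ i) ^ e i))"
      using c[of "vec_nth x"] by simp
  qed
  then show ?thesis using Rs[of "{e. sum e UNIV \<le> N}"] by simp
qed

lemma polyfun3_compose:
  assumes "polyfun3 P" "\<And>i. polyfun3 (\<lambda>x. g x $ i)"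
  shows "polyfun3 (\<lambda>x. P (g x))"
  using assms(1) by (induction rule: polyfun3_induct) (auto intro: polyfun3_intros assms(2))

lemma poly_sum_power_eq_0:
  fixes a :: "nat \<Rightarrow> complex"
  assumes "\<And>t. t \<noteq> 0 \<Longrightarrow> (\<Sum>i\<le>N. a i * t ^ i) = 0" "i \<le> N"
  shows "a i = 0"
proof -
  define p where "p = (\<Sum>i\<le>N. monom (a i) i)"
  have "poly p t = (\<Sum>i\<le>N. a i * t ^ i)" for t by (simp add: p_def poly_sum poly_monom)
  then have "UNIV - {0} \<subseteq> {t. poly p t = 0}" using assms by auto
  moreover have "infinite (UNIV - {0::complex})" by (simp add: infinite_UNIV_char_0)
  ultimately have "p = 0" using poly_roots_finite[of p] finite_subset by blast
  then have "coeff p i = 0" by simp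
  moreover have "coeff p i = a i" using assms(2) by (simp add: p_def coeff_sum sum.delta)
  ultimately show ?thesis by simp
qed

lemma hpoly3_iff: "hpoly3 k p \<longleftrightarrow> polyfun3 p \<and> (\<forall>t x. t \<noteq> 0 \<longrightarrow> p (t *s x) = t ^ k * p x)"
proof safe
  assume p: "polyfun3 p" "\<forall>t x. t \<noteq> 0 \<longrightarrow> p (t *s x) = t ^ k * p x"
  then obtain N q where q: "\<And>i. hpoly3 i (q i)" "\<And>x. p x = (\<Sum>i\<le>N. q i x)"
    unfolding polyfun3_iff_hpoly3s by blast
  \<comment> \<open>The decomposition is padded up to degree at least \<open>k\<close>, so that a
    coefficient of \<open>t ^ k\<close> is present to compare even when
    \<open>k > N\<close>.\<close>
  define N' where "N' = max N k"
  define r where "r i = (if i \<le> N then q i else (\<lambda>_. 0))" for i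
  have r: "hpoly3 i (r i)" for i by (simp add: r_def q hpoly3_zero)
  have pr: "p x = (\<Sum>i\<le>N'. r i x)" for x
    unfolding r_def by (rule sum_hpoly3_extend) (auto simp: q N'_def)
  have "r k x = p x" for x
  proof -
    have "(\<Sum>i\<le>N'. (r i x - (if i = k then p x else 0)) * t ^ i) = 0" if "t \<noteq> 0" for t
    proof -
      have "(\<Sum>i\<le>N'. r i x * t ^ i) = p (t *s x)"
        unfolding pr by (intro sum.cong refl) (simp add: hpoly3_homogeneous[OF r])
      also have "\<dots> = t ^ k * p x" using p that by blast
      finally show ?thesis
        by (simp add: left_diff_distrib sum_subtractf N'_def if_distrib[of "\<lambda>a. a * _"] cong: if_cong)
    qed
    from poly_sum_power_eq_0[OF this, of k] show ?thesis by (simp add: N'_def)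
  qed
  then have "r k = p" by auto
  then show "hpoly3 k p" using r by metis
qed (auto simp: polyfun3_hpoly3 hpoly3_homogeneous)

subsection \<open>Partial derivatives\<close>

text \<open>\<open>pd\<close> is defined through \<open>deriv\<close>, which has a value even where
  no derivative exists. So a polynomial candidate \<open>D\<close> is constructed first;
  \<open>pd_unique\<close> then identifies it with \<open>pd\<close>.\<close>

lemma has_derivative_pd_aux:
  assumes "polyfun3 p"
  shows "\<exists>D. (\<forall>j. polyfun3 (D j)) \<and> (\<forall>x. (p has_derivative (\<lambda>h. \<Sum>j\<in>UNIV. D j x * h $ j)) (at x))"
  using assms
proof (induction rule: polyfun3_induct)
  case (const a)
  show ?case by (intro exI[of _ "\<lambda>j x. 0"]) (auto intro: polyfun3_intros)
next
  case (coord i)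
  have "((\<lambda>x. x $ i) has_derivative (\<lambda>h. \<Sum>j\<in>UNIV. (if j = i then 1 else 0) * h $ j)) (at x)"
    for x :: "complex^3"
  proof -
    have "(\<lambda>h::complex^3. \<Sum>j\<in>UNIV. (if j = i then 1 else 0) * h $ j) = (\<lambda>h. h $ i)"
      by (simp add: if_distrib[of "\<lambda>a. a * _"] cong: if_cong)
    then show ?thesis
      using bounded_linear_imp_has_derivative[OF bounded_linear_vec_nth] by simp
  qed
  then show ?case by (intro exI[of _ "\<lambda>j x. if j = i then 1 else 0"]) (auto intro: polyfun3_intros)
next
  case (add p q)
  from add.IH obtain D E where
    "\<And>j. polyfun3 (D j)" "\<And>x. (p has_derivative (\<lambda>h. \<Sum>j\<in>UNIV. D j x * h $ j)) (at x)"
    "\<And>j. polyfun3 (E j)" "\<And>x. (q has_derivative (\<lambda>h. \<Sum>j\<in>UNIV. E j x * h $ j)) (at x)" by blast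
  then show ?case
    by (intro exI[of _ "\<lambda>j x. D j x + E j x"] conjI allI polyfun3_intros)
      (auto simp: distrib_right sum.distrib intro!: has_derivative_add)
next
  case (mult p q)
  from mult.IH obtain D E where
    DE: "\<And>j. polyfun3 (D j)" "\<And>x. (p has_derivative (\<lambda>h. \<Sum>j\<in>UNIV. D j x * h $ j)) (at x)"
    "\<And>j. polyfun3 (E j)" "\<And>x. (q has_derivative (\<lambda>h. \<Sum>j\<in>UNIV. E j x * h $ j)) (at x)" by blast
  have "((\<lambda>x. p x * q x) has_derivative (\<lambda>h. \<Sum>j\<in>UNIV. (p x * E j x + D j x * q x) * h $ j)) (at x)" for x
    by (rule has_derivative_eq_rhs[OF has_derivative_mult[OF DE(2) DE(4)]])
      (simp add: fun_eq_iff sum_distrib_left sum_distrib_right distrib_right sum.distrib algebra_simps)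
  with DE mult show ?case
    by (intro exI[of _ "\<lambda>j x. p x * E j x + D j x * q x"] conjI allI polyfun3_intros) auto
qed

lemma deriv_line_has_derivative:
  assumes "(p has_derivative (\<lambda>h. \<Sum>j\<in>UNIV. D j * h $ j)) (at (x + s *s v))"
  shows "((\<lambda>t. p (x + t *s v)) has_field_derivative (\<Sum>j\<in>UNIV. D j * v $ j)) (at (s::complex))"
proof -
  have bl: "bounded_linear (\<lambda>t::complex. t *s v)"
  proof (rule bounded_linear_intro[of _ "norm v"])
    fix t show "norm (t *s v) \<le> norm t * norm v"
    proof -
      have "norm (t *s v) = norm t * norm v"
        unfolding norm_vec_def by (simp add: norm_mult L2_set_right_distrib)
      then show ?thesis by simp
    qed
  qed (auto simp: vec_eq_iff algebra_simps)
  have "((\<lambda>t. x + t *s v) has_derivative (\<lambda>t. t *s v)) (at s)"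
    using has_derivative_add[OF has_derivative_const bounded_linear_imp_has_derivative[OF bl], of x "at s"]
    by simp
  from diff_chain_at[OF this assms]
  have "((\<lambda>t. p (x + t *s v)) has_derivative (\<lambda>t. \<Sum>j\<in>UNIV. D j * (t *s v) $ j)) (at s)"
    by (simp add: o_def)
  then show ?thesis
    unfolding has_field_derivative_def
    by (rule has_derivative_eq_rhs) (simp add: fun_eq_iff sum_distrib_left sum_distrib_right algebra_simps)
qed

lemma pd_unique:
  assumes "(p has_derivative (\<lambda>h. \<Sum>j\<in>UNIV. D j * h $ j)) (at x)"
  shows "pd j p x = D j"
proof -
  have "((\<lambda>t. p (x + t *s axis j 1)) has_field_derivative (\<Sum>i\<in>UNIV. D i * axis j 1 $ i)) (at 0)"
    by (rule deriv_line_has_derivative) (use assms in simp)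
  moreover have "(\<Sum>i\<in>UNIV. D i * axis j 1 $ i) = D j"
    by (simp add: axis_def if_distrib[of "\<lambda>a. _ * a"] cong: if_cong)
  moreover have "t *s axis j 1 = axis j t" for t :: complex
    by (simp add: vec_eq_iff axis_def)
  ultimately show ?thesis unfolding pd_def by (simp add: DERIV_imp_deriv)
qed

lemma polyfun3_has_derivative:
  assumes "polyfun3 p"
  shows "(p has_derivative (\<lambda>h. \<Sum>j\<in>UNIV. pd j p x * h $ j)) (at x)"
proof -
  obtain D where D: "\<And>x. (p has_derivative (\<lambda>h. \<Sum>j\<in>UNIV. D j x * h $ j)) (at x)"
    using has_derivative_pd_aux[OF assms] by blast
  show ?thesis using D[of x] unfolding pd_unique[OF D[of x]] .
qed

lemma polyfun3_pd:
  assumes "polyfun3 p" shows "polyfun3 (pd j p)"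
proof -
  obtain D where D: "\<And>j. polyfun3 (D j)"
    "\<And>x. (p has_derivative (\<lambda>h. \<Sum>j\<in>UNIV. D j x * h $ j)) (at x)"
    using has_derivative_pd_aux[OF assms] by blast
  have "pd j p = D j" using pd_unique[OF D(2)] by auto
  with D(1) show ?thesis by metis
qed

lemma polyfun3_deriv_line:
  assumes "polyfun3 p"
  shows "((\<lambda>t. p (x + t *s v)) has_field_derivative (\<Sum>j\<in>UNIV. pd j p (x + s *s v) * v $ j)) (at s)"
  by (rule deriv_line_has_derivative[OF polyfun3_has_derivative[OF assms]])

lemma pd_add: "polyfun3 p \<Longrightarrow> polyfun3 q \<Longrightarrow> pd j (\<lambda>x. p x + q x) x = pd j p x + pd j q x"
  by (rule pd_unique[where D="\<lambda>j. pd j p x + pd j q x"])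
    (auto simp: distrib_right sum.distrib intro!: has_derivative_add polyfun3_has_derivative)

lemma pd_mult:
  assumes "polyfun3 p" "polyfun3 q"
  shows "pd j (\<lambda>x. p x * q x) x = p x * pd j q x + pd j p x * q x"
  by (rule pd_unique[where D="\<lambda>j. p x * pd j q x + pd j p x * q x"],
      rule has_derivative_eq_rhs[OF has_derivative_mult[OF polyfun3_has_derivative polyfun3_has_derivative]])
    (use assms in \<open>auto simp: fun_eq_iff sum_distrib_left sum_distrib_right distrib_right sum.distrib algebra_simps\<close>)

lemma pd_const: "pd j (\<lambda>x. a) x = 0"
  by (rule pd_unique[where D="\<lambda>j. 0"]) simp

lemma pd_scale: "polyfun3 p \<Longrightarrow> pd j (\<lambda>x. a * p x) x = a * pd j p x"
  using pd_mult[OF polyfun3_const, of p j a] by (simp add: pd_const)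

lemma pd_sum:
  "(\<And>a. a \<in> A \<Longrightarrow> polyfun3 (P a)) \<Longrightarrow> pd j (\<lambda>x. \<Sum>a\<in>A. P a x) x = (\<Sum>a\<in>A. pd j (P a) x)"
  by (induction A rule: infinite_finite_induct) (auto simp: pd_const pd_add polyfun3_sum)

lemma pd_compose:
  assumes p: "polyfun3 p" and g: "\<And>i. polyfun3 (\<lambda>x. g x $ i)"
  shows "pd j (\<lambda>x. p (g x)) x = (\<Sum>i\<in>UNIV. pd i p (g x) * pd j (\<lambda>x. g x $ i) x)"
proof (rule pd_unique[where D="\<lambda>j. \<Sum>i\<in>UNIV. pd i p (g x) * pd j (\<lambda>x. g x $ i) x"])
  have "(g has_derivative (\<lambda>h. \<chi> i. \<Sum>j\<in>UNIV. pd j (\<lambda>x. g x $ i) x * h $ j)) (at x)"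
  proof -
    have bl: "bounded_linear (axis i :: complex \<Rightarrow> complex^3)" for i
    proof (rule bounded_linear_intro[of _ 1])
      fix x :: complex
      have "norm (axis i x $ j) ^ 2 = (if j = i then norm x ^ 2 else 0)" for j by (simp add: axis_def)
      then show "norm (axis i x :: complex^3) \<le> norm x * 1"
        by (simp add: norm_vec_def L2_set_def)
    qed (auto simp: vec_eq_iff axis_def)
    have sum_axis: "(\<Sum>i\<in>UNIV. axis i (v $ i)) = v" for v :: "complex^3"
      by (simp add: vec_eq_iff axis_def)
    have "((\<lambda>x. \<Sum>i\<in>UNIV. axis i (g x $ i)) has_derivative
        (\<lambda>h. \<Sum>i\<in>UNIV. axis i ((\<chi> i. \<Sum>j\<in>UNIV. pd j (\<lambda>x. g x $ i) x * h $ j) $ i))) (at x)"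
      by (intro has_derivative_sum bounded_linear.has_derivative[OF bl])
        (simp add: polyfun3_has_derivative[OF g])
    then show ?thesis unfolding sum_axis .
  qed
  from diff_chain_at[OF this polyfun3_has_derivative[OF p]]
  have "((\<lambda>x. p (g x)) has_derivative
     (\<lambda>h. \<Sum>i\<in>UNIV. pd i p (g x) * (\<Sum>j\<in>UNIV. pd j (\<lambda>x. g x $ i) x * h $ j))) (at x)"
    by (simp add: o_def)
  then show "((\<lambda>x. p (g x)) has_derivative
     (\<lambda>h. \<Sum>j\<in>UNIV. (\<Sum>i\<in>UNIV. pd i p (g x) * pd j (\<lambda>x. g x $ i) x) * h $ j)) (at x)"
    by (rule has_derivative_eq_rhs)
      (auto simp: fun_eq_iff sum_distrib_left sum_distrib_right mult.assoc intro: sum.swap)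
qed

text \<open>The factor \<open>t\<close> on the left avoids the exponent \<open>k - 1\<close>, which
  would be truncated at \<open>k = 0\<close>.\<close>

lemma hpoly3_pd_scale:
  assumes "hpoly3 k p" "t \<noteq> 0"
  shows "t * pd j p (t *s x) = t ^ k * pd j p x"
proof -
  have pf: "polyfun3 p" by (rule polyfun3_hpoly3[OF assms(1)])
  have "pd j (\<lambda>x. p (t *s x)) x = (\<Sum>i\<in>UNIV. pd i p (t *s x) * pd j (\<lambda>x. (t *s x) $ i) x)"
    by (rule pd_compose[OF pf]) (auto intro: polyfun3_intros)
  also have "\<dots> = (\<Sum>i\<in>UNIV. pd i p (t *s x) * (if i = j then t else 0))"
  proof (intro sum.cong refl)
    fix i
    have "pd j (\<lambda>x. x $ i) x = (if i = j then 1 else 0)"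
      by (rule pd_unique[where D="\<lambda>j. if i = j then 1 else 0"])
        (use bounded_linear_imp_has_derivative[OF bounded_linear_vec_nth] in
          \<open>simp add: if_distrib[of "\<lambda>a. a * _"] cong: if_cong\<close>)
    then show "pd i p (t *s x) * pd j (\<lambda>x. (t *s x) $ i) x = pd i p (t *s x) * (if i = j then t else 0)"
      using pd_scale[OF polyfun3_coord, of j t i x] by simp
  qed
  also have "\<dots> = t * pd j p (t *s x)"
    by (simp add: if_distrib[of "\<lambda>a. _ * a"] cong: if_cong)
  finally show ?thesis
    using hpoly3_homogeneous[OF assms(1)] pd_scale[OF pf, of j "t ^ k" x] by simp
qed

text \<open>Both sides are the derivative of \<open>p (t *s x)\<close> at
  \<open>t = 1\<close>.\<close>

lemma hpoly3_euler:
  assumes "hpoly3 k p"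
  shows "(\<Sum>j\<in>UNIV. x $ j * pd j p x) = of_nat k * p x"
proof -
  have pf: "polyfun3 p" by (rule polyfun3_hpoly3[OF assms(1)])
  have "((\<lambda>t. p (0 + t *s x)) has_field_derivative (\<Sum>j\<in>UNIV. pd j p (0 + 1 *s x) * x $ j)) (at 1)"
    by (rule polyfun3_deriv_line[OF pf])
  then have 1: "((\<lambda>t. t ^ k * p x) has_field_derivative (\<Sum>j\<in>UNIV. pd j p x * x $ j)) (at 1)"
    by (simp add: hpoly3_homogeneous[OF assms])
  have "((\<lambda>t. t ^ k * p x) has_field_derivative (of_nat k * p x)) (at 1)"
    by (auto intro!: derivative_eq_intros)
  from DERIV_unique[OF 1 this] show ?thesis by (simp add: mult.commute)
qed

subsection \<open>Divisibility of polynomial functions\<close>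

text \<open>The iterated ring C[x1][x2][x3] with \<open>x $ 3\<close> outermost. It is factorial, so
  primes and gcds are taken there and carried over to functions along \<open>ev\<close>, which is a
  bijection onto the polynomial functions (\<open>ev_eq_iff\<close>, \<open>polyfun3_ev\<close>,
  \<open>polyfun3_ev_exists\<close>).\<close>

definition ev :: "complex poly poly poly \<Rightarrow> complex^3 \<Rightarrow> complex" where
  "ev P x = poly (poly (poly P [:[:x $ 3:]:]) [:x $ 2:]) (x $ 1)"

lemma ev_simps:
  "ev 0 x = 0" "ev 1 x = 1" "ev (P + Q) x = ev P x + ev Q x" "ev (P - Q) x = ev P x - ev Q x"
  "ev (P * Q) x = ev P x * ev Q x" "ev [:[:[:c:]:]:] x = c"
  by (simp_all add: ev_def)

lemma poly_nonroot_in_infinite: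
  fixes p :: "'a::idom poly"
  assumes "p \<noteq> 0" "infinite A" shows "\<exists>a\<in>A. poly p a \<noteq> 0"
proof (rule ccontr)
  assume "\<not> ?thesis"
  then have "A \<subseteq> {a. poly p a = 0}" by auto
  then show False using poly_roots_finite[OF assms(1)] assms(2) finite_subset by blast
qed

text \<open>One variable at a time: a nonzero polynomial over an integral domain has a non-root in
  every infinite set, here the embedded complex constants.\<close>

lemma ev_inject:
  assumes "\<And>x. ev P x = 0" shows "P = 0"
proof (rule ccontr)
  assume "P \<noteq> 0"
  have "inj (\<lambda>c::complex. [:[:c:]:])" "inj (\<lambda>c::complex. [:c:])" by (simp_all add: inj_on_def)
  then have inf: "infinite (range (\<lambda>c::complex. [:[:c:]:]))" "infinite (range (\<lambda>c::complex. [:c:]))"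
    using finite_imageD infinite_UNIV_char_0 by blast+
  obtain c where c: "poly P [:[:c:]:] \<noteq> 0"
    using poly_nonroot_in_infinite[OF \<open>P \<noteq> 0\<close> inf(1)] by auto
  obtain b where b: "poly (poly P [:[:c:]:]) [:b:] \<noteq> 0"
    using poly_nonroot_in_infinite[OF c inf(2)] by auto
  obtain a where a: "poly (poly (poly P [:[:c:]:]) [:b:]) a \<noteq> 0"
    using poly_all_0_iff_0 b by blast
  have "ev P (vector [a, b, c]) \<noteq> 0" using a by (simp add: ev_def)
  with assms show False by blast
qed

lemma ev_eq_iff: "ev P = ev Q \<longleftrightarrow> P = Q"
  using ev_inject[of "P - Q"] by (auto simp: ev_simps)

lemma polyfun3_ev: "polyfun3 (ev P)"
proof -
  have "ev P x = (\<Sum>k\<le>degree P. \<Sum>j\<le>degree (coeff P k). \<Sum>i\<le>degree (coeff (coeff P k) j).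
     coeff (coeff (coeff P k) j) i * (x $ 1) ^ i * (x $ 2) ^ j * (x $ 3) ^ k)" for x
  proof -
    have "poly P [:[:x $ 3:]:] = (\<Sum>k\<le>degree P. coeff P k * [:[:x $ 3:]:] ^ k)"
      by (simp add: poly_altdef)
    moreover have "poly (coeff P k) [:x $ 2:] = (\<Sum>j\<le>degree (coeff P k). coeff (coeff P k) j * [:x $ 2:] ^ j)"
      for k by (simp add: poly_altdef)
    moreover have "poly (coeff (coeff P k) j) (x $ 1) = (\<Sum>i\<le>degree (coeff (coeff P k) j).
        coeff (coeff (coeff P k) j) i * (x $ 1) ^ i)" for k j by (simp add: poly_altdef)
    ultimately show ?thesis
      by (simp add: ev_def poly_sum poly_mult poly_power sum_distrib_left sum_distrib_right algebra_simps)
  qed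
  then have eq: "ev P = (\<lambda>x. \<Sum>k\<le>degree P. \<Sum>j\<le>degree (coeff P k). \<Sum>i\<le>degree (coeff (coeff P k) j).
     coeff (coeff (coeff P k) j) i * (x $ 1) ^ i * (x $ 2) ^ j * (x $ 3) ^ k)" by auto
  show ?thesis unfolding eq by (intro polyfun3_intros)
qed

lemma polyfun3_ev_exists:
  assumes "polyfun3 p" shows "\<exists>P. p = ev P"
  using assms
proof (induction rule: polyfun3_induct)
  case (const a)
  show ?case by (rule exI[of _ "[:[:[:a:]:]:]"]) (simp add: fun_eq_iff ev_simps)
next
  case (coord i)
  have "i = 1 \<or> i = 2 \<or> i = 3" using exhaust_3 by blast
  then show ?case
    by (elim disjE; intro exI[of _ "if i = 1 then [:[:[:0,1:]:]:] else if i = 2 then [:[:0,1:]:] else [:0,1:]"])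
      (auto simp: fun_eq_iff ev_def)
next
  case (add p q)
  then obtain P Q where "p = ev P" "q = ev Q" by blast
  then show ?case by (intro exI[of _ "P + Q"]) (simp add: fun_eq_iff ev_simps)
next
  case (mult p q)
  then obtain P Q where "p = ev P" "q = ev Q" by blast
  then show ?case by (intro exI[of _ "P * Q"]) (simp add: fun_eq_iff ev_simps)
qed

definition pdvd :: "(complex^3 \<Rightarrow> complex) \<Rightarrow> (complex^3 \<Rightarrow> complex) \<Rightarrow> bool" (infix "pdvd" 50) where
  "u pdvd p \<longleftrightarrow> (\<exists>h. polyfun3 h \<and> (\<forall>x. p x = u x * h x))"

definition pprime :: "(complex^3 \<Rightarrow> complex) \<Rightarrow> bool" where
  "pprime u \<longleftrightarrow> (\<exists>U. prime_elem U \<and> u = ev U)"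

lemma ev_pdvd_iff: "ev U pdvd ev P \<longleftrightarrow> U dvd P"
proof
  assume "ev U pdvd ev P"
  then obtain h where h: "polyfun3 h" "\<And>x. ev P x = ev U x * h x" unfolding pdvd_def by blast
  then obtain H where "h = ev H" using polyfun3_ev_exists by blast
  then have "ev P = ev (U * H)" using h by (simp add: fun_eq_iff ev_simps)
  then show "U dvd P" unfolding ev_eq_iff by simp
next
  assume "U dvd P"
  then show "ev U pdvd ev P" unfolding pdvd_def
    by (auto elim!: dvdE simp: ev_simps intro: polyfun3_ev)
qed

lemma pdvd_mult_left:
  assumes "u pdvd p" "polyfun3 q" shows "u pdvd (\<lambda>x. q x * p x)"
proof -
  obtain h where "polyfun3 h" "\<And>x. p x = u x * h x"
    using assms unfolding pdvd_def by blast
  then show ?thesis unfolding pdvd_def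
    by (intro exI[of _ "\<lambda>x. q x * h x"]) (auto intro: polyfun3_intros assms)
qed

lemma pdvd_mult_right: "u pdvd p \<Longrightarrow> polyfun3 q \<Longrightarrow> u pdvd (\<lambda>x. p x * q x)"
  using pdvd_mult_left[of u p q] by (simp add: mult.commute)

lemma pdvd_zero: "u pdvd (\<lambda>x. 0)"
  unfolding pdvd_def by (intro exI[of _ "\<lambda>x. 0"]) (auto intro: polyfun3_intros)

lemma pdvd_add:
  assumes "u pdvd p" "u pdvd q" shows "u pdvd (\<lambda>x. p x + q x)"
proof -
  obtain h k where "polyfun3 h" "\<And>x. p x = u x * h x" "polyfun3 k" "\<And>x. q x = u x * k x"
    using assms unfolding pdvd_def by blast
  then show ?thesis unfolding pdvd_def
    by (intro exI[of _ "\<lambda>x. h x + k x"]) (auto simp: algebra_simps intro: polyfun3_intros)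
qed

lemma pdvd_scale: "u pdvd p \<Longrightarrow> u pdvd (\<lambda>x. c * p x)"
  by (rule pdvd_mult_left) (auto intro: polyfun3_intros)

lemma pdvd_diff: "u pdvd p \<Longrightarrow> u pdvd q \<Longrightarrow> u pdvd (\<lambda>x. p x - q x)"
  using pdvd_add[OF _ pdvd_scale[of u q "-1"]] by simp

lemma pdvd_scale_cancel: "u pdvd (\<lambda>x. c * p x) \<Longrightarrow> c \<noteq> 0 \<Longrightarrow> u pdvd p"
  using pdvd_scale[of u "\<lambda>x. c * p x" "1 / c"] by simp

lemma pdvd_cong: "u pdvd p \<Longrightarrow> (\<And>x. p x = q x) \<Longrightarrow> u pdvd q"
  unfolding pdvd_def by auto

lemma pdvd_refl: "p pdvd p"
  unfolding pdvd_def by (intro exI[of _ "\<lambda>x. 1"]) (auto intro: polyfun3_intros)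

lemma pdvd_trans:
  assumes "u pdvd p" "p pdvd q" shows "u pdvd q"
proof -
  obtain h k where "polyfun3 h" "\<And>x. p x = u x * h x" "polyfun3 k" "\<And>x. q x = p x * k x"
    using assms unfolding pdvd_def by blast
  then show ?thesis unfolding pdvd_def
    by (intro exI[of _ "\<lambda>x. h x * k x"]) (auto intro: polyfun3_intros)
qed

lemma pprime_polyfun3: "pprime u \<Longrightarrow> polyfun3 u"
  unfolding pprime_def using polyfun3_ev by auto

lemma pprime_dvd_multD:
  assumes "pprime u" "polyfun3 p" "polyfun3 q" "u pdvd (\<lambda>x. p x * q x)"
  shows "u pdvd p \<or> u pdvd q"
proof -
  obtain U P Q where UPQ: "prime_elem U" "u = ev U" "p = ev P" "q = ev Q"
    using assms polyfun3_ev_exists unfolding pprime_def by metis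
  have "(\<lambda>x. p x * q x) = ev (P * Q)" using UPQ by (simp add: fun_eq_iff ev_simps)
  then have "U dvd P * Q" using assms(4) UPQ by (simp add: ev_pdvd_iff)
  then show ?thesis using UPQ by (auto simp: ev_pdvd_iff prime_elem_dvd_mult_iff)
qed

lemma pprime_dvd_powerD:
  assumes "pprime u" "polyfun3 p" "u pdvd (\<lambda>x. p x ^ n)" "n > 0"
  shows "u pdvd p"
  using assms(3,4)
proof (induction n)
  case (Suc n)
  then have "u pdvd p \<or> u pdvd (\<lambda>x. p x ^ n)"
    using pprime_dvd_multD[OF assms(1,2) polyfun3_power[OF assms(2)], of n] by simp
  moreover have "u pdvd p" if "u pdvd (\<lambda>x. p x ^ n)"
  proof (cases "n = 0")
    case True
    then have "u pdvd (\<lambda>x. 1)" using that by simp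
    from pdvd_mult_left[OF this assms(2)] show ?thesis by simp
  qed (use Suc that in auto)
  ultimately show ?case by blast
qed simp

lemma pprime_not_dvd_const:
  assumes "pprime u" "u pdvd (\<lambda>x. c)" shows "c = 0"
proof (rule ccontr)
  assume "c \<noteq> 0"
  obtain U where U: "prime_elem U" "u = ev U" using assms(1) unfolding pprime_def by blast
  have "u pdvd (\<lambda>x. 1)" using pdvd_scale[OF assms(2), of "1 / c"] \<open>c \<noteq> 0\<close> by simp
  moreover have "(\<lambda>x. 1) = ev 1" by (simp add: fun_eq_iff ev_simps)
  ultimately have "U dvd 1" using U by (simp add: ev_pdvd_iff)
  then show False using U by auto
qed

lemma pprime_dvd_zero_fun: "pprime u \<Longrightarrow> \<exists>x. u x \<noteq> 0"
proof (rule ccontr)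
  assume u: "pprime u" and "\<not> (\<exists>x. u x \<noteq> 0)"
  then obtain U where "prime_elem U" "u = ev U" unfolding pprime_def by blast
  with \<open>\<not> (\<exists>x. u x \<noteq> 0)\<close> show False using ev_inject[of U] by auto
qed

lemma polyfun3_mult_nonzero:
  assumes "polyfun3 p" "polyfun3 q" "\<exists>x. p x \<noteq> 0" "\<exists>x. q x \<noteq> 0"
  shows "\<exists>x. p x \<noteq> 0 \<and> q x \<noteq> 0"
proof -
  obtain P Q where PQ: "p = ev P" "q = ev Q" using assms polyfun3_ev_exists by metis
  then have "P \<noteq> 0" "Q \<noteq> 0" using assms by (auto simp: ev_simps)
  then have "P * Q \<noteq> 0" by simp
  then obtain x where "ev (P * Q) x \<noteq> 0" using ev_inject by blast
  then show ?thesis using PQ by (auto simp: ev_simps)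
qed

lemma polyfun3_prod_nonzero:
  assumes "finite A" "\<And>a. a \<in> A \<Longrightarrow> polyfun3 (P a)" "\<And>a. a \<in> A \<Longrightarrow> \<exists>x. P a x \<noteq> 0"
  shows "\<exists>x. \<forall>a\<in>A. P a x \<noteq> 0"
proof -
  have "\<exists>x. (\<Prod>a\<in>A. P a x) \<noteq> 0"
    using assms
  proof (induction A)
    case (insert a A)
    have "\<exists>x. P a x \<noteq> 0 \<and> (\<Prod>a\<in>A. P a x) \<noteq> 0"
      by (rule polyfun3_mult_nonzero) (use insert in \<open>auto intro: polyfun3_intros\<close>)
    then show ?case using insert by auto
  qed auto
  then show ?thesis using assms(1) by (auto simp: prod_zero_iff)
qed

lemma polyfun3_mult_cancel:
  assumes "polyfun3 p" "polyfun3 q" "polyfun3 r" "\<exists>x. r x \<noteq> 0" "\<And>x. r x * p x = r x * q x"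
  shows "p x = q x"
proof -
  obtain P Q R where PQ: "p = ev P" "q = ev Q" "r = ev R" using assms polyfun3_ev_exists by metis
  have "ev (R * P) = ev (R * Q)" using assms(5) PQ by (simp add: fun_eq_iff ev_simps)
  then have "R * P = R * Q" unfolding ev_eq_iff .
  moreover have "R \<noteq> 0" using assms(4) PQ by (auto simp: ev_simps)
  ultimately show ?thesis using PQ by simp
qed

lemma polyfun3_zero_off:
  assumes "polyfun3 p" "polyfun3 r" "\<exists>x. r x \<noteq> 0" "\<And>x. r x \<noteq> 0 \<Longrightarrow> p x = 0"
  shows "p x = 0"
  using polyfun3_mult_cancel[of p "\<lambda>x. 0" r x] assms by (auto intro: polyfun3_intros)

lemma pprime_nonconst:
  assumes "pprime u" shows "\<not> (\<exists>c. \<forall>x. u x = c)"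
proof
  assume "\<exists>c. \<forall>x. u x = c"
  then obtain c where c: "\<And>x. u x = c" by blast
  have "u pdvd (\<lambda>x. c)" using pdvd_refl[of u] c by (metis ext)
  then have "c = 0" by (rule pprime_not_dvd_const[OF assms])
  then show False using pprime_dvd_zero_fun[OF assms] c by auto
qed

lemma nonconst_has_pprime:
  assumes "polyfun3 g" "\<not> (\<exists>c. \<forall>x. g x = c)"
  shows "\<exists>u. pprime u \<and> u pdvd g"
proof -
  obtain G where G: "g = ev G" using assms polyfun3_ev_exists by metis
  have "G \<noteq> 0" using assms G by (auto simp: ev_simps)
  moreover have "\<not> is_unit G"
  proof
    assume "is_unit G"
    then obtain c where "G = [:[:[:c:]:]:]"
      by (metis is_unit_poly_iff)
    then show False using assms G by (auto simp: ev_simps)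
  qed
  ultimately obtain U where "U dvd G" "prime U" using prime_divisor_exists by blast
  then show ?thesis unfolding pprime_def
    by (intro exI[of _ "ev U"]) (auto simp: G ev_pdvd_iff)
qed

section \<open>Reduced triples and unique factorization\<close>

lemma common_factor_iff:
  "common_factor F \<longleftrightarrow> (\<exists>u. pprime u \<and> (\<forall>j. u pdvd (\<lambda>x. F x $ j)))"
proof
  assume "common_factor F"
  then obtain g where g: "polyfun3 g" "\<not> (\<exists>c. \<forall>x. g x = c)" "\<And>j. g pdvd (\<lambda>x. F x $ j)"
    unfolding common_factor_def pdvd_def by blast
  obtain u where "pprime u" "u pdvd g" using nonconst_has_pprime[OF g(1,2)] by blast
  then show "\<exists>u. pprime u \<and> (\<forall>j. u pdvd (\<lambda>x. F x $ j))" using g(3) pdvd_trans by blast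
next
  assume "\<exists>u. pprime u \<and> (\<forall>j. u pdvd (\<lambda>x. F x $ j))"
  then obtain u where u: "pprime u" "\<And>j. u pdvd (\<lambda>x. F x $ j)" by blast
  have "\<forall>j. \<exists>h. polyfun3 h \<and> (\<forall>x. F x $ j = u x * h x)"
    using u(2) unfolding pdvd_def by (intro allI)
  then show "common_factor F"
    unfolding common_factor_def using pprime_nonconst[OF u(1)] pprime_polyfun3[OF u(1)]
    by (intro exI[of _ u] conjI)
qed

text \<open>A vector proportional to a primitive one is a polynomial multiple of it:
  \<open>W i\<close> divides \<open>g i * W b\<close> for every \<open>b\<close>, hence also
  \<open>g i\<close> times the gcd of the \<open>W b\<close>, which is a unit.\<close>

lemma reduced_quotient:
  assumes G: "\<And>j. polyfun3 (\<lambda>x. G x $ j)" and w: "\<And>j. polyfun3 (\<lambda>x. w x $ j)"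
    and red: "reduced w" and pr: "proportional G w"
  shows "\<exists>\<phi>. polyfun3 \<phi> \<and> (\<forall>x. G x = \<phi> x *s w x)"
proof -
  have "\<forall>j. \<exists>P. (\<lambda>x. G x $ j) = ev P"
    using polyfun3_ev_exists[OF G] by (intro allI)
  from choice[OF this] obtain g where gW1: "\<And>j. (\<lambda>x. G x $ j) = ev (g j)" by blast
  have "\<forall>j. \<exists>P. (\<lambda>x. w x $ j) = ev P"
    using polyfun3_ev_exists[OF w] by (intro allI)
  from choice[OF this] obtain W where gW2: "\<And>j. (\<lambda>x. w x $ j) = ev (W j)" by blast
  note gW = gW1 gW2
  have evg: "G x $ j = ev (g j) x" "w x $ j = ev (W j) x" for x j
    using fun_cong[OF gW(1), of x j] fun_cong[OF gW(2), of x j] by auto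
  have noc: "\<not> (\<exists>U. prime_elem U \<and> (\<forall>j. U dvd W j))"
  proof
    assume "\<exists>U. prime_elem U \<and> (\<forall>j. U dvd W j)"
    then obtain U where "prime_elem U" "\<And>j. U dvd W j" by blast
    then have "common_factor w" unfolding common_factor_iff pprime_def gW
      by (intro exI[of _ "ev U"]) (auto simp: ev_pdvd_iff)
    then show False using red unfolding reduced_def by blast
  qed
  define D where "D = gcd (W 1) (gcd (W 2) (W 3))"
  have Dd: "D dvd W j" for j
  proof -
    have "D dvd W 1" "D dvd W 2" "D dvd W 3"
      unfolding D_def by (auto intro: dvd_trans[OF gcd_dvd2])
    then show ?thesis using exhaust_3[of j] by auto
  qed
  \<comment> \<open>If all \<open>W i\<close> were zero, every prime would divide them; a prime
    exists because the first coordinate function is not constant.\<close>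
  obtain i where i: "W i \<noteq> 0"
  proof (rule ccontr)
    assume "\<not> thesis"
    then have "\<And>i. W i = 0" using that by blast
    moreover have "\<not> (\<exists>c. \<forall>x :: complex^3. x $ 1 = c)" by (metis vector_3(1) zero_neq_one)
    then obtain u where "pprime u"
      using nonconst_has_pprime[of "\<lambda>x. x $ 1"] polyfun3_coord by blast
    ultimately show False using noc unfolding pprime_def by auto
  qed
  have "is_unit D"
  proof (rule ccontr)
    assume "\<not> is_unit D"
    moreover have "D \<noteq> 0" using Dd[of i] i by auto
    ultimately obtain U where "U dvd D" "prime U" using prime_divisor_exists by blast
    then show False using noc Dd dvd_trans by (metis prime_imp_prime_elem)
  qed
  have cross: "g a * W b = g b * W a" for a b
  proof -
    have "ev (g a * W b) = ev (g b * W a)"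
      using pr unfolding proportional_def by (auto simp: fun_eq_iff ev_simps evg)
    then show ?thesis unfolding ev_eq_iff .
  qed
  have "W i dvd g i * W b" for b using cross[of i b] by simp
  then have "W i dvd gcd (g i * W 1) (gcd (g i * W 2) (g i * W 3))" by simp
  also have "\<dots> dvd g i * D"
    unfolding D_def by (simp add: gcd_mult_left)
  also have "g i * D dvd g i" using \<open>is_unit D\<close> by simp
  finally obtain \<Phi> where \<Phi>: "g i = W i * \<Phi>" by (elim dvdE)
  have "g b = \<Phi> * W b" for b
  proof -
    have "W i * g b = W i * (\<Phi> * W b)" using cross[of i b] \<Phi> by (simp only: mult_ac)
    then show ?thesis using i by (simp only: mult_cancel_left) simp
  qed
  then have "G x = ev \<Phi> x *s w x" for x
    by (simp add: vec_eq_iff evg ev_simps)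
  then show ?thesis using polyfun3_ev by blast
qed

text \<open>\<open>S\<close> consists of normalized representatives of the finitely many classes of
  associated primes. Conditions ranging over all prime divisors thereby become finitely
  many.\<close>

lemma finite_pprimes:
  assumes "polyfun3 \<phi>" "\<exists>x. \<phi> x \<noteq> 0"
  shows "\<exists>S. finite S \<and> (\<forall>u\<in>S. pprime u \<and> u pdvd \<phi>) \<and>
     (\<forall>v. pprime v \<and> v pdvd \<phi> \<longrightarrow> (\<exists>u\<in>S. u pdvd v \<and> v pdvd u))"
proof -
  obtain P where P: "\<phi> = ev P" using assms polyfun3_ev_exists by metis
  then have "P \<noteq> 0" using assms by (auto simp: ev_simps)
  show ?thesis
  proof (intro exI[of _ "ev ` prime_factors P"] conjI ballI allI impI)
    fix u assume "u \<in> ev ` prime_factors P"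
    then show "pprime u" "u pdvd \<phi>"
      unfolding P pprime_def by (auto simp: ev_pdvd_iff in_prime_factors_iff intro: prime_imp_prime_elem)
  next
    fix v assume v: "pprime v \<and> v pdvd \<phi>"
    then obtain V where V: "prime_elem V" "v = ev V" unfolding pprime_def by blast
    then have "V dvd P" using v by (simp add: P ev_pdvd_iff)
    then have "normalize V \<in> prime_factors P" using V \<open>P \<noteq> 0\<close>
      by (simp add: in_prime_factors_iff prime_normalize_iff)
    then show "\<exists>u\<in>ev ` prime_factors P. u pdvd v \<and> v pdvd u"
      by (intro bexI[of _ "ev (normalize V)"]) (auto simp: V ev_pdvd_iff)
  qed auto
qed

text \<open>Up to a scalar, \<open>\<phi>\<close> is the product of a list of primes taken from the
  finitely many prime factors of \<open>J\<close>. Multiplicities are unbounded, so there may be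
  infinitely many classes, but such lists are countable.\<close>

lemma countable_divisor_classes:
  assumes "polyfun3 J" "\<exists>x. J x \<noteq> 0"
  shows "\<exists>D. countable D \<and> (\<forall>\<psi>\<in>D. polyfun3 \<psi> \<and> (\<exists>x. \<psi> x \<noteq> 0)) \<and>
    (\<forall>\<phi>. polyfun3 \<phi> \<and> (\<exists>x. \<phi> x \<noteq> 0) \<and> (\<forall>u. pprime u \<and> u pdvd \<phi> \<longrightarrow> u pdvd J) \<longrightarrow>
      (\<exists>\<psi>\<in>D. \<exists>c. c \<noteq> 0 \<and> (\<forall>x. \<phi> x = c * \<psi> x)))"
proof -
  obtain P where P: "J = ev P" using assms polyfun3_ev_exists by metis
  then have "P \<noteq> 0" using assms by (auto simp: ev_simps)
  define D where "D = (\<lambda>l. ev (prod_list l)) ` lists (prime_factors P)"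
  have pl: "prod_list l \<noteq> 0" if "l \<in> lists (prime_factors P)" for l
    using that by (induction l) (auto simp: in_prime_factors_iff)
  show ?thesis
  proof (intro exI[of _ D] conjI ballI allI impI)
    show "countable D" unfolding D_def by (intro countable_image countable_lists countable_finite) auto
  next
    fix \<psi> assume "\<psi> \<in> D"
    then obtain l where l: "l \<in> lists (prime_factors P)" "\<psi> = ev (prod_list l)" unfolding D_def by blast
    show "polyfun3 \<psi>" using l polyfun3_ev by simp
    show "\<exists>x. \<psi> x \<noteq> 0" using ev_inject[of "prod_list l"] pl[OF l(1)] l(2) by blast
  next
    fix \<phi>
    assume \<phi>: "polyfun3 \<phi> \<and> (\<exists>x. \<phi> x \<noteq> 0) \<and> (\<forall>u. pprime u \<and> u pdvd \<phi> \<longrightarrow> u pdvd J)"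
    obtain Q where Q: "\<phi> = ev Q" using \<phi> polyfun3_ev_exists by metis
    then have "Q \<noteq> 0" using \<phi> by (auto simp: ev_simps)
    obtain l where l: "mset l = prime_factorization Q" using ex_mset by blast
    have "set l \<subseteq> prime_factors P"
    proof
      fix U assume "U \<in> set l"
      then have "U \<in> prime_factors Q" using l by (metis set_mset_mset)
      then have U: "prime U" "U dvd Q" by (auto simp: in_prime_factors_iff)
      then have "pprime (ev U)" "ev U pdvd \<phi>" by (auto simp: Q pprime_def ev_pdvd_iff)
      then have "ev U pdvd J" using \<phi> by blast
      then show "U \<in> prime_factors P" using U \<open>P \<noteq> 0\<close> by (auto simp: P ev_pdvd_iff in_prime_factors_iff)
    qed
    have "normalize (prod_list l) = normalize Q"
      using prod_mset_prime_factorization_weak[OF \<open>Q \<noteq> 0\<close>] l by (metis prod_mset_prod_list)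
    then have "prod_list l dvd Q \<and> Q dvd prod_list l" using associatedD1 associatedD2 by blast
    then obtain V where V: "Q = prod_list l * V" "is_unit V"
      by (metis \<open>normalize (prod_list l) = normalize Q\<close> associatedE1 mult.commute)
    then obtain c where c: "V = [:[:[:c:]:]:]" by (metis is_unit_poly_iff)
    have "ev Q x = c * ev (prod_list l) x" for x
      unfolding V(1) c ev_simps by simp
    moreover have "c \<noteq> 0" using V(2) c by auto
    ultimately show "\<exists>\<psi>\<in>D. \<exists>c. c \<noteq> 0 \<and> (\<forall>x. \<phi> x = c * \<psi> x)"
      using \<open>set l \<subseteq> prime_factors P\<close>
      by (intro bexI[of _ "ev (prod_list l)"] exI[of _ c])
        (auto simp: D_def Q)
  qed
qed

lemma pdvd_cancel_coprime:
  assumes "polyfun3 \<phi>" "polyfun3 y" "polyfun3 \<omega>" "\<exists>x. \<phi> x \<noteq> 0"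
    and "\<And>u. pprime u \<Longrightarrow> u pdvd \<phi> \<Longrightarrow> \<not> u pdvd y"
    and "\<phi> pdvd (\<lambda>x. y x * \<omega> x)"
  shows "\<phi> pdvd \<omega>"
proof -
  obtain P Y W where PQ: "\<phi> = ev P" "y = ev Y" "\<omega> = ev W" using assms polyfun3_ev_exists by metis
  have "P \<noteq> 0" using assms PQ by (auto simp: ev_simps)
  have "coprime P Y"
  proof (rule ccontr)
    assume "\<not> coprime P Y"
    then have "\<not> is_unit (gcd P Y)" by (simp add: coprime_iff_gcd_eq_1)
    moreover have "gcd P Y \<noteq> 0" using \<open>P \<noteq> 0\<close> by simp
    ultimately obtain U where "U dvd gcd P Y" "prime U" using prime_divisor_exists by blast
    then show False using assms(5)[of "ev U"] by (auto simp: PQ pprime_def ev_pdvd_iff)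
  qed
  moreover have "(\<lambda>x. y x * \<omega> x) = ev (Y * W)" by (simp add: fun_eq_iff PQ ev_simps)
  ultimately show ?thesis using assms(6) by (simp add: PQ ev_pdvd_iff coprime_dvd_mult_right_iff)
qed

text \<open>Euclid's algorithm in the third variable, with denominators cleared.\<close>
lemma coprime_elimination:
  assumes "polyfun3 f" "polyfun3 g" "\<exists>x. f x \<noteq> 0"
    and "\<And>u. pprime u \<Longrightarrow> u pdvd f \<Longrightarrow> \<not> u pdvd g"
  shows "\<exists>a b r. polyfun3 a \<and> polyfun3 b \<and> polyfun3 r \<and> (\<exists>x. r x \<noteq> 0) \<and>
     (\<forall>x. r x = a x * f x + b x * g x) \<and> (\<forall>x y. x $ 1 = y $ 1 \<and> x $ 2 = y $ 2 \<longrightarrow> r x = r y)"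
proof -
  obtain F G where FG: "f = ev F" "g = ev G" using assms polyfun3_ev_exists by metis
  have F0: "F \<noteq> 0" using assms FG by (auto simp: ev_simps)
  define I where "I = {A * F + B * G | A B. True}"
  have I_comb: "C * h + E * k \<in> I" if "h \<in> I" "k \<in> I" for C E h k
  proof -
    from that obtain A B A' B' where hk: "h = A * F + B * G" "k = A' * F + B' * G" unfolding I_def by blast
    show ?thesis unfolding I_def hk
      by (rule CollectI, intro exI[of _ "C * A + E * A'"] exI[of _ "C * B + E * B'"])
        (simp add: algebra_simps)
  qed
  have FI: "F \<in> I" "G \<in> I" unfolding I_def
    by (rule CollectI, intro exI[of _ 1] exI[of _ 0], simp)
      (rule CollectI, intro exI[of _ 0] exI[of _ 1], simp)
  \<comment> \<open>An element of least degree in \<open>x $ 3\<close> of the ideal \<open>I\<close>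
    generated by \<open>F\<close> and \<open>G\<close>. Pseudo-division keeps remainders in
    \<open>I\<close>, so every element of \<open>I\<close> becomes a multiple of \<open>h\<close>
    after multiplication by a power of the leading coefficient.\<close>
  obtain h where h: "h \<in> I" "h \<noteq> 0" and hmin: "\<And>k. k \<in> I \<Longrightarrow> k \<noteq> 0 \<Longrightarrow> degree h \<le> degree k"
    using ex_has_least_nat[of "\<lambda>h. h \<in> I \<and> h \<noteq> 0" F degree] F0 FI by auto
  have pdiv: "\<exists>n q. smult (lead_coeff h ^ n) k = h * q" if "k \<in> I" for k
  proof -
    obtain q r where qr: "pseudo_divmod k h = (q, r)" by fastforce
    from pseudo_divmod[OF h(2) qr]
    have 1: "smult (lead_coeff h ^ (Suc (degree k) - degree h)) k = h * q + r"
      and 2: "r = 0 \<or> degree r < degree h" by auto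
    have "r = [:lead_coeff h ^ (Suc (degree k) - degree h):] * k + (- q) * h"
      using 1 by (simp add: algebra_simps)
    also have "\<dots> \<in> I" by (rule I_comb[OF that h(1)])
    finally have "r = 0" using 2 hmin[of r] by (cases "r = 0") auto
    with 1 show ?thesis by auto
  qed
  have "degree h = 0"
  proof (rule ccontr)
    assume deg: "degree h \<noteq> 0"
    \<comment> \<open>A prime factor of positive degree in \<open>x $ 3\<close> cannot divide a
      power of the leading coefficient, so it divides all of \<open>I\<close>, in particular
      \<open>F\<close> and \<open>G\<close>, against coprimality.\<close>
    have "\<exists>U. prime U \<and> U dvd h \<and> degree U \<noteq> 0"
    proof (rule ccontr)
      assume no: "\<not> ?thesis"
      have "degree (prod_mset M) = 0" if "set_mset M \<subseteq> prime_factors h" for M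
        using that
      proof (induction M)
        case (add U M)
        then have "degree U = 0" using no by (auto simp: in_prime_factors_iff)
        then show ?case using add degree_mult_le[of U "prod_mset M"] by auto
      qed simp
      then have "degree (prod_mset (prime_factorization h)) = 0" by blast
      moreover have "h dvd prod_mset (prime_factorization h)"
        using prod_mset_prime_factorization_weak[OF h(2)] associatedD2 by metis
      moreover have "prod_mset (prime_factorization h) \<noteq> 0" by (simp add: prod_mset_zero_iff)
      ultimately show False using deg dvd_imp_degree_le by (metis le_zero_eq)
    qed
    then obtain U where U: "prime U" "U dvd h" "degree U \<noteq> 0" by blast
    have "U dvd k" if k: "k \<in> I" for k
    proof -
      obtain n q where "smult (lead_coeff h ^ n) k = h * q" using pdiv[OF k] by blast
      then have "U dvd [:lead_coeff h ^ n:] * k" using U(2) by simp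
      moreover have "\<not> U dvd [:lead_coeff h ^ n:]"
      proof
        assume "U dvd [:lead_coeff h ^ n:]"
        moreover have "[:lead_coeff h ^ n:] \<noteq> 0" using h(2) by simp
        ultimately have "degree U \<le> degree [:lead_coeff h ^ n:]" by (rule dvd_imp_degree_le)
        then show False using U(3) by simp
      qed
      ultimately show ?thesis using U(1) prime_dvd_mult_iff by blast
    qed
    then have "U dvd F" "U dvd G" using FI by auto
    then show False using assms(4)[of "ev U"] U(1) by (auto simp: FG pprime_def ev_pdvd_iff)
  qed
  then obtain R where R: "h = [:R:]" using degree_eq_zeroE by blast
  obtain A B where AB: "h = A * F + B * G" using h(1) unfolding I_def by blast
  show ?thesis
  proof (rule exI[of _ "ev A"], rule exI[of _ "ev B"], rule exI[of _ "ev h"], intro conjI allI impI)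
    show "\<exists>x. ev h x \<noteq> 0" using ev_inject h(2) by blast
    show "ev h x = ev A x * f x + ev B x * g x" for x unfolding AB FG by (simp add: ev_simps)
    show "ev h x = ev h y" if "x $ 1 = y $ 1 \<and> x $ 2 = y $ 2" for x y
      using that by (simp add: R ev_def)
  qed (auto simp: polyfun3_ev)
qed

subsection \<open>Vector algebra in three complex dimensions\<close>

definition dot3 :: "complex^3 \<Rightarrow> complex^3 \<Rightarrow> complex" where
  "dot3 a b = a $ 1 * b $ 1 + a $ 2 * b $ 2 + a $ 3 * b $ 3"

definition crs3 :: "complex^3 \<Rightarrow> complex^3 \<Rightarrow> complex^3" where
  "crs3 a b = vector [a $ 2 * b $ 3 - a $ 3 * b $ 2, a $ 3 * b $ 1 - a $ 1 * b $ 3,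
     a $ 1 * b $ 2 - a $ 2 * b $ 1]"

lemma crs3_nth [simp]:
  "crs3 a b $ 1 = a $ 2 * b $ 3 - a $ 3 * b $ 2"
  "crs3 a b $ 2 = a $ 3 * b $ 1 - a $ 1 * b $ 3"
  "crs3 a b $ 3 = a $ 1 * b $ 2 - a $ 2 * b $ 1"
  by (simp_all add: crs3_def)

lemma vec3_eq_iff: "(a :: complex^3) = b \<longleftrightarrow> a $ 1 = b $ 1 \<and> a $ 2 = b $ 2 \<and> a $ 3 = b $ 3"
  by (simp add: vec_eq_iff forall_3)

lemma dot3_sum: "dot3 a b = (\<Sum>i\<in>UNIV. a $ i * b $ i)"
  by (simp add: dot3_def sum_3)

lemma dot3_linear:
  "dot3 a (b + c) = dot3 a b + dot3 a c" "dot3 (a + b) c = dot3 a c + dot3 b c"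
  "dot3 a (t *s b) = t * dot3 a b" "dot3 (t *s a) b = t * dot3 a b"
  "dot3 a (b - c) = dot3 a b - dot3 a c" "dot3 (a - b) c = dot3 a c - dot3 b c"
  "dot3 a 0 = 0" "dot3 0 b = 0"
  by (simp_all add: dot3_def algebra_simps)

lemma dot3_commute: "dot3 a b = dot3 b a"
  by (simp add: dot3_def algebra_simps)

lemma dot3_axis: "dot3 (axis i 1) a = a $ i" "dot3 a (axis i 1) = a $ i"
  using exhaust_3[of i] by (auto simp: dot3_def axis_def)

lemma vec3_nonzero_dot3: "a \<noteq> 0 \<Longrightarrow> \<exists>b. dot3 a b \<noteq> 0"
  by (metis dot3_axis(2) vec_eq_iff zero_index)

lemma dot3_polyfun3:
  assumes "\<And>i. polyfun3 (\<lambda>x. g x $ i)" shows "polyfun3 (\<lambda>x. dot3 a (g x))"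
  unfolding dot3_def by (intro polyfun3_intros assms)

lemma dot3_hpoly3:
  assumes "\<And>i. hpoly3 k (\<lambda>x. g x $ i)" shows "hpoly3 k (\<lambda>x. dot3 a (g x))"
  unfolding dot3_def by (intro hpoly3_add hpoly3_scale assms)

lemma crs3_eq_0_imp:
  assumes "crs3 a b = 0" "b \<noteq> 0" shows "\<exists>t. a = t *s b"
proof -
  have h: "a $ 2 * b $ 3 = a $ 3 * b $ 2" "a $ 3 * b $ 1 = a $ 1 * b $ 3" "a $ 1 * b $ 2 = a $ 2 * b $ 1"
    using assms(1) by (auto simp: vec3_eq_iff)
  consider "b $ 1 \<noteq> 0" | "b $ 2 \<noteq> 0" | "b $ 3 \<noteq> 0" using assms(2) by (auto simp: vec3_eq_iff)
  then show ?thesis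
  proof cases
    case 1 show ?thesis by (rule exI[of _ "a $ 1 / b $ 1"]) (use 1 h in \<open>auto simp: vec3_eq_iff field_simps\<close>)
  next
    case 2 show ?thesis by (rule exI[of _ "a $ 2 / b $ 2"]) (use 2 h in \<open>auto simp: vec3_eq_iff field_simps\<close>)
  next
    case 3 show ?thesis by (rule exI[of _ "a $ 3 / b $ 3"]) (use 3 h in \<open>auto simp: vec3_eq_iff field_simps\<close>)
  qed
qed

text \<open>\<open>l\<close> and \<open>m\<close> span the linear forms vanishing at
  \<open>p\<close>; \<open>n\<close> completes them to a basis.\<close>

lemma kernel_frame_exists:
  assumes "p \<noteq> 0"
  shows "\<exists>l m n. dot3 l p = 0 \<and> dot3 m p = 0 \<and> dot3 l (crs3 m n) \<noteq> 0"
proof -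
  consider "p $ 1 \<noteq> 0" | "p $ 2 \<noteq> 0" | "p $ 3 \<noteq> 0" using assms by (auto simp: vec3_eq_iff)
  then show ?thesis
  proof cases
    case 1 then show ?thesis
      by - (rule exI[of _ "vector [- p $ 2, p $ 1, 0]"], rule exI[of _ "vector [- p $ 3, 0, p $ 1]"],
          rule exI[of _ "vector [1, 0, 0]"], simp add: dot3_def)
  next
    case 2 then show ?thesis
      by - (rule exI[of _ "vector [p $ 2, - p $ 1, 0]"], rule exI[of _ "vector [0, - p $ 3, p $ 2]"],
          rule exI[of _ "vector [0, 1, 0]"], simp add: dot3_def)
  next
    case 3 then show ?thesis
      by - (rule exI[of _ "vector [p $ 3, 0, - p $ 1]"], rule exI[of _ "vector [0, p $ 3, - p $ 2]"],
          rule exI[of _ "vector [0, 0, 1]"], simp add: dot3_def)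
  qed
qed

lemma det3_dot3: "det (M :: complex^3^3) = dot3 (M $ 1) (crs3 (M $ 2) (M $ 3))"
  by (simp add: det_3 dot3_def algebra_simps)

lemma matrix_vector_dot3: "(M *v x) $ i = dot3 (M $ i) x"
  by (simp add: matrix_vector_mult_def dot3_sum)

subsection \<open>Homogeneous maps\<close>

text \<open>Unlike \<open>ratmap\<close> this admits the zero map, so that the maps of degree
  \<open>k\<close> form a finite-dimensional vector space, coordinatized by \<open>lincomb\<close>
  below.\<close>

definition hmap :: "nat \<Rightarrow> (complex^3 \<Rightarrow> complex^3) \<Rightarrow> bool" where
  "hmap k G \<longleftrightarrow> (\<forall>i. hpoly3 k (\<lambda>x. G x $ i))"

lemma hmap_hpoly3: "hmap k G \<Longrightarrow> hpoly3 k (\<lambda>x. G x $ i)" by (simp add: hmap_def)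
lemma hmap_polyfun3: "hmap k G \<Longrightarrow> polyfun3 (\<lambda>x. G x $ i)"
  by (rule polyfun3_hpoly3[OF hmap_hpoly3])
lemma hmap_homogeneous: "hmap k G \<Longrightarrow> G (t *s x) = t ^ k *s G x"
  using hpoly3_homogeneous[OF hmap_hpoly3] by (simp add: vec_eq_iff)

lemma hmap_compose: "hmap k F \<Longrightarrow> hmap n G \<Longrightarrow> hmap (k * n) (\<lambda>x. F (G x))"
  using hpoly3_compose unfolding hmap_def by blast

lemma hmap_matrix: "hmap k F \<Longrightarrow> hmap k (\<lambda>x. M *v F x)"
  unfolding hmap_def matrix_vector_dot3 by (intro allI dot3_hpoly3) auto

lemma hmap_id: "hmap 1 (\<lambda>x. x)"
  by (simp add: hmap_def hpoly3_coord[unfolded One_nat_def])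

lemma reduced_nonzero:
  assumes "reduced F" shows "\<exists>x. F x \<noteq> 0"
proof (rule ccontr)
  assume "\<not> ?thesis"
  then have F: "\<And>x j. F x $ j = 0" by simp
  have "\<not> (\<exists>c. \<forall>x :: complex^3. x $ 1 = c)" by (metis vector_3(1) zero_neq_one)
  then obtain u where "pprime u" using nonconst_has_pprime[of "\<lambda>x. x $ 1"] polyfun3_coord by blast
  then have "common_factor F" unfolding common_factor_iff F by (auto intro: pdvd_zero)
  then show False using assms by (simp add: reduced_def)
qed

lemma reducedD: "reduced F \<Longrightarrow> pprime u \<Longrightarrow> \<exists>j. \<not> u pdvd (\<lambda>x. F x $ j)"
  unfolding reduced_def common_factor_iff by blast

lemma reduced_component:
  assumes "reduced F" shows "\<exists>i x. F x $ i \<noteq> 0"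
  using reduced_nonzero[OF assms] by (metis vec_eq_iff zero_index)

subsection \<open>Contracted curves\<close>

lemma polyfun3_line:
  assumes "polyfun3 p" shows "\<exists>Q. \<forall>t. p (a + t *s v) = poly Q t"
  using assms
proof (induction rule: polyfun3_induct)
  case (const c) show ?case by (rule exI[of _ "[:c:]"]) simp
next
  case (coord i) show ?case by (rule exI[of _ "[:a $ i, v $ i:]"]) simp
next
  case (add p q)
  then obtain P Q where "\<And>t. p (a + t *s v) = poly P t" "\<And>t. q (a + t *s v) = poly Q t" by blast
  then show ?case by (intro exI[of _ "P + Q"]) simp
next
  case (mult p q)
  then obtain P Q where "\<And>t. p (a + t *s v) = poly P t" "\<And>t. q (a + t *s v) = poly Q t" by blast
  then show ?case by (intro exI[of _ "P * Q"]) simp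
qed

lemma sum_hpoly3_eq_0:
  assumes "\<And>i. hpoly3 i (e i)" "\<And>x. (\<Sum>i\<le>N. e i x) = 0" "i \<le> N"
  shows "e i x = 0"
proof (rule poly_sum_power_eq_0[where a="\<lambda>i. e i x" and N=N])
  fix t
  have "(\<Sum>i\<le>N. e i (t *s x)) = 0" by (rule assms(2))
  then show "(\<Sum>i\<le>N. e i x * t ^ i) = 0"
    by (simp add: hpoly3_homogeneous[OF assms(1)] mult.commute)
qed (rule assms(3))

lemma complex_poly_factorized:
  fixes Q :: "complex poly"
  shows "\<exists>as. smult (lead_coeff Q) (\<Prod>a\<leftarrow>as. [:- a, 1:]) = Q"
proof (induction "degree Q" arbitrary: Q)
  case 0
  then obtain c where "Q = [:c:]" by (metis degree_eq_zeroE)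
  then show ?case by (intro exI[of _ "[]"]) simp
next
  case (Suc n)
  then have "\<not> constant (poly Q)" by (simp add: constant_degree)
  then obtain a where "poly Q a = 0" using fundamental_theorem_of_algebra by blast
  then obtain R where R: "Q = [:- a, 1:] * R" unfolding poly_eq_0_iff_dvd by (elim dvdE)
  have "R \<noteq> 0" using Suc(2) R by auto
  then have "degree Q = 1 + degree R" unfolding R by (subst degree_mult_eq) auto
  then have "n = degree R" using Suc(2) by simp
  then obtain as where "smult (lead_coeff R) (\<Prod>a\<leftarrow>as. [:- a, 1:]) = R" using Suc(1) by blast
  moreover have "lead_coeff Q = lead_coeff R" unfolding R lead_coeff_mult by simp
  ultimately have "smult (lead_coeff Q) ([:- a, 1:] * (\<Prod>a\<leftarrow>as. [:- a, 1:])) = Q"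
    unfolding R by (metis mult_smult_right)
  then have "smult (lead_coeff Q) (\<Prod>a\<leftarrow>a # as. [:- a, 1:]) = Q" by simp
  then show ?case by blast
qed

text \<open>A binary form splits into linear factors, and \<open>u\<close> is prime.\<close>
lemma binary_form_dvd:
  assumes r: "hpoly3 m r" "\<exists>x. r x \<noteq> 0" and dep: "\<And>x y. x $ 1 = y $ 1 \<Longrightarrow> x $ 2 = y $ 2 \<Longrightarrow> r x = r y"
    and u: "pprime u" and G: "\<And>i. polyfun3 (\<lambda>x. G x $ i)" and ur: "u pdvd (\<lambda>x. r (G x))"
  shows "\<exists>\<alpha> \<beta>. (\<alpha>, \<beta>) \<noteq> (0, 0) \<and> u pdvd (\<lambda>x. \<alpha> * G x $ 1 + \<beta> * G x $ 2)"
proof -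
  have rp: "polyfun3 r" by (rule polyfun3_hpoly3[OF r(1)])
  \<comment> \<open>\<open>Q\<close> is the dehomogenization \<open>r\<close> at
    \<open>(t, 1, 0)\<close>; by \<open>dep\<close> the third coordinate can be set to 0.\<close>
  obtain Q where Q: "\<And>t. r (vector [0, 1, 0] + t *s vector [1, 0, 0]) = poly Q t"
    using polyfun3_line[OF rp] by blast
  have rQ: "r x = (x $ 2) ^ m * poly Q (x $ 1 / x $ 2)" if "x $ 2 \<noteq> 0" for x
  proof -
    have "r x = r (x $ 2 *s (vector [0, 1, 0] + (x $ 1 / x $ 2) *s vector [1, 0, 0]))"
      by (rule dep) (use that in simp_all)
    then show ?thesis unfolding hpoly3_homogeneous[OF r(1)] Q .
  qed
  have "Q \<noteq> 0"
  proof
    assume "Q = 0"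
    then have "r x = 0" if "x $ 2 \<noteq> 0" for x using rQ that by simp
    moreover have "\<exists>x :: complex^3. x $ 2 \<noteq> 0" by (rule exI[of _ "vector [0, 1, 0]"]) simp
    ultimately have "r x = 0" for x using polyfun3_zero_off[OF rp polyfun3_coord] by blast
    then show False using r(2) by simp
  qed
  obtain as where as: "smult (lead_coeff Q) (\<Prod>a\<leftarrow>as. [:- a, 1:]) = Q"
    using complex_poly_factorized[of Q] by blast
  define c where "c = lead_coeff Q"
  have c: "c \<noteq> 0" using \<open>Q \<noteq> 0\<close> by (simp add: c_def)
  have pas: "z ^ length bs * poly (\<Prod>a\<leftarrow>bs. [:- a, 1:]) (y / z) = (\<Prod>a\<leftarrow>bs. y - a * z)"
    if "z \<noteq> 0" for y z and bs :: "complex list"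
    by (induction bs) (use that in \<open>auto simp: field_simps\<close>)
  \<comment> \<open>The degree \<open>length as\<close> of \<open>Q\<close> may be smaller than
    \<open>m\<close>, so powers of \<open>x $ 2\<close> are cleared on both sides; the identity then
    extends to \<open>x $ 2 = 0\<close>.\<close>
  have key: "(x $ 2) ^ length as * r x = c * (x $ 2) ^ m * (\<Prod>a\<leftarrow>as. x $ 1 - a * x $ 2)" if "x $ 2 \<noteq> 0" for x
  proof -
    have "poly Q t = c * poly (\<Prod>a\<leftarrow>as. [:- a, 1:]) t" for t
      using arg_cong[OF as, of "\<lambda>p. poly p t"] by (simp add: c_def)
    then show ?thesis using rQ[OF that] pas[OF that, of as "x $ 1"] by simp
  qed
  have list_poly: "polyfun3 (\<lambda>x. \<Prod>a\<leftarrow>bs. g x $ 1 - a * g x $ 2)"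
    if "\<And>i. polyfun3 (\<lambda>x. g x $ i)" for bs and g :: "complex^3 \<Rightarrow> complex^3"
  proof (induction bs)
    case (Cons b bs)
    have "polyfun3 (\<lambda>x. g x $ 1 - b * g x $ 2)" by (intro polyfun3_intros that)
    from polyfun3_mult[OF this Cons.IH] show ?case by simp
  qed (simp add: polyfun3_const)
  have "(x $ 2) ^ length as * r x - c * (x $ 2) ^ m * (\<Prod>a\<leftarrow>as. x $ 1 - a * x $ 2) = 0" for x
  proof (rule polyfun3_zero_off[where r="\<lambda>x. x $ 2"])
    show "polyfun3 (\<lambda>x. (x $ 2) ^ length as * r x - c * (x $ 2) ^ m * (\<Prod>a\<leftarrow>as. x $ 1 - a * x $ 2))"
      by (intro polyfun3_intros rp list_poly)
    show "\<exists>x :: complex^3. x $ 2 \<noteq> 0" by (rule exI[of _ "vector [0, 1, 0]"]) simp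
  qed (use key polyfun3_coord in auto)
  then have "u pdvd (\<lambda>x. c * (G x $ 2) ^ m * (\<Prod>a\<leftarrow>as. G x $ 1 - a * G x $ 2))"
    by (intro pdvd_cong[OF pdvd_mult_left[OF ur polyfun3_power[OF G[of 2], of "length as"]]]) simp
  then have "u pdvd (\<lambda>x. c * ((G x $ 2) ^ m * (\<Prod>a\<leftarrow>as. G x $ 1 - a * G x $ 2)))" by (simp add: mult.assoc)
  then have "u pdvd (\<lambda>x. (G x $ 2) ^ m * (\<Prod>a\<leftarrow>as. G x $ 1 - a * G x $ 2))"
    by (rule pdvd_scale_cancel) (rule c)
  then have "u pdvd (\<lambda>x. (G x $ 2) ^ m) \<or> u pdvd (\<lambda>x. \<Prod>a\<leftarrow>as. G x $ 1 - a * G x $ 2)"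
    by (intro pprime_dvd_multD[OF u] polyfun3_intros list_poly G)
  then show ?thesis
  proof
    assume "u pdvd (\<lambda>x. (G x $ 2) ^ m)"
    moreover have "m > 0"
    proof (rule ccontr)
      assume "\<not> m > 0"
      then have "u pdvd (\<lambda>x. 1)" using calculation by simp
      then show False using pprime_not_dvd_const[OF u, of 1] by simp
    qed
    ultimately have "u pdvd (\<lambda>x. G x $ 2)" by (intro pprime_dvd_powerD[OF u G])
    then show ?thesis by - (rule exI[of _ 0], rule exI[of _ 1], simp)
  next
    assume "u pdvd (\<lambda>x. \<Prod>a\<leftarrow>as. G x $ 1 - a * G x $ 2)"
    then have "\<exists>a. u pdvd (\<lambda>x. G x $ 1 - a * G x $ 2)"
    proof (induction as)
      case Nil then show ?case using pprime_not_dvd_const[OF u, of 1] by simp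
    next
      case (Cons a as)
      then have "u pdvd (\<lambda>x. G x $ 1 - a * G x $ 2) \<or> u pdvd (\<lambda>x. \<Prod>a\<leftarrow>as. G x $ 1 - a * G x $ 2)"
        by (intro pprime_dvd_multD[OF u] polyfun3_intros list_poly G) auto
      then show ?case using Cons.IH by blast
    qed
    then obtain a where "u pdvd (\<lambda>x. G x $ 1 - a * G x $ 2)" by blast
    then show ?thesis by - (rule exI[of _ 1], rule exI[of _ "- a"], simp)
  qed
qed

text \<open>After substituting \<open>G\<close>, the eliminant \<open>a f + b g\<close> is divisible
  by \<open>u\<close>. The polynomials \<open>a\<close>, \<open>b\<close>, \<open>r\<close> from
  \<open>coprime_elimination\<close> need not be homogeneous, so the identity is split by degree,
  and a nonzero component of \<open>r\<close> is the binary form to which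
  \<open>binary_form_dvd\<close> applies.\<close>

lemma coprime_forms_linear_dvd:
  assumes f: "hpoly3 k f" "\<exists>x. f x \<noteq> 0" and g: "hpoly3 k g"
    and cop: "\<And>v. pprime v \<Longrightarrow> v pdvd f \<Longrightarrow> \<not> v pdvd g"
    and u: "pprime u" and G: "\<And>i. polyfun3 (\<lambda>x. G x $ i)"
    and uf: "u pdvd (\<lambda>x. f (G x))" and ug: "u pdvd (\<lambda>x. g (G x))"
  shows "\<exists>\<alpha> \<beta>. (\<alpha>, \<beta>) \<noteq> (0, 0) \<and> u pdvd (\<lambda>x. \<alpha> * G x $ 1 + \<beta> * G x $ 2)"
proof -
  obtain a b r where ab: "polyfun3 a" "polyfun3 b" "polyfun3 r" "\<exists>x. r x \<noteq> 0"
    and r: "\<And>x. r x = a x * f x + b x * g x" and dep: "\<And>x y. x $ 1 = y $ 1 \<Longrightarrow> x $ 2 = y $ 2 \<Longrightarrow> r x = r y"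
    using coprime_elimination[OF polyfun3_hpoly3[OF f(1)] polyfun3_hpoly3[OF g] f(2) cop] by blast
  obtain N1 a' where a': "\<And>i. hpoly3 i (a' i)" "\<And>x. a x = (\<Sum>i\<le>N1. a' i x)"
    using ab(1) unfolding polyfun3_iff_hpoly3s by blast
  obtain N2 b' where b': "\<And>i. hpoly3 i (b' i)" "\<And>x. b x = (\<Sum>i\<le>N2. b' i x)"
    using ab(2) unfolding polyfun3_iff_hpoly3s by blast
  obtain N3 r' where r': "\<And>i. hpoly3 i (r' i)" "\<And>x. r x = (\<Sum>i\<le>N3. r' i x)"
    using ab(3) unfolding polyfun3_iff_hpoly3s by blast
  define N where "N = N1 + N2 + N3"
  define A where "A i = (if i \<le> N1 then a' i else (\<lambda>_. 0))" for i
  define B where "B i = (if i \<le> N2 then b' i else (\<lambda>_. 0))" for i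
  define R where "R i = (if i \<le> N3 then r' i else (\<lambda>_. 0))" for i
  have hA: "hpoly3 i (A i)" and hB: "hpoly3 i (B i)" and hR: "hpoly3 i (R i)" for i
    by (simp_all add: A_def B_def R_def a' b' r' hpoly3_zero)
  have aA: "a x = (\<Sum>i\<le>N. A i x)" for x unfolding A_def by (rule sum_hpoly3_extend) (auto simp: a' N_def)
  have bB: "b x = (\<Sum>i\<le>N. B i x)" for x unfolding B_def by (rule sum_hpoly3_extend) (auto simp: b' N_def)
  have rR: "r x = (\<Sum>i\<le>N+k. R i x)" for x unfolding R_def by (rule sum_hpoly3_extend) (auto simp: r' N_def)
  \<comment> \<open>\<open>E i\<close> is the component of degree \<open>i\<close> of
    \<open>a f + b g\<close>; it vanishes for \<open>i < k\<close> because \<open>f\<close> and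
    \<open>g\<close> have degree \<open>k\<close>.\<close>
  define E where "E i x = (if k \<le> i then A (i - k) x * f x + B (i - k) x * g x else 0)" for i x
  have hE: "hpoly3 i (E i)" for i
  proof (cases "k \<le> i")
    case True
    have "hpoly3 ((i - k) + k) (\<lambda>x. A (i - k) x * f x + B (i - k) x * g x)"
      by (intro hpoly3_add hpoly3_mult hA hB f g)
    then show ?thesis using True by (simp add: E_def[abs_def])
  qed (simp add: E_def[abs_def] hpoly3_zero)
  have sE: "(\<Sum>i\<le>N+k. E i x) = r x" for x
  proof -
    have "(\<Sum>i\<le>N+k. E i x) = (\<Sum>i\<in>{k..N+k}. E i x)"
      by (rule sum.mono_neutral_right) (auto simp: E_def)
    also have "\<dots> = (\<Sum>i\<in>{0..N}. E (i + k) x)"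
      using sum.shift_bounds_cl_nat_ivl[of "\<lambda>i. E i x" 0 k N] by simp
    also have "\<dots> = a x * f x + b x * g x"
      by (simp add: E_def aA bB sum.distrib sum_distrib_right atMost_atLeast0)
    finally show ?thesis using r by simp
  qed
  have RE: "R i x = E i x" if "i \<le> N + k" for i x
  proof -
    have "R i x - E i x = 0"
      by (rule sum_hpoly3_eq_0[where e="\<lambda>i x. R i x - E i x", OF _ _ that])
        (auto intro: hpoly3_diff hR hE simp: sum_subtractf rR[symmetric] sE)
    then show ?thesis by simp
  qed
  obtain m where m: "m \<le> N + k" "\<exists>x. R m x \<noteq> 0"
  proof (rule ccontr)
    assume "\<not> thesis"
    then have "R i x = 0" if "i \<le> N + k" for i x using that \<open>\<And>m. m \<le> N + k \<Longrightarrow> \<exists>x. R m x \<noteq> 0 \<Longrightarrow> thesis\<close> by blast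
    then have "r x = 0" for x unfolding rR by simp
    then show False using ab(4) by simp
  qed
  \<comment> \<open>Comparing powers of \<open>t\<close> in \<open>r (t *s x) = r (t *s y)\<close>
    passes the independence of the third coordinate on to each component.\<close>
  have depR: "R m x = R m y" if "x $ 1 = y $ 1" "x $ 2 = y $ 2" for x y
  proof -
    have "R m x - R m y = 0"
    proof (rule poly_sum_power_eq_0[where a="\<lambda>i. R i x - R i y", OF _ m(1)])
      fix t
      have "r (t *s x) = r (t *s y)" by (rule dep) (simp_all add: that)
      then show "(\<Sum>i\<le>N+k. (R i x - R i y) * t ^ i) = 0"
        unfolding rR hpoly3_homogeneous[OF hR] by (simp add: algebra_simps sum_subtractf)
    qed
    then show ?thesis by simp
  qed
  have "u pdvd (\<lambda>x. R m (G x))"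
  proof (cases "k \<le> m")
    case True
    have "u pdvd (\<lambda>x. A (m - k) (G x) * f (G x) + B (m - k) (G x) * g (G x))"
      by (rule pdvd_add[OF pdvd_mult_left[OF uf polyfun3_compose[OF polyfun3_hpoly3[OF hA] G]]
            pdvd_mult_left[OF ug polyfun3_compose[OF polyfun3_hpoly3[OF hB] G]]])
    then show ?thesis using True by (simp add: RE[OF m(1)] E_def)
  next
    case False
    then show ?thesis using m by (auto simp: RE[OF m(1)] E_def pdvd_zero)
  qed
  with binary_form_dvd[OF hR m(2) depR u G] show ?thesis by blast
qed

text \<open>The third form of the frame \<open>A\<close> takes the part of the third coordinate.
  Coprimality of \<open>f\<close> and \<open>g\<close> survives the change of variables, since a
  common prime would pull back along \<open>A\<close>.\<close>

lemma coprime_forms_linear_dvd_frame: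
  fixes A B :: "complex^3^3"
  assumes f: "hpoly3 k f" "\<exists>x. f x \<noteq> 0" and g: "hpoly3 k g"
    and cop: "\<And>v. pprime v \<Longrightarrow> v pdvd f \<Longrightarrow> \<not> v pdvd g"
    and u: "pprime u" and G: "\<And>i. polyfun3 (\<lambda>x. G x $ i)"
    and uf: "u pdvd (\<lambda>x. f (G x))" and ug: "u pdvd (\<lambda>x. g (G x))"
    and AB: "A ** B = mat 1" "B ** A = mat 1"
  shows "\<exists>\<alpha> \<beta>. (\<alpha>, \<beta>) \<noteq> (0, 0) \<and> u pdvd (\<lambda>x. dot3 (\<alpha> *s A $ 1 + \<beta> *s A $ 2) (G x))"
proof -
  have BA: "B *v (A *v x) = x" and AB': "A *v (B *v x) = x" for x :: "complex^3"
    by (simp_all add: matrix_vector_mul_assoc AB)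
  have lin: "hpoly3 1 (\<lambda>x. (M *v x) $ i)" for M :: "complex^3^3" and i
    using hmap_matrix[OF hmap_id, of M] by (simp add: hmap_def)
  have hB: "hpoly3 k (\<lambda>x. h (B *v x))" if "hpoly3 k h" for h
    using hpoly3_compose[OF that lin] by simp
  have "\<exists>\<alpha> \<beta>. (\<alpha>, \<beta>) \<noteq> (0, 0) \<and> u pdvd (\<lambda>x. \<alpha> * (A *v G x) $ 1 + \<beta> * (A *v G x) $ 2)"
  proof (rule coprime_forms_linear_dvd[of k "\<lambda>x. f (B *v x)" "\<lambda>x. g (B *v x)"])
    show "\<exists>x. f (B *v x) \<noteq> 0" using f(2) BA by metis
    show "\<not> v pdvd (\<lambda>x. g (B *v x))" if v: "pprime v" "v pdvd (\<lambda>x. f (B *v x))" for v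
    proof
      assume vg: "v pdvd (\<lambda>x. g (B *v x))"
      have tr: "(\<lambda>x. v (A *v x)) pdvd h" if vh: "v pdvd (\<lambda>x. h (B *v x))" for h
      proof -
        obtain q where q: "polyfun3 q" "\<And>x. h (B *v x) = v x * q x" using vh unfolding pdvd_def by blast
        have "h x = v (A *v x) * q (A *v x)" for x using q(2)[of "A *v x"] by (simp add: BA)
        moreover have "polyfun3 (\<lambda>x. q (A *v x))" by (rule polyfun3_compose[OF q(1) polyfun3_hpoly3[OF lin]])
        ultimately show ?thesis unfolding pdvd_def by blast
      qed
      have "polyfun3 (\<lambda>x. v (A *v x))"
        by (rule polyfun3_compose[OF pprime_polyfun3[OF v(1)] polyfun3_hpoly3[OF lin]])
      moreover have "\<not> (\<exists>c. \<forall>x. v (A *v x) = c)" using pprime_nonconst[OF v(1)] AB' by metis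
      ultimately obtain w where w: "pprime w" "w pdvd (\<lambda>x. v (A *v x))" using nonconst_has_pprime by blast
      then have "w pdvd f" "w pdvd g" using tr[OF v(2)] tr[OF vg] pdvd_trans by blast+
      then show False using cop[OF w(1)] by blast
    qed
    show "polyfun3 (\<lambda>x. (A *v G x) $ i)" for i unfolding matrix_vector_dot3 by (rule dot3_polyfun3[OF G])
  qed (use hB f g u uf ug in \<open>simp_all add: BA\<close>)
  then show ?thesis by (simp add: matrix_vector_dot3 dot3_linear)
qed

text \<open>\<open>G\<close> maps the irreducible curve \<open>u = 0\<close> into the finite set
  \<open>f = g = 0\<close>, hence to one point \<open>p\<close>. Two eliminations give two
  independent linear forms in \<open>G\<close> divisible by \<open>u\<close>, and \<open>p\<close>
  is their common zero, the cross product.\<close>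

lemma coprime_forms_contracted:
  assumes f: "hpoly3 k f" "\<exists>x. f x \<noteq> 0" and g: "hpoly3 k g"
    and cop: "\<And>v. pprime v \<Longrightarrow> v pdvd f \<Longrightarrow> \<not> v pdvd g"
    and u: "pprime u" and G: "\<And>i. polyfun3 (\<lambda>x. G x $ i)"
    and uf: "u pdvd (\<lambda>x. f (G x))" and ug: "u pdvd (\<lambda>x. g (G x))"
  shows "\<exists>p. p \<noteq> 0 \<and> (\<forall>i. u pdvd (\<lambda>x. crs3 (G x) p $ i))"
proof -
  have L: "\<exists>\<alpha> \<beta>. (\<alpha>, \<beta>) \<noteq> (0, 0) \<and> u pdvd (\<lambda>x. dot3 (\<alpha> *s A $ 1 + \<beta> *s A $ 2) (G x))"
    if AB: "A ** B = mat 1" "B ** A = mat 1" for A B :: "complex^3^3"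
    by (rule coprime_forms_linear_dvd_frame[OF f g _ u G uf ug AB]) (use cop in blast)
  define perm :: "complex^3 \<Rightarrow> complex^3 \<Rightarrow> complex^3 \<Rightarrow> complex^3^3" where "perm a b c = vector [a, b, c]" for a b c
  define e1 e2 e3 :: "complex^3" where "e1 = vector [1,0,0]" and "e2 = vector [0,1,0]" and "e3 = vector [0,0,1]"
  note defs = perm_def e1_def e2_def e3_def
  have I: "perm e1 e2 e3 ** perm e1 e2 e3 = mat 1"
    by (simp add: defs vec_eq_iff forall_3 matrix_matrix_mult_def sum_3 mat_def)
  have S: "perm e1 e3 e2 ** perm e1 e3 e2 = mat 1"
    by (simp add: defs vec_eq_iff forall_3 matrix_matrix_mult_def sum_3 mat_def)
  have T: "perm e2 e3 e1 ** perm e3 e1 e2 = mat 1" "perm e3 e1 e2 ** perm e2 e3 e1 = mat 1"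
    by (simp_all add: defs vec_eq_iff forall_3 matrix_matrix_mult_def sum_3 mat_def)
  obtain a b where ab: "(a, b) \<noteq> (0, 0)" "u pdvd (\<lambda>x. dot3 (a *s e1 + b *s e2) (G x))"
    using L[OF I I] unfolding perm_def by auto
  \<comment> \<open>The second form must be independent of the first: if \<open>a = 0\<close>, the
    first is a multiple of the second coordinate and a form in the first and third is taken;
    otherwise a form in the second and third, which lacks the first coordinate.\<close>
  have "\<exists>l. u pdvd (\<lambda>x. dot3 l (G x)) \<and> crs3 (a *s e1 + b *s e2) l \<noteq> 0"
  proof (cases "a = 0")
    case True
    obtain c d where "(c, d) \<noteq> (0, 0)" "u pdvd (\<lambda>x. dot3 (c *s e1 + d *s e3) (G x))"
      using L[OF S S] unfolding perm_def by auto
    then show ?thesis using True ab(1)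
      by (intro exI[of _ "c *s e1 + d *s e3"]) (auto simp: vec3_eq_iff e1_def e2_def e3_def)
  next
    case False
    obtain c d where "(c, d) \<noteq> (0, 0)" "u pdvd (\<lambda>x. dot3 (c *s e2 + d *s e3) (G x))"
      using L[OF T] unfolding perm_def by auto
    then show ?thesis using False
      by (intro exI[of _ "c *s e2 + d *s e3"]) (auto simp: vec3_eq_iff e1_def e2_def e3_def)
  qed
  then obtain l where l: "u pdvd (\<lambda>x. dot3 l (G x))" "crs3 (a *s e1 + b *s e2) l \<noteq> 0" by blast
  define l' where "l' = a *s e1 + b *s e2"
  have "u pdvd (\<lambda>x. crs3 (G x) (crs3 l' l) $ i)" for i
  proof -
    have "u pdvd (\<lambda>x. l' $ i * dot3 l (G x) - l $ i * dot3 l' (G x))"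
      using ab(2) l(1) unfolding l'_def by (intro pdvd_diff pdvd_scale)
    moreover have "crs3 (G x) (crs3 l' l) $ i = l' $ i * dot3 l (G x) - l $ i * dot3 l' (G x)" for x
      using exhaust_3[of i] by (auto simp: dot3_def algebra_simps)
    ultimately show ?thesis by simp
  qed
  then show ?thesis using l(2) unfolding l'_def by blast
qed

text \<open>A curve that \<open>G\<close> sends into the indeterminacy set of \<open>H\<close> is
  contracted. The components of a reduced \<open>H\<close> may still share factors pairwise, so the
  two coprime forms are one component and a generic combination of the other two.\<close>

lemma reduced_contracted:
  assumes H: "hmap k H" "reduced H" and u: "pprime u" and G: "\<And>i. polyfun3 (\<lambda>x. G x $ i)"
    and uH: "\<And>j. u pdvd (\<lambda>x. H (G x) $ j)"
  shows "\<exists>p. p \<noteq> 0 \<and> (\<forall>i. u pdvd (\<lambda>x. crs3 (G x) p $ i))"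
proof -
  obtain i where i: "\<exists>x. H x $ i \<noteq> 0" using reduced_component[OF H(2)] by blast
  obtain j l where jl: "\<And>m. m = i \<or> m = j \<or> m = l"
    using exhaust_3[of i] exhaust_3 by metis
  obtain S where S: "finite S" "\<And>v. v \<in> S \<Longrightarrow> pprime v \<and> v pdvd (\<lambda>x. H x $ i)"
    "\<And>v. pprime v \<Longrightarrow> v pdvd (\<lambda>x. H x $ i) \<Longrightarrow> \<exists>w\<in>S. w pdvd v \<and> v pdvd w"
    using finite_pprimes[OF hmap_polyfun3[OF H(1)] i] by blast
  \<comment> \<open>If two values of \<open>s\<close> were bad for the same \<open>v\<close>,
    subtraction would make \<open>v\<close> divide all three components.\<close>
  have fin: "finite {s. v pdvd (\<lambda>x. H x $ j + s * H x $ l)}" if v: "v \<in> S" for v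
  proof (rule ccontr)
    assume inf: "infinite {s. v pdvd (\<lambda>x. H x $ j + s * H x $ l)}"
    obtain s where s: "v pdvd (\<lambda>x. H x $ j + s * H x $ l)" using inf by (metis (mono_tags) Collect_empty_eq finite.emptyI)
    have "infinite ({s. v pdvd (\<lambda>x. H x $ j + s * H x $ l)} - {s})" using inf by simp
    then obtain s' where s': "s' \<noteq> s" "v pdvd (\<lambda>x. H x $ j + s' * H x $ l)"
      by (metis (no_types, lifting) Diff_iff finite.emptyI insertCI mem_Collect_eq ex_in_conv)
    have "v pdvd (\<lambda>x. (s - s') * H x $ l)"
      using pdvd_diff[OF s s'(2)] by (simp add: algebra_simps)
    then have vl: "v pdvd (\<lambda>x. H x $ l)" by (rule pdvd_scale_cancel) (use s'(1) in simp)
    have "v pdvd (\<lambda>x. H x $ j)" using pdvd_diff[OF s pdvd_scale[OF vl, of s]] by simp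
    then have "v pdvd (\<lambda>x. H x $ m)" for m using jl[of m] vl S(2)[OF v] by auto
    then show False using reducedD[OF H(2)] S(2)[OF v] by blast
  qed
  have "finite (\<Union>v\<in>S. {s. v pdvd (\<lambda>x. H x $ j + s * H x $ l)})" using S(1) fin by blast
  then obtain s where s: "s \<notin> (\<Union>v\<in>S. {s. v pdvd (\<lambda>x. H x $ j + s * H x $ l)})"
    using ex_new_if_finite[OF infinite_UNIV_char_0] by blast
  show ?thesis
  proof (rule coprime_forms_contracted[where f="\<lambda>x. H x $ i" and g="\<lambda>x. H x $ j + s * H x $ l"])
    show "\<not> v pdvd (\<lambda>x. H x $ j + s * H x $ l)" if v: "pprime v" "v pdvd (\<lambda>x. H x $ i)" for v
    proof
      assume "v pdvd (\<lambda>x. H x $ j + s * H x $ l)"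
      then have "\<exists>w\<in>S. w pdvd (\<lambda>x. H x $ j + s * H x $ l)" using S(3)[OF v] pdvd_trans by blast
      then show False using s by blast
    qed
    show "hpoly3 k (\<lambda>x. H x $ j + s * H x $ l)" by (intro hpoly3_add hpoly3_scale hmap_hpoly3[OF H(1)])
    show "u pdvd (\<lambda>x. H (G x) $ j + s * H (G x) $ l)" by (intro pdvd_add pdvd_scale uH)
  qed (use i u G uH hmap_hpoly3[OF H(1)] in auto)
qed

text \<open>Divisibility of \<open>crs3 (G x) p\<close> says that \<open>G\<close> is proportional
  to \<open>p\<close> modulo \<open>u\<close>. Each case writes \<open>p $ m * dot3 l (G x)\<close>
  as a combination of components of the cross product plus \<open>G x $ m * dot3 l p\<close>, which
  is zero.\<close>

lemma contracted_linear:
  assumes "\<And>i. u pdvd (\<lambda>x. crs3 (G x) p $ i)" "p \<noteq> 0" "dot3 l p = 0"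
  shows "u pdvd (\<lambda>x. dot3 l (G x))"
proof -
  obtain m where m: "p $ m \<noteq> 0" using assms(2) by (auto simp: vec_eq_iff)
  have c: "u pdvd (\<lambda>x. G x $ 2 * p $ 3 - G x $ 3 * p $ 2)" "u pdvd (\<lambda>x. G x $ 3 * p $ 1 - G x $ 1 * p $ 3)"
    "u pdvd (\<lambda>x. G x $ 1 * p $ 2 - G x $ 2 * p $ 1)"
    using assms(1)[of 1] assms(1)[of 2] assms(1)[of 3] by simp_all
  have "u pdvd (\<lambda>x. p $ m * dot3 l (G x))"
  proof -
    consider "m = 1" | "m = 2" | "m = 3" using exhaust_3 by blast
    then show ?thesis
    proof cases
      case 1
      have "u pdvd (\<lambda>x. l $ 3 * (G x $ 3 * p $ 1 - G x $ 1 * p $ 3) - l $ 2 * (G x $ 1 * p $ 2 - G x $ 2 * p $ 1))"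
        by (intro pdvd_diff pdvd_scale c)
      moreover have "l $ 3 * (G x $ 3 * p $ 1 - G x $ 1 * p $ 3) - l $ 2 * (G x $ 1 * p $ 2 - G x $ 2 * p $ 1)
          = p $ m * dot3 l (G x) - G x $ 1 * dot3 l p" for x by (simp add: 1 dot3_def algebra_simps)
      ultimately show ?thesis by (simp add: assms(3))
    next
      case 2
      have "u pdvd (\<lambda>x. l $ 1 * (G x $ 1 * p $ 2 - G x $ 2 * p $ 1) - l $ 3 * (G x $ 2 * p $ 3 - G x $ 3 * p $ 2))"
        by (intro pdvd_diff pdvd_scale c)
      moreover have "l $ 1 * (G x $ 1 * p $ 2 - G x $ 2 * p $ 1) - l $ 3 * (G x $ 2 * p $ 3 - G x $ 3 * p $ 2)
          = p $ m * dot3 l (G x) - G x $ 2 * dot3 l p" for x by (simp add: 2 dot3_def algebra_simps)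
      ultimately show ?thesis by (simp add: assms(3))
    next
      case 3
      have "u pdvd (\<lambda>x. l $ 2 * (G x $ 2 * p $ 3 - G x $ 3 * p $ 2) - l $ 1 * (G x $ 3 * p $ 1 - G x $ 1 * p $ 3))"
        by (intro pdvd_diff pdvd_scale c)
      moreover have "l $ 2 * (G x $ 2 * p $ 3 - G x $ 3 * p $ 2) - l $ 1 * (G x $ 3 * p $ 1 - G x $ 1 * p $ 3)
          = p $ m * dot3 l (G x) - G x $ 3 * dot3 l p" for x by (simp add: 3 dot3_def algebra_simps)
      ultimately show ?thesis by (simp add: assms(3))
    qed
  qed
  then show ?thesis by (rule pdvd_scale_cancel) (rule m)
qed

lemma linear_contracted:
  assumes "\<And>l. dot3 l p = 0 \<Longrightarrow> u pdvd (\<lambda>x. dot3 l (G x))"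
  shows "u pdvd (\<lambda>x. crs3 (G x) p $ i)"
proof -
  have "crs3 (G x) p $ i = dot3 (crs3 p (axis i 1)) (G x)" for x
    using exhaust_3[of i] by (auto simp: dot3_def axis_def algebra_simps)
  moreover have "dot3 (crs3 p (axis i 1)) p = 0" by (simp add: dot3_def algebra_simps)
  ultimately show ?thesis using assms by simp
qed

section \<open>Jacobian determinants and contracted curves\<close>

definition grad :: "(complex^3 \<Rightarrow> complex) \<Rightarrow> complex^3 \<Rightarrow> complex^3" where
  "grad p x = (\<chi> j. pd j p x)"

definition jac :: "(complex^3 \<Rightarrow> complex^3) \<Rightarrow> complex^3 \<Rightarrow> complex" where
  "jac G x = dot3 (grad (\<lambda>x. G x $ 1) x) (crs3 (grad (\<lambda>x. G x $ 2) x) (grad (\<lambda>x. G x $ 3) x))"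

lemma grad_nth [simp]: "grad p x $ j = pd j p x" by (simp add: grad_def)

lemma polyfun3_jac: "(\<And>i. polyfun3 (\<lambda>x. G x $ i)) \<Longrightarrow> polyfun3 (jac G)"
  unfolding jac_def[abs_def] dot3_def by (simp, intro polyfun3_intros polyfun3_pd) auto

lemma grad_dot3:
  assumes "\<And>i. polyfun3 (\<lambda>x. G x $ i)"
  shows "grad (\<lambda>x. dot3 l (G x)) x = l $ 1 *s grad (\<lambda>x. G x $ 1) x + l $ 2 *s grad (\<lambda>x. G x $ 2) x + l $ 3 *s grad (\<lambda>x. G x $ 3) x"
  by (simp add: vec_eq_iff dot3_def pd_add pd_scale polyfun3_intros assms)

lemma det3_mult:
  "dot3 (l $ 1 *s a + l $ 2 *s b + l $ 3 *s c) (crs3 (m $ 1 *s a + m $ 2 *s b + m $ 3 *s c) (n $ 1 *s a + n $ 2 *s b + n $ 3 *s c))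
   = dot3 l (crs3 m n) * dot3 a (crs3 b c)"
  by (simp add: dot3_def algebra_simps)

text \<open>Modulo \<open>u\<close>, the gradients of \<open>u p\<close> and \<open>u q\<close> are
  both multiples of the gradient of \<open>u\<close>, so the determinant vanishes.\<close>

lemma common_divisor_jacobian:
  assumes "polyfun3 u" "u pdvd f" "u pdvd g" "polyfun3 h"
  shows "u pdvd (\<lambda>x. dot3 (grad f x) (crs3 (grad g x) (grad h x)))"
proof -
  obtain p q where p: "polyfun3 p" "\<And>x. f x = u x * p x" and q: "polyfun3 q" "\<And>x. g x = u x * q x"
    using assms unfolding pdvd_def by blast
  have f: "f = (\<lambda>x. u x * p x)" and g: "g = (\<lambda>x. u x * q x)" using p q by auto
  have "grad f x = u x *s grad p x + p x *s grad u x" "grad g x = u x *s grad q x + q x *s grad u x" for x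
    unfolding f g by (simp_all add: vec_eq_iff pd_mult assms p q algebra_simps)
  then have "dot3 (grad f x) (crs3 (grad g x) (grad h x)) =
     u x * (u x * dot3 (grad p x) (crs3 (grad q x) (grad h x)) + q x * dot3 (grad p x) (crs3 (grad u x) (grad h x))
       + p x * dot3 (grad u x) (crs3 (grad q x) (grad h x)))" for x
    by (simp add: dot3_def algebra_simps)
  moreover have "polyfun3 (\<lambda>x. u x * dot3 (grad p x) (crs3 (grad q x) (grad h x)) + q x * dot3 (grad p x) (crs3 (grad u x) (grad h x))
       + p x * dot3 (grad u x) (crs3 (grad q x) (grad h x)))"
    unfolding dot3_def by (simp, intro polyfun3_intros polyfun3_pd assms p q)
  ultimately show ?thesis unfolding pdvd_def by blast
qed

text \<open>In a frame \<open>l, m, n\<close> with \<open>l\<close> and \<open>m\<close> vanishing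
  at \<open>p\<close>, two components of \<open>G\<close> become divisible by \<open>u\<close>; the
  change of frame multiplies the Jacobian by a nonzero constant.\<close>

lemma contracted_dvd_jac:
  assumes u: "polyfun3 u" and G: "\<And>i. polyfun3 (\<lambda>x. G x $ i)" and p: "p \<noteq> 0"
    and c: "\<And>i. u pdvd (\<lambda>x. crs3 (G x) p $ i)"
  shows "u pdvd jac G"
proof -
  obtain l m n where lmn: "dot3 l p = 0" "dot3 m p = 0" "dot3 l (crs3 m n) \<noteq> 0"
    using kernel_frame_exists[OF p] by blast
  have "u pdvd (\<lambda>x. dot3 (grad (\<lambda>x. dot3 l (G x)) x)
      (crs3 (grad (\<lambda>x. dot3 m (G x)) x) (grad (\<lambda>x. dot3 n (G x)) x)))"
    by (intro common_divisor_jacobian u contracted_linear[OF c p] lmn dot3_polyfun3 G)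
  then have "u pdvd (\<lambda>x. dot3 l (crs3 m n) * jac G x)"
    unfolding grad_dot3[OF G] det3_mult jac_def .
  then show ?thesis by (rule pdvd_scale_cancel) (rule lmn(3))
qed

subsection \<open>Dominant maps have a nonzero Jacobian\<close>

lemma homogeneous_system_solution:
  fixes m :: "'b \<Rightarrow> 'a \<Rightarrow> complex"
  assumes "finite B" "finite A" "card B < card A"
  shows "\<exists>v. (\<exists>a\<in>A. v a \<noteq> 0) \<and> (\<forall>b\<in>B. (\<Sum>a\<in>A. m b a * v a) = 0)"
  using assms
proof (induction B arbitrary: A m rule: finite_induct)
  case empty
  then obtain a where "a \<in> A" by fastforce
  then show ?case by (intro exI[of _ "\<lambda>_. 1"]) auto
next
  case (insert b B)
  show ?case
  proof (cases "\<forall>a\<in>A. m b a = 0")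
    case True
    have "card B < card A" using insert by simp
    then obtain v where "\<exists>a\<in>A. v a \<noteq> 0" "\<forall>b\<in>B. (\<Sum>a\<in>A. m b a * v a) = 0"
      using insert.IH[OF insert.prems(1)] by blast
    then show ?thesis using True by (intro exI[of _ v]) auto
  next
    case False
    then obtain c where c: "c \<in> A" "m b c \<noteq> 0" by blast
    have "card B < card (A - {c})" using insert c by simp
    then obtain v where v: "\<exists>a\<in>A - {c}. v a \<noteq> 0"
      "\<And>b'. b' \<in> B \<Longrightarrow> (\<Sum>a\<in>A - {c}. (m b' a - m b' c * m b a / m b c) * v a) = 0"
      using insert.IH[of "A - {c}" "\<lambda>b' a. m b' a - m b' c * m b a / m b c"] insert.prems(1) by auto
    define w where "w a = (if a = c then - (\<Sum>a\<in>A - {c}. m b a * v a) / m b c else v a)" for a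
    have split: "(\<Sum>a\<in>A. g a * w a) = g c * w c + (\<Sum>a\<in>A - {c}. g a * v a)" for g
      using sum.remove[OF insert.prems(1) c(1), of "\<lambda>a. g a * w a"] by (simp add: w_def)
    have "(\<Sum>a\<in>A. m b' a * w a) = 0" if "b' \<in> insert b B" for b'
    proof (cases "b' = b")
      case True
      then show ?thesis unfolding split using c by (simp add: w_def)
    next
      case False
      then have "(\<Sum>a\<in>A - {c}. (m b' a - m b' c * m b a / m b c) * v a) = 0" using that v by auto
      moreover have "(\<Sum>a\<in>A - {c}. (m b' a - m b' c * m b a / m b c) * v a)
         = (\<Sum>a\<in>A - {c}. m b' a * v a) - m b' c / m b c * (\<Sum>a\<in>A - {c}. m b a * v a)"
        by (simp add: left_diff_distrib sum_subtractf sum_distrib_left mult.assoc)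
      ultimately show ?thesis unfolding split by (simp add: w_def)
    qed
    moreover have "\<exists>a\<in>A. w a \<noteq> 0" using v(1) by (auto simp: w_def)
    ultimately show ?thesis by blast
  qed
qed

lemma hpoly3_line_degree:
  assumes "hpoly3 k p" shows "\<exists>Q. degree Q \<le> k \<and> (\<forall>t. p (a + t *s v) = poly Q t)"
proof -
  obtain c where c: "\<And>x. p (vec_lambda x) = (\<Sum>e\<in>{e. sum e UNIV = k}. c e * monom_fun e x)"
    using assms unfolding hpoly3_def hompoly_def by blast
  define Q where "Q = (\<Sum>e\<in>{e. sum e UNIV = k}. smult (c e) (\<Prod>i\<in>UNIV. [:a $ i, v $ i:] ^ e i))"
  have "degree Q \<le> k" unfolding Q_def
  proof (rule degree_sum_le)
    show "finite {e :: 3 \<Rightarrow> nat. sum e UNIV = k}" by (rule finite_exponents_eq)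
    fix e :: "3 \<Rightarrow> nat" assume e: "e \<in> {e. sum e UNIV = k}"
    have "degree (\<Prod>i\<in>UNIV. [:a $ i, v $ i:] ^ e i) \<le> (\<Sum>i\<in>UNIV. degree ([:a $ i, v $ i:] ^ e i))"
      using degree_prod_sum_le[of UNIV "\<lambda>i. [:a $ i, v $ i:] ^ e i"] by (simp add: o_def)
    also have "\<dots> \<le> (\<Sum>i\<in>UNIV. e i)"
    proof (intro sum_mono)
      fix i
      have "degree ([:a $ i, v $ i:] ^ e i) \<le> degree [:a $ i, v $ i:] * e i" by (rule degree_power_le)
      also have "\<dots> \<le> 1 * e i" by (intro mult_right_mono) auto
      finally show "degree ([:a $ i, v $ i:] ^ e i) \<le> e i" by simp
    qed
    also have "\<dots> = k" using e by simp
    finally show "degree (smult (c e) (\<Prod>i\<in>UNIV. [:a $ i, v $ i:] ^ e i)) \<le> k"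
      using degree_smult_le order_trans by blast
  qed
  moreover have "p (a + t *s v) = poly Q t" for t
    using c[of "vec_nth (a + t *s v)"]
    by (simp add: Q_def poly_sum poly_prod poly_power algebra_simps)
  ultimately show ?thesis by blast
qed

lemma poly_zero_on_grid:
  fixes Q :: "complex poly"
  assumes "degree Q \<le> N" "\<And>i. i \<le> N \<Longrightarrow> poly Q (of_nat i) = 0"
  shows "poly Q t = 0"
proof (rule ccontr)
  assume "poly Q t \<noteq> 0"
  then have "Q \<noteq> 0" by auto
  have "of_nat ` {..N} \<subseteq> {t. poly Q t = 0}" using assms(2) by auto
  then have "card (of_nat ` {..N} :: complex set) \<le> card {t. poly Q t = 0}"
    by (rule card_mono[OF poly_roots_finite[OF \<open>Q \<noteq> 0\<close>]])
  moreover have "card (of_nat ` {..N} :: complex set) = Suc N"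
    by (subst card_image) (auto simp: inj_on_def)
  ultimately show False using card_poly_roots_bound[OF \<open>Q \<noteq> 0\<close>] assms(1) by linarith
qed

text \<open>A polynomial of degree at most \<open>N\<close> on a line is determined by
  \<open>N + 1\<close> points; freeing one coordinate at a time passes from the grid to all of
  C^3.\<close>

lemma zero_on_grid:
  fixes p :: "complex^3 \<Rightarrow> complex"
  assumes line: "\<And>a v. \<exists>Q. degree Q \<le> N \<and> (\<forall>t. p (a + t *s v) = poly Q t)"
    and grid: "\<And>i j k. i \<le> N \<Longrightarrow> j \<le> N \<Longrightarrow> k \<le> N \<Longrightarrow> p (vector [of_nat i, of_nat j, of_nat k]) = 0"
  shows "p x = 0"
proof -
  have one: "p (a + t *s v) = 0" if "\<And>i. i \<le> N \<Longrightarrow> p (a + of_nat i *s v) = 0" for a v t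
  proof -
    obtain Q where Q: "degree Q \<le> N" "\<And>t. p (a + t *s v) = poly Q t" using line by blast
    show ?thesis unfolding Q(2) by (rule poly_zero_on_grid[OF Q(1)]) (use that Q(2) in auto)
  qed
  have dec: "vector [s, t, r] = vector [0, t, r] + s *s (vector [1, 0, 0] :: complex^3)"
    "vector [s, t, r] = vector [s, 0, r] + t *s (vector [0, 1, 0] :: complex^3)"
    "vector [s, t, r] = vector [s, t, 0] + r *s (vector [0, 0, 1] :: complex^3)" for s t r
    by (simp_all add: vec3_eq_iff)
  have 1: "p (vector [s, of_nat j, of_nat k]) = 0" if "j \<le> N" "k \<le> N" for s j k
    unfolding dec(1)[of s] by (rule one) (use that grid in \<open>simp add: dec(1)[symmetric]\<close>)
  have 2: "p (vector [s, t, of_nat k]) = 0" if "k \<le> N" for s t k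
    unfolding dec(2)[of s t] by (rule one) (use that 1 in \<open>simp add: dec(2)[symmetric]\<close>)
  have 3: "p (vector [s, t, r]) = 0" for s t r
    unfolding dec(3)[of s t r] by (rule one) (use 2 in \<open>simp add: dec(3)[symmetric]\<close>)
  have "x = vector [x $ 1, x $ 2, x $ 3]" by (simp add: vec3_eq_iff)
  then show ?thesis using 3 by metis
qed

text \<open>\<open>dominant\<close> speaks of homogeneous \<open>h\<close> only. Since
  \<open>F\<close> scales by \<open>t ^ d\<close> and every nonzero complex number is a
  \<open>d\<close>-th power, the homogeneous components of \<open>h\<close> vanish on the image of
  \<open>F\<close> one by one.\<close>

lemma dominant_polyfun3_nonzero:
  assumes F: "hmap d F" "d \<ge> 1" "dominant F" and h: "polyfun3 h" "\<And>x. h (F x) = 0"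
  shows "h x = 0"
proof -
  obtain N q where q: "\<And>i. hpoly3 i (q i)" "\<And>x. h x = (\<Sum>i\<le>N. q i x)"
    using h(1) unfolding polyfun3_iff_hpoly3s by blast
  have "q i y = 0" if "i \<le> N" for i y
  proof -
    have "q i (F x) = 0" for x
    proof (rule poly_sum_power_eq_0[where a="\<lambda>i. q i (F x)", OF _ that])
      fix s :: complex assume "s \<noteq> 0"
      define t where "t = exp (ln s / of_nat d)"
      have td: "t ^ d = s" using \<open>s \<noteq> 0\<close> F(2) by (simp add: t_def exp_of_nat_mult[symmetric])
      have "0 = h (F (t *s x))" using h(2) by simp
      also have "\<dots> = (\<Sum>i\<le>N. q i (F x) * s ^ i)"
        unfolding q(2) hmap_homogeneous[OF F(1)] hpoly3_homogeneous[OF q(1)]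
        by (simp add: td mult.commute)
      finally show "(\<Sum>i\<le>N. q i (F x) * s ^ i) = 0" by simp
    qed
    then show ?thesis using F(3) q(1)[of i] unfolding dominant_def by blast
  qed
  then show ?thesis unfolding q(2) by simp
qed

lemma ev_monom: "ev (monom (monom (monom v a) b) c) x = v * (x $ 1) ^ a * (x $ 2) ^ b * (x $ 3) ^ c"
  by (simp add: ev_def poly_monom poly_mult poly_power)

text \<open>The three components of \<open>F\<close> and \<open>x $ i\<close> are four functions of
  three variables, hence algebraically dependent. The proof counts: there are more monomials in them
  than grid points on which a combination has to vanish.\<close>

lemma polynomial_relation_exists:
  assumes F: "hmap d F"
  shows "\<exists>S c. (\<forall>s. polyfun3 (c s)) \<and> (\<exists>s\<le>S. \<exists>y. c s y \<noteq> 0) \<and> (\<forall>x. (\<Sum>s\<le>S. c s (F x) * (x $ i) ^ s) = 0)"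
proof -
  \<comment> \<open>A monomial with exponents up to \<open>n\<close> has degree at most
    \<open>D * n = N\<close> in \<open>x\<close>, and \<open>N + 1 \<le> D * (n + 1)\<close>. With
    \<open>n = D ^ 3\<close> there are at most \<open>n * (n + 1) ^ 3\<close> grid points, fewer
    than the \<open>(n + 1) ^ 4\<close> monomials.\<close>
  define D where "D = 3 * d + 1"
  define n where "n = D ^ 3"
  define N where "N = D * n"
  define A where "A = {..n} \<times> {..n} \<times> {..n} \<times> {..n}"
  define B where "B = {..N} \<times> {..N} \<times> {..N}"
  define m where "m = (\<lambda>(a, b, c, s) x. (F x $ 1) ^ a * (F x $ 2) ^ b * (F x $ 3) ^ c * (x $ i) ^ s)"
  define g :: "nat \<times> nat \<times> nat \<Rightarrow> complex^3" where
    "g = (\<lambda>(i, j, k). vector [of_nat i, of_nat j, of_nat k])"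
  have "card B = (N + 1) ^ 3" by (simp add: B_def power3_eq_cube)
  also have "\<dots> \<le> (D * (n + 1)) ^ 3" by (rule power_mono) (auto simp: N_def D_def)
  also have "\<dots> = n * (n + 1) ^ 3" by (simp only: power_mult_distrib n_def)
  also have "\<dots> < (n + 1) * (n + 1) ^ 3" by simp
  also have "\<dots> = card A" by (simp add: A_def power3_eq_cube algebra_simps)
  finally have cd: "card B < card A" .
  have "finite A" "finite B" by (simp_all add: A_def B_def)
  then obtain v where v: "\<exists>a\<in>A. v a \<noteq> 0" "\<And>b. b \<in> B \<Longrightarrow> (\<Sum>a\<in>A. m a (g b) * v a) = 0"
    using homogeneous_system_solution[OF _ _ cd, of "\<lambda>b a. m a (g b)"] by blast
  have line_m: "\<exists>Q. degree Q \<le> N \<and> (\<forall>t. m e (a + t *s w) = poly Q t)" if "e \<in> A" for e a w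
  proof -
    obtain a1 b1 c1 s1 where e: "e = (a1, b1, c1, s1)" by (cases e)
    have "hpoly3 (d * a1 + d * b1 + d * c1 + 1 * s1)
        (\<lambda>x. (F x $ 1) ^ a1 * (F x $ 2) ^ b1 * (F x $ 3) ^ c1 * (x $ i) ^ s1)"
      by (intro hpoly3_mult hpoly3_power hmap_hpoly3[OF F] hpoly3_coord)
    then have "hpoly3 (d * a1 + d * b1 + d * c1 + s1) (m e)" by (simp add: m_def e)
    moreover have "d * a1 + d * b1 + d * c1 + s1 \<le> N"
    proof -
      have "d * a1 \<le> d * n" "d * b1 \<le> d * n" "d * c1 \<le> d * n" "s1 \<le> n" using that by (auto simp: e A_def)
      then have "d * a1 + d * b1 + d * c1 + s1 \<le> d * n + d * n + d * n + n" by (intro add_mono)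
      also have "\<dots> = N" unfolding N_def D_def by (simp add: algebra_simps)
      finally show ?thesis .
    qed
    ultimately show ?thesis using hpoly3_line_degree[of _ "m e" a w] order_trans by blast
  qed
  have rel: "(\<Sum>a\<in>A. m a x * v a) = 0" for x
  proof (rule zero_on_grid[where N=N])
    show "\<exists>Q. degree Q \<le> N \<and> (\<forall>t. (\<Sum>e\<in>A. m e (a + t *s w) * v e) = poly Q t)" for a w
    proof -
      have "\<exists>Q. \<forall>e\<in>A. degree (Q e) \<le> N \<and> (\<forall>t. m e (a + t *s w) = poly (Q e) t)"
        using line_m by (intro bchoice) blast
      then obtain Q where Q: "\<And>e. e \<in> A \<Longrightarrow> degree (Q e) \<le> N" "\<And>e t. e \<in> A \<Longrightarrow> m e (a + t *s w) = poly (Q e) t"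
        by blast
      show ?thesis
      proof (intro exI[of _ "\<Sum>e\<in>A. smult (v e) (Q e)"] conjI allI)
        show "degree (\<Sum>e\<in>A. smult (v e) (Q e)) \<le> N"
          by (rule degree_sum_le) (use Q degree_smult_le order_trans in \<open>auto simp: A_def\<close>)
        show "(\<Sum>e\<in>A. m e (a + t *s w) * v e) = poly (\<Sum>e\<in>A. smult (v e) (Q e)) t" for t
          unfolding poly_sum poly_smult by (intro sum.cong refl) (simp add: Q)
      qed
    qed
    show "(\<Sum>a\<in>A. m a (vector [of_nat i, of_nat j, of_nat k]) * v a) = 0"
      if "i \<le> N" "j \<le> N" "k \<le> N" for i j k
      using v(2)[of "(i, j, k)"] that by (simp add: g_def B_def)
  qed
  \<comment> \<open>\<open>P s\<close> collects the coefficients of \<open>(x $ i) ^ s\<close> as a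
    polynomial in the components of \<open>F\<close>; a nonzero entry of \<open>v\<close> survives
    as a coefficient of some \<open>P s\<close>.\<close>
  define P where "P s = (\<Sum>c\<le>n. \<Sum>b\<le>n. \<Sum>a\<le>n. monom (monom (monom (v (a, b, c, s)) a) b) c)" for s
  have evP: "ev (P s) y = (\<Sum>a\<le>n. \<Sum>b\<le>n. \<Sum>c\<le>n. v (a, b, c, s) * (y $ 1) ^ a * (y $ 2) ^ b * (y $ 3) ^ c)" for s y
  proof -
    have es: "ev (\<Sum>a\<in>X. f a) y = (\<Sum>a\<in>X. ev (f a) y)" for f and X :: "nat set"
      by (induction X rule: infinite_finite_induct) (auto simp: ev_simps)
    have "ev (P s) y = (\<Sum>c\<le>n. \<Sum>b\<le>n. \<Sum>a\<le>n. v (a, b, c, s) * (y $ 1) ^ a * (y $ 2) ^ b * (y $ 3) ^ c)"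
      by (simp add: P_def es ev_monom)
    also have "\<dots> = (\<Sum>c\<le>n. \<Sum>a\<le>n. \<Sum>b\<le>n. v (a, b, c, s) * (y $ 1) ^ a * (y $ 2) ^ b * (y $ 3) ^ c)"
      by (intro sum.cong refl sum.swap)
    also have "\<dots> = (\<Sum>a\<le>n. \<Sum>c\<le>n. \<Sum>b\<le>n. v (a, b, c, s) * (y $ 1) ^ a * (y $ 2) ^ b * (y $ 3) ^ c)"
      by (rule sum.swap)
    also have "\<dots> = (\<Sum>a\<le>n. \<Sum>b\<le>n. \<Sum>c\<le>n. v (a, b, c, s) * (y $ 1) ^ a * (y $ 2) ^ b * (y $ 3) ^ c)"
      by (intro sum.cong refl sum.swap)
    finally show ?thesis .
  qed
  obtain a0 b0 c0 s0 where v0: "(a0, b0, c0, s0) \<in> A" "v (a0, b0, c0, s0) \<noteq> 0" using v(1) by auto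
  have coeffP: "coeff (coeff (coeff (P s) c1) b1) a1 = v (a1, b1, c1, s)"
    if "a1 \<le> n" "b1 \<le> n" "c1 \<le> n" for a1 b1 c1 s
  proof -
    have "coeff (P s) c1 = (\<Sum>b\<le>n. \<Sum>a\<le>n. monom (monom (v (a, b, c1, s)) a) b)"
    proof -
      have "coeff (P s) c1 = (\<Sum>c\<le>n. if c = c1 then (\<Sum>b\<le>n. \<Sum>a\<le>n. monom (monom (v (a, b, c, s)) a) b) else 0)"
        unfolding P_def coeff_sum by (intro sum.cong refl) auto
      then show ?thesis using that(3) by simp
    qed
    then have "coeff (coeff (P s) c1) b1 = (\<Sum>a\<le>n. monom (v (a, b1, c1, s)) a)"
    proof -
      assume *: "coeff (P s) c1 = (\<Sum>b\<le>n. \<Sum>a\<le>n. monom (monom (v (a, b, c1, s)) a) b)"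
      have "coeff (coeff (P s) c1) b1 = (\<Sum>b\<le>n. if b = b1 then (\<Sum>a\<le>n. monom (v (a, b, c1, s)) a) else 0)"
        unfolding * coeff_sum by (intro sum.cong refl) auto
      then show ?thesis using that(2) by simp
    qed
    then show ?thesis using that(1) by (simp add: coeff_sum sum.delta)
  qed
  have "P s0 \<noteq> 0" using coeffP[of a0 b0 c0 s0] v0 by (auto simp: A_def)
  then obtain y where y: "ev (P s0) y \<noteq> 0" using ev_inject by blast
  have "(\<Sum>s\<le>n. ev (P s) (F x) * (x $ i) ^ s) = 0" for x
  proof -
    have "(\<Sum>s\<le>n. ev (P s) (F x) * (x $ i) ^ s)
      = (\<Sum>s\<le>n. \<Sum>a\<le>n. \<Sum>b\<le>n. \<Sum>c\<le>n. m (a, b, c, s) x * v (a, b, c, s))"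
      unfolding evP sum_distrib_right by (intro sum.cong refl) (simp add: m_def algebra_simps)
    also have "\<dots> = (\<Sum>a\<le>n. \<Sum>s\<le>n. \<Sum>b\<le>n. \<Sum>c\<le>n. m (a, b, c, s) x * v (a, b, c, s))"
      by (rule sum.swap)
    also have "\<dots> = (\<Sum>a\<le>n. \<Sum>b\<le>n. \<Sum>s\<le>n. \<Sum>c\<le>n. m (a, b, c, s) x * v (a, b, c, s))"
      by (intro sum.cong refl sum.swap)
    also have "\<dots> = (\<Sum>a\<le>n. \<Sum>b\<le>n. \<Sum>c\<le>n. \<Sum>s\<le>n. m (a, b, c, s) x * v (a, b, c, s))"
      by (intro sum.cong refl sum.swap)
    also have "\<dots> = (\<Sum>a\<in>A. m a x * v a)"
      by (simp add: A_def sum.cartesian_product)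
    finally show ?thesis using rel by simp
  qed
  then show ?thesis using y v0
    by (intro exI[of _ n] exI[of _ "\<lambda>s. ev (P s)"]) (auto simp: polyfun3_ev A_def)
qed

text \<open>Differentiating a relation of minimal degree satisfied by the \<open>i\<close>-th coordinate over the
  components of \<open>F\<close> expresses the \<open>i\<close>-th basis covector through the gradients of \<open>F\<close>.\<close>
lemma dominant_axis_in_gradient_span:
  assumes F: "hmap d F" "d \<ge> 1" "dominant F"
  shows "\<exists>D (b :: complex^3 \<Rightarrow> complex^3). polyfun3 D \<and> (\<exists>x. D x \<noteq> 0) \<and>
     (\<forall>x. D x *s axis i 1 = b x $ 1 *s grad (\<lambda>x. F x $ 1) x + b x $ 2 *s grad (\<lambda>x. F x $ 2) x + b x $ 3 *s grad (\<lambda>x. F x $ 3) x)"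
proof -
  define R where "R S \<longleftrightarrow> (\<exists>c. (\<forall>s. polyfun3 (c s)) \<and> (\<exists>s\<le>S. \<exists>y. c s y \<noteq> 0) \<and>
      (\<forall>x. (\<Sum>s\<le>S. c s (F x) * (x $ i) ^ s) = 0))" for S :: nat
  have "\<exists>S. R S" using polynomial_relation_exists[OF F(1), of i] unfolding R_def by blast
  then obtain S where S: "R S" and least: "\<And>S'. S' < S \<Longrightarrow> \<not> R S'"
    using exists_least_iff[of R] by blast
  obtain c where c: "\<And>s. polyfun3 (c s)" "\<exists>s\<le>S. \<exists>y. c s y \<noteq> 0"
     "\<And>x. (\<Sum>s\<le>S. c s (F x) * (x $ i) ^ s) = 0" using S unfolding R_def by blast
  have nz: "\<exists>x. h (F x) \<noteq> 0" if "polyfun3 h" "\<exists>y. h y \<noteq> 0" for h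
    using dominant_polyfun3_nonzero[OF F that(1)] that(2) by blast
  have "S \<noteq> 0"
  proof
    assume "S = 0"
    then have "\<exists>y. c 0 y \<noteq> 0" "\<And>x. c 0 (F x) = 0" using c(2,3) by auto
    then show False using nz[OF c(1)] by blast
  qed
  then obtain T where T: "S = Suc T" by (cases S) auto
  \<comment> \<open>Minimality of \<open>S\<close> is used twice: if the top coefficient vanished,
    or if the formal derivative in \<open>x $ i\<close> vanished, there would be a relation of
    degree \<open>T = S - 1\<close>.\<close>
  have top: "\<exists>y. c S y \<noteq> 0"
  proof (rule ccontr)
    assume no: "\<not> ?thesis"
    have "R T" unfolding R_def
    proof (intro exI[of _ c] conjI allI)
      show "\<exists>s\<le>T. \<exists>y. c s y \<noteq> 0" using c(2) no T by (metis le_SucE)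
      show "(\<Sum>s\<le>T. c s (F x) * (x $ i) ^ s) = 0" for x using c(3)[of x] no by (simp add: T)
    qed (rule c(1))
    then show False using least[of T] T by simp
  qed
  \<comment> \<open>The derivative of the relation with respect to \<open>x $ i\<close> with the
    components of \<open>F\<close> held fixed; \<open>b\<close> below is minus its derivative with
    respect to those components.\<close>
  define D where "D x = (\<Sum>s\<le>T. (of_nat (Suc s) * c (Suc s) (F x)) * (x $ i) ^ s)" for x
  have cF: "polyfun3 (\<lambda>x. c s (F x))" for s by (rule polyfun3_compose[OF c(1) hmap_polyfun3[OF F(1)]])
  have Dp: "polyfun3 D" unfolding D_def[abs_def] by (intro polyfun3_intros cF)
  have Dnz: "\<exists>x. D x \<noteq> 0"
  proof (rule ccontr)
    assume no: "\<not> ?thesis"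
    have "R T" unfolding R_def
    proof (intro exI[of _ "\<lambda>s y. of_nat (Suc s) * c (Suc s) y"] conjI allI)
      show "\<exists>s\<le>T. \<exists>y. of_nat (Suc s) * c (Suc s) y \<noteq> 0"
        using top by (intro exI[of _ T]) (auto simp: T simp del: of_nat_Suc)
      show "(\<Sum>s\<le>T. of_nat (Suc s) * c (Suc s) (F x) * (x $ i) ^ s) = 0" for x
        using no unfolding D_def by blast
    qed (intro polyfun3_intros c)
    then show False using least[of T] T by simp
  qed
  define b where "b x = (\<chi> l. - (\<Sum>s\<le>S. pd l (c s) (F x) * (x $ i) ^ s))" for x
  have pdc: "pd j (\<lambda>x. x $ i) x = (if j = i then 1 else 0)" for j x
  proof (rule pd_unique[where D="\<lambda>j. if j = i then 1 else 0"])
    show "((\<lambda>x. x $ i) has_derivative (\<lambda>h. \<Sum>j\<in>UNIV. (if j = i then 1 else 0) * h $ j)) (at x)"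
      using bounded_linear_imp_has_derivative[OF bounded_linear_vec_nth]
      by (simp add: if_distrib[of "\<lambda>a. a * _"] cong: if_cong)
  qed
  have pdpow: "pd j (\<lambda>x. (x $ i) ^ s) x = (if j = i then of_nat s * (x $ i) ^ (s - 1) else 0)" for j s x
  proof (induction s)
    case 0 show ?case using pd_const[of j 1 x] by simp
  next
    case (Suc s)
    have "pd j (\<lambda>x. x $ i * (x $ i) ^ s) x = x $ i * pd j (\<lambda>x. (x $ i) ^ s) x + pd j (\<lambda>x. x $ i) x * (x $ i) ^ s"
      by (rule pd_mult) (intro polyfun3_intros)+
    then show ?case unfolding Suc.IH pdc by (cases s) (auto simp: algebra_simps)
  qed
  have "D x * (if j = i then 1 else 0) = (\<Sum>l\<in>UNIV. b x $ l * pd j (\<lambda>x. F x $ l) x)" for x j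
  proof -
    have "0 = pd j (\<lambda>x. \<Sum>s\<le>S. c s (F x) * (x $ i) ^ s) x" by (simp add: c(3) pd_const)
    also have "\<dots> = (\<Sum>s\<le>S. pd j (\<lambda>x. c s (F x) * (x $ i) ^ s) x)"
      by (rule pd_sum) (intro polyfun3_intros cF)
    also have "\<dots> = (\<Sum>s\<le>S. c s (F x) * pd j (\<lambda>x. (x $ i) ^ s) x + pd j (\<lambda>x. c s (F x)) x * (x $ i) ^ s)"
      by (intro sum.cong refl pd_mult cF polyfun3_intros)
    also have "\<dots> = (\<Sum>s\<le>S. c s (F x) * pd j (\<lambda>x. (x $ i) ^ s) x)
       + (\<Sum>s\<le>S. (\<Sum>l\<in>UNIV. pd l (c s) (F x) * pd j (\<lambda>x. F x $ l) x) * (x $ i) ^ s)"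
      by (simp add: sum.distrib pd_compose[OF c(1) hmap_polyfun3[OF F(1)]])
    also have "(\<Sum>s\<le>S. c s (F x) * pd j (\<lambda>x. (x $ i) ^ s) x) = D x * (if j = i then 1 else 0)"
    proof -
      have "(\<Sum>s\<le>S. c s (F x) * pd j (\<lambda>x. (x $ i) ^ s) x)
         = (\<Sum>s\<le>T. c (Suc s) (F x) * pd j (\<lambda>x. (x $ i) ^ Suc s) x)"
        unfolding T sum.atMost_Suc_shift by (simp add: pd_const)
      also have "\<dots> = D x * (if j = i then 1 else 0)"
        unfolding D_def sum_distrib_right by (intro sum.cong refl) (simp only: pdpow, simp)
      finally show ?thesis .
    qed
    also have "(\<Sum>s\<le>S. (\<Sum>l\<in>UNIV. pd l (c s) (F x) * pd j (\<lambda>x. F x $ l) x) * (x $ i) ^ s)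
       = (\<Sum>l\<in>UNIV. - b x $ l * pd j (\<lambda>x. F x $ l) x)"
      unfolding sum_distrib_right by (subst sum.swap) (simp add: b_def sum_distrib_left sum_distrib_right algebra_simps)
    finally show ?thesis by (simp add: sum_negf)
  qed
  then have "D x *s axis i 1 = b x $ 1 *s grad (\<lambda>x. F x $ 1) x + b x $ 2 *s grad (\<lambda>x. F x $ 2) x
      + b x $ 3 *s grad (\<lambda>x. F x $ 3) x" for x
    by (simp add: vec_eq_iff axis_def sum_3 eq_commute)
  then show ?thesis using Dp Dnz by blast
qed

text \<open>At a point where the three multipliers \<open>D i\<close> are nonzero, the gradients
  span all covectors; multiplicativity of the determinant then makes the Jacobian nonzero.\<close>

lemma dominant_jac_nonzero:
  assumes F: "hmap d F" "d \<ge> 1" "dominant F"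
  shows "\<exists>x. jac F x \<noteq> 0"
proof -
  have "\<forall>i. \<exists>D (b :: complex^3 \<Rightarrow> complex^3). polyfun3 D \<and> (\<exists>x. D x \<noteq> 0) \<and>
     (\<forall>x. D x *s axis i 1 = b x $ 1 *s grad (\<lambda>x. F x $ 1) x + b x $ 2 *s grad (\<lambda>x. F x $ 2) x + b x $ 3 *s grad (\<lambda>x. F x $ 3) x)"
    using dominant_axis_in_gradient_span[OF F] by blast
  from choice[OF this] obtain D where D: "\<forall>i. \<exists>b :: complex^3 \<Rightarrow> complex^3. polyfun3 (D i) \<and> (\<exists>x. D i x \<noteq> 0) \<and>
     (\<forall>x. D i x *s axis i 1 = b x $ 1 *s grad (\<lambda>x. F x $ 1) x + b x $ 2 *s grad (\<lambda>x. F x $ 2) x + b x $ 3 *s grad (\<lambda>x. F x $ 3) x)"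
    by blast
  from choice[OF D] obtain b :: "3 \<Rightarrow> complex^3 \<Rightarrow> complex^3" where b: "\<And>i. polyfun3 (D i)" "\<And>i. \<exists>x. D i x \<noteq> 0"
     "\<And>i x. D i x *s axis i 1 = b i x $ 1 *s grad (\<lambda>x. F x $ 1) x + b i x $ 2 *s grad (\<lambda>x. F x $ 2) x + b i x $ 3 *s grad (\<lambda>x. F x $ 3) x"
    by blast
  obtain x where x: "\<And>i. D i x \<noteq> 0"
    using polyfun3_prod_nonzero[of UNIV D] b(1,2) by auto
  have "dot3 (D 1 x *s axis 1 1) (crs3 (D 2 x *s axis 2 1) (D 3 x *s axis 3 1)) = D 1 x * D 2 x * D 3 x"
    by (simp add: dot3_def axis_def)
  moreover have "\<dots> \<noteq> 0" using x by simp
  ultimately have "dot3 (b 1 x) (crs3 (b 2 x) (b 3 x)) * jac F x \<noteq> 0"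
    unfolding b(3) det3_mult jac_def by simp
  then show ?thesis by auto
qed

subsection \<open>Algebraic stability\<close>

text \<open>Scaling gives \<open>\<rho> x = \<rho> (t *s x) * t ^ (b - a)\<close> for nonzero
  \<open>t\<close>. If \<open>a < b\<close>, this polynomial identity in \<open>t\<close> fails at
  \<open>t = 0\<close> for a point with \<open>\<rho> x \<noteq> 0\<close>.\<close>

lemma quotient_degree_le:
  assumes "polyfun3 \<rho>" "hmap a L" "hmap b F" "\<And>x. L x = \<rho> x *s F x" "\<exists>x. L x \<noteq> 0"
  shows "b \<le> a"
proof (rule ccontr)
  assume "\<not> b \<le> a"
  then have ba: "a < b" by simp
  obtain x where x: "L x \<noteq> 0" using assms(5) by blast
  then have Fx: "F x \<noteq> 0" "\<rho> x \<noteq> 0" using assms(4) by auto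
  then obtain i where i: "F x $ i \<noteq> 0" by (auto simp: vec_eq_iff)
  obtain Q where Q: "\<And>t. \<rho> (0 + t *s x) = poly Q t" using polyfun3_line[OF assms(1)] by blast
  have "\<rho> x = poly Q t * t ^ (b - a)" if "t \<noteq> 0" for t
  proof -
    have "t ^ a *s L x = \<rho> (t *s x) *s (t ^ b *s F x)"
      using assms(4)[of "t *s x"] unfolding hmap_homogeneous[OF assms(2)] hmap_homogeneous[OF assms(3)] .
    then have "t ^ a * (\<rho> x * F x $ i) = \<rho> (t *s x) * (t ^ b * F x $ i)"
      unfolding assms(4) by (metis vector_smult_component)
    then have "t ^ a * \<rho> x = \<rho> (t *s x) * t ^ b" using i by simp
    also have "t ^ b = t ^ a * t ^ (b - a)" using ba by (simp add: power_add[symmetric])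
    finally show ?thesis using that Q[of t] by simp
  qed
  then have "UNIV - {0} \<subseteq> {t. poly ([:\<rho> x:] - Q * monom 1 (b - a)) t = 0}"
    by (auto simp: poly_monom)
  moreover have "infinite (UNIV - {0::complex})" by (simp add: infinite_UNIV_char_0)
  ultimately have "[:\<rho> x:] - Q * monom 1 (b - a) = 0" using poly_roots_finite finite_subset by blast
  then have "poly ([:\<rho> x:] - Q * monom 1 (b - a)) 0 = 0" by simp
  then show False using Fx ba by (simp add: poly_monom)
qed

section \<open>The degree of a reduced representative\<close>

lemma proportional_sym: "proportional F G \<Longrightarrow> proportional G F"
  unfolding proportional_def by (simp add: mult.commute)

lemma ratmap_hmap: "ratmap k F \<longleftrightarrow> hmap k F \<and> (\<exists>x. F x \<noteq> 0)"
  by (simp add: ratmap_def hmap_def)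

text \<open>Two reduced representatives are polynomial multiples of each other, so their degrees
  agree and the description in \<open>alg_deg\<close> is unique.\<close>

lemma alg_deg_eq:
  assumes F: "ratmap d F" "reduced F"
  shows "alg_deg F = d"
  unfolding alg_deg_def
proof (rule the_equality)
  have "proportional F F" unfolding proportional_def by (simp add: mult.commute)
  then show "\<exists>G. ratmap d G \<and> reduced G \<and> proportional F G" using F by blast
next
  fix e assume "\<exists>G. ratmap e G \<and> reduced G \<and> proportional F G"
  then obtain G where G: "ratmap e G" "reduced G" "proportional F G" by blast
  have hm: "hmap d F" "hmap e G" and nz: "\<exists>x. F x \<noteq> 0" "\<exists>x. G x \<noteq> 0"
    using F(1) G(1) by (simp_all add: ratmap_hmap)
  obtain \<phi> where \<phi>: "polyfun3 \<phi>" "\<And>x. F x = \<phi> x *s G x"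
    using reduced_quotient[OF hmap_polyfun3[OF hm(1)] hmap_polyfun3[OF hm(2)] G(2,3)] by blast
  obtain \<psi> where \<psi>: "polyfun3 \<psi>" "\<And>x. G x = \<psi> x *s F x"
    using reduced_quotient[OF hmap_polyfun3[OF hm(2)] hmap_polyfun3[OF hm(1)] F(2) proportional_sym[OF G(3)]] by blast
  have "e \<le> d" by (rule quotient_degree_le[OF \<phi>(1) hm \<phi>(2) nz(1)])
  moreover have "d \<le> e" by (rule quotient_degree_le[OF \<psi>(1) hm(2,1) \<psi>(2) nz(2)])
  ultimately show "e = d" by simp
qed

section \<open>Curves contracted by iterates\<close>

lemma pdvd_matrix:
  assumes "\<And>j. u pdvd (\<lambda>x. G x $ j)" shows "u pdvd (\<lambda>x. ((M :: complex^3^3) *v G x) $ i)"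
  unfolding matrix_vector_dot3 dot3_def by (intro pdvd_add pdvd_scale assms)

lemma reduced_matrix:
  assumes "reduced F" "invertible M" shows "reduced (\<lambda>x. M *v F x)"
  unfolding reduced_def common_factor_iff
proof
  assume "\<exists>u. pprime u \<and> (\<forall>j. u pdvd (\<lambda>x. (M *v F x) $ j))"
  then obtain u where u: "pprime u" "\<And>j. u pdvd (\<lambda>x. (M *v F x) $ j)" by blast
  obtain N where N: "N ** M = mat 1" using assms(2) unfolding invertible_def by blast
  have "u pdvd (\<lambda>x. (N *v (M *v F x)) $ j)" for j by (rule pdvd_matrix[OF u(2)])
  then have "u pdvd (\<lambda>x. F x $ j)" for j by (simp add: matrix_vector_mul_assoc N)
  then show False using reducedD[OF assms(1) u(1)] by blast
qed

lemma pdvd_congruence: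
  assumes P: "polyfun3 P" and A: "\<And>i. polyfun3 (\<lambda>x. A x $ i)" and B: "\<And>i. polyfun3 (\<lambda>x. B x $ i)"
    and u: "\<And>i. u pdvd (\<lambda>x. A x $ i - B x $ i)"
  shows "u pdvd (\<lambda>x. P (A x) - P (B x))"
  using P
proof (induction rule: polyfun3_induct)
  case (add p q)
  have "u pdvd (\<lambda>x. (p (A x) - p (B x)) + (q (A x) - q (B x)))" by (rule pdvd_add[OF add(3,4)])
  then show ?case by (simp add: algebra_simps)
next
  case (mult p q)
  have "u pdvd (\<lambda>x. p (A x) * (q (A x) - q (B x)) + q (B x) * (p (A x) - p (B x)))"
    by (intro pdvd_add pdvd_mult_left mult.IH polyfun3_compose[OF mult.hyps(1) A] polyfun3_compose[OF mult.hyps(2) B])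
  then show ?case by (simp add: algebra_simps)
qed (use u in \<open>auto intro: pdvd_zero\<close>)

lemma contracted_proportional:
  assumes "\<And>i. u pdvd (\<lambda>x. crs3 (G x) p $ i)"
  shows "u pdvd (\<lambda>x. p $ i * G x $ k - G x $ i * p $ k)"
proof (cases "p = 0")
  case False
  have "p $ i * G x $ k - G x $ i * p $ k = dot3 (p $ i *s axis k 1 - p $ k *s axis i 1) (G x)" for x
    by (simp add: dot3_linear dot3_axis algebra_simps)
  moreover have "dot3 (p $ i *s axis k 1 - p $ k *s axis i 1) p = 0"
    by (simp add: dot3_linear dot3_axis)
  ultimately show ?thesis using contracted_linear[OF assms False] by simp
qed (simp add: pdvd_zero)

text \<open>Modulo \<open>u\<close>, \<open>p $ i\<close> times \<open>G\<close> equals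
  \<open>G x $ i\<close> times \<open>p\<close>, so by homogeneity \<open>u\<close> divides
  \<open>h p * (G x $ i) ^ k\<close>. If \<open>h p \<noteq> 0\<close>, then \<open>u\<close>
  divides one component of \<open>G\<close> and with it all of them.\<close>

lemma contracted_value:
  assumes u: "pprime u" and G: "\<And>i. polyfun3 (\<lambda>x. G x $ i)" "\<not> (\<forall>j. u pdvd (\<lambda>x. G x $ j))"
    and p: "p \<noteq> 0" and c: "\<And>i. u pdvd (\<lambda>x. crs3 (G x) p $ i)"
    and h: "hpoly3 k h" "u pdvd (\<lambda>x. h (G x))"
  shows "h p = 0"
proof (rule ccontr)
  assume hp: "h p \<noteq> 0"
  obtain i where i: "p $ i \<noteq> 0" using p by (auto simp: vec_eq_iff)
  have "u pdvd (\<lambda>x. h (p $ i *s G x) - h (G x $ i *s p))"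
    by (rule pdvd_congruence[OF polyfun3_hpoly3[OF h(1)]])
      (use contracted_proportional[OF c, of i] in \<open>auto intro!: polyfun3_intros G\<close>)
  then have "u pdvd (\<lambda>x. (p $ i) ^ k * h (G x) - (G x $ i) ^ k * h p)"
    unfolding hpoly3_homogeneous[OF h(1)] .
  from pdvd_diff[OF pdvd_scale[OF h(2), of "(p $ i) ^ k"] this]
  have "u pdvd (\<lambda>x. h p * (G x $ i) ^ k)" by (simp add: mult.commute)
  then have uk: "u pdvd (\<lambda>x. (G x $ i) ^ k)" by (rule pdvd_scale_cancel) (rule hp)
  have "k \<noteq> 0"
  proof
    assume "k = 0"
    then have "u pdvd (\<lambda>x. 1)" using uk by simp
    then show False using pprime_not_dvd_const[OF u] by fastforce
  qed
  then have ui: "u pdvd (\<lambda>x. G x $ i)" using pprime_dvd_powerD[OF u G(1) uk] by simp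
  have "u pdvd (\<lambda>x. G x $ j)" for j
  proof (rule pdvd_scale_cancel[OF _ i])
    show "u pdvd (\<lambda>x. p $ i * G x $ j)"
      using pdvd_add[OF contracted_proportional[OF c, of i j] pdvd_scale[OF ui, of "p $ j"]]
      by (simp add: mult.commute)
  qed
  then show False using G(2) by blast
qed

lemma pd_coord: "pd j (\<lambda>x. x $ i) x = (if j = i then 1 else 0)"
proof (rule pd_unique[where D="\<lambda>j. if j = i then 1 else 0"])
  show "((\<lambda>x. x $ i) has_derivative (\<lambda>h. \<Sum>j\<in>UNIV. (if j = i then 1 else 0) * h $ j)) (at x)"
    using bounded_linear_imp_has_derivative[OF bounded_linear_vec_nth]
    by (simp add: if_distrib[of "\<lambda>a. a * _"] cong: if_cong)
qed

text \<open>The Jacobian of the identity is the constant 1, which no prime divides.\<close>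

lemma identity_not_contracted:
  assumes u: "pprime u" and p: "p \<noteq> 0" and c: "\<And>i. u pdvd (\<lambda>x. crs3 x p $ i)"
  shows False
proof -
  have "u pdvd jac (\<lambda>x. x)"
    by (rule contracted_dvd_jac[OF pprime_polyfun3[OF u] polyfun3_coord p c])
  moreover have "jac (\<lambda>x. x) x = 1" for x by (simp add: jac_def dot3_def pd_coord)
  ultimately have "u pdvd (\<lambda>x. 1)" by (auto intro: pdvd_cong)
  then show False using pprime_not_dvd_const[OF u] by fastforce
qed

lemma reduced_id: "reduced (\<lambda>x. x)"
  unfolding reduced_def common_factor_iff
proof
  assume "\<exists>u. pprime u \<and> (\<forall>j. u pdvd (\<lambda>x :: complex^3. x $ j))"
  then obtain u where u: "pprime u" "\<And>j. u pdvd (\<lambda>x :: complex^3. x $ j)" by blast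
  have "u pdvd (\<lambda>x. crs3 x (axis 1 1) $ i)" for i
    using exhaust_3[of i] by (auto simp: axis_def pdvd_zero intro: u(2) pdvd_scale[OF u(2), of "-1", simplified])
  then show False using identity_not_contracted[OF u(1)] by (metis axis_eq_0_iff zero_neq_one)
qed

lemma contracted_matrix:
  assumes M: "N ** M = mat 1" "M ** N = mat 1" and p: "p \<noteq> 0"
    and c: "\<And>i. u pdvd (\<lambda>x. crs3 ((M :: complex^3^3) *v G x) p $ i)"
  shows "u pdvd (\<lambda>x. crs3 (G x) (N *v p) $ i)"
proof (rule linear_contracted)
  fix l assume l: "dot3 l (N *v p) = 0"
  define k where "k = l v* N"
  have k: "dot3 k y = dot3 l (N *v y)" for y
    by (simp add: k_def dot3_def vector_matrix_mult_def matrix_vector_mult_def sum_3 algebra_simps)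
  have "u pdvd (\<lambda>x. dot3 k (M *v G x))"
    by (rule contracted_linear[OF c p]) (simp add: k l)
  then show "u pdvd (\<lambda>x. dot3 l (G x))" by (simp add: k matrix_vector_mul_assoc M)
qed

text \<open>Modulo \<open>v\<close>, \<open>F\<close> is proportional to both \<open>p\<close> and
  \<open>q\<close>. If these were independent, a nonzero component of \<open>crs3 p q\<close> times
  each \<open>F x $ i\<close> would be divisible by \<open>v\<close>.\<close>

lemma contracted_point_unique:
  assumes F: "hmap d F" "reduced F" and v: "pprime v"
    and p: "\<And>i. v pdvd (\<lambda>x. crs3 (F x) p $ i)" and q: "\<And>i. v pdvd (\<lambda>x. crs3 (F x) q $ i)"
  shows "crs3 p q = 0"
proof (rule ccontr)
  assume "crs3 p q \<noteq> 0"
  then obtain j where j: "crs3 p q $ j \<noteq> 0" by (metis vec_eq_iff zero_index)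
  have "v pdvd (\<lambda>x. F x $ i)" for i
  proof (rule pdvd_scale_cancel[OF _ j])
    define r where "r k x = p $ i * F x $ k - F x $ i * p $ k" for k x
    have r: "v pdvd r k" for k unfolding r_def by (rule contracted_proportional) (rule p)
    have rc: "v pdvd (\<lambda>x. crs3 (\<chi> k. r k x) q $ j)"
      using exhaust_3[of j]
      by (auto intro!: pdvd_diff pdvd_scale[OF r, where c="q $ _", simplified mult.commute[of "q $ _"]])
    have "v pdvd (\<lambda>x. p $ i * crs3 (F x) q $ j - crs3 (\<chi> k. r k x) q $ j)"
      by (intro pdvd_diff pdvd_scale rc q)
    moreover have "p $ i * crs3 (F x) q $ j - crs3 (\<chi> k. r k x) q $ j = crs3 p q $ j * F x $ i" for x
      using exhaust_3[of j] by (auto simp: r_def algebra_simps)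
    ultimately show "v pdvd (\<lambda>x. crs3 p q $ j * F x $ i)" by simp
  qed
  then show False using reducedD[OF F(2) v] by blast
qed

text \<open>Contracted primes divide the Jacobian, so there are finitely many up to associates, and
  each has a single image point.\<close>

lemma contracted_points_finite:
  assumes F: "hmap d F" "reduced F" and J: "\<exists>x. jac F x \<noteq> 0"
  shows "\<exists>B. finite B \<and> 0 \<notin> B \<and> (\<forall>p u. p \<noteq> 0 \<and> pprime u \<and> (\<forall>i. u pdvd (\<lambda>x. crs3 (F x) p $ i)) \<longrightarrow>
     (\<exists>b\<in>B. \<exists>t. t \<noteq> 0 \<and> p = t *s b))"
proof -
  have pF: "polyfun3 (\<lambda>x. F x $ i)" for i by (rule hmap_polyfun3[OF F(1)])
  obtain S where S: "finite S" "\<And>v. v \<in> S \<Longrightarrow> pprime v \<and> v pdvd jac F"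
    "\<And>v. pprime v \<Longrightarrow> v pdvd jac F \<Longrightarrow> \<exists>w\<in>S. w pdvd v \<and> v pdvd w"
    using finite_pprimes[OF polyfun3_jac[OF pF] J] by blast
  define C where "C v p \<longleftrightarrow> p \<noteq> 0 \<and> (\<forall>i. v pdvd (\<lambda>x. crs3 (F x) p $ i))" for v p
  define B where "B = (\<lambda>v. SOME p. C v p) ` {v\<in>S. \<exists>p. C v p}"
  have CB: "C v (SOME p. C v p)" if "\<exists>p. C v p" for v using that by (rule someI_ex)
  have uniq: "crs3 p q = 0" if "pprime v" "C v p" "C v q" for v p q
    by (rule contracted_point_unique[OF F that(1)]) (use that in \<open>simp_all add: C_def\<close>)
  show ?thesis
  proof (intro exI[of _ B] conjI allI impI)
    show "finite B" using S(1) by (simp add: B_def)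
    have "\<And>v p. C v p \<Longrightarrow> p \<noteq> 0" by (simp add: C_def)
    then show "0 \<notin> B" using CB unfolding B_def by (metis (mono_tags, lifting) imageE mem_Collect_eq)
  next
    fix p u assume pu: "p \<noteq> 0 \<and> pprime u \<and> (\<forall>i. u pdvd (\<lambda>x. crs3 (F x) p $ i))"
    then have "u pdvd jac F" using contracted_dvd_jac[OF pprime_polyfun3 pF] by blast
    then obtain v where v: "v \<in> S" "v pdvd u" using S(3) pu by blast
    have Cp: "C v p" using pu v(2) pdvd_trans unfolding C_def by blast
    define b where "b = (SOME p. C v p)"
    have b: "b \<in> B" "C v b" using v(1) Cp CB unfolding B_def b_def by auto
    have "crs3 p b = 0" using uniq S(2)[OF v(1)] Cp b(2) by blast
    then obtain t where "p = t *s b" using crs3_eq_0_imp b(2) unfolding C_def by blast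
    moreover have "t \<noteq> 0" using pu calculation by auto
    ultimately show "\<exists>b\<in>B. \<exists>t. t \<noteq> 0 \<and> p = t *s b" using b(1) by blast
  qed
qed

text \<open>The last factor is peeled off by writing \<open>p = M p'\<close>. Either
  \<open>F\<close> itself contracts some curve to \<open>p'\<close>, which is then in
  \<open>B\<close> up to a scalar, or the curve is already contracted by the previous iterate, to a
  point \<open>q\<close> with \<open>F q\<close> proportional to \<open>p'\<close>.\<close>

lemma iterate_contracted_to_orbit:
  assumes F: "hmap d F" "reduced F" "d \<ge> 1" and M: "invertible M"
    and B: "\<And>p u. p \<noteq> 0 \<Longrightarrow> pprime u \<Longrightarrow> (\<And>i. u pdvd (\<lambda>x. crs3 (F x) p $ i)) \<Longrightarrow>
        \<exists>b\<in>B. \<exists>t. t \<noteq> 0 \<and> p = t *s b"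
    and orb: "\<And>b m. b \<in> B \<Longrightarrow> F (((\<lambda>x. M *v F x) ^^ m) (M *v b)) \<noteq> 0"
    and u: "pprime u" and p: "p \<noteq> 0"
    and nd: "\<not> (\<forall>j. u pdvd (\<lambda>x. ((\<lambda>x. M *v F x) ^^ n) x $ j))"
    and c: "\<And>i. u pdvd (\<lambda>x. crs3 (((\<lambda>x. M *v F x) ^^ n) x) p $ i)"
    and hG: "\<And>n. hmap (d ^ n) ((\<lambda>x. M *v F x) ^^ n)"
  shows "\<exists>b\<in>B. \<exists>m t. t \<noteq> 0 \<and> p = t *s ((\<lambda>x. M *v F x) ^^ m) (M *v b)"
  using p nd c
proof (induction n arbitrary: p)
  case 0
  then show ?case using identity_not_contracted[OF u 0(1)] by simp
next
  case (Suc n)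
  let ?f = "\<lambda>x. M *v F x"
  define G where "G = ?f ^^ n"
  have GS: "(?f ^^ Suc n) x = M *v F (G x)" for x by (simp add: G_def)
  have G: "polyfun3 (\<lambda>x. G x $ i)" for i unfolding G_def by (rule hmap_polyfun3[OF hG])
  obtain N where N: "N ** M = mat 1" "M ** N = mat 1" using M unfolding invertible_def by blast
  define p' where "p' = N *v p"
  have Mp': "M *v p' = p" by (simp add: p'_def matrix_vector_mul_assoc N)
  have p'0: "p' \<noteq> 0" using Mp' Suc.prems(1) by auto
  have c': "u pdvd (\<lambda>x. crs3 (F (G x)) p' $ i)" for i
    unfolding p'_def by (rule contracted_matrix[OF N Suc.prems(1)]) (use Suc.prems(3) in \<open>simp only: GS\<close>)
  \<comment> \<open>\<open>H\<close> vanishes where \<open>F x\<close> is proportional to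
    \<open>p'\<close>. A common factor of \<open>H\<close> is a curve that \<open>F\<close>
    contracts to \<open>p'\<close>; without one, \<open>H\<close> is reduced and
    \<open>reduced_contracted\<close> applies to \<open>H (G x)\<close>.\<close>
  define H where "H x = crs3 (F x) p'" for x
  have hH: "hmap d H" unfolding hmap_def H_def
  proof
    fix i show "hpoly3 d (\<lambda>x. crs3 (F x) p' $ i)"
      using exhaust_3[of i]
      by (auto intro!: hpoly3_diff hpoly3_scale[where a="p' $ _", simplified mult.commute[of "p' $ _"]] hmap_hpoly3[OF F(1)])
  qed
  show ?case
  proof (cases "reduced H")
    case False
    then obtain v where "pprime v" "\<And>i. v pdvd (\<lambda>x. crs3 (F x) p' $ i)"
      unfolding reduced_def common_factor_iff H_def by blast
    then obtain b t where bt: "b \<in> B" "t \<noteq> 0" "p' = t *s b" using B p'0 by blast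
    then have "p = t *s (?f ^^ 0) (M *v b)" using Mp' by (simp add: vector_scalar_commute)
    then show ?thesis using bt by blast
  next
    case True
    have uH: "u pdvd (\<lambda>x. H (G x) $ j)" for j using c' by (simp add: H_def)
    obtain q where q: "q \<noteq> 0" "\<And>i. u pdvd (\<lambda>x. crs3 (G x) q $ i)"
      using reduced_contracted[OF hH True u G uH] by blast
    \<comment> \<open>If \<open>u\<close> divided \<open>G\<close>, it would divide
      \<open>F (G x)\<close> as well, because \<open>F 0 = 0\<close> for
      \<open>d \<ge> 1\<close>.\<close>
    have ndG: "\<not> (\<forall>j. u pdvd (\<lambda>x. G x $ j))"
    proof
      assume all: "\<forall>j. u pdvd (\<lambda>x. G x $ j)"
      have "u pdvd (\<lambda>x. F (G x) $ j)" for j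
      proof -
        have "u pdvd (\<lambda>x. F (G x) $ j - F 0 $ j)"
          by (rule pdvd_congruence[OF hmap_polyfun3[OF F(1), of j], where B="\<lambda>x. 0"])
            (use all G in \<open>auto intro: polyfun3_intros\<close>)
        moreover have "F 0 = 0" using hmap_homogeneous[OF F(1), of 0 0] F(3) by (simp add: power_0_left)
        ultimately show ?thesis by simp
      qed
      then have "u pdvd (\<lambda>x. (M *v F (G x)) $ j)" for j by (rule pdvd_matrix)
      then show False using Suc.prems(2) unfolding GS by blast
    qed
    obtain b m t where bmt: "b \<in> B" "t \<noteq> 0" "q = t *s (?f ^^ m) (M *v b)"
      using Suc.IH[OF q(1)] ndG q(2) unfolding G_def by blast
    have "F q = t ^ d *s F ((?f ^^ m) (M *v b))" unfolding bmt(3) hmap_homogeneous[OF F(1)] ..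
    then have Fq: "M *v F q = t ^ d *s (?f ^^ Suc m) (M *v b)"
      by (simp add: vector_scalar_commute)
    have "F q \<noteq> 0" using orb[OF bmt(1), of m] bmt(2) \<open>F q = _\<close> by simp
    have "H q $ j = 0" for j
      by (rule contracted_value[OF u G ndG q(1) q(2) hmap_hpoly3[OF hH] uH])
    from this[of 1] this[of 2] this[of 3] have "crs3 p' (F q) = 0"
      unfolding H_def by (simp add: vec3_eq_iff mult.commute)
    then obtain s where s: "p' = s *s F q" using crs3_eq_0_imp \<open>F q \<noteq> 0\<close> by blast
    then have "p = (s * t ^ d) *s (?f ^^ Suc m) (M *v b)"
      using Mp' Fq by (simp add: vector_scalar_commute)
    moreover have "s * t ^ d \<noteq> 0" using calculation Suc.prems(1) by auto
    ultimately show ?thesis using bmt(1) by blast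
  qed
qed

text \<open>A common factor \<open>u\<close> of the next iterate means that \<open>F (G x)\<close>
  vanishes modulo \<open>u\<close>, so \<open>G\<close> contracts \<open>u\<close> to a point
  \<open>q\<close> with \<open>F q = 0\<close>. But \<open>q\<close> lies on the orbit of some
  \<open>M b\<close>, and these orbits avoid the zeros of \<open>F\<close>.\<close>

lemma iterate_reduced:
  assumes F: "hmap d F" "reduced F" "d \<ge> 1" and M: "invertible M"
    and B: "\<And>p u. p \<noteq> 0 \<Longrightarrow> pprime u \<Longrightarrow> (\<And>i. u pdvd (\<lambda>x. crs3 (F x) p $ i)) \<Longrightarrow>
        \<exists>b\<in>B. \<exists>t. t \<noteq> 0 \<and> p = t *s b"
    and orb: "\<And>b m. b \<in> B \<Longrightarrow> F (((\<lambda>x. M *v F x) ^^ m) (M *v b)) \<noteq> 0"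
  shows "hmap (d ^ n) ((\<lambda>x. M *v F x) ^^ n) \<and> reduced ((\<lambda>x. M *v F x) ^^ n)"
proof -
  let ?f = "\<lambda>x. M *v F x"
  have hG: "hmap (d ^ n) (?f ^^ n)" for n
  proof (induction n)
    case 0 show ?case using hmap_id by (simp add: id_def)
  next
    case (Suc n)
    have "hmap (d * d ^ n) (\<lambda>x. ?f ((?f ^^ n) x))" by (rule hmap_compose[OF hmap_matrix[OF F(1)] Suc])
    then show ?case by (simp add: o_def)
  qed
  have "reduced (?f ^^ n)"
  proof (induction n)
    case 0 show ?case using reduced_id by (simp add: id_def)
  next
    case (Suc n)
    define G where "G = ?f ^^ n"
    have G: "polyfun3 (\<lambda>x. G x $ i)" for i unfolding G_def by (rule hmap_polyfun3[OF hG])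
    show ?case
    proof (rule ccontr)
      assume "\<not> ?thesis"
      then obtain u where u: "pprime u" "\<And>j. u pdvd (\<lambda>x. (M *v F (G x)) $ j)"
        unfolding reduced_def common_factor_iff by (auto simp: G_def o_def)
      obtain N where N: "N ** M = mat 1" using M unfolding invertible_def by blast
      have "u pdvd (\<lambda>x. (N *v (M *v F (G x))) $ j)" for j by (rule pdvd_matrix[OF u(2)])
      then have uF: "u pdvd (\<lambda>x. F (G x) $ j)" for j by (simp add: matrix_vector_mul_assoc N)
      obtain q where q: "q \<noteq> 0" "\<And>i. u pdvd (\<lambda>x. crs3 (G x) q $ i)"
        using reduced_contracted[OF F(1,2) u(1) G uF] by blast
      have ndG: "\<not> (\<forall>j. u pdvd (\<lambda>x. G x $ j))" using reducedD[OF Suc u(1)] by (simp add: G_def)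
      obtain b m t where bmt: "b \<in> B" "t \<noteq> 0" "q = t *s (?f ^^ m) (M *v b)"
        using iterate_contracted_to_orbit[OF F M _ _ u(1) q(1) ndG[unfolded G_def] q(2)[unfolded G_def] hG, of B]
          B orb by blast
      have "F q = t ^ d *s F ((?f ^^ m) (M *v b))" unfolding bmt(3) hmap_homogeneous[OF F(1)] ..
      then have "F q \<noteq> 0" using orb[OF bmt(1), of m] bmt(2) by simp
      moreover have "F q $ j = 0" for j
        by (rule contracted_value[OF u(1) G ndG q(1) q(2) hmap_hpoly3[OF F(1)] uF])
      ultimately show False by (simp add: vec_eq_iff)
    qed
  qed
  with hG show ?thesis by blast
qed

section \<open>Forms in the entries of the matrix\<close>

lemma hompoly_line:
  assumes "hompoly k P" shows "\<exists>Q. \<forall>t. P (\<lambda>i. a i + t * v i) = poly Q t"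
proof -
  obtain c where c: "\<And>x. P x = (\<Sum>e\<in>{e. sum e UNIV = k}. c e * monom_fun e x)"
    using assms unfolding hompoly_def by blast
  show ?thesis
    by (rule exI[of _ "\<Sum>e\<in>{e. sum e UNIV = k}. smult (c e) (\<Prod>i\<in>UNIV. [:a i, v i:] ^ e i)"])
      (simp add: c poly_sum poly_prod poly_power)
qed

text \<open>On the line through \<open>M\<close> and \<open>N\<close> both forms become nonzero
  polynomials in one variable, so some point avoids the roots of both.\<close>

lemma mhpoly_mult_nonzero:
  assumes P: "mhpoly k P" "P M \<noteq> 0" and Q: "mhpoly l Q" "Q N \<noteq> 0"
  shows "\<exists>R. P R \<noteq> 0 \<and> Q R \<noteq> 0"
proof -
  define L where "L t = (\<chi> i j. M $ i $ j + t * (N $ i $ j - M $ i $ j))" for t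
  have ex: "\<exists>p. \<forall>t. R (L t) = poly p t" if "mhpoly m R" for m R
    using hompoly_line[OF that[unfolded mhpoly_def], of "\<lambda>(i, j). M $ i $ j" "\<lambda>(i, j). N $ i $ j - M $ i $ j"]
    by (simp add: L_def)
  obtain p q where pq: "\<And>t. P (L t) = poly p t" "\<And>t. Q (L t) = poly q t"
    using ex[OF P(1)] ex[OF Q(1)] by blast
  have "L 0 = M" "L 1 = N" by (simp_all add: L_def vec_eq_iff)
  then have "p \<noteq> 0" "q \<noteq> 0" using pq(1)[of 0] pq(2)[of 1] P Q by auto
  then have "p * q \<noteq> 0" by simp
  then obtain t where "poly (p * q) t \<noteq> 0" using poly_all_0_iff_0 by blast
  then show ?thesis using pq by (intro exI[of _ "L t"]) auto
qed

lemma mhpoly_det: "mhpoly 3 (\<lambda>M. det M)"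
proof -
  have "mhpoly (1 + 1 + 1) (\<lambda>M::complex^3^3. det M)"
    unfolding det_3 by (intro mhpoly_add mhpoly_diff mhpoly_mult mhpoly_coord)
  then show ?thesis by (simp add: eval_nat_numeral)
qed

text \<open>The product with \<open>det\<close> moves a possibly singular witness to an invertible
  one. This is what allows matrices of rank one as witnesses.\<close>

lemma mhpoly_invertible_nonzero:
  assumes "mhpoly k P" "P M \<noteq> 0" shows "\<exists>M. invertible M \<and> P M \<noteq> 0"
  using mhpoly_mult_nonzero[OF assms mhpoly_det, of "mat 1"] by (auto simp: invertible_det_nz)

text \<open>The witness is a matrix of rank one with image spanned by \<open>q\<close>: every orbit stays at \<open>q\<close>.\<close>
lemma orbit_polynomial:
  assumes F: "hmap d F" "reduced F" and b: "b \<noteq> 0"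
  shows "\<exists>P k M. mhpoly k P \<and> P M \<noteq> 0 \<and> (\<forall>M. P M \<noteq> 0 \<longrightarrow> F (((\<lambda>x. M *v F x) ^^ m) (M *v b)) \<noteq> 0)"
proof -
  obtain j q where jq: "F q $ j \<noteq> 0" using reduced_component[OF F(2)] by blast
  \<comment> \<open>For \<open>M0 = q l^T\<close> the image of \<open>y\<close> is
    \<open>dot3 y l\<close> times \<open>q\<close>. The linear form \<open>l\<close> must not vanish
    at \<open>b\<close>, where the orbit starts, nor at \<open>F q\<close>, from which it returns to
    \<open>q\<close>.\<close>
  have "\<exists>l. dot3 b l \<noteq> 0 \<and> dot3 (F q) l \<noteq> 0"
  proof (rule polyfun3_mult_nonzero)
    have "F q \<noteq> 0" using jq by auto
    then show "\<exists>l. dot3 b l \<noteq> 0" "\<exists>l. dot3 (F q) l \<noteq> 0" using vec3_nonzero_dot3 b by blast+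
  qed (intro dot3_polyfun3 polyfun3_intros)+
  then obtain l where l: "dot3 b l \<noteq> 0" "dot3 (F q) l \<noteq> 0" by blast
  define M0 :: "complex^3^3" where "M0 = (\<chi> i k. q $ i * l $ k)"
  have M0: "M0 *v y = dot3 y l *s q" for y
    by (simp add: vec_eq_iff matrix_vector_mult_def M0_def dot3_sum sum_distrib_left algebra_simps)
  have orb0: "\<exists>c. c \<noteq> 0 \<and> ((\<lambda>x. M0 *v F x) ^^ m) (M0 *v b) = c *s q" for m
  proof (induction m)
    case 0 then show ?case using M0 l by auto
  next
    case (Suc m)
    then obtain c where c: "c \<noteq> 0" "((\<lambda>x. M0 *v F x) ^^ m) (M0 *v b) = c *s q" by blast
    then have "((\<lambda>x. M0 *v F x) ^^ Suc m) (M0 *v b) = (c ^ d * dot3 (F q) l) *s q"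
      by (simp add: hmap_homogeneous[OF F(1)] M0 dot3_linear)
    then show ?case using c l by (intro exI[of _ "c ^ d * dot3 (F q) l"]) simp
  qed
  have pol: "\<exists>k. \<forall>i. mhpoly k (\<lambda>M. ((\<lambda>x. M *v F x) ^^ m) (M *v b) $ i)" for m
  proof (induction m)
    case 0
    have "mhpoly (1 + 0) (\<lambda>M. (M *v b) $ i)" for i
      unfolding matrix_vector_dot3 dot3_def by (intro mhpoly_add mhpoly_mult mhpoly_coord mhpoly_const)
    then show ?case by auto
  next
    case (Suc m)
    then obtain k where k: "\<And>i. mhpoly k (\<lambda>M. ((\<lambda>x. M *v F x) ^^ m) (M *v b) $ i)" by blast
    have "mhpoly (d * k) (\<lambda>M. F (((\<lambda>x. M *v F x) ^^ m) (M *v b)) $ i)" for i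
      by (rule mhpoly_compose_hpoly3[OF hmap_hpoly3[OF F(1)] k])
    then have "mhpoly (1 + d * k) (\<lambda>M. (M *v F (((\<lambda>x. M *v F x) ^^ m) (M *v b))) $ i)" for i
      unfolding matrix_vector_dot3 dot3_def by (intro mhpoly_add mhpoly_mult mhpoly_coord)
    then show ?case by (intro exI[of _ "1 + d * k"]) simp
  qed
  obtain k where k: "\<And>i. mhpoly k (\<lambda>M. ((\<lambda>x. M *v F x) ^^ m) (M *v b) $ i)" using pol by blast
  obtain c where c: "c \<noteq> 0" "((\<lambda>x. M0 *v F x) ^^ m) (M0 *v b) = c *s q" using orb0 by blast
  show ?thesis
  proof (intro exI conjI allI impI)
    show "mhpoly (d * k) (\<lambda>M. F (((\<lambda>x. M *v F x) ^^ m) (M *v b)) $ j)"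
      by (rule mhpoly_compose_hpoly3[OF hmap_hpoly3[OF F(1)] k])
    show "F (((\<lambda>x. M0 *v F x) ^^ m) (M0 *v b)) $ j \<noteq> 0"
      unfolding c(2) hmap_homogeneous[OF F(1)] using jq c(1) by simp
  qed auto
qed

subsection \<open>The topological degree\<close>

lemma preim_matrix:
  assumes N: "N ** M = mat 1" "M ** N = mat 1"
  shows "preim (\<lambda>x. M *v F x) p = preim F (N *v p)"
proof -
  have NM: "N *v (M *v y) = y" "M *v (N *v y) = y" for y by (simp_all add: matrix_vector_mul_assoc N)
  have "M *v F x \<noteq> 0 \<longleftrightarrow> F x \<noteq> 0" for x using NM by (metis matrix_vector_mult_0_right)
  moreover have cls: "proj_cls (A *v y) = (*v) A ` proj_cls y" for A :: "complex^3^3" and y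
    unfolding proj_cls_def by (auto simp: vector_scalar_commute image_iff) (metis vector_scalar_commute)
  have "proj_cls (M *v y) = proj_cls p \<longleftrightarrow> proj_cls y = proj_cls (N *v p)" for y
  proof
    assume "proj_cls (M *v y) = proj_cls p"
    then have "(*v) N ` proj_cls (M *v y) = (*v) N ` proj_cls p" by simp
    then show "proj_cls y = proj_cls (N *v p)" by (simp add: cls[symmetric] NM)
  next
    assume "proj_cls y = proj_cls (N *v p)"
    then have "(*v) M ` proj_cls y = (*v) M ` proj_cls (N *v p)" by simp
    then show "proj_cls (M *v y) = proj_cls p" by (simp add: cls[symmetric] NM)
  qed
  ultimately show ?thesis unfolding preim_def by simp
qed

text \<open>Composition with \<open>M\<close> only relabels the fibres
  (\<open>preim_matrix\<close>), so the exceptional form \<open>h\<close> is transported by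
  \<open>M\<close> or its inverse and the predicates under \<open>THE\<close> agree for every
  \<open>n\<close>.\<close>

lemma topdeg_matrix:
  assumes "invertible M" shows "topdeg (\<lambda>x. M *v F x) = topdeg F"
proof -
  obtain N where N: "N ** M = mat 1" "M ** N = mat 1" using assms unfolding invertible_def by blast
  have NM: "N *v (M *v y) = y" "M *v (N *v y) = y" for y by (simp_all add: matrix_vector_mul_assoc N)
  have lin: "hpoly3 1 (\<lambda>x. (A *v x) $ i)" for A :: "complex^3^3" and i
    using hmap_matrix[OF hmap_id, of A] by (simp add: hmap_def)
  have hA: "hpoly3 k (\<lambda>x. h (A *v x))" if "hpoly3 k h" for h k and A :: "complex^3^3"
    using hpoly3_compose[OF that lin] by simp
  let ?P = "\<lambda>F n. \<exists>k h. hpoly3 k h \<and> (\<exists>x. h x \<noteq> 0) \<and> (\<forall>p. p \<noteq> 0 \<and> h p \<noteq> 0 \<longrightarrow> card (preim F p) = n)"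
  have "?P (\<lambda>x. M *v F x) n \<longleftrightarrow> ?P F n" for n
  proof
    assume "?P (\<lambda>x. M *v F x) n"
    then obtain k h where h: "hpoly3 k h" "\<exists>x. h x \<noteq> 0"
      "\<And>p. p \<noteq> 0 \<Longrightarrow> h p \<noteq> 0 \<Longrightarrow> card (preim F (N *v p)) = n"
      unfolding preim_matrix[OF N] by blast
    show "?P F n"
    proof (intro exI[of _ k] exI[of _ "\<lambda>x. h (M *v x)"] conjI allI impI)
      show "hpoly3 k (\<lambda>x. h (M *v x))" by (rule hA[OF h(1)])
      show "\<exists>x. h (M *v x) \<noteq> 0" using h(2) NM by metis
      fix p assume "p \<noteq> 0 \<and> h (M *v p) \<noteq> 0"
      moreover have "M *v p \<noteq> 0" using calculation NM(1)[of p] by auto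
      ultimately show "card (preim F p) = n" using h(3)[of "M *v p"] by (simp add: NM)
    qed
  next
    assume "?P F n"
    then obtain k h where h: "hpoly3 k h" "\<exists>x. h x \<noteq> 0"
      "\<And>p. p \<noteq> 0 \<Longrightarrow> h p \<noteq> 0 \<Longrightarrow> card (preim F p) = n" by blast
    show "?P (\<lambda>x. M *v F x) n"
    proof (intro exI[of _ k] exI[of _ "\<lambda>x. h (N *v x)"] conjI allI impI)
      show "hpoly3 k (\<lambda>x. h (N *v x))" by (rule hA[OF h(1)])
      show "\<exists>x. h (N *v x) \<noteq> 0" using h(2) NM by metis
      fix p assume "p \<noteq> 0 \<and> h (N *v p) \<noteq> 0"
      moreover have "N *v p \<noteq> 0" using calculation NM(2)[of p] by auto
      ultimately show "card (preim (\<lambda>x. M *v F x) p) = n" unfolding preim_matrix[OF N] using h(3) by blast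
    qed
  qed
  then show ?thesis unfolding topdeg_def by presburger
qed

subsection \<open>The cofactor of an invariant form\<close>

lemma pullback_grad:
  "pullback F w x = w (F x) $ 1 *s grad (\<lambda>x. F x $ 1) x + w (F x) $ 2 *s grad (\<lambda>x. F x $ 2) x
     + w (F x) $ 3 *s grad (\<lambda>x. F x $ 3) x"
  by (simp add: vec_eq_iff pullback_def sum_3)

lemma jac_matrix:
  assumes "\<And>i. polyfun3 (\<lambda>x. F x $ i)" shows "jac (\<lambda>x. M *v F x) x = det M * jac F x"
  unfolding jac_def matrix_vector_dot3 grad_dot3[OF assms] det3_mult det3_dot3 ..

lemma polyfun3_pullback:
  assumes "\<And>i. polyfun3 (\<lambda>x. F x $ i)" "\<And>i. polyfun3 (\<lambda>x. w x $ i)"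
  shows "polyfun3 (\<lambda>x. pullback F w x $ j)"
proof -
  have wF: "polyfun3 (\<lambda>x. w (F x) $ i)" for i
    by (rule polyfun3_compose[of "\<lambda>x. w x $ i" F, OF assms(2) assms(1)])
  show ?thesis unfolding pullback_def by (simp, intro polyfun3_intros wF polyfun3_pd assms)
qed

text \<open>Cramer's rule: where the Jacobian is nonzero, the pull-back determines
  \<open>w (F x)\<close>.\<close>

lemma pullback_cramer:
  "dot3 (pullback F w x) (crs3 (grad (\<lambda>x. F x $ 2) x) (grad (\<lambda>x. F x $ 3) x)) = w (F x) $ 1 * jac F x"
  "dot3 (pullback F w x) (crs3 (grad (\<lambda>x. F x $ 3) x) (grad (\<lambda>x. F x $ 1) x)) = w (F x) $ 2 * jac F x"
  "dot3 (pullback F w x) (crs3 (grad (\<lambda>x. F x $ 1) x) (grad (\<lambda>x. F x $ 2) x)) = w (F x) $ 3 * jac F x"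
  unfolding pullback_grad jac_def by (simp_all add: dot3_def algebra_simps)

lemma pullback_nonzero:
  assumes F: "\<And>i. polyfun3 (\<lambda>x. F x $ i)" "\<exists>x. jac F x \<noteq> 0" and w: "\<And>i. polyfun3 (\<lambda>x. w x $ i)"
    and z: "\<And>x. pullback F w x = 0"
  shows "w (F x) = 0"
proof -
  have "jac F x * w (F x) $ i = 0" for x i
    using pullback_cramer[of F w x] exhaust_3[of i] by (auto simp: z dot3_linear mult.commute)
  then have "w (F x) $ i = 0" for i
    using polyfun3_zero_off[OF polyfun3_compose[OF w F(1)] polyfun3_jac[OF F(1)] F(2)] by (metis mult_eq_0_iff)
  then show ?thesis by (simp add: vec_eq_iff)
qed

text \<open>Suppose a prime \<open>u\<close> divides the cofactor but not the Jacobian. By Cramer's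
  rule \<open>u\<close> divides \<open>w\<close> composed with the map. As \<open>w\<close> is
  reduced, the map contracts \<open>u\<close> to a singular point of the foliation, and a contracted
  prime divides the Jacobian after all.\<close>

lemma invariant_cofactor:
  assumes F: "hmap d F" and M: "invertible M"
    and w: "hmap k w" "reduced w" and inv: "invariant_foliation (\<lambda>x. M *v F x) w"
  shows "\<exists>\<phi>. polyfun3 \<phi> \<and> (\<exists>x. \<phi> x \<noteq> 0) \<and> (\<forall>x. pullback (\<lambda>x. M *v F x) w x = \<phi> x *s w x) \<and>
     (\<forall>u. pprime u \<and> u pdvd \<phi> \<longrightarrow> u pdvd jac F)"
proof -
  let ?G = "\<lambda>x. M *v F x"
  have G: "polyfun3 (\<lambda>x. ?G x $ i)" for i by (rule hmap_polyfun3[OF hmap_matrix[OF F]])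
  have wp: "polyfun3 (\<lambda>x. w x $ i)" for i by (rule hmap_polyfun3[OF w(1)])
  obtain \<phi> where \<phi>: "polyfun3 \<phi>" "\<And>x. pullback ?G w x = \<phi> x *s w x"
    using reduced_quotient[OF polyfun3_pullback[OF G wp] wp w(2)] inv unfolding invariant_foliation_def by blast
  have "\<exists>x. pullback ?G w x \<noteq> 0" using inv unfolding invariant_foliation_def by blast
  then have "\<exists>x. \<phi> x \<noteq> 0" using \<phi>(2) by auto
  moreover have "u pdvd jac F" if u: "pprime u" "u pdvd \<phi>" for u
  proof (rule ccontr)
    assume no: "\<not> u pdvd jac F"
    have jp: "polyfun3 (jac ?G)" by (rule polyfun3_jac[OF G])
    have noG: "\<not> u pdvd jac ?G"
    proof
      assume "u pdvd jac ?G"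
      then have "u pdvd (\<lambda>x. det M * jac F x)"
        by (rule pdvd_cong) (rule jac_matrix[OF hmap_polyfun3[OF F]])
      then have "u pdvd jac F" by (rule pdvd_scale_cancel) (use M in \<open>simp add: invertible_det_nz\<close>)
      then show False using no by blast
    qed
    have up: "u pdvd (\<lambda>x. pullback ?G w x $ i)" for i
      unfolding \<phi>(2) vector_smult_component by (rule pdvd_mult_right[OF u(2) wp])
    have gp: "polyfun3 (\<lambda>x. crs3 (grad (\<lambda>x. ?G x $ a) x) (grad (\<lambda>x. ?G x $ b) x) $ i)" for a b i
      using exhaust_3[of i] by (auto intro!: polyfun3_intros polyfun3_pd G)
    have ud: "u pdvd (\<lambda>x. dot3 (pullback ?G w x) (crs3 (grad (\<lambda>x. ?G x $ a) x) (grad (\<lambda>x. ?G x $ b) x)))" for a b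
      unfolding dot3_def by (intro pdvd_add pdvd_mult_right up gp)
    have "u pdvd (\<lambda>x. w (?G x) $ i)" for i
    proof -
      have "u pdvd (\<lambda>x. w (?G x) $ i * jac ?G x)"
        using ud[of 2 3] ud[of 3 1] ud[of 1 2] exhaust_3[of i] unfolding pullback_cramer by auto
      then show ?thesis
        using pprime_dvd_multD[OF u(1) polyfun3_compose[of "\<lambda>x. w x $ i" ?G, OF wp G] jp] noG by blast
    qed
    then obtain p where "p \<noteq> 0" "\<And>i. u pdvd (\<lambda>x. crs3 (?G x) p $ i)"
      using reduced_contracted[OF w u(1) G] by blast
    then have "u pdvd jac ?G" using contracted_dvd_jac[OF pprime_polyfun3[OF u(1)] G] by blast
    then show False using noG by blast
  qed
  ultimately show ?thesis using \<phi> by blast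
qed

subsection \<open>A monomial basis\<close>

text \<open>The pair \<open>(l, i)\<close> stands for the monomial with exponents \<open>i\<close>,
  \<open>l - i\<close>, \<open>k - l\<close>. Grouping by the degree \<open>l\<close> in the first
  two variables prepares for the jets at \<open>axis 3 1\<close>, where \<open>l\<close> is the
  order of vanishing.\<close>

definition tri :: "nat \<Rightarrow> (nat \<times> nat) set" where
  "tri k = {(l, i). i \<le> l \<and> l \<le> k}"

definition tmono :: "nat \<Rightarrow> nat \<times> nat \<Rightarrow> complex^3 \<Rightarrow> complex" where
  "tmono k = (\<lambda>(l, i) x. (x $ 1) ^ i * (x $ 2) ^ (l - i) * (x $ 3) ^ (k - l))"

lemma finite_tri: "finite (tri k)"
proof -
  have "tri k \<subseteq> {..k} \<times> {..k}" by (auto simp: tri_def)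
  then show ?thesis by (rule finite_subset) auto
qed

lemma hpoly3_tmono: "a \<in> tri k \<Longrightarrow> hpoly3 k (tmono k a)"
proof -
  assume a: "a \<in> tri k"
  obtain l i where li: "a = (l, i)" by (cases a)
  have "hpoly3 (1 * i + 1 * (l - i) + 1 * (k - l)) (\<lambda>x. (x $ 1) ^ i * (x $ 2) ^ (l - i) * (x $ 3) ^ (k - l))"
    by (intro hpoly3_mult hpoly3_power hpoly3_coord)
  then show ?thesis using a by (simp add: li tri_def tmono_def)
qed

lemma hpoly3_tri_expansion:
  assumes "hpoly3 k p" shows "\<exists>c. \<forall>x. p x = (\<Sum>a\<in>tri k. c a * tmono k a x)"
proof -
  obtain c where c: "\<And>v. p (vec_lambda v) = (\<Sum>e\<in>{e. sum e UNIV = k}. c e * monom_fun e v)"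
    using assms unfolding hpoly3_def hompoly_def by blast
  define g :: "nat \<times> nat \<Rightarrow> 3 \<Rightarrow> nat" where
    "g = (\<lambda>(l, i) j. if j = 1 then i else if j = 2 then l - i else k - l)"
  have "p x = (\<Sum>a\<in>tri k. c (g a) * tmono k a x)" for x
  proof -
    have "p x = (\<Sum>e\<in>{e. sum e UNIV = k}. c e * monom_fun e (vec_nth x))" using c[of "vec_nth x"] by simp
    also have "\<dots> = (\<Sum>a\<in>tri k. c (g a) * tmono k a x)"
    proof (rule sum.reindex_bij_witness[where i=g and j="\<lambda>e. (e 1 + e 2, e 1)"])
      fix e :: "3 \<Rightarrow> nat" assume "e \<in> {e. sum e UNIV = k}"
      then have e: "e 1 + e 2 + e 3 = k" by (simp add: sum_3)
      show "g (e 1 + e 2, e 1) = e"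
      proof
        fix j show "g (e 1 + e 2, e 1) j = e j" using e exhaust_3[of j] by (auto simp: g_def)
      qed
      show "(e 1 + e 2, e 1) \<in> tri k" using e by (auto simp: tri_def)
      show "c (g (e 1 + e 2, e 1)) * tmono k (e 1 + e 2, e 1) x = c e * monom_fun e (vec_nth x)"
      proof -
        have e3: "k - (e 1 + e 2) = e 3" "e 1 + e 2 - e 1 = e 2" using e by simp_all
        have "monom_fun e (vec_nth x) = (x $ 1) ^ e 1 * (x $ 2) ^ e 2 * (x $ 3) ^ e 3"
          unfolding UNIV_3 by (simp add: mult.assoc)
        then show ?thesis
          unfolding \<open>g (e 1 + e 2, e 1) = e\<close> tmono_def split e3 by (simp only:)
      qed
    next
      fix a assume "a \<in> tri k"
      then obtain l i where a: "a = (l, i)" "i \<le> l" "l \<le> k" by (auto simp: tri_def)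
      have g: "g a 1 = i" "g a 2 = l - i" "g a 3 = k - l" by (simp_all add: a g_def)
      show "(g a 1 + g a 2, g a 1) = a" unfolding g using a by simp
      show "g a \<in> {e. sum e UNIV = k}" unfolding mem_Collect_eq sum_3 g using a by simp
    qed
    finally show ?thesis .
  qed
  then show ?thesis by (intro exI[of _ "\<lambda>a. c (g a)"]) blast
qed

lemma tmono_independent:
  assumes "\<And>x. (\<Sum>a\<in>tri k. c a * tmono k a x) = 0" "a \<in> tri k"
  shows "c a = 0"
proof -
  define P where "P = (\<Sum>(l, i)\<in>tri k. monom (monom (monom (c (l, i)) i) (l - i)) (k - l))"
  have es: "ev (\<Sum>a\<in>X. f a) y = (\<Sum>a\<in>X. ev (f a) y)" if "finite X" for f y and X :: "(nat \<times> nat) set"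
    using that by induction (auto simp: ev_simps)
  have "ev P x = 0" for x
  proof -
    have "ev P x = (\<Sum>a\<in>tri k. c a * tmono k a x)"
      unfolding P_def es[OF finite_tri]
      by (intro sum.cong refl) (auto simp: ev_monom tmono_def mult.assoc)
    then show ?thesis using assms(1) by simp
  qed
  then have "P = 0" by (rule ev_inject)
  obtain l i where a: "a = (l, i)" "i \<le> l" "l \<le> k" using assms(2) by (auto simp: tri_def)
  have "coeff (coeff (coeff P (k - l)) (l - i)) i
     = (\<Sum>b\<in>tri k. coeff (coeff (coeff (case b of (l, i) \<Rightarrow> monom (monom (monom (c (l, i)) i) (l - i)) (k - l)) (k - l)) (l - i)) i)"
    unfolding P_def by (simp add: coeff_sum)
  also have "\<dots> = (\<Sum>b\<in>tri k. if b = a then c b else 0)"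
  proof (intro sum.cong refl)
    fix b assume "b \<in> tri k"
    then obtain l' i' where b: "b = (l', i')" "i' \<le> l'" "l' \<le> k" by (auto simp: tri_def)
    have "k - l' = k - l \<longleftrightarrow> l' = l" "l' = l \<Longrightarrow> l' - i' = l - i \<longleftrightarrow> i' = i" using a b by auto
    then show "coeff (coeff (coeff (case b of (l, i) \<Rightarrow> monom (monom (monom (c (l, i)) i) (l - i)) (k - l)) (k - l)) (l - i)) i
        = (if b = a then c b else 0)"
      by (cases "l' = l"; cases "i' = i") (auto simp: a(1) b(1))
  qed
  also have "\<dots> = c a" using assms(2) finite_tri by simp
  finally show ?thesis using \<open>P = 0\<close> by simp
qed

definition ebasis :: "nat \<Rightarrow> (nat \<times> nat) \<times> 3 \<Rightarrow> complex^3 \<Rightarrow> complex^3" where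
  "ebasis k = (\<lambda>(a, j) x. axis j (tmono k a x))"

definition lincomb :: "nat \<Rightarrow> ((nat \<times> nat) \<times> 3 \<Rightarrow> complex) \<Rightarrow> complex^3 \<Rightarrow> complex^3" where
  "lincomb k v x = (\<Sum>b\<in>tri k \<times> UNIV. v b *s ebasis k b x)"

lemma lincomb_nth: "lincomb k v x $ j = (\<Sum>a\<in>tri k. v (a, j) * tmono k a x)"
proof -
  have "lincomb k v x $ j = (\<Sum>a\<in>tri k. \<Sum>i\<in>UNIV. v (a, i) * axis i (tmono k a x) $ j)"
    by (simp add: lincomb_def ebasis_def sum.cartesian_product split_def)
  also have "\<dots> = (\<Sum>a\<in>tri k. v (a, j) * tmono k a x)"
  proof (intro sum.cong refl)
    fix a
    have "(\<Sum>i\<in>UNIV. v (a, i) * axis i (tmono k a x) $ j) = (\<Sum>i\<in>UNIV. if i = j then v (a, i) * tmono k a x else 0)"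
      by (intro sum.cong refl) (auto simp: axis_def)
    then show "(\<Sum>i\<in>UNIV. v (a, i) * axis i (tmono k a x) $ j) = v (a, j) * tmono k a x" by simp
  qed
  finally show ?thesis .
qed

lemma hmap_lincomb: "hmap k (lincomb k v)"
  unfolding hmap_def lincomb_nth by (intro allI hpoly3_sum hpoly3_scale hpoly3_tmono)

lemma hmap_lincomb_exists:
  assumes "hmap k w" shows "\<exists>v. w = lincomb k v"
proof -
  have "\<forall>j. \<exists>c. \<forall>x. w x $ j = (\<Sum>a\<in>tri k. c a * tmono k a x)"
    using hpoly3_tri_expansion[OF hmap_hpoly3[OF assms]] by blast
  from choice[OF this] obtain c where "\<And>j x. w x $ j = (\<Sum>a\<in>tri k. c j a * tmono k a x)" by blast
  then have "w x = lincomb k (\<lambda>(a, j). c j a) x" for x by (simp add: vec_eq_iff lincomb_nth)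
  then show ?thesis by blast
qed

lemma lincomb_independent:
  assumes "\<And>x. lincomb k v x = 0" "b \<in> tri k \<times> UNIV" shows "v b = 0"
proof -
  obtain a j where b: "b = (a, j)" "a \<in> tri k" using assms(2) by auto
  have "v (a, j) = 0"
    by (rule tmono_independent[where c="\<lambda>a. v (a, j)", OF _ b(2)])
      (metis assms(1) lincomb_nth zero_index)
  then show ?thesis by (simp add: b)
qed

lemma lincomb_linear:
  "lincomb k (\<lambda>b. s * v b) x = s *s lincomb k v x"
  "lincomb k (\<lambda>b. v b + w b) x = lincomb k v x + lincomb k w x"
  by (simp_all add: vec_eq_iff lincomb_nth sum_distrib_left sum.distrib algebra_simps)

lemma lincomb_sum: "lincomb k (\<lambda>b. \<Sum>n\<in>N. f n b) x = (\<Sum>n\<in>N. lincomb k (f n) x)"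
proof (cases "finite N")
  case True then show ?thesis
    by induction (auto simp: lincomb_linear(2) vec_eq_iff lincomb_nth)
qed (simp add: vec_eq_iff lincomb_nth)

subsection \<open>Elimination\<close>

text \<open>Gaussian elimination without division. \<open>R\<close> may be infinite; at
  \<open>M0\<close> its equations have only the zero solution, and the product of the pivots is a
  form that is nonzero at \<open>M0\<close> and vanishes wherever a nonzero solution exists.\<close>

lemma elimination_polynomial:
  assumes "finite I"
    and "\<And>\<rho>. \<rho> \<in> R \<Longrightarrow> \<exists>n. \<forall>a\<in>I. mhpoly n (\<rho> a)"
    and "\<And>v. (\<And>\<rho>. \<rho> \<in> R \<Longrightarrow> (\<Sum>a\<in>I. \<rho> a M0 * v a) = 0) \<Longrightarrow> \<forall>a\<in>I. v a = 0"
  shows "\<exists>P n. mhpoly n P \<and> P M0 \<noteq> 0 \<and>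
     (\<forall>M v. (\<forall>\<rho>\<in>R. (\<Sum>a\<in>I. \<rho> a M * v a) = 0) \<and> (\<exists>a\<in>I. v a \<noteq> 0) \<longrightarrow> P M = 0)"
  using assms
proof (induction I arbitrary: R rule: finite_induct)
  case empty
  show ?case by (intro exI[of _ "\<lambda>_. 1"] exI[of _ 0]) (simp add: mhpoly_const)
next
  case (insert c I)
  have "\<exists>\<rho>\<in>R. \<rho> c M0 \<noteq> 0"
  proof (rule ccontr)
    assume no: "\<not> ?thesis"
    have "\<forall>a\<in>insert c I. (if a = c then 1 else 0 :: complex) = 0"
    proof (rule insert.prems(2))
      fix \<rho> assume "\<rho> \<in> R"
      then have "\<rho> c M0 = 0" using no by blast
      moreover have "(\<Sum>a\<in>I. \<rho> a M0 * (if a = c then 1 else 0)) = 0"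
        by (intro sum.neutral) (use insert.hyps in auto)
      ultimately show "(\<Sum>a\<in>insert c I. \<rho> a M0 * (if a = c then 1 else 0)) = 0"
        using insert.hyps by simp
    qed
    then show False by simp
  qed
  then obtain \<sigma> where \<sigma>: "\<sigma> \<in> R" "\<sigma> c M0 \<noteq> 0" by blast
  obtain m where m: "\<And>a. a \<in> insert c I \<Longrightarrow> mhpoly m (\<sigma> a)" using insert.prems(1)[OF \<sigma>(1)] by blast
  \<comment> \<open>Cross-multiplication with the pivot row \<open>\<sigma>\<close> removes the
    unknown \<open>c\<close> and keeps the coefficients polynomial in \<open>M\<close>.\<close>
  define T where "T \<rho> = (\<lambda>a M. \<sigma> c M * \<rho> a M - \<rho> c M * \<sigma> a M)" for \<rho> :: "'a \<Rightarrow> complex^3^3 \<Rightarrow> complex"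
  have Tsum: "(\<Sum>a\<in>I. T \<rho> a M * v a) = \<sigma> c M * (\<Sum>a\<in>I. \<rho> a M * v a) - \<rho> c M * (\<Sum>a\<in>I. \<sigma> a M * v a)" for \<rho> M v
    by (simp add: T_def left_diff_distrib sum_subtractf sum_distrib_left mult.assoc)
  have "\<exists>P n. mhpoly n P \<and> P M0 \<noteq> 0 \<and>
     (\<forall>M v. (\<forall>\<rho>\<in>T ` R. (\<Sum>a\<in>I. \<rho> a M * v a) = 0) \<and> (\<exists>a\<in>I. v a \<noteq> 0) \<longrightarrow> P M = 0)"
  proof (rule insert.IH)
    fix \<rho>' assume "\<rho>' \<in> T ` R"
    then obtain \<rho> where \<rho>: "\<rho> \<in> R" "\<rho>' = T \<rho>" by blast
    obtain n where n: "\<And>a. a \<in> insert c I \<Longrightarrow> mhpoly n (\<rho> a)" using insert.prems(1)[OF \<rho>(1)] by blast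
    have "mhpoly (m + n) (T \<rho> a)" if "a \<in> I" for a
    proof -
      have "mhpoly (m + n) (\<lambda>M. \<sigma> c M * \<rho> a M)" using m n that by (intro mhpoly_mult) auto
      moreover have "mhpoly (n + m) (\<lambda>M. \<rho> c M * \<sigma> a M)" using m n that by (intro mhpoly_mult) auto
      ultimately show ?thesis unfolding T_def by (intro mhpoly_diff) (simp_all add: add.commute)
    qed
    then show "\<exists>n. \<forall>a\<in>I. mhpoly n (\<rho>' a)" using \<rho>(2) by blast
  next
    fix v assume v: "\<And>\<rho>. \<rho> \<in> T ` R \<Longrightarrow> (\<Sum>a\<in>I. \<rho> a M0 * v a) = 0"
    define w where "w a = (if a = c then - (\<Sum>a\<in>I. \<sigma> a M0 * v a) / \<sigma> c M0 else v a)" for a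
    have wsum: "(\<Sum>a\<in>I. f a * w a) = (\<Sum>a\<in>I. f a * v a)" for f
      by (intro sum.cong refl) (use insert.hyps in \<open>auto simp: w_def\<close>)
    have "\<forall>a\<in>insert c I. w a = 0"
    proof (rule insert.prems(2))
      fix \<rho> assume "\<rho> \<in> R"
      then have "\<sigma> c M0 * (\<Sum>a\<in>I. \<rho> a M0 * v a) = \<rho> c M0 * (\<Sum>a\<in>I. \<sigma> a M0 * v a)"
        using v[of "T \<rho>"] unfolding Tsum by simp
      then show "(\<Sum>a\<in>insert c I. \<rho> a M0 * w a) = 0"
        using insert.hyps \<sigma>(2) by (simp add: wsum) (simp add: w_def field_simps)
    qed
    then show "\<forall>a\<in>I. v a = 0" using insert.hyps by (auto simp: w_def split: if_splits)
  qed
  then obtain P n where P: "mhpoly n P" "P M0 \<noteq> 0"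
    "\<And>M v. (\<forall>\<rho>\<in>T ` R. (\<Sum>a\<in>I. \<rho> a M * v a) = 0) \<Longrightarrow> (\<exists>a\<in>I. v a \<noteq> 0) \<Longrightarrow> P M = 0"
    by blast
  show ?case
  proof (intro exI conjI allI impI)
    show "mhpoly (m + n) (\<lambda>M. \<sigma> c M * P M)" by (rule mhpoly_mult[OF m P(1)]) simp
    show "\<sigma> c M0 * P M0 \<noteq> 0" using \<sigma> P by simp
    fix M v assume h: "(\<forall>\<rho>\<in>R. (\<Sum>a\<in>insert c I. \<rho> a M * v a) = 0) \<and> (\<exists>a\<in>insert c I. v a \<noteq> 0)"
    have e: "\<rho> c M * v c + (\<Sum>a\<in>I. \<rho> a M * v a) = 0" if "\<rho> \<in> R" for \<rho>
      using h that insert.hyps by simp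
    show "\<sigma> c M * P M = 0"
    proof (cases "\<sigma> c M = 0")
      case False
      have 1: "\<forall>\<rho>\<in>T ` R. (\<Sum>a\<in>I. \<rho> a M * v a) = 0"
      proof
        fix \<rho>' assume "\<rho>' \<in> T ` R"
        then obtain \<rho> where \<rho>: "\<rho> \<in> R" "\<rho>' = T \<rho>" by blast
        have "(\<Sum>a\<in>I. \<rho> a M * v a) = - (\<rho> c M * v c)" "(\<Sum>a\<in>I. \<sigma> a M * v a) = - (\<sigma> c M * v c)"
          using e[OF \<rho>(1)] e[OF \<sigma>(1)] by (simp_all add: add_eq_0_iff2)
        then show "(\<Sum>a\<in>I. \<rho>' a M * v a) = 0" unfolding \<rho>(2) Tsum by simp
      qed
      have 2: "\<exists>a\<in>I. v a \<noteq> 0"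
      proof (rule ccontr)
        assume no: "\<not> ?thesis"
        then have "v c = 0" using e[OF \<sigma>(1)] False by simp
        then show False using h no by auto
      qed
      show ?thesis using P(3)[OF 1 2] by simp
    qed simp
  qed
qed

text \<open>Independent functions have a biorthogonal system made of finite combinations of point
  evaluations. Evaluations are the right functionals here because, applied to a pull-back, they give
  expressions polynomial in \<open>M\<close>.\<close>

lemma dual_evaluations:
  fixes f :: "'a \<Rightarrow> 'b \<Rightarrow> complex"
  assumes "finite I" "\<And>c. (\<And>x. (\<Sum>b\<in>I. c b * f b x) = 0) \<Longrightarrow> \<forall>b\<in>I. c b = 0"
  shows "\<exists>X g. finite X \<and> (\<forall>b\<in>I. \<forall>b'\<in>I. (\<Sum>x\<in>X. g b x * f b' x) = (if b = b' then 1 else 0))"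
  using assms
proof (induction I rule: finite_induct)
  case empty show ?case by (intro exI[of _ "{}"]) auto
next
  case (insert i I)
  have "\<exists>X g. finite X \<and> (\<forall>b\<in>I. \<forall>b'\<in>I. (\<Sum>x\<in>X. g b x * f b' x) = (if b = b' then 1 else 0))"
  proof (rule insert.IH)
    fix c assume c: "\<And>x. (\<Sum>b\<in>I. c b * f b x) = 0"
    have "(\<Sum>b\<in>I. (if b = i then 0 else c b) * f b x) = 0" for x
    proof -
      have "(\<Sum>b\<in>I. (if b = i then 0 else c b) * f b x) = (\<Sum>b\<in>I. c b * f b x)"
        by (intro sum.cong refl) (use insert.hyps in auto)
      then show ?thesis using c by simp
    qed
    then have "\<forall>b\<in>insert i I. (if b = i then 0 else c b) = 0"
      using insert.hyps by (intro insert.prems) simp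
    then show "\<forall>b\<in>I. c b = 0" using insert.hyps by (metis insertCI)
  qed
  then obtain X g where X: "finite X"
    "\<And>b b'. b \<in> I \<Longrightarrow> b' \<in> I \<Longrightarrow> (\<Sum>x\<in>X. g b x * f b' x) = (if b = b' then 1 else 0)" by blast
  define \<psi> where "\<psi> b h = (\<Sum>x\<in>X. g b x * h x)" for b h
  \<comment> \<open>\<open>r\<close> subtracts the projection onto the span of the earlier
    functions. Evaluating it at a point \<open>y\<close> where \<open>r (f i)\<close> does not
    vanish gives a functional that kills those functions and not \<open>f i\<close>.\<close>
  define r where "r h x = h x - (\<Sum>b\<in>I. \<psi> b h * f b x)" for h x
  have "\<exists>x. r (f i) x \<noteq> 0"
  proof (rule ccontr)
    assume no: "\<not> ?thesis"
    then have "(\<Sum>b\<in>insert i I. (if b = i then 1 else - \<psi> b (f i)) * f b x) = 0" for x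
    proof -
      have "(\<Sum>b\<in>I. (if b = i then 1 else - \<psi> b (f i)) * f b x) = - (\<Sum>b\<in>I. \<psi> b (f i) * f b x)"
        unfolding sum_negf[symmetric] by (intro sum.cong refl) (use insert.hyps in auto)
      moreover have "r (f i) x = 0" using no by blast
      ultimately show ?thesis using insert.hyps by (simp add: r_def)
    qed
    then have "\<forall>b\<in>insert i I. (if b = i then 1 else - \<psi> b (f i)) = 0" by (rule insert.prems)
    then show False by simp
  qed
  then obtain y where y: "r (f i) y \<noteq> 0" by blast
  have rf: "r (f b) y = 0" if "b \<in> I" for b
  proof -
    have "(\<Sum>b'\<in>I. \<psi> b' (f b) * f b' y) = (\<Sum>b'\<in>I. if b' = b then f b' y else 0)"
      by (intro sum.cong refl) (use that X(2) in \<open>auto simp: \<psi>_def\<close>)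
    then show ?thesis using that insert.hyps by (simp add: r_def)
  qed
  define Y where "Y = insert y X"
  define e where "e x = (if x = y then 1 else 0 :: complex)" for x
  define g0 where "g0 b x = (if x \<in> X then g b x else 0)" for b x
  have Y: "finite Y" using X(1) by (simp add: Y_def)
  have sg0: "(\<Sum>x\<in>Y. g0 b x * h x) = \<psi> b h" for b h
  proof -
    have "(\<Sum>x\<in>Y. g0 b x * h x) = (\<Sum>x\<in>X. g0 b x * h x)"
      by (rule sum.mono_neutral_right) (use Y in \<open>auto simp: Y_def g0_def\<close>)
    also have "\<dots> = \<psi> b h" unfolding \<psi>_def by (intro sum.cong refl) (simp add: g0_def)
    finally show ?thesis .
  qed
  have se: "(\<Sum>x\<in>Y. e x * h x) = h y" for h
  proof -
    have "(\<Sum>x\<in>Y. e x * h x) = (\<Sum>x\<in>Y. if x = y then h x else 0)" by (intro sum.cong) (auto simp: e_def)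
    then show ?thesis using Y by (simp add: Y_def)
  qed
  define gi where "gi x = (e x - (\<Sum>b\<in>I. f b y * g0 b x)) / r (f i) y" for x
  have sgi: "(\<Sum>x\<in>Y. gi x * h x) = r h y / r (f i) y" for h
  proof -
    have "(\<Sum>x\<in>Y. gi x * h x) = ((\<Sum>x\<in>Y. e x * h x) - (\<Sum>x\<in>Y. \<Sum>b\<in>I. f b y * (g0 b x * h x))) / r (f i) y"
      by (simp add: gi_def sum_divide_distrib sum_subtractf[symmetric] diff_divide_distrib[symmetric]
          left_diff_distrib sum_distrib_right mult.assoc)
    also have "(\<Sum>x\<in>Y. \<Sum>b\<in>I. f b y * (g0 b x * h x)) = (\<Sum>b\<in>I. f b y * (\<Sum>x\<in>Y. g0 b x * h x))"
      by (subst sum.swap) (simp add: sum_distrib_left)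
    finally show ?thesis unfolding se sg0 r_def by (simp add: mult.commute)
  qed
  define g' where "g' b x = (if b = i then gi x else g0 b x - \<psi> b (f i) * gi x)" for b x
  have sg': "(\<Sum>x\<in>Y. g' b x * h x) = (if b = i then r h y / r (f i) y else \<psi> b h - \<psi> b (f i) * (r h y / r (f i) y))" for b h
  proof (cases "b = i")
    case True then show ?thesis by (simp add: g'_def sgi)
  next
    case False
    then have "(\<Sum>x\<in>Y. g' b x * h x) = (\<Sum>x\<in>Y. g0 b x * h x) - \<psi> b (f i) * (\<Sum>x\<in>Y. gi x * h x)"
      by (simp add: g'_def left_diff_distrib sum_subtractf sum_distrib_left mult.assoc)
    then show ?thesis using False by (simp add: sgi sg0)
  qed
  have "\<forall>b\<in>insert i I. \<forall>b'\<in>insert i I. (\<Sum>x\<in>Y. g' b x * f b' x) = (if b = b' then 1 else 0)"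
  proof (intro ballI)
    fix b b' assume bb: "b \<in> insert i I" "b' \<in> insert i I"
    show "(\<Sum>x\<in>Y. g' b x * f b' x) = (if b = b' then 1 else 0)"
      unfolding sg' using bb y rf insert.hyps X(2)[of b b'] by (auto simp: \<psi>_def)
  qed
  then show ?case using Y by blast
qed

text \<open>\<open>w\<close> may have common factors, so for a given \<open>c\<close> the conditions
  on \<open>w\<close> are linear apart from being nonzero; \<open>c\<close> absorbs the scalar by
  which a cofactor differs from its representative \<open>\<phi>\<close>.\<close>

definition bad_matrix :: "(complex^3 \<Rightarrow> complex^3) \<Rightarrow> (complex^3 \<Rightarrow> complex) \<Rightarrow> nat \<Rightarrow> complex^3^3 \<Rightarrow> bool" where
  "bad_matrix F \<phi> k M \<longleftrightarrow> (\<exists>w c. hmap k w \<and> (\<exists>x. w x \<noteq> 0) \<and> (\<forall>x. dot3 x (w x) = 0) \<and>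
     (\<forall>x. pullback (\<lambda>x. M *v F x) w x = (c * \<phi> x) *s w x))"

lemma pullback_sum:
  "pullback F (\<lambda>x. \<Sum>b\<in>I. v b *s E b x) x = (\<Sum>b\<in>I. v b *s pullback F (E b) x)"
  by (simp add: vec_eq_iff pullback_def sum_distrib_right sum_distrib_left mult.assoc sum.swap[of _ I])

lemma mhpoly_pullback:
  assumes F: "hmap d F" and w: "hmap k w"
  shows "mhpoly (k + 1) (\<lambda>M. pullback (\<lambda>x. M *v F x) w x $ j)"
proof -
  have pF: "polyfun3 (\<lambda>x. F x $ i)" for i by (rule hmap_polyfun3[OF F])
  have MF: "mhpoly 1 (\<lambda>M. dot3 (M $ i) a)" for i a
  proof -
    have "mhpoly (1 + 0) (\<lambda>M. dot3 (M $ i) a)"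
      unfolding dot3_def by (intro mhpoly_add mhpoly_mult mhpoly_coord mhpoly_const)
    then show ?thesis by simp
  qed
  have "mhpoly (k * 1) (\<lambda>M. w (M *v F x) $ i)" for i
    by (rule mhpoly_compose_hpoly3[OF hmap_hpoly3[OF w]]) (use MF in \<open>simp add: matrix_vector_dot3\<close>)
  moreover have "mhpoly 1 (\<lambda>M. pd j (\<lambda>y. (M *v F y) $ i) x)" for i
  proof -
    have "pd j (\<lambda>y. (M *v F y) $ i) x = dot3 (M $ i) (\<chi> l. pd j (\<lambda>y. F y $ l) x)" for M :: "complex^3^3"
      using arg_cong[OF grad_dot3[of F "M $ i" x, OF pF], of "\<lambda>v. v $ j"]
      by (simp add: matrix_vector_dot3 dot3_def)
    then show ?thesis using MF by simp
  qed
  ultimately have "mhpoly (k * 1 + 1) (\<lambda>M. w (M *v F x) $ i * pd j (\<lambda>y. (M *v F y) $ i) x)" for i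
    by (intro mhpoly_mult)
  then show ?thesis unfolding pullback_def by (simp, intro mhpoly_sum) simp
qed

text \<open>The Popov-Belevitch-Hautus test: with \<open>S\<close> a left inverse of multiplication by \<open>\<phi>\<close> applied to
  the pull-back, an eigenvector \<open>w\<close> as in \<^const>\<open>bad_matrix\<close> exists iff the functionals
  \<open>(pull-back - \<phi> S) S^n\<close> and the Euler contraction composed with \<open>S^n\<close> have a common
  nonzero kernel vector, and these are polynomial in \<open>M\<close>.\<close>
lemma bad_matrix_polynomial:
  assumes F: "hmap d F" and \<phi>: "polyfun3 \<phi>" "\<exists>x. \<phi> x \<noteq> 0" and M0: "\<not> bad_matrix F \<phi> k M0"
  shows "\<exists>P n. mhpoly n P \<and> P M0 \<noteq> 0 \<and> (\<forall>M. bad_matrix F \<phi> k M \<longrightarrow> P M = 0)"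
proof -
  define I where "I = tri k \<times> (UNIV :: 3 set)"
  have finI: "finite I" by (simp add: I_def finite_tri)
  define L where "L M w = pullback (\<lambda>x. M *v F x) w" for M w
  have lin: "L M (lincomb k v) x = (\<Sum>b\<in>I. v b *s L M (ebasis k b) x)" for M v x
    unfolding L_def I_def using pullback_sum[of "\<lambda>x. M *v F x" v "ebasis k" "tri k \<times> UNIV" x]
    by (simp add: lincomb_def[abs_def])
  have "\<exists>X g. finite X \<and> (\<forall>b\<in>I. \<forall>b'\<in>I. (\<Sum>y\<in>X. g b y * (\<lambda>b (x, j). \<phi> x * ebasis k b x $ j) b' y) = (if b = b' then 1 else 0))"
  proof (rule dual_evaluations[OF finI])
    fix c assume c: "\<And>y. (\<Sum>b\<in>I. c b * (case y of (x, j) \<Rightarrow> \<phi> x * ebasis k b x $ j)) = 0"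
    have "\<phi> x * lincomb k c x $ j = 0" for x j
      using c[of "(x, j)"] by (simp add: lincomb_def I_def sum_distrib_left algebra_simps)
    then have "lincomb k c x $ j = 0" for x j
      using polyfun3_zero_off[OF hmap_polyfun3[OF hmap_lincomb] \<phi>] by (metis mult_eq_0_iff)
    then have "lincomb k c x = 0" for x by (simp add: vec_eq_iff)
    then show "\<forall>b\<in>I. c b = 0" using lincomb_independent[of k c] unfolding I_def by blast
  qed
  then obtain X g where X: "finite X" and
    dual: "\<And>b b'. b \<in> I \<Longrightarrow> b' \<in> I \<Longrightarrow> (\<Sum>y\<in>X. g b y * (\<phi> (fst y) * ebasis k b' (fst y) $ snd y)) = (if b = b' then 1 else 0)"
    by (auto simp: split_def)
  \<comment> \<open>In coordinates with respect to the monomial basis, \<open>S M\<close> is the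
    pull-back followed by the left inverse of multiplication by \<open>\<phi>\<close>, the latter
    realized by the evaluations \<open>g\<close>.\<close>
  define S where "S M b b' = (\<Sum>y\<in>X. g b y * L M (ebasis k b') (fst y) $ snd y)" for M b b'
  define Sv where "Sv M v b = (\<Sum>b'\<in>I. S M b b' * v b')" for M v b
  have mL: "mhpoly (k + 1) (\<lambda>M. L M (ebasis k b) x $ j)" if "b \<in> I" for b x j
    unfolding L_def
  proof (rule mhpoly_pullback[OF F])
    have "ebasis k b = lincomb k (\<lambda>b'. if b' = b then 1 else 0)"
    proof
      fix x
      have "lincomb k (\<lambda>b'. if b' = b then 1 else 0) x = (\<Sum>b'\<in>I. if b' = b then ebasis k b' x else 0)"
        unfolding lincomb_def I_def by (intro sum.cong refl) auto
      then show "ebasis k b x = lincomb k (\<lambda>b'. if b' = b then 1 else 0) x" using finI that by simp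
    qed
    then show "hmap k (ebasis k b)" using hmap_lincomb by simp
  qed
  have mS: "mhpoly (k + 1) (\<lambda>M. S M b b')" if "b' \<in> I" for b b'
    unfolding S_def by (intro mhpoly_sum mhpoly_scale mL that)
  have SvL: "Sv M v b = (\<Sum>y\<in>X. g b y * L M (lincomb k v) (fst y) $ snd y)" for M v b
    unfolding Sv_def S_def lin by (simp add: sum_distrib_right sum_distrib_left sum.swap[of _ I] algebra_simps)
  have dualv: "(\<Sum>y\<in>X. g b y * (\<phi> (fst y) * lincomb k v (fst y) $ snd y)) = v b" if "b \<in> I" for b v
  proof -
    have "(\<Sum>y\<in>X. g b y * (\<phi> (fst y) * lincomb k v (fst y) $ snd y))
       = (\<Sum>b'\<in>I. v b' * (\<Sum>y\<in>X. g b y * (\<phi> (fst y) * ebasis k b' (fst y) $ snd y)))"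
      by (simp add: lincomb_def I_def sum_distrib_right sum_distrib_left sum.swap[of _ X] algebra_simps)
    also have "\<dots> = (\<Sum>b'\<in>I. if b' = b then v b' else 0)"
      by (intro sum.cong refl) (use dual that in auto)
    finally show ?thesis using finI that by simp
  qed
  \<comment> \<open>Powers of the matrix \<open>S M\<close> with sums over \<open>I\<close>; by
    \<open>pwv\<close> they compute the iterates of \<open>Sv\<close> on the indices in
    \<open>I\<close>.\<close>
  define pw where "pw M n = ((\<lambda>A b b'. \<Sum>b''\<in>I. S M b b'' * A b'' b') ^^ n) (\<lambda>b b'. if b = b' then 1 else 0)" for M n
  have pw0: "pw M 0 b b' = (if b = b' then 1 else 0)" for M b b' by (simp add: pw_def)
  have pwS: "pw M (Suc n) b b' = (\<Sum>b''\<in>I. S M b b'' * pw M n b'' b')" for M n b b' by (simp add: pw_def)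
  have mpw: "mhpoly ((k + 1) * n) (\<lambda>M. pw M n b b')" for n b b'
  proof (induction n arbitrary: b)
    case 0 show ?case by (simp add: pw0 mhpoly_const)
  next
    case (Suc n)
    have "mhpoly ((k + 1) + (k + 1) * n) (\<lambda>M. \<Sum>b''\<in>I. S M b b'' * pw M n b'' b')"
      by (intro mhpoly_sum mhpoly_mult mS Suc)
    then show ?case by (simp add: pwS)
  qed
  define vv where "vv M v n = (Sv M ^^ n) v" for M v n
  have vvS: "vv M v (Suc n) = Sv M (vv M v n)" for M v n by (simp add: vv_def)
  have Sv_cong: "Sv M v b = Sv M v' b" if "\<And>b. b \<in> I \<Longrightarrow> v b = v' b" for M v v' b
    unfolding Sv_def by (intro sum.cong refl) (simp add: that)
  have pwv: "(\<Sum>b'\<in>I. pw M n b b' * v b') = vv M v n b" if "b \<in> I" for M n b v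
    using that
  proof (induction n arbitrary: b)
    case 0
    have "(\<Sum>b'\<in>I. pw M 0 b b' * v b') = (\<Sum>b'\<in>I. if b' = b then v b' else 0)"
      by (intro sum.cong refl) (simp add: pw0)
    then show ?case using finI 0 by (simp add: vv_def)
  next
    case (Suc n)
    have "(\<Sum>b'\<in>I. pw M (Suc n) b b' * v b') = (\<Sum>b''\<in>I. S M b b'' * (\<Sum>b'\<in>I. pw M n b'' b' * v b'))"
      unfolding pwS sum_distrib_right sum_distrib_left by (subst sum.swap) (simp add: mult.assoc)
    also have "\<dots> = Sv M (vv M v n) b" unfolding Sv_def by (intro sum.cong refl) (simp add: Suc.IH)
    finally show ?case by (simp add: vvS)
  qed
  \<comment> \<open>\<open>Q\<close> measures how far the pull-back is from \<open>\<phi>\<close>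
    times \<open>S\<close>. \<open>R1\<close> and \<open>R2\<close> impose \<open>Q = 0\<close> and
    the Euler condition on all iterates \<open>S^n v\<close>, so their common kernel is the largest
    \<open>S\<close>-invariant subspace on which both hold.\<close>
  define Q where "Q M x j b = L M (ebasis k b) x $ j - \<phi> x * (\<Sum>b'\<in>I. S M b' b * ebasis k b' x $ j)" for M x j b
  define R1 where "R1 = (\<lambda>(n, x, j) b M. \<Sum>b1\<in>I. Q M x j b1 * pw M n b1 b)"
  define R2 where "R2 = (\<lambda>(n, x) b M. \<Sum>b1\<in>I. dot3 x (ebasis k b1 x) * pw M n b1 b)"
  have Qv: "(\<Sum>b\<in>I. Q M x j b * v b) = L M (lincomb k v) x $ j - \<phi> x * lincomb k (Sv M v) x $ j" for M x j v
  proof -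
    have "(\<Sum>b\<in>I. \<phi> x * (\<Sum>b'\<in>I. S M b' b * ebasis k b' x $ j) * v b) = \<phi> x * (\<Sum>b'\<in>I. \<Sum>b\<in>I. S M b' b * v b * ebasis k b' x $ j)"
    proof -
      have "(\<Sum>b\<in>I. \<phi> x * (\<Sum>b'\<in>I. S M b' b * ebasis k b' x $ j) * v b) = (\<Sum>b\<in>I. \<Sum>b'\<in>I. \<phi> x * (S M b' b * v b * ebasis k b' x $ j))"
        by (simp add: sum_distrib_left sum_distrib_right algebra_simps)
      also have "\<dots> = (\<Sum>b'\<in>I. \<Sum>b\<in>I. \<phi> x * (S M b' b * v b * ebasis k b' x $ j))" by (rule sum.swap)
      finally show ?thesis by (simp add: sum_distrib_left)
    qed
    also have "\<dots> = \<phi> x * lincomb k (Sv M v) x $ j"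
      by (simp add: lincomb_def I_def[symmetric] Sv_def sum_distrib_right)
    finally show ?thesis
      by (simp only: Q_def left_diff_distrib sum_subtractf) (simp add: lin mult.commute)
  qed
  have Ev: "(\<Sum>b\<in>I. dot3 x (ebasis k b x) * v b) = dot3 x (lincomb k v x)" for x v
    by (simp add: dot3_sum lincomb_def I_def[symmetric] sum_distrib_left sum_distrib_right sum.swap[of _ I] algebra_simps)
  have R1v: "(\<Sum>b\<in>I. R1 (n, x, j) b M * v b) = L M (lincomb k (vv M v n)) x $ j - \<phi> x * lincomb k (vv M v (Suc n)) x $ j" for n x j M v
  proof -
    have "(\<Sum>b\<in>I. R1 (n, x, j) b M * v b) = (\<Sum>b1\<in>I. Q M x j b1 * (\<Sum>b\<in>I. pw M n b1 b * v b))"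
      unfolding R1_def split sum_distrib_right sum_distrib_left by (subst sum.swap) (simp add: mult.assoc)
    also have "\<dots> = (\<Sum>b1\<in>I. Q M x j b1 * vv M v n b1)" by (intro sum.cong refl) (simp add: pwv)
    finally show ?thesis by (simp add: Qv vvS)
  qed
  have R2v: "(\<Sum>b\<in>I. R2 (n, x) b M * v b) = dot3 x (lincomb k (vv M v n) x)" for n x M v
  proof -
    have "(\<Sum>b\<in>I. R2 (n, x) b M * v b) = (\<Sum>b1\<in>I. dot3 x (ebasis k b1 x) * (\<Sum>b\<in>I. pw M n b1 b * v b))"
      unfolding R2_def split sum_distrib_right sum_distrib_left by (subst sum.swap) (simp add: mult.assoc)
    also have "\<dots> = (\<Sum>b1\<in>I. dot3 x (ebasis k b1 x) * vv M v n b1)" by (intro sum.cong refl) (simp add: pwv)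
    finally show ?thesis by (simp add: Ev)
  qed
  have "\<exists>P n. mhpoly n P \<and> P M0 \<noteq> 0 \<and>
     (\<forall>M v. (\<forall>\<rho>\<in>range R1 \<union> range R2. (\<Sum>a\<in>I. \<rho> a M * v a) = 0) \<and> (\<exists>a\<in>I. v a \<noteq> 0) \<longrightarrow> P M = 0)"
  proof (rule elimination_polynomial[OF finI])
    fix \<rho> assume "\<rho> \<in> range R1 \<union> range R2"
    then consider n x j where "\<rho> = R1 (n, x, j)" | n x where "\<rho> = R2 (n, x)" by auto
    then show "\<exists>n. \<forall>a\<in>I. mhpoly n (\<rho> a)"
    proof cases
      case 1
      have "mhpoly (k + 1) (\<lambda>M. Q M x j b)" if "b \<in> I" for b
      proof -
        have "mhpoly (k + 1) (\<lambda>M. ebasis k b' x $ j * S M b' b)" for b' by (rule mhpoly_scale[OF mS[OF that]])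
        then show ?thesis unfolding Q_def by (intro mhpoly_diff mhpoly_scale mhpoly_sum mL that) (simp add: mult.commute)
      qed
      then have "mhpoly ((k + 1) + (k + 1) * n) (R1 (n, x, j) a)" for a
        unfolding R1_def split by (intro mhpoly_sum mhpoly_mult mpw)
      then show ?thesis using 1 by blast
    next
      case 2
      have "mhpoly ((k + 1) * n) (R2 (n, x) a)" for a
        unfolding R2_def split by (intro mhpoly_sum mhpoly_scale mpw)
      then show ?thesis using 2 by blast
    qed
  next
    fix v assume v: "\<And>\<rho>. \<rho> \<in> range R1 \<union> range R2 \<Longrightarrow> (\<Sum>a\<in>I. \<rho> a M0 * v a) = 0"
    have Lv: "L M0 (lincomb k (vv M0 v n)) x = \<phi> x *s lincomb k (vv M0 v (Suc n)) x" for n x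
    proof -
      have "L M0 (lincomb k (vv M0 v n)) x $ j = \<phi> x * lincomb k (vv M0 v (Suc n)) x $ j" for j
        using v[of "R1 (n, x, j)"] unfolding R1v by simp
      then show ?thesis by (simp add: vec_eq_iff)
    qed
    have Eu: "dot3 x (lincomb k (vv M0 v n) x) = 0" for n x
      using v[of "R2 (n, x)"] unfolding R2v by simp
    show "\<forall>a\<in>I. v a = 0"
    proof (rule ccontr)
      assume nz: "\<not> (\<forall>a\<in>I. v a = 0)"
      define V where "V p b = (\<Sum>n\<le>degree p. coeff p n * vv M0 v n b)" for p b
      have VN: "V p b = (\<Sum>n\<le>N. coeff p n * vv M0 v n b)" if "degree p \<le> N" for p b N
        unfolding V_def by (rule sum.mono_neutral_left) (use that in \<open>auto simp: coeff_eq_0\<close>)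
      define Z where "Z p \<longleftrightarrow> p \<noteq> 0 \<and> (\<forall>b\<in>I. V p b = 0)" for p
      have "card I < card {..card I}" by simp
      then obtain \<alpha> where \<alpha>: "\<exists>n\<in>{..card I}. \<alpha> n \<noteq> 0" "\<And>b. b \<in> I \<Longrightarrow> (\<Sum>n\<le>card I. vv M0 v n b * \<alpha> n) = 0"
        using homogeneous_system_solution[OF finI, of "{..card I}" "\<lambda>b n. vv M0 v n b"] by auto
      \<comment> \<open>The vectors \<open>S^n v\<close> for \<open>n \<le> card I\<close> are
        dependent, so a nonzero polynomial in \<open>S\<close> annihilates \<open>v\<close>. One of
        least degree factors as \<open>(X - c) q\<close>, and \<open>q(S) v\<close> is then a
        nonzero eigenvector. It inherits the linear conditions and shows that \<open>M0\<close> is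
        bad.\<close>
      define p0 where "p0 = (\<Sum>n\<le>card I. monom (\<alpha> n) n)"
      have cp0: "coeff p0 n = \<alpha> n" if "n \<le> card I" for n using that by (simp add: p0_def coeff_sum)
      have "degree p0 \<le> card I" unfolding p0_def
        by (rule degree_sum_le) (auto intro: order_trans[OF degree_monom_le])
      moreover have "p0 \<noteq> 0" using \<alpha>(1) cp0 by (metis atMost_iff coeff_0)
      ultimately have "Z p0" unfolding Z_def using \<alpha>(2) VN cp0 by (simp add: mult.commute)
      then obtain p where p: "Z p" "\<And>q. Z q \<Longrightarrow> degree p \<le> degree q"
        using ex_has_least_nat[of Z p0 degree] by blast
      have "degree p \<noteq> 0"
      proof
        assume "degree p = 0"
        then obtain a where a: "p = [:a:]" "a \<noteq> 0" using p(1) unfolding Z_def by (metis degree_eq_zeroE pCons_0_0)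
        then have "\<forall>b\<in>I. a * v b = 0" using p(1) unfolding Z_def V_def by (simp add: vv_def)
        then show False using nz a(2) by auto
      qed
      then obtain c where "poly p c = 0" using fundamental_theorem_of_algebra[of p] by (auto simp: constant_degree)
      then obtain q where q: "p = [:- c, 1:] * q" unfolding poly_eq_0_iff_dvd by (elim dvdE)
      have "q \<noteq> 0" using p(1) q unfolding Z_def by auto
      then have dp: "degree p = Suc (degree q)" unfolding q by (subst degree_mult_eq) auto
      have "\<not> Z q" using p(2)[of q] dp by auto
      then have Vq: "\<exists>b\<in>I. V q b \<noteq> 0" using \<open>q \<noteq> 0\<close> unfolding Z_def by blast
      \<comment> \<open>\<open>u\<close> is \<open>S\<close> applied to \<open>V q\<close>, and the
        relation \<open>p(S) v = 0\<close> reads \<open>u = c V q\<close>.\<close>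
      define u where "u b = (\<Sum>n\<le>degree q. coeff q n * vv M0 v (Suc n) b)" for b
      have uV: "u b = c * V q b" if "b \<in> I" for b
      proof -
        have "0 = V p b" using p(1) that unfolding Z_def by simp
        also have "\<dots> = (\<Sum>n\<le>Suc (degree q). coeff p n * vv M0 v n b)" by (rule VN) (simp add: dp)
        also have "\<dots> = (\<Sum>n\<le>Suc (degree q). (coeff (pCons 0 q) n - c * coeff q n) * vv M0 v n b)"
          unfolding q by (intro sum.cong refl) simp
        also have "\<dots> = (\<Sum>n\<le>Suc (degree q). coeff (pCons 0 q) n * vv M0 v n b) - c * (\<Sum>n\<le>Suc (degree q). coeff q n * vv M0 v n b)"
          by (simp only: left_diff_distrib sum_subtractf sum_distrib_left mult.assoc)
        also have "(\<Sum>n\<le>Suc (degree q). coeff q n * vv M0 v n b) = V q b" by (rule VN[symmetric]) simp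
        also have "(\<Sum>n\<le>Suc (degree q). coeff (pCons 0 q) n * vv M0 v n b) = u b"
          unfolding u_def sum.atMost_Suc_shift by simp
        finally show ?thesis by simp
      qed
      have lu: "lincomb k u x = c *s lincomb k (V q) x" for x
      proof -
        have "lincomb k u x = lincomb k (\<lambda>b. c * V q b) x"
          unfolding lincomb_def I_def[symmetric] by (intro sum.cong refl) (simp add: uV)
        then show ?thesis by (simp add: lincomb_linear)
      qed
      have lV: "lincomb k (V q) x = (\<Sum>n\<le>degree q. coeff q n *s lincomb k (vv M0 v n) x)" for x
        unfolding V_def[abs_def] lincomb_sum lincomb_linear ..
      have lu': "lincomb k u x = (\<Sum>n\<le>degree q. coeff q n *s lincomb k (vv M0 v (Suc n)) x)" for x
        unfolding u_def[abs_def] lincomb_sum lincomb_linear ..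
      have "L M0 (lincomb k (V q)) x = (c * \<phi> x) *s lincomb k (V q) x" for x
      proof -
        have "L M0 (lincomb k (V q)) x = (\<Sum>n\<le>degree q. coeff q n *s L M0 (lincomb k (vv M0 v n)) x)"
          unfolding L_def lV[abs_def] by (rule pullback_sum)
        also have "\<dots> = \<phi> x *s lincomb k u x"
          unfolding Lv lu' by (simp add: vec_eq_iff sum_distrib_left algebra_simps)
        finally show ?thesis by (simp add: lu mult.commute)
      qed
      moreover have "dot3 x (lincomb k (V q) x) = 0" for x
      proof -
        have "dot3 x (\<Sum>n\<in>N. coeff q n *s lincomb k (vv M0 v n) x) = 0" if "finite N" for N
          using that by induction (auto simp: dot3_linear Eu)
        then show ?thesis unfolding lV by simp
      qed
      moreover have "\<exists>x. lincomb k (V q) x \<noteq> 0"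
        using lincomb_independent[of k "V q"] Vq unfolding I_def by blast
      ultimately have "bad_matrix F \<phi> k M0"
        unfolding bad_matrix_def L_def using hmap_lincomb by blast
      then show False using M0 by blast
    qed
  qed
  then obtain P n where P: "mhpoly n P" "P M0 \<noteq> 0"
    "\<And>M v. (\<forall>\<rho>\<in>range R1 \<union> range R2. (\<Sum>a\<in>I. \<rho> a M * v a) = 0) \<Longrightarrow> (\<exists>a\<in>I. v a \<noteq> 0) \<Longrightarrow> P M = 0"
    by blast
  have "P M = 0" if bad: "bad_matrix F \<phi> k M" for M
  proof -
    obtain w c where w: "hmap k w" "\<exists>x. w x \<noteq> 0" "\<And>x. dot3 x (w x) = 0"
      "\<And>x. L M w x = (c * \<phi> x) *s w x" using bad unfolding bad_matrix_def L_def by blast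
    obtain v where v: "w = lincomb k v" using hmap_lincomb_exists[OF w(1)] by blast
    \<comment> \<open>Conversely, the coordinates of an eigenform are an eigenvector of
      \<open>S\<close>, because the left inverse undoes multiplication by \<open>\<phi>\<close>; all
      iterates are then multiples of \<open>w\<close>.\<close>
    have eig: "Sv M v b = c * v b" if "b \<in> I" for b
    proof -
      have "Sv M v b = c * (\<Sum>y\<in>X. g b y * (\<phi> (fst y) * lincomb k v (fst y) $ snd y))"
        unfolding SvL using w(4) by (simp add: v sum_distrib_left algebra_simps)
      then show ?thesis using dualv[OF that] by simp
    qed
    have vvn: "vv M v n b = c ^ n * v b" if "b \<in> I" for n b
      using that
    proof (induction n arbitrary: b)
      case 0 show ?case by (simp add: vv_def)
    next
      case (Suc n)
      have "vv M v (Suc n) b = Sv M (\<lambda>b. c ^ n * v b) b" unfolding vvS by (rule Sv_cong) (rule Suc.IH)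
      also have "\<dots> = c ^ n * Sv M v b" by (simp add: Sv_def sum_distrib_left algebra_simps)
      finally show ?case using eig[OF Suc.prems] by simp
    qed
    have lvv: "lincomb k (vv M v n) = (\<lambda>x. c ^ n *s w x)" for n
    proof
      fix x
      have "lincomb k (vv M v n) x = lincomb k (\<lambda>b. c ^ n * v b) x"
        unfolding lincomb_def I_def[symmetric] by (intro sum.cong refl) (simp add: vvn)
      then show "lincomb k (vv M v n) x = c ^ n *s w x" by (simp add: lincomb_linear v)
    qed
    have "L M (\<lambda>x. c ^ n *s w x) x = c ^ n *s L M w x" for n x
      by (simp add: L_def pullback_def vec_eq_iff sum_distrib_left algebra_simps)
    then have "(\<Sum>b\<in>I. R1 (n, x, j) b M * v b) = 0" for n x j
      unfolding R1v lvv by (simp add: w(4))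
    moreover have "(\<Sum>b\<in>I. R2 (n, x) b M * v b) = 0" for n x
      unfolding R2v lvv by (simp add: dot3_linear w(3))
    ultimately have 1: "\<forall>\<rho>\<in>range R1 \<union> range R2. (\<Sum>a\<in>I. \<rho> a M * v a) = 0" by auto
    have 2: "\<exists>a\<in>I. v a \<noteq> 0"
    proof (rule ccontr)
      assume "\<not> ?thesis"
      then have "w x = 0" for x unfolding v lincomb_def I_def[symmetric] by (intro sum.neutral) auto
      then show False using w(2) by blast
    qed
    show ?thesis by (rule P(3)[OF 1 2])
  qed
  then show ?thesis using P(1,2) by blast
qed

subsection \<open>Degeneration at an attracting fixed point\<close>

lemma pullback_compose:
  assumes A: "\<And>i. polyfun3 (\<lambda>x. A x $ i)" and B: "\<And>i. polyfun3 (\<lambda>x. B x $ i)"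
  shows "pullback (\<lambda>x. A (B x)) w x = pullback B (pullback A w) x"
  by (simp add: vec_eq_iff pullback_def pd_compose[OF A B] sum_3 algebra_simps)

lemma pullback_id: "pullback (\<lambda>x. x) w x = w x"
  by (simp add: vec_eq_iff pullback_def pd_coord if_distrib[of "\<lambda>a. _ * a"] cong: if_cong)

lemma pullback_matrix: "pullback ((*v) M) w x = w (M *v x) v* (M :: complex^3^3)"
proof -
  have "pd j (\<lambda>y. (M *v y) $ i) x = M $ i $ j" for i j
    using arg_cong[OF grad_dot3[of "\<lambda>x. x" "M $ i" x], of "\<lambda>v. v $ j"] exhaust_3[of j]
    by (auto simp: matrix_vector_dot3 polyfun3_coord pd_coord)
  then show ?thesis
    by (simp add: vec_eq_iff pullback_def vector_matrix_mult_def algebra_simps)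
qed

lemma polyfun3_matrix: "polyfun3 (\<lambda>x. ((M :: complex^3^3) *v x) $ i)"
  by (rule hmap_polyfun3[OF hmap_matrix[OF hmap_id]])

lemma hmap_pullback_matrix:
  assumes "hmap k w" shows "hmap k (pullback ((*v) M) w)"
proof -
  have *: "hpoly3 k (\<lambda>x. w (M *v x) $ i)" for i
    using hpoly3_compose[OF hmap_hpoly3[OF assms] hmap_hpoly3[OF hmap_matrix[OF hmap_id]]] by simp
  have "hpoly3 k (\<lambda>x. \<Sum>i\<in>UNIV. M $ i $ j * w (M *v x) $ i)" for j
    by (intro hpoly3_sum hpoly3_scale *)
  then show ?thesis unfolding hmap_def pullback_matrix by (simp add: vector_matrix_mult_def mult.commute)
qed

lemma dot3_pullback_matrix: "dot3 x (pullback ((*v) M) w x) = dot3 (M *v x) (w (M *v x))"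
  unfolding pullback_matrix by (simp add: dot3_def vector_matrix_mult_def matrix_vector_mult_def sum_3 algebra_simps)

text \<open>In the chart \<open>x $ 3 = 1\<close> this is the homogeneous part of degree
  \<open>l\<close> of the \<open>j\<close>-th coefficient, so the smallest \<open>l\<close> with
  nonzero parts describes the leading jet of the form at \<open>axis 3 1\<close>.\<close>

definition part :: "((nat \<times> nat) \<times> 3 \<Rightarrow> complex) \<Rightarrow> 3 \<Rightarrow> nat \<Rightarrow> complex \<Rightarrow> complex \<Rightarrow> complex" where
  "part a j l x y = (\<Sum>i\<le>l. a ((l, i), j) * x ^ i * y ^ (l - i))"

lemma part_scale: "part a j l (t * x) (t * y) = t ^ l * part a j l x y"
  unfolding part_def sum_distrib_left
proof (intro sum.cong refl)
  fix i assume "i \<in> {..l}"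
  then have "t ^ l = t ^ i * t ^ (l - i)" by (simp add: power_add[symmetric])
  then show "a ((l, i), j) * (t * x) ^ i * (t * y) ^ (l - i) = t ^ l * (a ((l, i), j) * x ^ i * y ^ (l - i))"
    by (simp add: power_mult_distrib)
qed

lemma part_tendsto:
  assumes "\<And>i. i \<le> l \<Longrightarrow> ((\<lambda>n. f n ((l, i), j)) \<longlongrightarrow> a ((l, i), j)) H" "(X \<longlongrightarrow> x) H" "(Y \<longlongrightarrow> y) H"
  shows "((\<lambda>n. part (f n) j l (X n) (Y n)) \<longlongrightarrow> part a j l x y) H"
  unfolding part_def by (intro tendsto_sum tendsto_mult tendsto_power assms) auto

lemma lincomb_parts: "lincomb k a x $ j = (\<Sum>l\<le>k. part a j l (x $ 1) (x $ 2) * (x $ 3) ^ (k - l))"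
proof -
  have tri: "tri k = Sigma {..k} (\<lambda>l. {..l})" by (auto simp: tri_def)
  have "lincomb k a x $ j = (\<Sum>l\<le>k. \<Sum>i\<le>l. a ((l, i), j) * tmono k (l, i) x)"
    unfolding lincomb_nth tri by (subst sum.Sigma) (auto simp: split_def)
  then show ?thesis by (simp add: part_def tmono_def sum_distrib_right sum_distrib_left mult.assoc)
qed

lemma finite_family_subsequence:
  fixes f :: "nat \<Rightarrow> 'a \<Rightarrow> complex"
  assumes "finite I" "\<And>n i. i \<in> I \<Longrightarrow> norm (f n i) \<le> 1"
  shows "\<exists>r l. strict_mono r \<and> (\<forall>i\<in>I. (\<lambda>n. f (r n) i) \<longlonglongrightarrow> l i)"
  using assms
proof (induction I rule: finite_induct)
  case empty show ?case by (intro exI[of _ id]) (auto simp: strict_mono_def)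
next
  case (insert i I)
  then obtain r l where r: "strict_mono r" "\<forall>i\<in>I. (\<lambda>n. f (r n) i) \<longlonglongrightarrow> l i" by auto
  have "bounded (range (\<lambda>n. f (r n) i))" using insert.prems by (auto intro!: boundedI)
  then obtain l' s where s: "strict_mono s" "((\<lambda>n. f (r n) i) \<circ> s) \<longlonglongrightarrow> l'"
    using bounded_imp_convergent_subsequence by blast
  have "(\<lambda>n. f (r (s n)) j) \<longlonglongrightarrow> (l(i := l')) j" if "j \<in> insert i I" for j
  proof (cases "j = i")
    case True then show ?thesis using s(2) by (simp add: o_def)
  next
    case False
    then have "(\<lambda>n. f (r n) j) \<longlonglongrightarrow> l j" using that r by auto
    from LIMSEQ_subseq_LIMSEQ[OF this s(1)] show ?thesis using False by (simp add: o_def)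
  qed
  then show ?case using strict_mono_o[OF r(1) s(1)]
    by (intro exI[of _ "r \<circ> s"] exI[of _ "l(i := l')"]) (simp add: o_def)
qed

text \<open>Comparing leading coefficients gives \<open>\<tau> = 1\<close>; a polynomial invariant
  under the shift takes one value at all natural numbers and is constant.\<close>

lemma pcompose_shift_eigen:
  fixes P :: "complex poly"
  assumes "P \<noteq> 0" "\<And>x. poly P x = \<tau> * poly P (x + 1)"
  shows "\<tau> = 1 \<and> (\<exists>c. P = [:c:])"
proof -
  have "poly P x = poly (smult \<tau> (pcompose P [:1, 1:])) x" for x
    using assms(2)[of x] by (simp add: poly_pcompose add.commute)
  then have "poly P = poly (smult \<tau> (pcompose P [:1, 1:]))" by (rule ext)
  then have "P = smult \<tau> (pcompose P [:1, 1:])" by (simp only: poly_eq_poly_eq_iff)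
  then have "lead_coeff P = \<tau> * lead_coeff (pcompose P [:1, 1:])" by (metis lead_coeff_smult)
  moreover have "lead_coeff (pcompose P [:1, 1:]) = lead_coeff P" by (subst lead_coeff_comp) auto
  ultimately have \<tau>: "\<tau> = 1" using assms(1) by simp
  have "poly P (of_nat n) = poly P 0" for n
  proof (induction n)
    case (Suc n)
    then show ?case using assms(2)[of "of_nat n"] \<tau> by (simp add: add.commute)
  qed simp
  then have "range of_nat \<subseteq> {x. poly (P - [:poly P 0:]) x = 0}" by auto
  moreover have "infinite (range (of_nat :: nat \<Rightarrow> complex))" by (rule range_inj_infinite) (rule inj_of_nat)
  ultimately have "P - [:poly P 0:] = 0" using poly_roots_finite finite_subset by blast
  then show ?thesis using \<tau> by auto
qed

text \<open>The assumptions say that the 1-form with coefficients \<open>part a 1 m\<close>, \<open>part a 2 m\<close> is an eigenvector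
  of the substitution \<open>(x, y) \<mapsto> (x + y, y)\<close>.\<close>
lemma unipotent_eigenform:
  assumes e1: "\<And>x y. part a 1 m x y = \<tau> * part a 1 m (x + y) y"
    and e2: "\<And>x y. part a 2 m x y = \<tau> * (part a 1 m (x + y) y + part a 2 m (x + y) y)"
    and nz: "\<exists>j\<in>{1, 2}. \<exists>x y. part a j m x y \<noteq> 0"
  shows "\<exists>A B. (A, B) \<noteq> (0, 0) \<and> (\<forall>x y. y \<noteq> 0 \<longrightarrow> part a 1 m x y = A * y ^ m \<and>
      y * part a 2 m x y = (B * y - A * x) * y ^ m)"
proof -
  define P where "P j = (\<Sum>i\<le>m. monom (a ((m, i), j)) i)" for j
  have P: "poly (P j) x = part a j m x 1" for j x by (simp add: P_def part_def poly_sum poly_monom)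
  have scale: "part a j m x y = y ^ m * poly (P j) (x / y)" if "y \<noteq> 0" for j x y
    using part_scale[of a j m y "x / y" 1] that by (simp add: P)
  have nzP: "P 1 \<noteq> 0 \<or> P 2 \<noteq> 0"
  proof (rule ccontr)
    assume no: "\<not> ?thesis"
    then have z: "part a j m x y = 0" if "y \<noteq> 0" "j \<in> {1, 2}" for j x y using scale[OF that(1)] that(2) by auto
    have "part a j m x y = 0" if j: "j \<in> {1, 2}" for j x y
    proof -
      have "P j = 0" using no j by auto
      then have cz: "coeff (P j) i = 0" for i by simp
      then have "a ((m, i), j) = 0" if "i \<le> m" for i using that cz[of i] by (simp add: P_def coeff_sum)
      then show ?thesis by (simp add: part_def)
    qed
    then show False using nz by blast
  qed
  have E1: "poly (P 1) x = \<tau> * poly (P 1) (x + 1)" for x unfolding P by (rule e1)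
  have E2: "poly (P 2) x = \<tau> * (poly (P 1) (x + 1) + poly (P 2) (x + 1))" for x unfolding P by (rule e2)
  have "\<exists>A B. (A, B) \<noteq> (0, 0) \<and> P 1 = [:A:] \<and> P 2 = [:B, - A:]"
  proof (cases "P 1 = 0")
    case True
    then have "P 2 \<noteq> 0" using nzP by blast
    moreover have "poly (P 2) x = \<tau> * poly (P 2) (x + 1)" for x using E2[of x] True by simp
    ultimately obtain c where "P 2 = [:c:]" using pcompose_shift_eigen by blast
    then show ?thesis using True \<open>P 2 \<noteq> 0\<close> by (intro exI[of _ 0] exI[of _ c]) auto
  next
    case False
    then obtain A where A: "\<tau> = 1" "P 1 = [:A:]" using pcompose_shift_eigen[OF False E1] by blast
    \<comment> \<open>Adding the linear term \<open>A x\<close> compensates the contribution of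
      \<open>P 1\<close>, so that \<open>Q\<close> is invariant under the shift.\<close>
    define Q where "Q = P 2 + [:0, A:]"
    have Q: "poly Q x = 1 * poly Q (x + 1)" for x using E2[of x] A by (simp add: Q_def algebra_simps)
    have "\<exists>c. Q = [:c:]"
    proof (cases "Q = 0")
      case False then show ?thesis using pcompose_shift_eigen[OF False Q] by blast
    qed (auto intro: exI[of _ 0])
    then obtain c where "Q = [:c:]" by blast
    then have "P 2 = [:c:] - [:0, A:]" unfolding Q_def by (metis add_diff_cancel_right')
    then have "P 2 = [:c, - A:]" by simp
    then show ?thesis using A False by auto
  qed
  then obtain A B where AB: "(A, B) \<noteq> (0, 0)" "P 1 = [:A:]" "P 2 = [:B, - A:]" by blast
  have "part a 1 m x y = A * y ^ m \<and> y * part a 2 m x y = (B * y - A * x) * y ^ m" if "y \<noteq> 0" for x y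
    unfolding scale[OF that] AB(2,3) using that by (simp add: field_simps)
  then show ?thesis using AB(1) by blast
qed

lemma polyfun3_isCont: "polyfun3 p \<Longrightarrow> isCont p x"
  using has_derivative_continuous[OF polyfun3_has_derivative] by blast

lemma polyfun3_line_tendsto:
  assumes "polyfun3 p" shows "((\<lambda>t. p (x + t *s v)) \<longlongrightarrow> p x) (at 0)"
  using DERIV_isCont[OF polyfun3_deriv_line[OF assms, of x v 0]] by (simp add: isCont_def)

text \<open>Both sides are restricted to the line \<open>e + t *s v\<close> and divided by
  \<open>t ^ m\<close>. To first order \<open>G\<close> is \<open>c e + t v\<close> there, so the
  left side tends to the leading part of \<open>a\<close> times \<open>c ^ (k - m)\<close>.\<close>

lemma lowest_jet:
  assumes G: "\<And>i. polyfun3 (\<lambda>x. G x $ i)" and \<psi>: "polyfun3 \<psi>"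
    and fixp: "G (axis 3 1) = c *s axis 3 1" "c \<noteq> 0"
    and DG: "\<And>i j. pd j (\<lambda>x. G x $ i) (axis 3 1) = (if i = j then 1 else 0)"
    and eq: "\<And>x. pullback G (lincomb k a) x = \<psi> x *s lincomb k b x"
    and euler: "\<And>x. dot3 x (lincomb k a x) = 0"
    and low: "\<And>l j x y. l < m \<Longrightarrow> j \<in> {1, 2} \<Longrightarrow> part a j l x y = 0 \<and> part b j l x y = 0"
    and m: "m \<le> k" and j: "j \<in> {1, 2}"
  shows "c ^ (k - m) * part a j m x y = \<psi> (axis 3 1) * part b j m x y"
proof -
  define e :: "complex^3" where "e = axis 3 1"
  define v :: "complex^3" where "v = vector [x, y, 0]"
  define g where "g t = G (e + t *s v)" for t
  have e: "e $ 1 = 0" "e $ 2 = 0" "e $ 3 = 1" by (simp_all add: e_def axis_def)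
  have v: "v $ 1 = x" "v $ 2 = y" "v $ 3 = 0" by (simp_all add: v_def)
  have g0: "G e $ 1 = 0" "G e $ 2 = 0" "G e $ 3 = c" using fixp e by (simp_all add: e_def[symmetric])
  have gt: "((\<lambda>t. g t $ i) \<longlongrightarrow> G e $ i) (at 0)" for i
    unfolding g_def by (rule polyfun3_line_tendsto[OF G])
  have quot: "((\<lambda>t. (g t $ i - G e $ i) / t) \<longlongrightarrow> v $ i) (at 0)" for i
  proof -
    have "((\<lambda>t. G (e + t *s v) $ i) has_field_derivative (\<Sum>j\<in>UNIV. pd j (\<lambda>x. G x $ i) (e + 0 *s v) * v $ j)) (at 0)"
      by (rule polyfun3_deriv_line[OF G])
    moreover have "(\<Sum>j\<in>UNIV. pd j (\<lambda>x. G x $ i) (e + 0 *s v) * v $ j) = v $ i"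
      by (simp add: e_def DG if_distrib[of "\<lambda>a. a * _"] cong: if_cong)
    ultimately show ?thesis unfolding has_field_derivative_iff g_def by simp
  qed
  have q1: "((\<lambda>t. g t $ 1 / t) \<longlongrightarrow> x) (at 0)" and q2: "((\<lambda>t. g t $ 2 / t) \<longlongrightarrow> y) (at 0)"
    using quot[of 1] quot[of 2] by (simp_all add: g0 v)
  have low_lim: "((\<lambda>t. (\<Sum>l\<le>k. part f i l (X t) (Y t) * Z t ^ (k - l)) / t ^ m) \<longlongrightarrow> part f i m X0 Y0 * z0 ^ (k - m)) (at 0)"
    if XYZ: "((\<lambda>t. X t / t) \<longlongrightarrow> X0) (at 0)" "((\<lambda>t. Y t / t) \<longlongrightarrow> Y0) (at 0)" "(Z \<longlongrightarrow> z0) (at 0)"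
      and lf: "\<And>l x y. l < m \<Longrightarrow> part f i l x y = 0" for f i X Y Z X0 Y0 z0
  proof -
    have "((\<lambda>t. \<Sum>l\<le>k. (if l < m then 0 else t ^ (l - m) * part f i l (X t / t) (Y t / t) * Z t ^ (k - l)))
        \<longlongrightarrow> (\<Sum>l\<le>k. if l < m then 0 else 0 ^ (l - m) * part f i l X0 Y0 * z0 ^ (k - l))) (at 0)"
    proof (rule tendsto_sum)
      fix l
      show "((\<lambda>t. if l < m then 0 else t ^ (l - m) * part f i l (X t / t) (Y t / t) * Z t ^ (k - l))
          \<longlongrightarrow> (if l < m then 0 else 0 ^ (l - m) * part f i l X0 Y0 * z0 ^ (k - l))) (at 0)"
        by (cases "l < m") (auto intro!: tendsto_mult tendsto_power part_tendsto XYZ tendsto_ident_at)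
    qed
    moreover have "(\<Sum>l\<le>k. if l < m then 0 else 0 ^ (l - m) * part f i l X0 Y0 * z0 ^ (k - l))
        = (\<Sum>l\<le>k. if l = m then part f i l X0 Y0 * z0 ^ (k - l) else 0)"
      by (intro sum.cong refl) (auto simp: power_0_left)
    then have "(\<Sum>l\<le>k. if l < m then 0 else 0 ^ (l - m) * part f i l X0 Y0 * z0 ^ (k - l)) = part f i m X0 Y0 * z0 ^ (k - m)"
      using m by simp
    moreover have "\<forall>\<^sub>F t in at 0. (\<Sum>l\<le>k. (if l < m then 0 else t ^ (l - m) * part f i l (X t / t) (Y t / t) * Z t ^ (k - l)))
       = (\<Sum>l\<le>k. part f i l (X t) (Y t) * Z t ^ (k - l)) / t ^ m"
      unfolding eventually_at
    proof (intro exI[of _ 1] conjI ballI impI)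
      fix t :: complex assume "t \<noteq> 0 \<and> dist t 0 < 1"
      then have t: "t \<noteq> 0" by simp
      show "(\<Sum>l\<le>k. (if l < m then 0 else t ^ (l - m) * part f i l (X t / t) (Y t / t) * Z t ^ (k - l)))
       = (\<Sum>l\<le>k. part f i l (X t) (Y t) * Z t ^ (k - l)) / t ^ m"
        unfolding sum_divide_distrib
      proof (intro sum.cong refl)
        fix l
        have "part f i l (X t) (Y t) = t ^ l * part f i l (X t / t) (Y t / t)"
          using part_scale[of f i l t "X t / t" "Y t / t"] t by simp
        moreover have "t ^ l = t ^ (l - m) * t ^ m" if "\<not> l < m" using that by (simp add: power_add[symmetric])
        ultimately show "(if l < m then 0 else t ^ (l - m) * part f i l (X t / t) (Y t / t) * Z t ^ (k - l))
           = part f i l (X t) (Y t) * Z t ^ (k - l) / t ^ m"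
          using t lf[of l] by (cases "l < m") auto
      qed
    qed simp
    ultimately show ?thesis using Lim_transform_eventually by force
  qed
  have A: "((\<lambda>t. lincomb k a (g t) $ i / t ^ m) \<longlongrightarrow> part a i m x y * c ^ (k - m)) (at 0)" if "i \<in> {1, 2}" for i
    unfolding lincomb_parts
    by (rule low_lim[OF q1 q2]) (use gt[of 3] low that in \<open>auto simp: g0\<close>)
  \<comment> \<open>The Euler condition expresses the third coefficient by the first two with
    factors \<open>g t $ 1\<close> and \<open>g t $ 2\<close>, which tend to 0; so it does not
    contribute in order \<open>m\<close>.\<close>
  have A3: "((\<lambda>t. lincomb k a (g t) $ 3 / t ^ m) \<longlongrightarrow> 0) (at 0)"
  proof -
    have g1: "((\<lambda>t. g t $ 1) \<longlongrightarrow> 0) (at 0)" "((\<lambda>t. g t $ 2) \<longlongrightarrow> 0) (at 0)" "((\<lambda>t. g t $ 3) \<longlongrightarrow> c) (at 0)"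
      using gt[of 1] gt[of 2] gt[of 3] by (simp_all add: g0)
    have "((\<lambda>t. - (g t $ 1 * (lincomb k a (g t) $ 1 / t ^ m) + g t $ 2 * (lincomb k a (g t) $ 2 / t ^ m)) / g t $ 3)
       \<longlongrightarrow> - (0 * (part a 1 m x y * c ^ (k - m)) + 0 * (part a 2 m x y * c ^ (k - m))) / c) (at 0)"
      by (intro tendsto_divide tendsto_minus tendsto_add tendsto_mult g1 A fixp(2)) auto
    moreover have "\<forall>\<^sub>F t in at 0. g t $ 3 \<noteq> 0" using g1(3) fixp(2) tendsto_imp_eventually_ne by blast
    then have "\<forall>\<^sub>F t in at 0. - (g t $ 1 * (lincomb k a (g t) $ 1 / t ^ m) + g t $ 2 * (lincomb k a (g t) $ 2 / t ^ m)) / g t $ 3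
       = lincomb k a (g t) $ 3 / t ^ m"
    proof eventually_elim
      case (elim t)
      have "g t $ 3 * lincomb k a (g t) $ 3 = - (g t $ 1 * lincomb k a (g t) $ 1 + g t $ 2 * lincomb k a (g t) $ 2)"
        using euler[of "g t"] unfolding dot3_def by (simp add: add_eq_0_iff2 add.commute)
      then have "lincomb k a (g t) $ 3 = - (g t $ 1 * lincomb k a (g t) $ 1 + g t $ 2 * lincomb k a (g t) $ 2) / g t $ 3"
        using elim by (simp add: field_simps)
      show ?case unfolding \<open>lincomb k a (g t) $ 3 = _\<close>
        by (simp add: divide_inverse algebra_simps)
    qed
    ultimately show ?thesis using Lim_transform_eventually by force
  qed
  have D: "((\<lambda>t. pd j (\<lambda>x. G x $ i) (e + t *s v)) \<longlongrightarrow> (if i = j then 1 else 0)) (at 0)" for i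
    using polyfun3_line_tendsto[OF polyfun3_pd[OF G], of j i e v] by (simp add: e_def DG)
  have "((\<lambda>t. \<Sum>i\<in>UNIV. lincomb k a (g t) $ i / t ^ m * pd j (\<lambda>x. G x $ i) (e + t *s v))
     \<longlongrightarrow> (\<Sum>i\<in>UNIV. (if i = 3 then 0 else part a i m x y * c ^ (k - m)) * (if i = j then 1 else 0))) (at 0)"
  proof (intro tendsto_sum tendsto_mult D)
    fix i :: 3
    show "((\<lambda>t. lincomb k a (g t) $ i / t ^ m) \<longlongrightarrow> (if i = 3 then 0 else part a i m x y * c ^ (k - m))) (at 0)"
      using A[of i] A3 exhaust_3[of i] by auto
  qed
  moreover have "(\<Sum>i\<in>UNIV. (if i = 3 then 0 else part a i m x y * c ^ (k - m)) * (if i = j then 1 else 0)) = part a j m x y * c ^ (k - m)"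
    using j by (auto simp: sum_3)
  moreover have "(\<Sum>i\<in>UNIV. lincomb k a (g t) $ i / t ^ m * pd j (\<lambda>x. G x $ i) (e + t *s v)) = \<psi> (e + t *s v) * (lincomb k b (e + t *s v) $ j / t ^ m)" for t
  proof -
    have "(\<Sum>i\<in>UNIV. lincomb k a (g t) $ i / t ^ m * pd j (\<lambda>x. G x $ i) (e + t *s v)) = pullback G (lincomb k a) (e + t *s v) $ j / t ^ m"
      by (simp add: pullback_def g_def sum_divide_distrib)
    then show ?thesis unfolding eq by simp
  qed
  ultimately have lim1: "((\<lambda>t. \<psi> (e + t *s v) * (lincomb k b (e + t *s v) $ j / t ^ m)) \<longlongrightarrow> part a j m x y * c ^ (k - m)) (at 0)"
    by simp
  have cst: "((\<lambda>t::complex. (t * z) / t) \<longlongrightarrow> z) (at 0)" for z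
    by (rule Lim_transform_eventually[OF tendsto_const]) (auto simp: eventually_at intro!: exI[of _ 1])
  have "((\<lambda>t. lincomb k b (e + t *s v) $ j / t ^ m) \<longlongrightarrow> part b j m x y * 1 ^ (k - m)) (at 0)"
    unfolding lincomb_parts
    by (rule low_lim) (use cst[of x] cst[of y] low j in \<open>auto simp: e v\<close>)
  then have "((\<lambda>t. \<psi> (e + t *s v) * (lincomb k b (e + t *s v) $ j / t ^ m)) \<longlongrightarrow> \<psi> e * (part b j m x y * 1 ^ (k - m))) (at 0)"
    by (intro tendsto_mult polyfun3_line_tendsto[OF \<psi>])
  from tendsto_unique[OF _ this lim1] show ?thesis by (simp add: e_def mult.commute)
qed

lemma pullback_scale: "pullback F (\<lambda>x. c *s w x) x = c *s pullback F w x"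
  by (simp add: vec_eq_iff pullback_def sum_distrib_left algebra_simps)

text \<open>In the chart \<open>x $ 3 = 1\<close> this is \<open>t\<close> times the Jordan block
  \<open>(x, y) \<mapsto> (x + y, y)\<close>, which contracts to \<open>axis 3 1\<close> as
  \<open>t\<close> tends to 0.\<close>

definition shear :: "complex \<Rightarrow> complex^3^3" where
  "shear t = vector [vector [t, t, 0], vector [0, t, 0], vector [0, 0, 1]]"

lemma shear_mult:
  "(shear t *v x) $ 1 = t * (x $ 1 + x $ 2)" "(shear t *v x) $ 2 = t * x $ 2" "(shear t *v x) $ 3 = x $ 3"
  by (simp_all add: shear_def matrix_vector_dot3 dot3_def algebra_simps)

lemma pullback_shear:
  "pullback ((*v) (shear t)) w x $ 1 = t * w (shear t *v x) $ 1"
  "pullback ((*v) (shear t)) w x $ 2 = t * (w (shear t *v x) $ 1 + w (shear t *v x) $ 2)"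
  "pullback ((*v) (shear t)) w x $ 3 = w (shear t *v x) $ 3"
  unfolding pullback_matrix by (simp_all add: shear_def vector_matrix_mult_def sum_3 algebra_simps)

lemma shear_surj:
  assumes "t \<noteq> 0" shows "\<exists>y. shear t *v y = x"
  by (rule exI[of _ "vector [x $ 1 / t - x $ 2 / t, x $ 2 / t, x $ 3]"])
    (use assms in \<open>simp add: vec3_eq_iff shear_mult field_simps\<close>)

lemma det_shear: "det (shear t) = t ^ 2"
  by (simp add: det3_dot3 shear_def dot3_def power2_eq_square)

lemma sum_power_diff_eq_0:
  fixes c :: "nat \<Rightarrow> complex"
  assumes "\<And>z. (\<Sum>l\<le>k. c l * z ^ (k - l)) = 0" "l \<le> k"
  shows "c l = 0"
proof -
  have "(\<Sum>i\<le>k. c (k - i) * z ^ i) = (\<Sum>l\<le>k. c l * z ^ (k - l))" for z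
    by (rule sum.reindex_bij_witness[where i="\<lambda>l. k - l" and j="\<lambda>l. k - l"]) auto
  then have "c (k - (k - l)) = 0"
    by (intro poly_sum_power_eq_0[where a="\<lambda>i. c (k - i)" and N=k]) (use assms in auto)
  then show ?thesis using assms(2) by simp
qed

text \<open>The eigenform \<open>w\<close> of the sheared map is split into \<open>a\<close>, its
  pull-back by the shear, and \<open>b = c w\<close>, whereupon the equation for \<open>G\<close> no
  longer involves \<open>t\<close>. The pair is normalized jointly, since either member alone may
  degenerate in the limit; the ratio \<open>s = 1 / c\<close> stays uncontrolled.\<close>

lemma normalized_solution:
  assumes G: "\<And>i. polyfun3 (\<lambda>x. G x $ i)" and jac: "\<exists>x. jac G x \<noteq> 0"
    and dom: "\<And>h x. polyfun3 h \<Longrightarrow> (\<And>x. h (G x) = 0) \<Longrightarrow> h x = 0"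
    and t: "t \<noteq> 0"
    and w: "hmap k w" "\<exists>x. w x \<noteq> 0" "\<And>x. dot3 x (w x) = 0"
      "\<And>x. pullback (\<lambda>x. shear t *v G x) w x = (c * \<psi> x) *s w x"
  shows "\<exists>a b s. (\<Sum>i\<in>tri k \<times> UNIV. norm (a i) + norm (b i)) = 1 \<and>
     (\<forall>x. pullback G (lincomb k a) x = \<psi> x *s lincomb k b x) \<and> (\<forall>x. dot3 x (lincomb k a x) = 0) \<and>
     (\<forall>x. lincomb k a x = s *s pullback ((*v) (shear t)) (lincomb k b) x)"
proof -
  let ?S = "shear t"
  have SG: "polyfun3 (\<lambda>x. (?S *v G x) $ i)" for i
    unfolding matrix_vector_dot3 by (rule dot3_polyfun3[OF G])
  \<comment> \<open>For \<open>c = 0\<close> the pull-back vanishes, hence so does \<open>w\<close>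
    on the image of the sheared map, and \<open>dom\<close> forces \<open>w = 0\<close>.\<close>
  have c0: "c \<noteq> 0"
  proof
    assume "c = 0"
    have "w (?S *v G x) = 0" for x
    proof (rule pullback_nonzero[of "\<lambda>x. ?S *v G x"])
      show "\<exists>x. jac (\<lambda>x. ?S *v G x) x \<noteq> 0" using jac t unfolding jac_matrix[OF G] det_shear by simp
      show "pullback (\<lambda>x. ?S *v G x) w x = 0" for x unfolding w(4) \<open>c = 0\<close> by simp
    qed (use SG hmap_polyfun3[OF w(1)] in auto)
    then have "w (?S *v y) $ i = 0" for y i
      using dom[of "\<lambda>y. w (?S *v y) $ i"] polyfun3_compose[OF hmap_polyfun3[OF w(1)] polyfun3_matrix] by simp
    then show False using w(2) shear_surj[OF t] by (metis vec_eq_iff zero_index)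
  qed
  define v where "v = pullback ((*v) ?S) w"
  define h where "h x = c *s w x" for x
  have hv: "hmap k v" unfolding v_def by (rule hmap_pullback_matrix[OF w(1)])
  have hh: "hmap k h" using hpoly3_scale[OF hmap_hpoly3[OF w(1)]] by (simp add: hmap_def h_def)
  have 1: "pullback G v x = \<psi> x *s h x" for x
    unfolding v_def pullback_compose[OF polyfun3_matrix G, symmetric] w(4) h_def by (simp add: mult.commute)
  have 2: "dot3 x (v x) = 0" for x unfolding v_def dot3_pullback_matrix by (rule w(3))
  have 3: "v x = (1 / c) *s pullback ((*v) ?S) h x" for x
    unfolding h_def[abs_def] pullback_scale v_def using c0 by simp
  obtain a b where ab: "v = lincomb k a" "h = lincomb k b"
    using hmap_lincomb_exists[OF hv] hmap_lincomb_exists[OF hh] by blast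
  define N where "N = (\<Sum>i\<in>tri k \<times> UNIV. norm (a i) + norm (b i))"
  have "N \<noteq> 0"
  proof
    assume "N = 0"
    then have "\<forall>i\<in>tri k \<times> UNIV. norm (a i) + norm (b i) = 0"
      unfolding N_def by (subst (asm) sum_nonneg_eq_0_iff) (auto simp: finite_tri)
    then have "\<forall>i\<in>tri k \<times> UNIV. b i = 0" by (metis add_nonneg_eq_0_iff norm_eq_zero norm_ge_zero)
    then have "h x = 0" for x unfolding ab(2) lincomb_def by (intro sum.neutral) auto
    then show False using w(2) c0 by (simp add: h_def)
  qed
  moreover have "N \<ge> 0" unfolding N_def by (intro sum_nonneg) auto
  ultimately have N: "N > 0" by simp
  define r where "r = complex_of_real (1 / N)"
  have nr: "norm r = 1 / N" using N by (simp add: r_def norm_divide)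
  show ?thesis
  proof (intro exI conjI allI)
    show "(\<Sum>i\<in>tri k \<times> UNIV. norm (r * a i) + norm (r * b i)) = 1"
    proof -
      have "(\<Sum>i\<in>tri k \<times> UNIV. norm (r * a i) + norm (r * b i)) = 1 / N * N"
        unfolding N_def sum_distrib_left by (intro sum.cong refl) (simp add: norm_mult nr N_def[symmetric] distrib_left add_divide_distrib)
      then show ?thesis using N by simp
    qed
    show "pullback G (lincomb k (\<lambda>i. r * a i)) x = \<psi> x *s lincomb k (\<lambda>i. r * b i) x" for x
      unfolding lincomb_linear(1)[abs_def] pullback_scale ab[symmetric] 1 by (simp add: mult.commute)
    show "dot3 x (lincomb k (\<lambda>i. r * a i) x) = 0" for x
      unfolding lincomb_linear(1)[abs_def] ab[symmetric] by (simp add: dot3_linear 2)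
    show "lincomb k (\<lambda>i. r * a i) x = (1 / c) *s pullback ((*v) ?S) (lincomb k (\<lambda>i. r * b i)) x" for x
      unfolding lincomb_linear(1)[abs_def] pullback_scale ab[symmetric] 3 by (simp add: mult.commute)
  qed
qed

text \<open>The part of degree \<open>l\<close> acquires \<open>t ^ l\<close> from the substitution
  and one more \<open>t\<close> from the differentials of the first two variables; comparing powers
  of the third coordinate separates the degrees.\<close>

lemma part_shear:
  assumes "\<And>x. lincomb k a x = s *s pullback ((*v) (shear t)) (lincomb k b) x" "l \<le> k"
  shows "part a 1 l x y = s * t ^ Suc l * part b 1 l (x + y) y"
    and "part a 2 l x y = s * t ^ Suc l * (part b 1 l (x + y) y + part b 2 l (x + y) y)"
proof -
  have e: "part b j l (t * (x + y)) (t * y) = t ^ l * part b j l (x + y) y" for j l by (rule part_scale)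
  have "part a 1 l x y - s * t ^ Suc l * part b 1 l (x + y) y = 0"
  proof (rule sum_power_diff_eq_0[where k=k, OF _ assms(2)])
    fix z
    have "lincomb k a (vector [x, y, z]) $ 1 = s * (t * lincomb k b (shear t *v vector [x, y, z]) $ 1)"
      unfolding assms(1) by (simp add: pullback_shear)
    then show "(\<Sum>l\<le>k. (part a 1 l x y - s * t ^ Suc l * part b 1 l (x + y) y) * z ^ (k - l)) = 0"
      unfolding lincomb_parts shear_mult vector_3 e
      by (simp add: left_diff_distrib sum_subtractf sum_distrib_left mult.assoc)
  qed
  then show "part a 1 l x y = s * t ^ Suc l * part b 1 l (x + y) y" by simp
  have "part a 2 l x y - s * t ^ Suc l * (part b 1 l (x + y) y + part b 2 l (x + y) y) = 0"
  proof (rule sum_power_diff_eq_0[where k=k, OF _ assms(2)])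
    fix z
    have "lincomb k a (vector [x, y, z]) $ 2
        = s * (t * (lincomb k b (shear t *v vector [x, y, z]) $ 1 + lincomb k b (shear t *v vector [x, y, z]) $ 2))"
      unfolding assms(1) by (simp add: pullback_shear)
    then show "(\<Sum>l\<le>k. (part a 2 l x y - s * t ^ Suc l * (part b 1 l (x + y) y + part b 2 l (x + y) y)) * z ^ (k - l)) = 0"
      unfolding lincomb_parts shear_mult vector_3 e
      by (simp add: left_diff_distrib distrib_left distrib_right sum_subtractf sum.distrib sum_distrib_left mult.assoc)
  qed
  then show "part a 2 l x y = s * t ^ Suc l * (part b 1 l (x + y) y + part b 2 l (x + y) y)" by simp
qed

text \<open>Compactness gives a limit pair \<open>(a, b)\<close> as \<open>t\<close> tends to 0. In
  the lowest order \<open>m\<close>, the equation for \<open>G\<close> makes \<open>b\<close>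
  proportional to \<open>a\<close>, and the shear makes \<open>a\<close> an eigenform of the Jordan
  block; parts of higher order are suppressed by powers of \<open>t\<close>. Up to monomial factors
  the limit is \<open>A\<close> times the pencil at \<open>axis 3 1\<close> plus \<open>B\<close>
  times the pencil at \<open>axis 1 1\<close>. The factors \<open>x $ 2\<close> and
  \<open>x $ 3\<close> in the conclusion avoid negative exponents.\<close>

lemma degenerate_invariant_form:
  assumes G: "\<And>i. polyfun3 (\<lambda>x. G x $ i)" and \<psi>: "polyfun3 \<psi>" "\<psi> (axis 3 1) \<noteq> 0"
    and dom: "\<And>h x. polyfun3 h \<Longrightarrow> (\<And>x. h (G x) = 0) \<Longrightarrow> h x = 0"
    and fixp: "G (axis 3 1) = c *s axis 3 1" "c \<noteq> 0"
    and DG: "\<And>i j. pd j (\<lambda>x. G x $ i) (axis 3 1) = (if i = j then 1 else 0)"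
    and bad: "\<And>t. t \<noteq> 0 \<Longrightarrow> \<exists>w c. hmap k w \<and> (\<exists>x. w x \<noteq> 0) \<and> (\<forall>x. dot3 x (w x) = 0) \<and>
       (\<forall>x. pullback (\<lambda>x. shear t *v G x) w x = (c * \<psi> x) *s w x)"
  shows "\<exists>A0 B0 m A B. hmap k A0 \<and> hmap k B0 \<and> (\<forall>x. pullback G A0 x = \<psi> x *s B0 x) \<and> m \<le> k \<and>
     (A, B) \<noteq> (0, 0) \<and> (\<forall>x. A0 x $ 1 = A * (x $ 2) ^ m * (x $ 3) ^ (k - m) \<and>
       x $ 2 * A0 x $ 2 = (B * x $ 2 - A * x $ 1) * (x $ 2) ^ m * (x $ 3) ^ (k - m) \<and>
       x $ 3 * A0 x $ 3 = - B * (x $ 2) ^ Suc m * (x $ 3) ^ (k - m))"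
proof -
  define I where "I = tri k \<times> (UNIV :: 3 set)"
  have finI: "finite I" by (simp add: I_def finite_tri)
  have "jac G (axis 3 1) = 1" by (simp add: jac_def dot3_def DG)
  then have jac: "\<exists>x. jac G x \<noteq> 0" by (metis zero_neq_one)
  define t :: "nat \<Rightarrow> complex" where "t n = 1 / of_nat (Suc n)" for n
  have t0: "t n \<noteq> 0" for n by (simp add: t_def del: of_nat_Suc)
  have tlim: "t \<longlonglongrightarrow> 0" unfolding t_def by (rule LIMSEQ_Suc[OF lim_1_over_n])
  have "\<forall>n. \<exists>a b s. (\<Sum>i\<in>I. norm (a i) + norm (b i)) = 1 \<and>
     (\<forall>x. pullback G (lincomb k a) x = \<psi> x *s lincomb k b x) \<and> (\<forall>x. dot3 x (lincomb k a x) = 0) \<and>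
     (\<forall>x. lincomb k a x = s *s pullback ((*v) (shear (t n))) (lincomb k b) x)"
  proof
    fix n
    obtain w c where w: "hmap k w" "\<exists>x. w x \<noteq> 0" "\<And>x. dot3 x (w x) = 0"
      "\<And>x. pullback (\<lambda>x. shear (t n) *v G x) w x = (c * \<psi> x) *s w x" using bad[OF t0] by blast
    show "\<exists>a b s. (\<Sum>i\<in>I. norm (a i) + norm (b i)) = 1 \<and>
     (\<forall>x. pullback G (lincomb k a) x = \<psi> x *s lincomb k b x) \<and> (\<forall>x. dot3 x (lincomb k a x) = 0) \<and>
     (\<forall>x. lincomb k a x = s *s pullback ((*v) (shear (t n))) (lincomb k b) x)"
      unfolding I_def
      by (rule normalized_solution[where G=G and w=w and c=c], rule G, rule jac, erule dom, assumption,
          rule t0, rule w(1), rule w(2), rule w(3), rule w(4))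
  qed
  from choice[OF this] obtain a0 where "\<forall>n. \<exists>b s. (\<Sum>i\<in>I. norm (a0 n i) + norm (b i)) = 1 \<and>
     (\<forall>x. pullback G (lincomb k (a0 n)) x = \<psi> x *s lincomb k b x) \<and> (\<forall>x. dot3 x (lincomb k (a0 n) x) = 0) \<and>
     (\<forall>x. lincomb k (a0 n) x = s *s pullback ((*v) (shear (t n))) (lincomb k b) x)" by blast
  from choice[OF this] obtain b0 where "\<forall>n. \<exists>s. (\<Sum>i\<in>I. norm (a0 n i) + norm (b0 n i)) = 1 \<and>
     (\<forall>x. pullback G (lincomb k (a0 n)) x = \<psi> x *s lincomb k (b0 n) x) \<and> (\<forall>x. dot3 x (lincomb k (a0 n) x) = 0) \<and>
     (\<forall>x. lincomb k (a0 n) x = s *s pullback ((*v) (shear (t n))) (lincomb k (b0 n)) x)" by blast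
  from choice[OF this] obtain s0 where ab0: "\<And>n. (\<Sum>i\<in>I. norm (a0 n i) + norm (b0 n i)) = 1"
     "\<And>n x. pullback G (lincomb k (a0 n)) x = \<psi> x *s lincomb k (b0 n) x" "\<And>n x. dot3 x (lincomb k (a0 n) x) = 0"
     "\<And>n x. lincomb k (a0 n) x = s0 n *s pullback ((*v) (shear (t n))) (lincomb k (b0 n)) x" by blast
  define f where "f n i = (if snd i then a0 n (fst i) else b0 n (fst i))" for n and i :: "((nat \<times> nat) \<times> 3) \<times> bool"
  have "\<exists>r l. strict_mono r \<and> (\<forall>i\<in>I \<times> UNIV. (\<lambda>n. f (r n) i) \<longlonglongrightarrow> l i)"
  proof (rule finite_family_subsequence)
    fix n and i assume i: "i \<in> I \<times> (UNIV :: bool set)"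
    have "norm (a0 n (fst i)) + norm (b0 n (fst i)) \<le> (\<Sum>i\<in>I. norm (a0 n i) + norm (b0 n i))"
      by (rule member_le_sum) (use i finI in auto)
    then have "norm (a0 n (fst i)) + norm (b0 n (fst i)) \<le> 1" by (simp add: ab0(1))
    moreover have "norm (a0 n (fst i)) \<ge> 0" "norm (b0 n (fst i)) \<ge> 0" by simp_all
    ultimately have "norm (a0 n (fst i)) \<le> 1" "norm (b0 n (fst i)) \<le> 1" by linarith+
    then show "norm (f n i) \<le> 1" by (simp add: f_def)
  qed (simp add: finI)
  then obtain r l where r: "strict_mono r" "\<And>i. i \<in> I \<times> UNIV \<Longrightarrow> (\<lambda>n. f (r n) i) \<longlonglongrightarrow> l i" by blast
  define a where "a i = l (i, True)" for i
  define b where "b i = l (i, False)" for i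
  have al: "(\<lambda>n. a0 (r n) i) \<longlonglongrightarrow> a i" and bl: "(\<lambda>n. b0 (r n) i) \<longlonglongrightarrow> b i" if "i \<in> I" for i
    using r(2)[of "(i, True)"] r(2)[of "(i, False)"] that by (simp_all add: f_def a_def b_def)
  have trl: "(\<lambda>n. t (r n)) \<longlonglongrightarrow> 0" using LIMSEQ_subseq_LIMSEQ[OF tlim r(1)] by (simp add: o_def)
  have "(\<lambda>n. \<Sum>i\<in>I. norm (a0 (r n) i) + norm (b0 (r n) i)) \<longlonglongrightarrow> (\<Sum>i\<in>I. norm (a i) + norm (b i))"
    by (intro tendsto_sum tendsto_add tendsto_norm al bl)
  then have sum1: "(\<Sum>i\<in>I. norm (a i) + norm (b i)) = 1"
    unfolding ab0(1) using LIMSEQ_unique tendsto_const by blast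
  have lca: "(\<lambda>n. lincomb k (a0 (r n)) x $ j) \<longlonglongrightarrow> lincomb k a x $ j"
    and lcb: "(\<lambda>n. lincomb k (b0 (r n)) x $ j) \<longlonglongrightarrow> lincomb k b x $ j" for x j
    unfolding lincomb_nth by (intro tendsto_sum tendsto_mult tendsto_const al bl; simp add: I_def)+
  have eq: "pullback G (lincomb k a) x = \<psi> x *s lincomb k b x" for x
  proof -
    have "pullback G (lincomb k a) x $ j = (\<psi> x *s lincomb k b x) $ j" for j
    proof -
      have "(\<lambda>n. pullback G (lincomb k (a0 (r n))) x $ j) \<longlonglongrightarrow> pullback G (lincomb k a) x $ j"
        unfolding pullback_def by (simp, intro tendsto_sum tendsto_mult tendsto_const lca)
      moreover have "(\<lambda>n. pullback G (lincomb k (a0 (r n))) x $ j) \<longlonglongrightarrow> (\<psi> x *s lincomb k b x) $ j"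
        unfolding ab0(2) by (simp, intro tendsto_mult tendsto_const lcb)
      ultimately show ?thesis using LIMSEQ_unique by blast
    qed
    then show ?thesis by (simp add: vec_eq_iff)
  qed
  have euler: "dot3 x (lincomb k a x) = 0" for x
  proof -
    have "(\<lambda>n. dot3 x (lincomb k (a0 (r n)) x)) \<longlonglongrightarrow> dot3 x (lincomb k a x)"
      unfolding dot3_def by (intro tendsto_add tendsto_mult tendsto_const lca)
    then show ?thesis unfolding ab0(3) using LIMSEQ_unique tendsto_const by blast
  qed
  \<comment> \<open>If \<open>a\<close> vanished, the equation would give \<open>b = 0\<close> too,
    against the joint normalization.\<close>
  have a_nz: "\<exists>x. lincomb k a x \<noteq> 0"
  proof (rule ccontr)
    assume "\<not> ?thesis"
    then have az: "\<And>x. lincomb k a x = 0" by blast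
    then have "\<psi> x *s lincomb k b x = 0" for x using eq[of x] by (simp add: pullback_def vec_eq_iff)
    then have "\<psi> x * lincomb k b x $ j = 0" for x j by (metis vector_smult_component zero_index)
    then have "lincomb k b x $ j = 0" for x j
      using polyfun3_zero_off[OF hmap_polyfun3[OF hmap_lincomb] \<psi>(1)] \<psi>(2) by (metis mult_eq_0_iff)
    then have "lincomb k b x = 0" for x by (simp add: vec_eq_iff)
    then have "\<forall>i\<in>I. a i = 0 \<and> b i = 0" using az lincomb_independent unfolding I_def by blast
    then show False using sum1 by simp
  qed
  have pt: "part (a0 n) 1 l x y = s0 n * t n ^ Suc l * part (b0 n) 1 l (x + y) y"
    "part (a0 n) 2 l x y = s0 n * t n ^ Suc l * (part (b0 n) 1 l (x + y) y + part (b0 n) 2 l (x + y) y)" if "l \<le> k" for n l x y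
    using part_shear[OF ab0(4) that] by blast+
  have pal: "(\<lambda>n. part (a0 (r n)) j l x y) \<longlonglongrightarrow> part a j l x y"
    and pbl: "(\<lambda>n. part (b0 (r n)) j l x y) \<longlonglongrightarrow> part b j l x y" if "l \<le> k" for j l x y
    by (rule part_tendsto[OF _ tendsto_const tendsto_const]; use al bl that in \<open>simp add: I_def tri_def\<close>)+
  define nz where "nz l \<longleftrightarrow> (\<exists>j\<in>{1, 2}. \<exists>x y. part a j l x y \<noteq> 0 \<or> part b j l x y \<noteq> 0)" for l
  have "\<exists>l\<le>k. nz l"
  proof (rule ccontr)
    assume "\<not> ?thesis"
    then have z: "part a j l x y = 0" if "l \<le> k" "j \<in> {1, 2}" for j l x y using that unfolding nz_def by blast
    have a12: "lincomb k a x $ 1 = 0" "lincomb k a x $ 2 = 0" for x unfolding lincomb_parts by (simp_all add: z)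
    then have "x $ 3 * lincomb k a x $ 3 = 0" for x using euler[of x] by (simp add: dot3_def)
    moreover have "\<exists>x :: complex^3. x $ 3 \<noteq> 0" by (rule exI[of _ "vector [0, 0, 1]"]) simp
    ultimately have "lincomb k a x $ 3 = 0" for x
      using polyfun3_zero_off[OF hmap_polyfun3[OF hmap_lincomb] polyfun3_coord] by (metis mult_eq_0_iff)
    then show False using a_nz a12 by (simp add: vec3_eq_iff)
  qed
  then obtain l0 where l0: "l0 \<le> k" "nz l0" by blast
  define m where "m = (LEAST l. nz l)"
  have m: "nz m" "m \<le> k" unfolding m_def using LeastI[of nz, OF l0(2)] Least_le[of nz, OF l0(2)] l0(1) by auto
  have low: "part a j l x y = 0 \<and> part b j l x y = 0" if "l < m" "j \<in> {1, 2}" for l j x y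
    using not_less_Least[of l nz] that unfolding m_def nz_def by blast
  define \<kappa> where "\<kappa> = c ^ (k - m) / \<psi> (axis 3 1)"
  have \<kappa>: "\<kappa> \<noteq> 0" using fixp(2) \<psi>(2) by (simp add: \<kappa>_def)
  have jet: "part b j m x y = \<kappa> * part a j m x y" if "j \<in> {1, 2}" for j x y
    using lowest_jet[OF G \<psi>(1) fixp DG eq euler low m(2) that, of x y] \<psi>(2) by (simp add: \<kappa>_def field_simps)
  have anz: "\<exists>j\<in>{1, 2}. \<exists>x y. part a j m x y \<noteq> 0" and bnz: "\<exists>j\<in>{1, 2}. \<exists>x y. part b j m x y \<noteq> 0"
    using m(1) jet \<kappa> unfolding nz_def by auto
  \<comment> \<open>\<open>U b\<close> is the pull-back of the parts of \<open>b\<close> under the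
    Jordan block alone, the powers of \<open>t\<close> having been split off.\<close>
  define U where "U b j l x y = (if j = 1 then part b 1 l (x + y) y else part b 1 l (x + y) y + part b 2 l (x + y) y)"
    for b :: "(nat \<times> nat) \<times> 3 \<Rightarrow> complex" and j :: 3 and l x y
  have Ul: "(\<lambda>n. U (b0 (r n)) j l x y) \<longlonglongrightarrow> U b j l x y" if "l \<le> k" for j l x y
    unfolding U_def by (cases "j = 1") (auto intro!: tendsto_add pbl that)
  have pU: "part (a0 n) j l x y = s0 n * t n ^ Suc l * U (b0 n) j l x y" if "l \<le> k" "j \<in> {1, 2}" for n j l x y
    using pt[OF that(1)] that(2) by (auto simp: U_def)
  have "\<exists>j\<in>{1, 2}. \<exists>x y. U b j m x y \<noteq> 0"
  proof (cases "\<exists>x y. part b 1 m x y \<noteq> 0")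
    case True
    then obtain x y where "part b 1 m x y \<noteq> 0" by blast
    then have "U b 1 m (x - y) y \<noteq> 0" by (simp add: U_def)
    then show ?thesis by blast
  next
    case False
    then obtain x y where "part b 2 m x y \<noteq> 0" using bnz by auto
    then have "U b 2 m (x - y) y \<noteq> 0" using False by (simp add: U_def)
    then show ?thesis by blast
  qed
  then obtain j1 x1 y1 where U1: "j1 \<in> {1, 2}" "U b j1 m x1 y1 \<noteq> 0" by blast
  define \<sigma> where "\<sigma> = part a j1 m x1 y1 / U b j1 m x1 y1"
  define \<sigma>n where "\<sigma>n n = s0 (r n) * t (r n) ^ Suc m" for n
  \<comment> \<open>The scalars \<open>s0\<close> themselves may diverge. Their product with
    \<open>t ^ Suc m\<close> is a quotient of two convergent sequences, the denominator having a
    nonzero limit.\<close>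
  have \<sigma>lim: "\<sigma>n \<longlonglongrightarrow> \<sigma>"
  proof -
    have "(\<lambda>n. part (a0 (r n)) j1 m x1 y1 / U (b0 (r n)) j1 m x1 y1) \<longlonglongrightarrow> \<sigma>"
      unfolding \<sigma>_def by (intro tendsto_divide pal Ul m(2) U1(2))
    moreover have "\<forall>\<^sub>F n in sequentially. U (b0 (r n)) j1 m x1 y1 \<noteq> 0"
      by (rule tendsto_imp_eventually_ne[OF Ul[OF m(2)] U1(2)])
    then have "\<forall>\<^sub>F n in sequentially. part (a0 (r n)) j1 m x1 y1 / U (b0 (r n)) j1 m x1 y1 = \<sigma>n n"
      by eventually_elim (simp add: pU[OF m(2) U1(1)] \<sigma>n_def)
    ultimately show ?thesis by (rule Lim_transform_eventually)
  qed
  have aU: "part a j m x y = \<sigma> * U b j m x y" if "j \<in> {1, 2}" for j x y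
  proof -
    have "(\<lambda>n. \<sigma>n n * U (b0 (r n)) j m x y) \<longlonglongrightarrow> \<sigma> * U b j m x y"
      by (intro tendsto_mult \<sigma>lim Ul m(2))
    then have "(\<lambda>n. part (a0 (r n)) j m x y) \<longlonglongrightarrow> \<sigma> * U b j m x y"
      by (simp add: pU[OF m(2) that] \<sigma>n_def)
    then show ?thesis using pal[OF m(2)] LIMSEQ_unique by blast
  qed
  \<comment> \<open>Below \<open>m\<close> everything vanishes by minimality. For
    \<open>l > m\<close> the scalar is \<open>\<sigma>n\<close> times \<open>t ^ (l - m)\<close>,
    which tends to 0 since \<open>\<sigma>n\<close> converges.\<close>
  have high: "part a j l x y = 0" if "l \<le> k" "l \<noteq> m" "j \<in> {1, 2}" for j l x y
  proof (cases "l < m")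
    case True then show ?thesis using low that by blast
  next
    case False
    then have lm: "m < l" using that by simp
    have "(\<lambda>n. \<sigma>n n * t (r n) ^ (l - m) * U (b0 (r n)) j l x y) \<longlonglongrightarrow> \<sigma> * 0 ^ (l - m) * U b j l x y"
      by (intro tendsto_mult tendsto_power \<sigma>lim trl Ul that)
    moreover have "\<sigma>n n * t (r n) ^ (l - m) * U (b0 (r n)) j l x y = part (a0 (r n)) j l x y" for n
    proof -
      have "t (r n) ^ Suc m * t (r n) ^ (l - m) = t (r n) ^ Suc l" using lm by (simp only: power_add[symmetric]) simp
      then show ?thesis unfolding pU[OF that(1,3)] \<sigma>n_def by (simp only: mult.assoc)
    qed
    ultimately have "(\<lambda>n. part (a0 (r n)) j l x y) \<longlonglongrightarrow> 0" using lm by (simp add: power_0_left)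
    then show ?thesis using pal[OF that(1)] LIMSEQ_unique by blast
  qed
  have UU: "U b j m x y = \<kappa> * U a j m x y" if "j \<in> {1, 2}" for j x y
    using that by (auto simp: U_def jet distrib_left)
  have e1: "part a 1 m x y = (\<sigma> * \<kappa>) * part a 1 m (x + y) y" for x y
    using aU[of 1 x y] UU[of 1 x y] by (simp add: U_def)
  have e2: "part a 2 m x y = (\<sigma> * \<kappa>) * (part a 1 m (x + y) y + part a 2 m (x + y) y)" for x y
    using aU[of 2 x y] UU[of 2 x y] by (simp add: U_def)
  obtain A B where AB: "(A, B) \<noteq> (0, 0)" "\<And>x y. y \<noteq> 0 \<Longrightarrow> part a 1 m x y = A * y ^ m \<and> y * part a 2 m x y = (B * y - A * x) * y ^ m"
    using unipotent_eigenform[OF e1 e2 anz] by blast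
  have lc: "lincomb k a x $ j = part a j m (x $ 1) (x $ 2) * (x $ 3) ^ (k - m)" if "j \<in> {1, 2}" for j x
  proof -
    have "lincomb k a x $ j = (\<Sum>l\<le>k. if l = m then part a j l (x $ 1) (x $ 2) * (x $ 3) ^ (k - l) else 0)"
      unfolding lincomb_parts by (intro sum.cong refl) (use high that in auto)
    then show ?thesis using m(2) by simp
  qed
  have x2: "\<exists>x :: complex^3. x $ 2 \<noteq> 0" by (rule exI[of _ "vector [0, 1, 0]"]) simp
  have pl: "polyfun3 (\<lambda>x. lincomb k a x $ i)" for i by (rule hmap_polyfun3[OF hmap_lincomb])
  have f1: "lincomb k a x $ 1 = A * (x $ 2) ^ m * (x $ 3) ^ (k - m)" for x
  proof -
    have "lincomb k a x $ 1 - A * (x $ 2) ^ m * (x $ 3) ^ (k - m) = 0"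
    proof (rule polyfun3_zero_off[OF _ polyfun3_coord x2, where p="\<lambda>x. lincomb k a x $ 1 - A * (x $ 2) ^ m * (x $ 3) ^ (k - m)"])
      fix x :: "complex^3" assume x: "x $ 2 \<noteq> 0"
      show "lincomb k a x $ 1 - A * (x $ 2) ^ m * (x $ 3) ^ (k - m) = 0" using AB(2)[OF x] by (simp add: lc)
    qed (intro polyfun3_intros pl)
    then show ?thesis by simp
  qed
  have f2: "x $ 2 * lincomb k a x $ 2 = (B * x $ 2 - A * x $ 1) * (x $ 2) ^ m * (x $ 3) ^ (k - m)" for x
  proof -
    have "x $ 2 * lincomb k a x $ 2 - (B * x $ 2 - A * x $ 1) * (x $ 2) ^ m * (x $ 3) ^ (k - m) = 0"
    proof (rule polyfun3_zero_off[OF _ polyfun3_coord x2,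
          where p="\<lambda>x. x $ 2 * lincomb k a x $ 2 - (B * x $ 2 - A * x $ 1) * (x $ 2) ^ m * (x $ 3) ^ (k - m)"])
      fix x :: "complex^3" assume x: "x $ 2 \<noteq> 0"
      have "x $ 2 * lincomb k a x $ 2 = (x $ 2 * part a 2 m (x $ 1) (x $ 2)) * (x $ 3) ^ (k - m)"
        by (simp add: lc)
      then show "x $ 2 * lincomb k a x $ 2 - (B * x $ 2 - A * x $ 1) * (x $ 2) ^ m * (x $ 3) ^ (k - m) = 0"
        using AB(2)[OF x, of "x $ 1"] by simp
    qed (intro polyfun3_intros pl)
    then show ?thesis by simp
  qed
  have f3: "x $ 3 * lincomb k a x $ 3 = - B * (x $ 2) ^ Suc m * (x $ 3) ^ (k - m)" for x
  proof -
    have "x $ 3 * lincomb k a x $ 3 = - (x $ 1 * lincomb k a x $ 1 + x $ 2 * lincomb k a x $ 2)"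
      using euler[of x] unfolding dot3_def by (simp add: add_eq_0_iff2 add.commute)
    then show ?thesis unfolding f1 f2 by (simp add: algebra_simps)
  qed
  show ?thesis
    using hmap_lincomb[of k a] hmap_lincomb[of k b] eq m(2) AB(1) f1 f2 f3 by blast
qed

lemma euler_gradient:
  assumes "hmap d F"
  shows "(\<chi> i j. pd j (\<lambda>x. F x $ i) q) *v q = of_nat d *s F q"
  using hpoly3_euler[OF hmap_hpoly3[OF assms]]
  by (simp add: vec_eq_iff matrix_vector_mult_def mult.commute)

text \<open>Conjugating \<open>F\<close> so that \<open>q\<close> becomes a fixed point with identity differential and letting the
  parameter of the shear tend to 0.\<close>
lemma frame_divisibility:
  fixes R :: "complex^3^3"
  assumes F: "hmap d F" "d \<ge> 1" "dominant F" and \<phi>: "polyfun3 \<phi>"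
    and q: "jac F q \<noteq> 0" "\<phi> q \<noteq> 0"
    and R: "invertible R" "R *v F q = (1 / of_nat d) *s axis 3 1"
    and bad: "\<And>M. invertible M \<Longrightarrow> bad_matrix F \<phi> k M"
  shows "\<exists>m A B. m \<le> k \<and> (A, B) \<noteq> (0, 0) \<and> (\<forall>j. \<phi> pdvd (\<lambda>x.
     dot3 (R $ 2) (F x) ^ m * dot3 (R $ 3) (F x) ^ (k - m) *
     (A * dot3 (R $ 3) (F x) * (dot3 (R $ 2) (F x) * pd j (\<lambda>x. dot3 (R $ 1) (F x)) x
          - dot3 (R $ 1) (F x) * pd j (\<lambda>x. dot3 (R $ 2) (F x)) x)
      + B * dot3 (R $ 2) (F x) * (dot3 (R $ 3) (F x) * pd j (\<lambda>x. dot3 (R $ 2) (F x)) x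
          - dot3 (R $ 2) (F x) * pd j (\<lambda>x. dot3 (R $ 3) (F x)) x))))"
proof -
  have pF: "polyfun3 (\<lambda>x. F x $ i)" for i by (rule hmap_polyfun3[OF F(1)])
  define D :: "complex^3 \<Rightarrow> complex^3^3" where "D y = (\<chi> i j. pd j (\<lambda>x. F x $ i) y)" for y
  have "det (D q) = jac F q" by (simp add: det3_dot3 D_def jac_def grad_def)
  then have "det (R ** D q) \<noteq> 0" using q R(1) by (simp add: det_mul invertible_det_nz)
  then have "invertible (R ** D q)" by (simp add: invertible_det_nz)
  then obtain P where P: "(R ** D q) ** P = mat 1" "P ** (R ** D q) = mat 1" unfolding invertible_def by blast
  have iP: "invertible P" unfolding invertible_def using P by blast
  \<comment> \<open>\<open>T\<close> is the differential of \<open>R F\<close> at \<open>q\<close>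
    and \<open>P\<close> its inverse, so that \<open>G = R F P\<close> has identity differential at
    \<open>T q\<close>. Euler's relation gives \<open>T q = d R F(q) = axis 3 1\<close>, the origin
    of the factor \<open>1 / d\<close> in the condition on \<open>R\<close>.\<close>
  define T where "T = R ** D q"
  have PT: "P *v (T *v x) = x" "T *v (P *v x) = x" for x by (simp_all add: T_def matrix_vector_mul_assoc P)
  have Tq: "T *v q = axis 3 1"
  proof -
    have "T *v q = R *v (of_nat d *s F q)"
      unfolding T_def matrix_vector_mul_assoc[symmetric] using euler_gradient[OF F(1)] by (simp add: D_def)
    also have "\<dots> = of_nat d *s (R *v F q)" by (rule vector_scalar_commute)
    finally show ?thesis using F(2) by (simp add: R(2))
  qed
  have Pe: "P *v axis 3 1 = q" using PT(1)[of q] by (simp add: Tq)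
  define G where "G x = R *v F (P *v x)" for x
  define \<psi> where "\<psi> x = \<phi> (P *v x)" for x
  have pRF: "polyfun3 (\<lambda>x. (R *v F x) $ i)" for i by (rule hmap_polyfun3[OF hmap_matrix[OF F(1)]])
  have G: "polyfun3 (\<lambda>x. G x $ i)" for i unfolding G_def by (rule polyfun3_compose[OF pRF polyfun3_matrix])
  have p\<psi>: "polyfun3 \<psi>" unfolding \<psi>_def[abs_def] by (rule polyfun3_compose[OF \<phi> polyfun3_matrix])
  have pdlin: "pd j (\<lambda>x. (P *v x) $ i) x = P $ i $ j" for i j x
    using arg_cong[OF grad_dot3[of "\<lambda>x. x" "P $ i" x], of "\<lambda>v. v $ j"] exhaust_3[of j]
    by (auto simp: matrix_vector_dot3 polyfun3_coord pd_coord)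
  have DG: "pd j (\<lambda>x. G x $ i) (axis 3 1) = (if i = j then 1 else 0)" for i j
  proof -
    have RT: "pd l (\<lambda>x. (R *v F x) $ i) q = T $ i $ l" for l
      using arg_cong[OF grad_dot3[of F "R $ i" q, OF pF], of "\<lambda>v. v $ l"]
      by (simp add: T_def D_def matrix_vector_dot3 matrix_matrix_mult_def sum_3)
    have "pd j (\<lambda>x. G x $ i) (axis 3 1) = (\<Sum>l\<in>UNIV. pd l (\<lambda>x. (R *v F x) $ i) q * P $ l $ j)"
      unfolding G_def pd_compose[OF pRF polyfun3_matrix] Pe pdlin ..
    also have "\<dots> = (T ** P) $ i $ j" unfolding RT by (simp add: matrix_matrix_mult_def)
    finally have "pd j (\<lambda>x. G x $ i) (axis 3 1) = (T ** P) $ i $ j" .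
    then show ?thesis unfolding T_def P by (simp add: mat_def)
  qed
  have dom: "h x = 0" if h: "polyfun3 h" "\<And>x. h (G x) = 0" for h x
  proof -
    have "h (R *v F y) = 0" for y using h(2)[of "T *v y"] by (simp add: G_def PT)
    then have "h (R *v y) = 0" for y
      using dominant_polyfun3_nonzero[OF F, of "\<lambda>y. h (R *v y)"] polyfun3_compose[OF h(1) polyfun3_matrix] by blast
    moreover obtain R' where "R ** R' = mat 1" using R(1) unfolding invertible_def by blast
    ultimately show ?thesis by (metis matrix_vector_mul_assoc matrix_vector_mul_lid)
  qed
  have badG: "\<exists>w c. hmap k w \<and> (\<exists>x. w x \<noteq> 0) \<and> (\<forall>x. dot3 x (w x) = 0) \<and>
       (\<forall>x. pullback (\<lambda>x. shear t *v G x) w x = (c * \<psi> x) *s w x)" if t: "t \<noteq> 0" for t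
  proof -
    \<comment> \<open>\<open>P\<close> conjugates the sheared map to \<open>M F\<close>, so
      eigenforms for \<open>M\<close> pull back along \<open>P\<close> to eigenforms of the sheared
      map.\<close>
    define M where "M = P ** shear t ** R"
    have "invertible M" unfolding M_def using iP R(1) t by (simp add: invertible_det_nz det_mul det_shear)
    then obtain w c where w: "hmap k w" "\<exists>x. w x \<noteq> 0" "\<And>x. dot3 x (w x) = 0"
      "\<And>x. pullback (\<lambda>x. M *v F x) w x = (c * \<phi> x) *s w x" using bad unfolding bad_matrix_def by blast
    have MG: "P *v (shear t *v G x) = M *v F (P *v x)" for x
      by (simp add: M_def G_def matrix_vector_mul_assoc[symmetric])
    have pSG: "polyfun3 (\<lambda>x. (shear t *v G x) $ i)" for i
      unfolding matrix_vector_dot3 by (rule dot3_polyfun3[OF G])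
    have pMF: "polyfun3 (\<lambda>x. (M *v F x) $ i)" for i by (rule hmap_polyfun3[OF hmap_matrix[OF F(1)]])
    have "pullback (\<lambda>x. shear t *v G x) (pullback ((*v) P) w) x = (c * \<psi> x) *s pullback ((*v) P) w x" for x
    proof -
      have "pullback (\<lambda>x. shear t *v G x) (pullback ((*v) P) w) x = pullback (\<lambda>x. P *v (shear t *v G x)) w x"
        by (rule pullback_compose[OF polyfun3_matrix pSG, symmetric])
      also have "\<dots> = pullback (\<lambda>x. M *v F (P *v x)) w x" unfolding MG ..
      also have "\<dots> = pullback ((*v) P) (pullback (\<lambda>x. M *v F x) w) x"
        by (rule pullback_compose[OF pMF polyfun3_matrix])
      also have "\<dots> = (c * \<psi> x) *s pullback ((*v) P) w x"
        unfolding pullback_matrix w(4) \<psi>_def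
        by (simp add: vec_eq_iff vector_matrix_mult_def sum_distrib_left algebra_simps)
      finally show ?thesis .
    qed
    moreover have "\<exists>x. pullback ((*v) P) w x \<noteq> 0"
    proof (rule ccontr)
      assume "\<not> ?thesis"
      then have z: "\<And>x. pullback ((*v) P) w x = 0" by blast
      have "w y = 0" for y
      proof -
        have "w y = pullback (\<lambda>x. x) w y" by (rule pullback_id[symmetric])
        also have "\<dots> = pullback (\<lambda>x. P *v (T *v x)) w y" by (simp add: PT)
        also have "\<dots> = pullback ((*v) T) (pullback ((*v) P) w) y"
          by (rule pullback_compose[OF polyfun3_matrix polyfun3_matrix])
        also have "\<dots> = 0" unfolding pullback_matrix[of T] z by (simp add: vec_eq_iff vector_matrix_mult_def)
        finally show ?thesis .
      qed
      then show False using w(2) by blast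
    qed
    moreover have "dot3 x (pullback ((*v) P) w x) = 0" for x unfolding dot3_pullback_matrix by (rule w(3))
    ultimately show ?thesis using hmap_pullback_matrix[OF w(1)] by blast
  qed
  have degenerate: "\<exists>A0 B0 m A B. hmap k A0 \<and> hmap k B0 \<and> (\<forall>x. pullback G A0 x = \<psi> x *s B0 x) \<and> m \<le> k \<and>
     (A, B) \<noteq> (0, 0) \<and> (\<forall>x. A0 x $ 1 = A * (x $ 2) ^ m * (x $ 3) ^ (k - m) \<and>
       x $ 2 * A0 x $ 2 = (B * x $ 2 - A * x $ 1) * (x $ 2) ^ m * (x $ 3) ^ (k - m) \<and>
       x $ 3 * A0 x $ 3 = - B * (x $ 2) ^ Suc m * (x $ 3) ^ (k - m))"
    by (rule degenerate_invariant_form[where G=G and c="1 / of_nat d"], rule G, rule p\<psi>,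
        simp add: \<psi>_def Pe q, erule dom, assumption, simp add: G_def Pe R(2), use F(2) in simp, rule DG, erule badG)
  then obtain A0 B0 m A B where AB: "hmap k A0" "hmap k B0" "\<And>x. pullback G A0 x = \<psi> x *s B0 x" "m \<le> k" "(A, B) \<noteq> (0, 0)"
     "\<And>x. A0 x $ 1 = A * (x $ 2) ^ m * (x $ 3) ^ (k - m)"
     "\<And>x. x $ 2 * A0 x $ 2 = (B * x $ 2 - A * x $ 1) * (x $ 2) ^ m * (x $ 3) ^ (k - m)"
     "\<And>x. x $ 3 * A0 x $ 3 = - B * (x $ 2) ^ Suc m * (x $ 3) ^ (k - m)"
    using degenerate by blast
  define H where "H = pullback ((*v) T) B0"
  have pH: "polyfun3 (\<lambda>x. H x $ j)" for j unfolding H_def by (rule hmap_polyfun3[OF hmap_pullback_matrix[OF AB(2)]])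
  have RF: "pullback (\<lambda>x. R *v F x) A0 x = \<phi> x *s H x" for x
  proof -
    have "pullback (\<lambda>x. R *v F x) A0 x = pullback (\<lambda>x. G (T *v x)) A0 x" by (simp add: G_def PT)
    also have "\<dots> = pullback ((*v) T) (pullback G A0) x" by (rule pullback_compose[OF G polyfun3_matrix])
    also have "\<dots> = \<phi> x *s H x"
      unfolding H_def pullback_matrix AB(3) \<psi>_def PT
      by (simp add: vec_eq_iff vector_matrix_mult_def sum_distrib_left algebra_simps)
    finally show ?thesis .
  qed
  have pd3: "polyfun3 (\<lambda>x. dot3 (R $ i) (F x))" for i by (rule dot3_polyfun3[OF pF])
  show ?thesis
  proof (rule exI[of _ m], rule exI[of _ A], rule exI[of _ B], intro conjI allI AB(4,5))
    fix j
    define X where "X i x = dot3 (R $ i) (F x)" for i x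
    have "\<phi> x * (X 2 x * X 3 x * H x $ j) = X 2 x ^ m * X 3 x ^ (k - m) *
      (A * X 3 x * (X 2 x * pd j (X 1) x - X 1 x * pd j (X 2) x) + B * X 2 x * (X 3 x * pd j (X 2) x - X 2 x * pd j (X 3) x))" for x
    proof -
      define y where "y = R *v F x"
      have y: "y $ i = X i x" for i by (simp add: y_def X_def matrix_vector_dot3)
      have "\<phi> x * H x $ j = A0 y $ 1 * pd j (X 1) x + A0 y $ 2 * pd j (X 2) x + A0 y $ 3 * pd j (X 3) x"
        using arg_cong[OF RF[of x], of "\<lambda>v. v $ j"]
        by (simp add: pullback_grad y_def matrix_vector_dot3 X_def[abs_def])
      then have "X 2 x * X 3 x * (\<phi> x * H x $ j)
          = X 2 x * X 3 x * (A0 y $ 1 * pd j (X 1) x + A0 y $ 2 * pd j (X 2) x + A0 y $ 3 * pd j (X 3) x)"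
        by simp
      then have "\<phi> x * (X 2 x * X 3 x * H x $ j) = X 2 x * X 3 x * (A0 y $ 1 * pd j (X 1) x)
          + X 3 x * (X 2 x * A0 y $ 2) * pd j (X 2) x + X 2 x * (X 3 x * A0 y $ 3) * pd j (X 3) x"
        by (simp add: algebra_simps)
      also have "\<dots> = X 2 x * X 3 x * (A * X 2 x ^ m * X 3 x ^ (k - m) * pd j (X 1) x)
          + X 3 x * ((B * X 2 x - A * X 1 x) * X 2 x ^ m * X 3 x ^ (k - m)) * pd j (X 2) x
          + X 2 x * (- B * X 2 x ^ Suc m * X 3 x ^ (k - m)) * pd j (X 3) x"
        using AB(6-8)[of y] by (simp only: y)
      finally show ?thesis by (simp add: algebra_simps)
    qed
    moreover have "polyfun3 (\<lambda>x. X 2 x * X 3 x * H x $ j)" unfolding X_def by (intro polyfun3_intros pd3 pH)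
    ultimately show "\<phi> pdvd (\<lambda>x. dot3 (R $ 2) (F x) ^ m * dot3 (R $ 3) (F x) ^ (k - m) *
     (A * dot3 (R $ 3) (F x) * (dot3 (R $ 2) (F x) * pd j (\<lambda>x. dot3 (R $ 1) (F x)) x
          - dot3 (R $ 1) (F x) * pd j (\<lambda>x. dot3 (R $ 2) (F x)) x)
      + B * dot3 (R $ 2) (F x) * (dot3 (R $ 3) (F x) * pd j (\<lambda>x. dot3 (R $ 2) (F x)) x
          - dot3 (R $ 2) (F x) * pd j (\<lambda>x. dot3 (R $ 3) (F x)) x)))"
      unfolding pdvd_def X_def[abs_def] by (intro exI[of _ "\<lambda>x. X 2 x * X 3 x * H x $ j"]) (simp add: X_def)
  qed
qed

subsection \<open>Preserved pencils of lines\<close>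

definition subspace3 :: "(complex^3) set \<Rightarrow> bool" where
  "subspace3 K \<longleftrightarrow> (\<forall>a\<in>K. \<forall>b\<in>K. a + b \<in> K) \<and> (\<forall>c. \<forall>a\<in>K. c *s a \<in> K)"

lemma subspace3_line:
  assumes K: "subspace3 K" and y: "y \<notin> K" and t: "y + t *s z \<in> K" "y + t' *s z \<in> K"
  shows "t = t'"
proof (rule ccontr)
  assume ne: "t \<noteq> t'"
  have "(t' / (t' - t)) *s (y + t *s z) + (- t / (t' - t)) *s (y + t' *s z) \<in> K"
    using K t unfolding subspace3_def by blast
  moreover have "(t' / (t' - t)) *s (y + t *s z) + (- t / (t' - t)) *s (y + t' *s z) = y"
  proof -
    have "(t' / (t' - t)) * (a + t * b) + (- t / (t' - t)) * (a + t' * b) = a" for a b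
    proof -
      have "(t' / (t' - t)) * (a + t * b) + (- t / (t' - t)) * (a + t' * b) = (t' - t) * inverse (t' - t) * a"
        unfolding divide_inverse by (simp only: ring_distribs) (simp add: mult_ac)
      then show ?thesis using ne by simp
    qed
    then show ?thesis by (simp only: vec_eq_iff vector_add_component vector_smult_component) simp
  qed
  ultimately show False using y by simp
qed

text \<open>On a line \<open>y + t *s z\<close> at most one \<open>t\<close> lands in a given
  subspace if \<open>y\<close> or \<open>z\<close> lies outside it. So \<open>y\<close>, which
  avoids the earlier subspaces, can be moved off the new one.\<close>

lemma avoid_subspaces:
  assumes "finite S" "\<And>s. s \<in> S \<Longrightarrow> subspace3 (K s)" "\<And>s. s \<in> S \<Longrightarrow> \<exists>y. y \<notin> K s"
  shows "\<exists>y. \<forall>s\<in>S. y \<notin> K s"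
  using assms
proof (induction S rule: finite_induct)
  case (insert r S)
  then obtain y where y: "\<And>s. s \<in> S \<Longrightarrow> y \<notin> K s" by auto
  obtain z where z: "z \<notin> K r" using insert.prems by blast
  have "finite {t. y + t *s z \<in> K s}" if "s \<in> S" for s
  proof (cases "{t. y + t *s z \<in> K s} = {}")
    case False
    then obtain t where t: "y + t *s z \<in> K s" by blast
    have "{t. y + t *s z \<in> K s} \<subseteq> {t}"
      using subspace3_line[of "K s" y _ z t] insert.prems(1) that y t by blast
    then show ?thesis by (rule finite_subset) simp
  qed simp
  moreover have "finite {t. y + t *s z \<in> K r}"
  proof (cases "y \<in> K r")
    case True
    have K: "subspace3 (K r)" using insert.prems by blast
    have "t = 0" if t: "y + t *s z \<in> K r" for t
    proof (rule ccontr)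
      assume "t \<noteq> 0"
      have "(1 / t) *s (y + t *s z) + (- 1 / t) *s y \<in> K r" using K t True unfolding subspace3_def by blast
      moreover have "(1 / t) *s (y + t *s z) + (- 1 / t) *s y = z" using \<open>t \<noteq> 0\<close> by (simp add: vec_eq_iff field_simps)
      ultimately show False using z by simp
    qed
    then have "{t. y + t *s z \<in> K r} \<subseteq> {0}" by blast
    then show ?thesis by (rule finite_subset) simp
  next
    case False
    show ?thesis
    proof (cases "{t. y + t *s z \<in> K r} = {}")
      case ne: False
      then obtain t where t: "y + t *s z \<in> K r" by blast
      have "{t. y + t *s z \<in> K r} \<subseteq> {t}"
        using subspace3_line[of "K r" y _ z t] insert.prems(1) False t by blast
      then show ?thesis by (rule finite_subset) simp
    qed simp
  qed
  ultimately have "finite (\<Union>s\<in>insert r S. {t. y + t *s z \<in> K s})" using insert.hyps by blast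
  then obtain t where "t \<notin> (\<Union>s\<in>insert r S. {t. y + t *s z \<in> K s})"
    using ex_new_if_finite[OF infinite_UNIV_char_0] by blast
  then show ?case by (intro exI[of _ "y + t *s z"]) auto
qed simp

text \<open>The 1-form \<open>crs3 b\<close> is \<open>det (b, x, dx)\<close>, whose leaves are the lines through \<open>b\<close>.\<close>
lemma pullback_crs3: "pullback F (crs3 b) x $ j = dot3 b (crs3 (F x) (\<chi> i. pd j (\<lambda>x. F x $ i) x))"
  by (simp add: pullback_def sum_3 dot3_def algebra_simps)

lemma polyfun3_crs3: "(\<And>i. polyfun3 (\<lambda>x. g x $ i)) \<Longrightarrow> polyfun3 (\<lambda>x. crs3 b (g x) $ i)"
  using exhaust_3[of i] by (auto intro!: polyfun3_intros)

lemma pullback_pencil_nonzero: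
  assumes F: "hmap d F" "d \<ge> 1" "dominant F" and z: "\<And>x. pullback F (crs3 b) x = 0"
  shows "b = 0"
proof -
  have "crs3 b (F x) = 0" for x
    by (rule pullback_nonzero[OF hmap_polyfun3[OF F(1)] dominant_jac_nonzero[OF F] _ z])
      (rule polyfun3_crs3[OF polyfun3_coord])
  then have "crs3 b y $ i = 0" for y i
    using dominant_polyfun3_nonzero[OF F, of "\<lambda>y. crs3 b y $ i"] polyfun3_crs3[OF polyfun3_coord] by simp
  from this[of "axis 1 1" 2] this[of "axis 1 1" 3] this[of "axis 2 1" 3] show ?thesis
    by (simp add: vec3_eq_iff axis_def)
qed

text \<open>The left side is the pull-back of the form \<open>l dl' - l' dl\<close>, whose leaves
  are the lines through the common zero \<open>crs3 l l'\<close> of \<open>l\<close> and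
  \<open>l'\<close>.\<close>

lemma wronskian_pullback:
  assumes "\<And>i. polyfun3 (\<lambda>x. F x $ i)"
  shows "dot3 l (F x) * pd j (\<lambda>x. dot3 l' (F x)) x - dot3 l' (F x) * pd j (\<lambda>x. dot3 l (F x)) x
     = pullback F (crs3 (crs3 l l')) x $ j"
proof -
  have "pd j (\<lambda>x. dot3 l (F x)) x = dot3 l (\<chi> i. pd j (\<lambda>x. F x $ i) x)" for l
    using arg_cong[OF grad_dot3[OF assms, of l x], of "\<lambda>v. v $ j"] by (simp add: dot3_def)
  then show ?thesis unfolding pullback_crs3 by (simp add: dot3_def algebra_simps)
qed

text \<open>In a generic frame the powers of \<open>dot3 y (F x)\<close> and
  \<open>dot3 w (F x)\<close> in \<open>frame_divisibility\<close> are coprime to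
  \<open>\<phi>\<close> and cancel, leaving a combination of two pencils with unknown coefficients.
  Replacing the third covector \<open>z\<close> by \<open>z + \<delta> y\<close> changes one term
  but not the other, and elimination leaves a single pencil. Its base point lies on the line
  \<open>y = 0\<close>, which is kept away from \<open>b'\<close>; this later yields a second,
  independent pencil.\<close>

lemma preserved_pencil:
  assumes F: "hmap d F" "d \<ge> 1" "dominant F" "reduced F" and \<phi>: "polyfun3 \<phi>" "\<exists>x. \<phi> x \<noteq> 0"
    and bad: "\<And>M. invertible M \<Longrightarrow> bad_matrix F \<phi> k M" and b': "b' \<noteq> 0"
  shows "\<exists>y b. b \<noteq> 0 \<and> dot3 b y = 0 \<and> dot3 y b' \<noteq> 0 \<and> (\<forall>j. \<phi> pdvd (\<lambda>x. pullback F (crs3 b) x $ j))"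
proof -
  have pF: "polyfun3 (\<lambda>x. F x $ i)" for i by (rule hmap_polyfun3[OF F(1)])
  obtain S where S: "finite S" "\<And>u. u \<in> S \<Longrightarrow> pprime u \<and> u pdvd \<phi>"
    "\<And>v. pprime v \<Longrightarrow> v pdvd \<phi> \<Longrightarrow> \<exists>u\<in>S. u pdvd v \<and> v pdvd u"
    using finite_pprimes[OF \<phi>] by blast
  define K where "K u = {y. u pdvd (\<lambda>x. dot3 y (F x))}" for u
  have K: "subspace3 (K u)" for u
    unfolding subspace3_def K_def by (auto simp: dot3_linear intro: pdvd_add pdvd_scale)
  have Kproper: "\<exists>y. y \<notin> K u" if u: "u \<in> S" for u
  proof -
    obtain j where "\<not> u pdvd (\<lambda>x. F x $ j)" using reducedD[OF F(4)] S(2)[OF u] by blast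
    then show ?thesis by (intro exI[of _ "axis j 1"]) (simp add: K_def dot3_axis)
  qed
  define C where "C u = {p. \<forall>i. u pdvd (\<lambda>x. crs3 (F x) p $ i)}" for u
  have form: "\<exists>t. t \<noteq> 0 \<and> dot3 t p = 0" for p :: "complex^3"
  proof (cases "p = 0")
    case True then show ?thesis by (intro exI[of _ "axis 1 1"]) (auto simp: dot3_linear axis_eq_0_iff)
  next
    case False
    then obtain l m n where "dot3 l p = 0" "dot3 l (crs3 m n) \<noteq> 0" using kernel_frame_exists by blast
    then show ?thesis by (intro exI[of _ l]) (auto simp: dot3_linear)
  qed
  \<comment> \<open>\<open>\<tau> u\<close> is a covector killing the image point of
    \<open>u\<close> in case \<open>F\<close> contracts it. That \<open>F q\<close> is not this
    point then follows from one polynomial inequality in \<open>q\<close>.\<close>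
  have "\<forall>u\<in>S. \<exists>t. t \<noteq> 0 \<and> (\<forall>p\<in>C u. dot3 t p = 0)"
  proof
    fix u assume u: "u \<in> S"
    show "\<exists>t. t \<noteq> 0 \<and> (\<forall>p\<in>C u. dot3 t p = 0)"
    proof (cases "C u \<subseteq> {0}")
      case True
      have "axis 1 1 \<noteq> (0 :: complex^3)" by (simp add: axis_eq_0_iff)
      then show ?thesis using True by (intro exI[of _ "axis 1 1"]) (auto simp: dot3_linear)
    next
      case False
      then obtain p0 where p0: "p0 \<in> C u" "p0 \<noteq> 0" by blast
      obtain t where t: "t \<noteq> 0" "dot3 t p0 = 0" using form by blast
      have "dot3 t p = 0" if "p \<in> C u" for p
      proof -
        have "crs3 p p0 = 0" using contracted_point_unique[OF F(1,4)] S(2)[OF u] that p0(1) unfolding C_def by blast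
        then obtain s where "p = s *s p0" using crs3_eq_0_imp p0(2) by blast
        then show ?thesis using t by (simp add: dot3_linear)
      qed
      then show ?thesis using t by blast
    qed
  qed
  from bchoice[OF this] obtain \<tau> where \<tau>: "\<And>u. u \<in> S \<Longrightarrow> \<tau> u \<noteq> 0" "\<And>u p. u \<in> S \<Longrightarrow> p \<in> C u \<Longrightarrow> dot3 (\<tau> u) p = 0"
    by blast
  obtain \<tau>' where \<tau>': "\<tau>' \<noteq> 0" "dot3 \<tau>' b' = 0" using form by blast
  have tF: "\<exists>x. dot3 t (F x) \<noteq> 0" if "t \<noteq> 0" for t
  proof (rule ccontr)
    assume "\<not> ?thesis"
    then have "dot3 t y = 0" for y
      using dominant_polyfun3_nonzero[OF F(1-3), of "dot3 t"] dot3_polyfun3[OF polyfun3_coord] by blast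
    then show False using vec3_nonzero_dot3[OF that] by blast
  qed
  have "\<exists>x. \<forall>g\<in>{jac F, \<phi>} \<union> (\<lambda>t x. dot3 t (F x)) ` insert \<tau>' (\<tau> ` S). g x \<noteq> 0"
  proof (rule polyfun3_prod_nonzero[where P="\<lambda>g. g"])
    show "polyfun3 g" if "g \<in> {jac F, \<phi>} \<union> (\<lambda>t x. dot3 t (F x)) ` insert \<tau>' (\<tau> ` S)" for g
      using that \<phi>(1) polyfun3_jac[OF pF] dot3_polyfun3[OF pF] by auto
    show "\<exists>x. g x \<noteq> 0" if "g \<in> {jac F, \<phi>} \<union> (\<lambda>t x. dot3 t (F x)) ` insert \<tau>' (\<tau> ` S)" for g
      using that \<phi>(2) dominant_jac_nonzero[OF F(1-3)] tF \<tau>(1) \<tau>'(1) by auto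
  qed (use S(1) in simp)
  then obtain q where q: "jac F q \<noteq> 0" "\<phi> q \<noteq> 0" "\<And>u. u \<in> S \<Longrightarrow> dot3 (\<tau> u) (F q) \<noteq> 0" "dot3 \<tau>' (F q) \<noteq> 0" by auto
  define f where "f = F q"
  have f0: "f \<noteq> 0" using q(4) by (auto simp: f_def dot3_linear)
  have fC: "f \<notin> C u" if "u \<in> S" for u using \<tau>(2)[OF that] q(3)[OF that] by (auto simp: f_def)
  have crs_lin: "crs3 (a + a') f = crs3 a f + crs3 a' f" "crs3 (c *s a) f = c *s crs3 a f" for a a' c
    by (simp_all add: vec3_eq_iff algebra_simps)
  \<comment> \<open>The covectors vanishing at \<open>f\<close> are the \<open>crs3 a f\<close>, so
    \<open>y\<close> is chosen through \<open>a\<close>. A prime \<open>u\<close> with all of them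
    in \<open>K u\<close> would be contracted by \<open>F\<close> to \<open>f\<close>, which the
    choice of \<open>q\<close> excludes.\<close>
  define L where "L = (\<lambda>s. case s of None \<Rightarrow> {a. dot3 (crs3 a f) b' = 0} | Some u \<Rightarrow> {a. crs3 a f \<in> K u})"
  have "\<exists>a. \<forall>s\<in>insert None (Some ` S). a \<notin> L s"
  proof (rule avoid_subspaces)
    fix s assume s: "s \<in> insert None (Some ` S)"
    show "subspace3 (L s)"
      using K by (cases s) (auto simp: L_def subspace3_def crs_lin dot3_linear)
    show "\<exists>a. a \<notin> L s"
    proof (cases s)
      case None
      have "\<exists>a. dot3 (crs3 a f) b' \<noteq> 0"
      proof (rule ccontr)
        assume no: "\<not> ?thesis"
        have "dot3 a (crs3 f b') = dot3 (crs3 a f) b'" for a by (simp add: dot3_def algebra_simps)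
        then have "dot3 (crs3 f b') a = 0" for a using no by (simp add: dot3_commute)
        then have "crs3 f b' = 0" using vec3_nonzero_dot3 by blast
        then obtain c where "f = c *s b'" using crs3_eq_0_imp b' by blast
        then show False using q(4) \<tau>'(2) by (simp add: f_def[symmetric] dot3_linear)
      qed
      then show ?thesis by (simp add: L_def None)
    next
      case (Some u)
      then have u: "u \<in> S" using s by auto
      show ?thesis
      proof (rule ccontr)
        assume "\<not> ?thesis"
        then have all: "u pdvd (\<lambda>x. dot3 (crs3 a f) (F x))" for a by (simp add: L_def Some K_def)
        have "u pdvd (\<lambda>x. crs3 (F x) f $ i)" for i
        proof -
          have "crs3 (F x) f $ i = dot3 (crs3 (- axis i 1) f) (F x)" for x
            using exhaust_3[of i] by (auto simp: dot3_def axis_def algebra_simps)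
          then show ?thesis using all by simp
        qed
        then show False using fC[OF u] by (simp add: C_def)
      qed
    qed
  qed (use S(1) in simp)
  then obtain a where a: "dot3 (crs3 a f) b' \<noteq> 0" "\<And>u. u \<in> S \<Longrightarrow> crs3 a f \<notin> K u" by (auto simp: L_def)
  define y where "y = crs3 a f"
  have y: "dot3 y b' \<noteq> 0" "\<And>u. u \<in> S \<Longrightarrow> y \<notin> K u" "dot3 y f = 0" "y \<noteq> 0"
    using a by (auto simp: y_def dot3_linear) (simp add: dot3_def algebra_simps)
  define L' where "L' = (\<lambda>s. case s of None \<Rightarrow> {z. dot3 z f = 0} | Some u \<Rightarrow> K u)"
  have "\<exists>z. \<forall>s\<in>insert None (Some ` S). z \<notin> L' s"
  proof (rule avoid_subspaces)
    fix s assume s: "s \<in> insert None (Some ` S)"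
    show "subspace3 (L' s)" using K by (cases s) (auto simp: L'_def subspace3_def dot3_linear)
    show "\<exists>a. a \<notin> L' s"
      using s Kproper vec3_nonzero_dot3[OF f0] by (cases s) (auto simp: L'_def dot3_commute)
  qed (use S(1) in simp)
  then obtain z0 where z0: "dot3 z0 f \<noteq> 0" "\<And>u. u \<in> S \<Longrightarrow> z0 \<notin> K u" by (auto simp: L'_def)
  \<comment> \<open>Scaling \<open>z0\<close> gives the normalization
    \<open>dot3 z f = 1 / of_nat d\<close> that \<open>frame_divisibility\<close> asks for.\<close>
  define c0 where "c0 = 1 / (of_nat d * dot3 z0 f)"
  have c0: "c0 \<noteq> 0" using z0 F(2) by (simp add: c0_def)
  define z where "z = c0 *s z0"
  have zf: "dot3 z f = 1 / of_nat d" using z0(1) by (simp add: z_def c0_def dot3_linear)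
  have zf0: "dot3 z f \<noteq> 0" using zf F(2) by simp
  have zK: "z \<notin> K u" if "u \<in> S" for u
  proof
    assume "z \<in> K u"
    then have "(1 / c0) *s z \<in> K u" using K unfolding subspace3_def by blast
    then show False using z0(2)[OF that] c0 by (simp add: z_def)
  qed
  have "finite (\<Union>u\<in>S. {\<delta>. z + \<delta> *s y \<in> K u})"
  proof (intro finite_UN_I S(1))
    fix u assume u: "u \<in> S"
    show "finite {\<delta>. z + \<delta> *s y \<in> K u}"
    proof (cases "{\<delta>. z + \<delta> *s y \<in> K u} = {}")
      case False
      then obtain t where t: "z + t *s y \<in> K u" by blast
      have "{\<delta>. z + \<delta> *s y \<in> K u} \<subseteq> {t}" using subspace3_line[OF K zK[OF u] _ t] by blast
      then show ?thesis by (rule finite_subset) simp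
    qed simp
  qed
  then have "finite (insert 0 (\<Union>u\<in>S. {\<delta>. z + \<delta> *s y \<in> K u}))" by (rule finite.insertI)
  from ex_new_if_finite[OF infinite_UNIV_char_0 this] obtain \<delta>
    where d': "\<delta> \<notin> insert 0 (\<Union>u\<in>S. {\<delta>. z + \<delta> *s y \<in> K u})" ..
  have \<delta>: "\<delta> \<noteq> 0" using d' by simp
  have \<delta>K: "z + \<delta> *s y \<notin> K u" if "u \<in> S" for u using d' that by blast
  obtain a2 where a2: "dot3 a2 y \<noteq> 0" using vec3_nonzero_dot3[OF y(4)] dot3_commute by metis
  \<comment> \<open>\<open>x0\<close> completes the frame: it vanishes at \<open>f\<close>, and by
    \<open>det_id\<close> the frame \<open>x0, y, w\<close> is invertible whenever
    \<open>dot3 w f \<noteq> 0\<close>.\<close>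
  define x0 where "x0 = crs3 a2 f"
  have x0f: "dot3 x0 f = 0" by (simp add: x0_def dot3_def algebra_simps)
  have det_id: "dot3 x0 (crs3 y w) = dot3 w f * dot3 a2 y" for w
    by (simp add: x0_def y_def dot3_def algebra_simps)
  have frame: "\<exists>A B. (A, B) \<noteq> (0, 0) \<and> (\<forall>j. \<phi> pdvd (\<lambda>x.
     A * dot3 w (F x) * pullback F (crs3 (crs3 y x0)) x $ j + B * dot3 y (F x) * pullback F (crs3 (crs3 w y)) x $ j))"
    if wf: "dot3 w f = 1 / of_nat d" and wK: "\<And>u. u \<in> S \<Longrightarrow> w \<notin> K u" for w
  proof -
    define R :: "complex^3^3" where "R = vector [x0, y, w]"
    have R: "R $ 1 = x0" "R $ 2 = y" "R $ 3 = w" by (simp_all add: R_def)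
    have "det R \<noteq> 0" unfolding det3_dot3 R det_id using wf a2 F(2) by simp
    then have iR: "invertible R" by (simp add: invertible_det_nz)
    have Rq: "R *v F q = (1 / of_nat d) *s axis 3 1"
      by (simp add: vec3_eq_iff matrix_vector_dot3 R f_def[symmetric] x0f y(3) wf axis_def)
    obtain m A B where AB: "m \<le> k" "(A, B) \<noteq> (0, 0)"
     "\<And>j. \<phi> pdvd (\<lambda>x. dot3 y (F x) ^ m * dot3 w (F x) ^ (k - m) *
     (A * dot3 w (F x) * (dot3 y (F x) * pd j (\<lambda>x. dot3 x0 (F x)) x - dot3 x0 (F x) * pd j (\<lambda>x. dot3 y (F x)) x)
      + B * dot3 y (F x) * (dot3 w (F x) * pd j (\<lambda>x. dot3 y (F x)) x - dot3 y (F x) * pd j (\<lambda>x. dot3 w (F x)) x)))"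
      using frame_divisibility[OF F(1-3) \<phi>(1) q(1,2) iR Rq bad] unfolding R by blast
    note om = wronskian_pullback[OF pF]
    have pp: "polyfun3 (\<lambda>x. pullback F (crs3 b) x $ j)" for b j
      by (rule polyfun3_pullback[OF pF polyfun3_crs3[OF polyfun3_coord]])
    have ndvd: "\<not> v pdvd (\<lambda>x. dot3 l (F x) ^ n)" if v: "pprime v" "v pdvd \<phi>" and l: "\<And>u. u \<in> S \<Longrightarrow> l \<notin> K u" for v l n
    proof
      assume d: "v pdvd (\<lambda>x. dot3 l (F x) ^ n)"
      have "n > 0"
      proof (rule ccontr)
        assume "\<not> n > 0"
        then have "v pdvd (\<lambda>x. 1)" using d by simp
        then show False using pprime_not_dvd_const[OF v(1)] by fastforce
      qed
      then have "v pdvd (\<lambda>x. dot3 l (F x))" by (rule pprime_dvd_powerD[OF v(1) dot3_polyfun3[OF pF] d])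
      moreover obtain u where "u \<in> S" "u pdvd v" using S(3)[OF v] by blast
      ultimately show False using l pdvd_trans unfolding K_def by blast
    qed
    have "\<phi> pdvd (\<lambda>x. A * dot3 w (F x) * pullback F (crs3 (crs3 y x0)) x $ j + B * dot3 y (F x) * pullback F (crs3 (crs3 w y)) x $ j)" for j
    proof (rule pdvd_cancel_coprime[OF \<phi>(1) _ _ \<phi>(2)])
      show "polyfun3 (\<lambda>x. dot3 y (F x) ^ m * dot3 w (F x) ^ (k - m))" by (intro polyfun3_intros dot3_polyfun3 pF)
      show "polyfun3 (\<lambda>x. A * dot3 w (F x) * pullback F (crs3 (crs3 y x0)) x $ j + B * dot3 y (F x) * pullback F (crs3 (crs3 w y)) x $ j)"
        by (intro polyfun3_intros dot3_polyfun3 pF pp)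
      show "\<not> v pdvd (\<lambda>x. dot3 y (F x) ^ m * dot3 w (F x) ^ (k - m))" if v: "pprime v" "v pdvd \<phi>" for v
      proof
        assume "v pdvd (\<lambda>x. dot3 y (F x) ^ m * dot3 w (F x) ^ (k - m))"
        then have "v pdvd (\<lambda>x. dot3 y (F x) ^ m) \<or> v pdvd (\<lambda>x. dot3 w (F x) ^ (k - m))"
          by (intro pprime_dvd_multD[OF v(1)] polyfun3_intros dot3_polyfun3 pF)
        then show False using ndvd[OF v y(2)] ndvd[OF v wK] by blast
      qed
      show "\<phi> pdvd (\<lambda>x. dot3 y (F x) ^ m * dot3 w (F x) ^ (k - m) *
         (A * dot3 w (F x) * pullback F (crs3 (crs3 y x0)) x $ j + B * dot3 y (F x) * pullback F (crs3 (crs3 w y)) x $ j))"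
        using AB(3)[of j] unfolding om .
    qed
    then show ?thesis using AB(2) by blast
  qed
  have pp: "polyfun3 (\<lambda>x. pullback F (crs3 b) x $ j)" for b j
    by (rule polyfun3_pullback[OF pF polyfun3_crs3[OF polyfun3_coord]])
  have pb_lin: "pullback F (crs3 (s *s b + s' *s c)) x $ j = s * pullback F (crs3 b) x $ j + s' * pullback F (crs3 c) x $ j" for s s' b c x j
    unfolding pullback_crs3 by (simp add: dot3_linear)
  have cancelY: "\<phi> pdvd (\<lambda>x. pullback F (crs3 b) x $ j)" if "\<phi> pdvd (\<lambda>x. dot3 y (F x) * pullback F (crs3 b) x $ j)" for b j
  proof (rule pdvd_cancel_coprime[OF \<phi>(1) dot3_polyfun3[OF pF, of y] pp \<phi>(2) _ that])
    show "\<not> v pdvd (\<lambda>x. dot3 y (F x))" if v: "pprime v" "v pdvd \<phi>" for v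
    proof
      assume "v pdvd (\<lambda>x. dot3 y (F x))"
      moreover obtain u where "u \<in> S" "u pdvd v" using S(3)[OF v] by blast
      ultimately show False using y(2) pdvd_trans unfolding K_def by blast
    qed
  qed
  have wzd: "crs3 (z + \<delta> *s y) y = crs3 z y" by (simp add: vec3_eq_iff algebra_simps)
  obtain A B where AB: "(A, B) \<noteq> (0, 0)" "\<And>j. \<phi> pdvd (\<lambda>x. A * dot3 z (F x) * pullback F (crs3 (crs3 y x0)) x $ j
      + B * dot3 y (F x) * pullback F (crs3 (crs3 z y)) x $ j)"
    using frame[OF zf zK] by blast
  have "dot3 (z + \<delta> *s y) f = 1 / of_nat d" by (simp add: dot3_linear zf y(3))
  then obtain A' B' where AB': "(A', B') \<noteq> (0, 0)" "\<And>j. \<phi> pdvd (\<lambda>x. A' * dot3 (z + \<delta> *s y) (F x) * pullback F (crs3 (crs3 y x0)) x $ j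
      + B' * dot3 y (F x) * pullback F (crs3 (crs3 z y)) x $ j)"
    using frame[of "z + \<delta> *s y"] \<delta>K unfolding wzd by blast
  have zyz: "dot3 (crs3 z y) x0 \<noteq> 0"
  proof -
    have "dot3 (crs3 z y) x0 = - dot3 x0 (crs3 y z)" by (simp add: dot3_def algebra_simps)
    then show ?thesis unfolding det_id using a2 zf0 by simp
  qed
  \<comment> \<open>If the coefficient \<open>A\<close> is zero, the divisibility already concerns
    the single pencil at \<open>crs3 z y\<close>.\<close>
  have case0: "\<exists>b. b \<noteq> 0 \<and> dot3 b y = 0 \<and> (\<forall>j. \<phi> pdvd (\<lambda>x. pullback F (crs3 b) x $ j))"
    if "B0 \<noteq> 0" "\<And>j. \<phi> pdvd (\<lambda>x. B0 * dot3 y (F x) * pullback F (crs3 (crs3 z y)) x $ j)" for B0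
  proof (intro exI[of _ "crs3 z y"] conjI allI)
    show "crs3 z y \<noteq> 0" using zyz by (auto simp: dot3_linear)
    show "dot3 (crs3 z y) y = 0" by (simp add: dot3_def algebra_simps)
    fix j
    have "\<phi> pdvd (\<lambda>x. B0 * (dot3 y (F x) * pullback F (crs3 (crs3 z y)) x $ j))" using that(2) by (simp add: mult.assoc)
    then have "\<phi> pdvd (\<lambda>x. dot3 y (F x) * pullback F (crs3 (crs3 z y)) x $ j)" by (rule pdvd_scale_cancel) (rule that(1))
    then show "\<phi> pdvd (\<lambda>x. pullback F (crs3 (crs3 z y)) x $ j)" by (rule cancelY)
  qed
  have "\<exists>b. b \<noteq> 0 \<and> dot3 b y = 0 \<and> (\<forall>j. \<phi> pdvd (\<lambda>x. pullback F (crs3 b) x $ j))"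
  proof (cases "A = 0 \<or> A' = 0")
    case True
    then show ?thesis
    proof
      assume "A = 0" then show ?thesis using AB by (intro case0[of B]) auto
    next
      assume "A' = 0" then show ?thesis using AB' by (intro case0[of B']) auto
    qed
  next
    case False
    \<comment> \<open>\<open>A'\<close> times the first relation minus \<open>A\<close> times the
      second: the terms in \<open>dot3 z (F x)\<close> cancel and \<open>dot3 y (F x)\<close>
      factors out.\<close>
    define b where "b = (- A * A' * \<delta>) *s crs3 y x0 + (A' * B - A * B') *s crs3 z y"
    have "\<phi> pdvd (\<lambda>x. pullback F (crs3 b) x $ j)" for j
    proof (rule cancelY)
      have "\<phi> pdvd (\<lambda>x. A' * (A * dot3 z (F x) * pullback F (crs3 (crs3 y x0)) x $ j + B * dot3 y (F x) * pullback F (crs3 (crs3 z y)) x $ j)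
        - A * (A' * dot3 (z + \<delta> *s y) (F x) * pullback F (crs3 (crs3 y x0)) x $ j + B' * dot3 y (F x) * pullback F (crs3 (crs3 z y)) x $ j))"
        by (intro pdvd_diff pdvd_scale AB AB')
      moreover have "A' * (A * dot3 z (F x) * pullback F (crs3 (crs3 y x0)) x $ j + B * dot3 y (F x) * pullback F (crs3 (crs3 z y)) x $ j)
        - A * (A' * dot3 (z + \<delta> *s y) (F x) * pullback F (crs3 (crs3 y x0)) x $ j + B' * dot3 y (F x) * pullback F (crs3 (crs3 z y)) x $ j)
        = dot3 y (F x) * pullback F (crs3 b) x $ j" for x
        unfolding b_def pb_lin dot3_linear by (simp add: algebra_simps)
      ultimately show "\<phi> pdvd (\<lambda>x. dot3 y (F x) * pullback F (crs3 b) x $ j)" by simp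
    qed
    moreover have "dot3 b y = 0" by (simp add: b_def dot3_def algebra_simps)
    moreover have "b \<noteq> 0"
    proof
      assume "b = 0"
      then have "dot3 b z = 0" by (simp add: dot3_linear)
      moreover have "dot3 (crs3 y x0) z = dot3 (crs3 z y) x0" "dot3 (crs3 z y) z = 0" by (simp_all add: dot3_def algebra_simps)
      ultimately have "A * A' * \<delta> * dot3 (crs3 z y) x0 = 0" unfolding b_def dot3_linear by simp
      then show False using False \<delta> zyz by simp
    qed
    ultimately show ?thesis by blast
  qed
  then show ?thesis using y(1) by blast
qed

section \<open>Degree count for the pull-back of a pencil\<close>

lemma hpoly3_1_dot3:
  assumes "hpoly3 1 p" shows "\<exists>a. \<forall>x. p x = dot3 a x"
proof -
  obtain c where c: "\<And>x. p x = (\<Sum>a\<in>tri 1. c a * tmono 1 a x)" using hpoly3_tri_expansion[OF assms] by blast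
  have "tri 1 = {(0, 0), (1, 0), (1, 1)}" by (auto simp: tri_def)
  then show ?thesis
    by (intro exI[of _ "vector [c (1, 1), c (1, 0), c (0, 0)]"]) (simp add: c tmono_def dot3_def)
qed

lemma dot3_pullback:
  assumes "hmap d F" shows "dot3 x (pullback F w x) = of_nat d * dot3 (F x) (w (F x))"
proof -
  have "x $ 1 * pd 1 (\<lambda>x. F x $ i) x + x $ 2 * pd 2 (\<lambda>x. F x $ i) x + x $ 3 * pd 3 (\<lambda>x. F x $ i) x
     = of_nat d * F x $ i" for i
    using hpoly3_euler[OF hmap_hpoly3[OF assms], of x i] by (simp add: sum_3)
  note e = this[of 1] this[of 2] this[of 3]
  have "dot3 x (pullback F w x)
     = w (F x) $ 1 * (x $ 1 * pd 1 (\<lambda>x. F x $ 1) x + x $ 2 * pd 2 (\<lambda>x. F x $ 1) x + x $ 3 * pd 3 (\<lambda>x. F x $ 1) x)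
     + w (F x) $ 2 * (x $ 1 * pd 1 (\<lambda>x. F x $ 2) x + x $ 2 * pd 2 (\<lambda>x. F x $ 2) x + x $ 3 * pd 3 (\<lambda>x. F x $ 2) x)
     + w (F x) $ 3 * (x $ 1 * pd 1 (\<lambda>x. F x $ 3) x + x $ 2 * pd 2 (\<lambda>x. F x $ 3) x + x $ 3 * pd 3 (\<lambda>x. F x $ 3) x)"
    by (simp add: dot3_def pullback_def sum_3 algebra_simps)
  then show ?thesis unfolding e by (simp add: dot3_def algebra_simps)
qed

lemma pullback_homogeneous:
  assumes F: "hmap d F" and w: "\<And>s y. s \<noteq> 0 \<Longrightarrow> w (s *s y) = s ^ k *s w y" and t: "t \<noteq> 0"
  shows "t *s pullback F w (t *s x) = t ^ (d * k + d) *s pullback F w x"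
proof -
  have "t * pullback F w (t *s x) $ j = t ^ (d * k + d) * pullback F w x $ j" for j
  proof -
    have "t * pullback F w (t *s x) $ j = (\<Sum>i\<in>UNIV. w (F (t *s x)) $ i * (t * pd j (\<lambda>y. F y $ i) (t *s x)))"
      by (simp add: pullback_def sum_distrib_left algebra_simps)
    also have "\<dots> = (\<Sum>i\<in>UNIV. (t ^ (d * k) * w (F x) $ i) * (t ^ d * pd j (\<lambda>y. F y $ i) x))"
      unfolding hpoly3_pd_scale[OF hmap_hpoly3[OF F] t] hmap_homogeneous[OF F]
      using t by (simp add: w power_mult[symmetric])
    also have "\<dots> = t ^ (d * k + d) * pullback F w x $ j"
      by (simp add: pullback_def sum_distrib_left power_add algebra_simps)
    finally show ?thesis .
  qed
  then show ?thesis by (simp add: vec_eq_iff)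
qed

text \<open>The pull-back of a pencil has coefficients of degree \<open>2 d - 1\<close>, so a
  divisor of degree at least \<open>2 (d - 1)\<close> leaves degree at most 1. Degree 0 is
  impossible by the Euler condition, and a linear field orthogonal to \<open>x\<close> is
  skew-symmetric, that is, a cross product \<open>crs3 a x\<close>.\<close>

lemma pencil_quotient:
  assumes F: "hmap d F" "d \<ge> 1" "dominant F" and \<phi>: "polyfun3 \<phi>" "\<exists>x. \<phi> x \<noteq> 0"
    and hom: "\<And>t x. t \<noteq> 0 \<Longrightarrow> \<phi> (t *s x) = t ^ D * \<phi> x" "D \<ge> 2 * (d - 1)"
    and b: "b \<noteq> 0" "\<And>j. \<phi> pdvd (\<lambda>x. pullback F (crs3 b) x $ j)"
  shows "\<exists>a. a \<noteq> 0 \<and> (\<forall>x. pullback F (crs3 b) x = \<phi> x *s crs3 a x)"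
proof -
  have "\<forall>j. \<exists>A. polyfun3 A \<and> (\<forall>x. pullback F (crs3 b) x $ j = \<phi> x * A x)"
    using b(2) unfolding pdvd_def by blast
  from choice[OF this] obtain A where A: "\<And>j. polyfun3 (A j)" "\<And>j x. pullback F (crs3 b) x $ j = \<phi> x * A j x"
    by blast
  \<comment> \<open>The quotient has degree \<open>1 - e\<close>; the scaling law below carries
    \<open>t ^ e\<close> on the left so as to cover negative values.\<close>
  obtain e where e: "D = 2 * (d - 1) + e" using hom(2) le_Suc_ex by blast
  have scale: "t ^ e * A j (t *s x) = t * A j x" if t: "t \<noteq> 0" for t j x
  proof -
    have "t ^ e * A j (t *s x) - t * A j x = 0" for x
    proof (rule polyfun3_zero_off[OF _ \<phi>, where p="\<lambda>x. t ^ e * A j (t *s x) - t * A j x"])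
      show "polyfun3 (\<lambda>x. t ^ e * A j (t *s x) - t * A j x)"
        by (intro polyfun3_intros A polyfun3_compose[OF A(1), of "\<lambda>x. t *s x"]) (simp, intro polyfun3_intros)
      fix x assume x: "\<phi> x \<noteq> 0"
      have "t *s pullback F (crs3 b) (t *s x) = t ^ (d * 1 + d) *s pullback F (crs3 b) x"
        by (rule pullback_homogeneous[OF F(1) _ t]) (simp add: vec3_eq_iff algebra_simps)
      then have "t * pullback F (crs3 b) (t *s x) $ j = t ^ (d * 1 + d) * pullback F (crs3 b) x $ j"
        by (metis vector_smult_component)
      then have "t * (t ^ D * \<phi> x * A j (t *s x)) = t ^ (2 * d) * (\<phi> x * A j x)"
        unfolding A(2) hom(1)[OF t] by (simp add: mult_2)
      moreover have "t ^ (2 * d) = t ^ (2 * (d - 1)) * t ^ 2"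
        proof -
        have "2 * d = 2 * (d - 1) + 2" using F(2) by simp
        then show ?thesis by (simp only: power_add)
      qed
      ultimately have "\<phi> x * t ^ (2 * (d - 1)) * t * (t ^ e * A j (t *s x)) = \<phi> x * t ^ (2 * (d - 1)) * t * (t * A j x)"
        unfolding e power_add power2_eq_square by (auto simp add: mult_ac)
      then show "t ^ e * A j (t *s x) - t * A j x = 0" using x t by simp
    qed
    then show ?thesis by simp
  qed
  have euler: "dot3 x (\<chi> j. A j x) = 0" for x
  proof (rule polyfun3_zero_off[OF _ \<phi>, where p="\<lambda>x. dot3 x (\<chi> j. A j x)"])
    show "polyfun3 (\<lambda>x. dot3 x (\<chi> j. A j x))" unfolding dot3_def by (simp, intro polyfun3_intros A)
    fix x assume x: "\<phi> x \<noteq> 0"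
    have "dot3 x (pullback F (crs3 b) x) = 0"
      unfolding dot3_pullback[OF F(1)] by (simp add: dot3_def algebra_simps)
    then have "\<phi> x * dot3 x (\<chi> j. A j x) = 0" by (simp add: dot3_def A algebra_simps)
    then show "dot3 x (\<chi> j. A j x) = 0" using x by simp
  qed
  have "e = 0"
  proof (rule ccontr)
    assume e0: "e \<noteq> 0"
    \<comment> \<open>Here \<open>0 ^ (e - 1)\<close> is 1 for \<open>e = 1\<close> and 0 beyond, so
      the coefficients are constant in either case; a constant vector orthogonal to every
      \<open>x\<close> vanishes.\<close>
    have const: "A j x = 0 ^ (e - 1) * A j 0" for j x
    proof -
      obtain Q where Q: "\<And>t. A j (0 + t *s x) = poly Q t" using polyfun3_line[OF A(1)] by blast
      define P where "P = monom 1 (e - 1) * Q - [:A j x:]"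
      have "poly P t = 0" if "t \<noteq> 0" for t
      proof -
        have "t * (t ^ (e - 1) * A j (t *s x)) = t * A j x" using scale[OF that, of j x] e0 by (simp add: power_eq_if)
        then show ?thesis using that Q[of t] by (simp add: P_def poly_monom)
      qed
      then have "UNIV - {0} \<subseteq> {t. poly P t = 0}" by auto
      moreover have "infinite (UNIV - {0::complex})" by (simp add: infinite_UNIV_char_0)
      ultimately have "P = 0" using poly_roots_finite finite_subset by blast
      then have "poly P 0 = 0" by simp
      then show ?thesis using Q[of 0] by (simp add: P_def poly_monom)
    qed
    have c: "A j x = A j y" for j x y using const[of j x] const[of j y] by simp
    have "A j x = 0" for j x
      using euler[of "axis j 1"] c[of j x "axis j 1"] by (simp add: dot3_axis)
    then have "pullback F (crs3 b) x = 0" for x by (simp add: vec_eq_iff A)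
    then show False using pullback_pencil_nonzero[OF F] b(1) by blast
  qed
  then have "hpoly3 1 (A j)" for j
    unfolding hpoly3_iff using scale A(1) by simp
  then have "\<forall>j. \<exists>\<alpha>. \<forall>x. A j x = dot3 \<alpha> x" using hpoly3_1_dot3 by blast
  from choice[OF this] obtain \<alpha> where \<alpha>: "\<And>j x. A j x = dot3 (\<alpha> j) x" by blast
  have q: "dot3 x (\<chi> j. dot3 (\<alpha> j) x) = 0" for x using euler[of x] by (simp add: \<alpha>)
  have z: "\<alpha> 1 $ 1 = 0" "\<alpha> 2 $ 2 = 0" "\<alpha> 3 $ 3 = 0"
    using q[of "axis 1 1"] q[of "axis 2 1"] q[of "axis 3 1"] by (simp_all add: dot3_axis)
  have w: "\<alpha> 1 $ 2 = - \<alpha> 2 $ 1" "\<alpha> 1 $ 3 = - \<alpha> 3 $ 1" "\<alpha> 2 $ 3 = - \<alpha> 3 $ 2"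
    using q[of "axis 1 1 + axis 2 1"] q[of "axis 1 1 + axis 3 1"] q[of "axis 2 1 + axis 3 1"]
    by (simp_all add: dot3_linear dot3_axis z add_eq_0_iff2 add.commute)
  define a :: "complex^3" where "a = vector [\<alpha> 3 $ 2, \<alpha> 1 $ 3, \<alpha> 2 $ 1]"
  have "A j x = crs3 a x $ j" for j x
    using exhaust_3[of j] by (auto simp: \<alpha> dot3_def a_def z w)
  then have eq: "pullback F (crs3 b) x = \<phi> x *s crs3 a x" for x by (simp add: vec_eq_iff A)
  moreover have "a \<noteq> 0"
  proof
    assume "a = 0"
    then have "pullback F (crs3 b) x = 0" for x unfolding eq by (simp add: vec3_eq_iff)
    then show False using pullback_pencil_nonzero[OF F] b(1) by blast
  qed
  ultimately show ?thesis by blast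
qed

section \<open>Local integration along two pencils\<close>

lemma deriv_zero_on_ball:
  fixes h :: "complex \<Rightarrow> complex"
  assumes "\<And>s. norm s < \<epsilon> \<Longrightarrow> (h has_field_derivative 0) (at s)" "norm s < \<epsilon>" "norm t < \<epsilon>"
  shows "h s = h t"
proof -
  have "\<exists>c. \<forall>x\<in>ball 0 \<epsilon>. h x = c"
    by (rule has_field_derivative_zero_constant[OF convex_ball])
      (use assms(1) in \<open>auto intro: has_field_derivative_at_within\<close>)
  then show ?thesis using assms(2,3) by auto
qed

text \<open>\<open>f\<close> depends on \<open>s\<close> only and \<open>g\<close> on
  \<open>t\<close> only; their common derivative \<open>\<rho>\<close> is thus independent of both
  variables.\<close>

lemma separated_derivatives:
  fixes f g \<rho> :: "complex \<Rightarrow> complex \<Rightarrow> complex"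
  assumes \<epsilon>: "\<epsilon> > 0"
    and fs: "\<And>s t. norm s < \<epsilon> \<Longrightarrow> norm t < \<epsilon> \<Longrightarrow> ((\<lambda>s. f s t) has_field_derivative \<rho> s t) (at s)"
    and ft: "\<And>s t. norm s < \<epsilon> \<Longrightarrow> norm t < \<epsilon> \<Longrightarrow> ((\<lambda>t. f s t) has_field_derivative 0) (at t)"
    and gs: "\<And>s t. norm s < \<epsilon> \<Longrightarrow> norm t < \<epsilon> \<Longrightarrow> ((\<lambda>s. g s t) has_field_derivative 0) (at s)"
    and gt: "\<And>s t. norm s < \<epsilon> \<Longrightarrow> norm t < \<epsilon> \<Longrightarrow> ((\<lambda>t. g s t) has_field_derivative \<rho> s t) (at t)"
  shows "\<exists>f0 g0 r. \<forall>s t. norm s < \<epsilon> \<and> norm t < \<epsilon> \<longrightarrow> f s t = f0 + r * s \<and> g s t = g0 + r * t"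
proof -
  have z: "norm (0::complex) < \<epsilon>" using \<epsilon> by simp
  have f0: "f s t = f s 0" if "norm s < \<epsilon>" "norm t < \<epsilon>" for s t
    by (rule deriv_zero_on_ball[OF ft]) (use that z in auto)
  have g0: "g s t = g 0 t" if "norm s < \<epsilon>" "norm t < \<epsilon>" for s t
    by (rule deriv_zero_on_ball[OF gs]) (use that z in auto)
  have 1: "\<rho> s t = \<rho> s 0" if "norm s < \<epsilon>" "norm t < \<epsilon>" for s t
  proof -
    have "((\<lambda>s. f s t) has_field_derivative \<rho> s 0) (at s)"
      by (rule has_field_derivative_transform_within_open[OF fs[OF that(1) z] open_ball[of 0 \<epsilon>]])
        (use that f0 in auto)
    then show ?thesis using DERIV_unique fs that by blast
  qed
  have 2: "\<rho> s t = \<rho> 0 t" if "norm s < \<epsilon>" "norm t < \<epsilon>" for s t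
  proof -
    have "((\<lambda>t. g s t) has_field_derivative \<rho> 0 t) (at t)"
      by (rule has_field_derivative_transform_within_open[OF gt[OF z that(2)] open_ball[of 0 \<epsilon>]])
        (use that g0 in auto)
    then show ?thesis using DERIV_unique gt that by blast
  qed
  have \<rho>: "\<rho> s t = \<rho> 0 0" if "norm s < \<epsilon>" "norm t < \<epsilon>" for s t
    using 1[OF that] 2[OF that(1) z] by simp
  have "f s 0 - \<rho> 0 0 * s = f 0 0 - \<rho> 0 0 * 0" if s: "norm s < \<epsilon>" for s
  proof (rule deriv_zero_on_ball[OF _ s z, where h="\<lambda>s. f s 0 - \<rho> 0 0 * s"])
    fix s :: complex assume s: "norm s < \<epsilon>"
    show "((\<lambda>s. f s 0 - \<rho> 0 0 * s) has_field_derivative 0) (at s)"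
      by (rule derivative_eq_intros fs[OF s z] refl)+ (simp add: \<rho>[OF s z])
  qed
  moreover have "g 0 t - \<rho> 0 0 * t = g 0 0 - \<rho> 0 0 * 0" if t: "norm t < \<epsilon>" for t
  proof (rule deriv_zero_on_ball[OF _ t z, where h="\<lambda>t. g 0 t - \<rho> 0 0 * t"])
    fix t :: complex assume t: "norm t < \<epsilon>"
    show "((\<lambda>t. g 0 t - \<rho> 0 0 * t) has_field_derivative 0) (at t)"
      by (rule derivative_eq_intros gt[OF z t] refl)+ (simp add: \<rho>[OF z t])
  qed
  ultimately have "f s t = f 0 0 + \<rho> 0 0 * s \<and> g s t = g 0 0 + \<rho> 0 0 * t" if "norm s < \<epsilon>" "norm t < \<epsilon>" for s t
    using f0[OF that] g0[OF that] that by (metis diff_add_cancel mult_zero_right diff_zero)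
  then show ?thesis by blast
qed

lemma polyfun3_locally_zero:
  assumes p: "polyfun3 p" and ev: "\<And>v. \<forall>\<^sub>F t in at 0. p (a + t *s v) = 0"
  shows "p x = 0"
proof -
  obtain Q where Q: "\<And>t. p (a + t *s (x - a)) = poly Q t" using polyfun3_line[OF p] by blast
  obtain \<delta> where \<delta>: "\<delta> > 0" "\<And>t. t \<noteq> 0 \<Longrightarrow> dist t 0 < \<delta> \<Longrightarrow> poly Q t = 0"
    using ev[of "x - a"] unfolding Q eventually_at by blast
  have "Q = 0"
  proof (rule ccontr)
    assume "Q \<noteq> 0"
    have "ball 0 \<delta> - {0} \<subseteq> {t. poly Q t = 0}" using \<delta>(2) by (auto simp: dist_commute)
    then have "finite (ball (0::complex) \<delta> - {0})" using poly_roots_finite[OF \<open>Q \<noteq> 0\<close>] finite_subset by blast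
    then have "finite (ball (0::complex) \<delta>)" by simp
    then show False using uncountable_ball[OF \<delta>(1), of "0::complex"] countable_finite by blast
  qed
  then show ?thesis using Q[of 1] by simp
qed

text \<open>If two independent pencils of lines were pulled back to pencils, then in suitable affine
  coordinates \<open>F = (f (s), g (t))\<close> with \<open>f' (s) = g' (t)\<close>, so \<open>F\<close> would be linear.\<close>
lemma two_preserved_pencils:
  assumes F: "hmap d F" "d \<ge> 2" "dominant F" "reduced F" and \<phi>: "polyfun3 \<phi>" "\<exists>x. \<phi> x \<noteq> 0"
    and hom: "\<And>t x. t \<noteq> 0 \<Longrightarrow> \<phi> (t *s x) = t ^ D * \<phi> x" "D \<ge> 2 * (d - 1)"
    and b1: "\<And>j. \<phi> pdvd (\<lambda>x. pullback F (crs3 b1) x $ j)" and b2: "\<And>j. \<phi> pdvd (\<lambda>x. pullback F (crs3 b2) x $ j)"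
    and ind: "crs3 b1 b2 \<noteq> 0"
  shows False
proof -
  have d1: "d \<ge> 1" using F(2) by simp
  have pF: "polyfun3 (\<lambda>x. F x $ i)" for i by (rule hmap_polyfun3[OF F(1)])
  have bnz: "b1 \<noteq> 0" "b2 \<noteq> 0" using ind by (auto simp: vec3_eq_iff)
  obtain a1 where a1: "a1 \<noteq> 0" "\<And>x. pullback F (crs3 b1) x = \<phi> x *s crs3 a1 x"
    using pencil_quotient[OF F(1) d1 F(3) \<phi> hom bnz(1) b1] by blast
  obtain a2 where a2: "a2 \<noteq> 0" "\<And>x. pullback F (crs3 b2) x = \<phi> x *s crs3 a2 x"
    using pencil_quotient[OF F(1) d1 F(3) \<phi> hom bnz(2) b2] by blast
  have pb_lin: "pullback F (crs3 (b + s *s c)) x = pullback F (crs3 b) x + s *s pullback F (crs3 c) x" for s b c x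
    by (simp add: vec_eq_iff pullback_crs3 dot3_linear)
  have aind: "crs3 a1 a2 \<noteq> 0"
  proof
    assume "crs3 a1 a2 = 0"
    then obtain s where s: "a1 = s *s a2" using crs3_eq_0_imp a2(1) by blast
    have "pullback F (crs3 (b1 + (- s) *s b2)) x = 0" for x
      unfolding pb_lin a1(2) a2(2) s by (simp add: vec3_eq_iff algebra_simps)
    then have "b1 + (- s) *s b2 = 0" using pullback_pencil_nonzero[OF F(1) d1 F(3)] by blast
    then have "b1 = s *s b2" by (simp add: vec_eq_iff)
    then show False using ind by (simp add: vec3_eq_iff algebra_simps)
  qed
  define l where "l = crs3 b1 b2"
  obtain n0 where n0: "dot3 l n0 \<noteq> 0" using vec3_nonzero_dot3 ind unfolding l_def by blast
  \<comment> \<open>The covectors \<open>r1, r2, l\<close> are adapted to the pencils: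
    \<open>l\<close> vanishes at \<open>b1\<close> and \<open>b2\<close>, and the normalization
    \<open>dot3 n l = 1\<close> makes \<open>crs3 l r1 = b2\<close> and
    \<open>crs3 l r2 = - b1\<close>. So the differentials of \<open>r1 / l\<close> and
    \<open>r2 / l\<close> composed with \<open>F\<close> are given by the two pull-backs.\<close>
  define n where "n = (1 / dot3 l n0) *s n0"
  have nl: "dot3 n l = 1" using n0 by (simp add: n_def dot3_linear dot3_commute)
  define r1 where "r1 = crs3 b2 n"
  define r2 where "r2 = crs3 n b1"
  have bac: "crs3 u (crs3 v w) = dot3 u w *s v - dot3 u v *s w" for u v w
    by (simp add: vec3_eq_iff dot3_def algebra_simps)
  have lb: "dot3 l b1 = 0" "dot3 l b2 = 0" by (simp_all add: l_def dot3_def algebra_simps)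
  have lr1: "crs3 l r1 = b2" unfolding r1_def bac lb using nl by (simp add: dot3_commute vec_eq_iff)
  have lr2: "crs3 l r2 = - b1" unfolding r2_def bac lb using nl by (simp add: dot3_commute vec_eq_iff)
  define f3 where "f3 x = dot3 l (F x)" for x
  have f3p: "polyfun3 f3" unfolding f3_def[abs_def] by (rule dot3_polyfun3[OF pF])
  have f3nz: "\<exists>x. f3 x \<noteq> 0"
  proof (rule ccontr)
    assume "\<not> ?thesis"
    then have "dot3 l y = 0" for y
      using dominant_polyfun3_nonzero[OF F(1) d1 F(3), of "dot3 l"] dot3_polyfun3[OF polyfun3_coord]
      unfolding f3_def by blast
    then show False using n0 by blast
  qed
  have "\<exists>p. f3 p \<noteq> 0 \<and> dot3 (crs3 a1 a2) p \<noteq> 0"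
    by (rule polyfun3_mult_nonzero[OF f3p dot3_polyfun3[OF polyfun3_coord] f3nz vec3_nonzero_dot3[OF aind]])
  then obtain p3 where p3: "f3 p3 \<noteq> 0" "dot3 (crs3 a1 a2) p3 \<noteq> 0" by blast
  define \<kappa> where "\<kappa> = dot3 (crs3 a1 a2) p3"
  \<comment> \<open>Affine coordinates around \<open>p3\<close> along \<open>a1\<close> and
    \<open>a2\<close>. Moving in the direction \<open>a1\<close> stays on a line through
    \<open>a1\<close>, so \<open>g\<close> will be constant in \<open>s\<close>, and likewise
    \<open>f\<close> in \<open>t\<close>.\<close>
  define X where "X s t = p3 + s *s a1 + t *s a2" for s t
  have X1: "X s t = (p3 + t *s a2) + s *s a1" and X2: "X s t = (p3 + s *s a1) + t *s a2" for s t
    by (simp_all add: X_def add_ac)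
  have quot: "((\<lambda>\<tau>. dot3 r (F (x + \<tau> *s v)) / f3 (x + \<tau> *s v)) has_field_derivative
      \<phi> (x + \<sigma> *s v) * dot3 v (crs3 a (x + \<sigma> *s v)) / (f3 (x + \<sigma> *s v)) ^ 2) (at \<sigma>)"
    if a: "\<And>x. pullback F (crs3 (crs3 l r)) x = \<phi> x *s crs3 a x" and nz: "f3 (x + \<sigma> *s v) \<noteq> 0" for r a x v \<sigma>
  proof -
    let ?y = "x + \<sigma> *s v"
    define g where "g x = dot3 r (F x)" for x
    have gp: "polyfun3 g" unfolding g_def[abs_def] by (rule dot3_polyfun3[OF pF])
    have "((\<lambda>\<tau>. g (x + \<tau> *s v) / f3 (x + \<tau> *s v)) has_field_derivative
       ((\<Sum>j\<in>UNIV. pd j g ?y * v $ j) * f3 ?y - g ?y * (\<Sum>j\<in>UNIV. pd j f3 ?y * v $ j)) / (f3 ?y * f3 ?y)) (at \<sigma>)"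
      by (rule DERIV_divide[OF polyfun3_deriv_line[OF gp] polyfun3_deriv_line[OF f3p] nz])
    moreover have "(\<Sum>j\<in>UNIV. pd j g ?y * v $ j) * f3 ?y - g ?y * (\<Sum>j\<in>UNIV. pd j f3 ?y * v $ j)
       = (\<Sum>j\<in>UNIV. v $ j * pullback F (crs3 (crs3 l r)) ?y $ j)"
      unfolding wronskian_pullback[OF pF, symmetric] f3_def[abs_def] g_def[abs_def]
      by (simp add: sum_3 algebra_simps)
    then have "(\<Sum>j\<in>UNIV. pd j g ?y * v $ j) * f3 ?y - g ?y * (\<Sum>j\<in>UNIV. pd j f3 ?y * v $ j)
       = \<phi> ?y * dot3 v (crs3 a ?y)"
      unfolding a by (simp add: sum_3 dot3_def algebra_simps)
    ultimately show ?thesis by (simp add: g_def power2_eq_square)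
  qed
  have q1: "pullback F (crs3 (crs3 l r1)) x = \<phi> x *s crs3 a2 x" for x unfolding lr1 by (rule a2(2))
  have q2: "pullback F (crs3 (crs3 l r2)) x = \<phi> x *s crs3 (- a1) x" for x
  proof -
    have "pullback F (crs3 (- b1)) x = - pullback F (crs3 b1) x" by (simp add: vec_eq_iff pullback_crs3 dot3_def)
    then show ?thesis unfolding lr2 a1(2) by (simp add: vec3_eq_iff algebra_simps)
  qed
  have v: "dot3 a1 (crs3 a2 (X s t)) = \<kappa>" "dot3 a2 (crs3 a2 (X s t)) = 0"
    "dot3 a1 (crs3 (- a1) (X s t)) = 0" "dot3 a2 (crs3 (- a1) (X s t)) = \<kappa>" for s t
    by (simp_all add: X_def \<kappa>_def dot3_def algebra_simps)
  define f where "f s t = dot3 r1 (F (X s t)) / f3 (X s t)" for s t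
  define g where "g s t = dot3 r2 (F (X s t)) / f3 (X s t)" for s t
  define \<rho> where "\<rho> s t = \<phi> (X s t) * \<kappa> / (f3 (X s t)) ^ 2" for s t
  have "\<exists>\<epsilon>>0. \<forall>s t. norm s < \<epsilon> \<and> norm t < \<epsilon> \<longrightarrow> f3 (X s t) \<noteq> 0"
  proof -
    have "isCont (\<lambda>st. X (fst st) (snd st)) (0, 0)"
      unfolding isCont_def X_def by (rule vec_tendstoI) (auto intro!: tendsto_eq_intros)
    then have "isCont (\<lambda>st. f3 (X (fst st) (snd st))) (0, 0)"
      by (rule isCont_o2) (rule polyfun3_isCont[OF f3p])
    then have "((\<lambda>st. f3 (X (fst st) (snd st))) \<longlongrightarrow> f3 (X 0 0)) (at (0, 0))" by (simp add: isCont_def)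
    then have "\<forall>\<^sub>F st in at (0, 0). f3 (X (fst st) (snd st)) \<noteq> 0"
      by (rule tendsto_imp_eventually_ne) (use p3 in \<open>simp add: X_def\<close>)
    then obtain \<delta> where \<delta>: "\<delta> > 0" "\<And>st. st \<noteq> (0, 0) \<Longrightarrow> dist st (0, 0) < \<delta> \<Longrightarrow> f3 (X (fst st) (snd st)) \<noteq> 0"
      unfolding eventually_at by blast
    have "f3 (X s t) \<noteq> 0" if "norm s < \<delta> / 2" "norm t < \<delta> / 2" for s t
    proof (cases "(s, t) = (0, 0)")
      case True then show ?thesis using p3 by (simp add: X_def)
    next
      case False
      have "dist (s, t) (0, 0) \<le> norm s + norm t" by (simp add: dist_norm norm_Pair sqrt_sum_squares_le_sum)
      then have "dist (s, t) (0, 0) < \<delta>" using that by simp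
      then show ?thesis using \<delta>(2)[of "(s, t)"] False by simp
    qed
    then show ?thesis using \<delta>(1) by (intro exI[of _ "\<delta> / 2"]) auto
  qed
  then obtain \<epsilon> where \<epsilon>: "\<epsilon> > 0" "\<And>s t. norm s < \<epsilon> \<Longrightarrow> norm t < \<epsilon> \<Longrightarrow> f3 (X s t) \<noteq> 0" by blast
  have "\<exists>f0 g0 r. \<forall>s t. norm s < \<epsilon> \<and> norm t < \<epsilon> \<longrightarrow> f s t = f0 + r * s \<and> g s t = g0 + r * t"
  proof (rule separated_derivatives[OF \<epsilon>(1)])
    fix s t :: complex assume st: "norm s < \<epsilon>" "norm t < \<epsilon>"
    have nz: "f3 (X s t) \<noteq> 0" by (rule \<epsilon>(2)[OF st])
    show "((\<lambda>s. f s t) has_field_derivative \<rho> s t) (at s)"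
      using quot[OF q1 nz[unfolded X1]] unfolding f_def \<rho>_def X1[symmetric] v .
    show "((\<lambda>s. g s t) has_field_derivative 0) (at s)"
      using quot[OF q2 nz[unfolded X1]] unfolding g_def X1[symmetric] v by simp
    show "((\<lambda>t. f s t) has_field_derivative 0) (at t)"
      using quot[OF q1 nz[unfolded X2]] unfolding f_def X2[symmetric] v by simp
    show "((\<lambda>t. g s t) has_field_derivative \<rho> s t) (at t)"
      using quot[OF q2 nz[unfolded X2]] unfolding g_def \<rho>_def X2[symmetric] v .
  qed
  then obtain f0 g0 r where fg: "\<And>s t. norm s < \<epsilon> \<Longrightarrow> norm t < \<epsilon> \<Longrightarrow> f s t = f0 + r * s \<and> g s t = g0 + r * t" by blast
  define c1 where "c1 = (1 / \<kappa>) *s crs3 a2 p3"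
  define c2 where "c2 = (1 / \<kappa>) *s crs3 p3 a1"
  define c3 where "c3 = (1 / \<kappa>) *s crs3 a1 a2"
  have \<kappa>0: "\<kappa> \<noteq> 0" using p3 by (simp add: \<kappa>_def)
  have cp: "dot3 c1 p3 = 0" "dot3 c2 p3 = 0" "dot3 c3 p3 = 1"
    using \<kappa>0 by (simp_all add: c1_def c2_def c3_def dot3_linear \<kappa>_def[symmetric]) (simp_all add: dot3_def algebra_simps)
  have decomp: "x = dot3 c3 x *s p3 + dot3 c1 x *s a1 + dot3 c2 x *s a2" for x
  proof -
    have "\<kappa> *s x = dot3 (crs3 a1 a2) x *s p3 + dot3 (crs3 a2 p3) x *s a1 + dot3 (crs3 p3 a1) x *s a2"
      unfolding \<kappa>_def by (simp add: vec3_eq_iff dot3_def algebra_simps)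
    then have "(1 / \<kappa>) *s (\<kappa> *s x) = (1 / \<kappa>) *s (dot3 (crs3 a1 a2) x *s p3 + dot3 (crs3 a2 p3) x *s a1 + dot3 (crs3 p3 a1) x *s a2)"
      by simp
    then show ?thesis using \<kappa>0 by (simp add: c1_def c2_def c3_def dot3_linear vec_eq_iff algebra_simps add_divide_distrib)
  qed
  \<comment> \<open>Homogenizations of \<open>f0 + r s\<close> and \<open>g0 + r t\<close>, where
    \<open>s = c1 / c3\<close> and \<open>t = c2 / c3\<close> in the basis dual to
    \<open>a1, a2, p3\<close>.\<close>
  define L1 where "L1 = f0 *s c3 + r *s c1"
  define L2 where "L2 = g0 *s c3 + r *s c2"
  have Xz: "x = dot3 c3 x *s X (dot3 c1 x / dot3 c3 x) (dot3 c2 x / dot3 c3 x)" if "dot3 c3 x \<noteq> 0" for x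
    by (subst decomp[of x]) (use that in \<open>simp add: X_def vec_eq_iff algebra_simps\<close>)
  have local: "dot3 r1 (F x) * dot3 c3 x = dot3 L1 x * f3 x \<and> dot3 r2 (F x) * dot3 c3 x = dot3 L2 x * f3 x"
    if z: "dot3 c3 x \<noteq> 0" and s: "norm (dot3 c1 x / dot3 c3 x) < \<epsilon>" and t: "norm (dot3 c2 x / dot3 c3 x) < \<epsilon>" for x
  proof -
    define Y where "Y = X (dot3 c1 x / dot3 c3 x) (dot3 c2 x / dot3 c3 x)"
    have nz: "f3 Y \<noteq> 0" unfolding Y_def by (rule \<epsilon>(2)[OF s t])
    have Fx: "F x = (dot3 c3 x) ^ d *s F Y"
      by (subst Xz[OF z]) (simp add: hmap_homogeneous[OF F(1)] Y_def[symmetric])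
    have clear: "a * z = (u * z + v * b) * c" if "a / c = u + v * (b / z)" "c \<noteq> 0" "z \<noteq> 0" for a b c u v z :: complex
    proof -
      have "a = (u + v * (b / z)) * c" using that by (metis nonzero_divide_eq_eq)
      then show ?thesis using that(3) by (simp add: algebra_simps)
    qed
    have fr: "dot3 r1 (F Y) / f3 Y = f0 + r * (dot3 c1 x / dot3 c3 x)" "dot3 r2 (F Y) / f3 Y = g0 + r * (dot3 c2 x / dot3 c3 x)"
      using fg[OF s t] unfolding f_def g_def Y_def[symmetric] by blast+
    have "dot3 r1 (F Y) * dot3 c3 x = (f0 * dot3 c3 x + r * dot3 c1 x) * f3 Y"
      "dot3 r2 (F Y) * dot3 c3 x = (g0 * dot3 c3 x + r * dot3 c2 x) * f3 Y"
      by (rule clear[OF fr(1) nz z], rule clear[OF fr(2) nz z])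
    then show ?thesis unfolding f3_def Fx dot3_linear L1_def L2_def by (simp add: f3_def mult_ac)
  qed
  have near: "\<forall>\<^sub>F \<tau> in at 0. dot3 c3 (p3 + \<tau> *s v) \<noteq> 0 \<and> norm (dot3 c1 (p3 + \<tau> *s v) / dot3 c3 (p3 + \<tau> *s v)) < \<epsilon>
     \<and> norm (dot3 c2 (p3 + \<tau> *s v) / dot3 c3 (p3 + \<tau> *s v)) < \<epsilon>" for v
  proof -
    have l: "((\<lambda>\<tau>. dot3 c (p3 + \<tau> *s v)) \<longlongrightarrow> dot3 c p3) (at 0)" for c
      by (rule polyfun3_line_tendsto[OF dot3_polyfun3[OF polyfun3_coord]])
    have 1: "\<forall>\<^sub>F \<tau> in at 0. dot3 c3 (p3 + \<tau> *s v) \<noteq> 0"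
      by (rule tendsto_imp_eventually_ne[OF l]) (simp add: cp)
    have "((\<lambda>\<tau>. norm (dot3 c1 (p3 + \<tau> *s v) / dot3 c3 (p3 + \<tau> *s v))) \<longlongrightarrow> norm (dot3 c1 p3 / dot3 c3 p3)) (at 0)"
      by (intro tendsto_norm tendsto_divide l) (simp add: cp)
    then have 2: "\<forall>\<^sub>F \<tau> in at 0. norm (dot3 c1 (p3 + \<tau> *s v) / dot3 c3 (p3 + \<tau> *s v)) < \<epsilon>"
      by (rule order_tendstoD(2)) (simp add: cp \<epsilon>)
    have "((\<lambda>\<tau>. norm (dot3 c2 (p3 + \<tau> *s v) / dot3 c3 (p3 + \<tau> *s v))) \<longlongrightarrow> norm (dot3 c2 p3 / dot3 c3 p3)) (at 0)"
      by (intro tendsto_norm tendsto_divide l) (simp add: cp)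
    then have 3: "\<forall>\<^sub>F \<tau> in at 0. norm (dot3 c2 (p3 + \<tau> *s v) / dot3 c3 (p3 + \<tau> *s v)) < \<epsilon>"
      by (rule order_tendstoD(2)) (simp add: cp \<epsilon>)
    from 1 2 3 show ?thesis by eventually_elim blast
  qed
  have pd: "polyfun3 (\<lambda>x. dot3 c x)" for c by (rule dot3_polyfun3[OF polyfun3_coord])
  \<comment> \<open>The identity holds for points near \<open>p3\<close> on every line through
    \<open>p3\<close>, hence everywhere.\<close>
  have G1: "dot3 r1 (F x) * dot3 c3 x - dot3 L1 x * f3 x = 0" for x
    by (rule polyfun3_locally_zero[where p="\<lambda>x. dot3 r1 (F x) * dot3 c3 x - dot3 L1 x * f3 x" and a=p3],
        intro polyfun3_intros pd f3p dot3_polyfun3[OF pF])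
      (use near in eventually_elim, use local in auto)
  have G2: "dot3 r2 (F x) * dot3 c3 x - dot3 L2 x * f3 x = 0" for x
    by (rule polyfun3_locally_zero[where p="\<lambda>x. dot3 r2 (F x) * dot3 c3 x - dot3 L2 x * f3 x" and a=p3],
        intro polyfun3_intros pd f3p dot3_polyfun3[OF pF])
      (use near in eventually_elim, use local in auto)
  define R :: "complex^3^3" where "R = vector [r1, r2, l]"
  have R: "R $ 1 = r1" "R $ 2 = r2" "R $ 3 = l" by (simp_all add: R_def)
  have "det R = 1"
  proof -
    have "det R = dot3 l (crs3 r1 r2)" unfolding det3_dot3 R by (simp add: dot3_def algebra_simps)
    also have "\<dots> = dot3 (crs3 l r1) r2" by (simp add: dot3_def algebra_simps)
    also have "\<dots> = dot3 b2 (crs3 n b1)" by (simp only: lr1 r2_def)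
    also have "\<dots> = dot3 n l" by (simp add: l_def dot3_def algebra_simps)
    finally show ?thesis by (simp add: nl)
  qed
  then have iR: "invertible R" by (simp add: invertible_det_nz)
  define N :: "complex^3^3" where "N = vector [L1, L2, c3]"
  have N: "N $ 1 = L1" "N $ 2 = L2" "N $ 3 = c3" by (simp_all add: N_def)
  define H where "H x = R *v F x" for x
  have hH: "hmap d H" unfolding H_def[abs_def] by (rule hmap_matrix[OF F(1)])
  have hN: "hmap 1 (\<lambda>x. N *v x)" by (rule hmap_matrix[OF hmap_id])
  have Hc: "H x $ 1 = dot3 r1 (F x)" "H x $ 2 = dot3 r2 (F x)" "H x $ 3 = f3 x" for x
    by (simp_all add: H_def matrix_vector_dot3 R f3_def)
  have Nc: "(N *v x) $ 1 = dot3 L1 x" "(N *v x) $ 2 = dot3 L2 x" "(N *v x) $ 3 = dot3 c3 x" for x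
    by (simp_all add: matrix_vector_dot3 N)
  have c3nz: "\<exists>x. dot3 c3 x \<noteq> 0" using cp(3) by (metis zero_neq_one)
  have cross: "dot3 L1 x * dot3 r2 (F x) = dot3 L2 x * dot3 r1 (F x)" for x
  proof (rule polyfun3_mult_cancel[where p="\<lambda>x. dot3 L1 x * dot3 r2 (F x)"
        and q="\<lambda>x. dot3 L2 x * dot3 r1 (F x)", OF _ _ pd c3nz])
    show "polyfun3 (\<lambda>x. dot3 L1 x * dot3 r2 (F x))" "polyfun3 (\<lambda>x. dot3 L2 x * dot3 r1 (F x))"
      by (intro polyfun3_intros pd dot3_polyfun3[OF pF])+
    show "dot3 c3 x * (dot3 L1 x * dot3 r2 (F x)) = dot3 c3 x * (dot3 L2 x * dot3 r1 (F x))" for x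
    proof -
      have "dot3 c3 x * (dot3 L1 x * dot3 r2 (F x)) = dot3 L1 x * (dot3 r2 (F x) * dot3 c3 x)" by (simp add: mult_ac)
      also have "\<dots> = dot3 L2 x * (dot3 L1 x * f3 x)" using G2[of x] by (simp add: mult_ac)
      also have "\<dots> = dot3 L2 x * (dot3 r1 (F x) * dot3 c3 x)" using G1[of x] by simp
      finally show ?thesis by (simp add: mult_ac)
    qed
  qed
  \<comment> \<open>\<open>R F\<close> is reduced and proportional to the linear map
    \<open>N\<close>, so \<open>N\<close> is a polynomial multiple of it and
    \<open>d \<le> 1\<close>.\<close>
  have "proportional (\<lambda>x. N *v x) H"
    unfolding proportional_def
  proof (intro allI)
    fix x i j
    have g: "dot3 r1 (F x) * dot3 c3 x = dot3 L1 x * f3 x" "dot3 r2 (F x) * dot3 c3 x = dot3 L2 x * f3 x"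
      using G1[of x] G2[of x] by simp_all
    show "(N *v x) $ i * H x $ j = (N *v x) $ j * H x $ i"
      using exhaust_3[of i] exhaust_3[of j] g cross[of x] by (auto simp: Nc Hc mult.commute)
  qed
  then obtain \<rho>' where \<rho>': "polyfun3 \<rho>'" "\<And>x. N *v x = \<rho>' x *s H x"
    using reduced_quotient[OF hmap_polyfun3[OF hN] hmap_polyfun3[OF hH]] reduced_matrix[OF F(4) iR]
    unfolding H_def[abs_def] by blast
  have "d \<le> 1"
  proof (rule quotient_degree_le[OF \<rho>'(1) hN hH \<rho>'(2)])
    show "\<exists>x. N *v x \<noteq> 0" using c3nz Nc(3) by (metis zero_index)
  qed
  then show False using F(2) by simp
qed

text \<open>If every invertible \<open>M\<close> were bad, the case \<open>M = mat 1\<close> would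
  give an actual eigenform, which makes \<open>\<phi>\<close> homogeneous of degree
  \<open>(k + 1) * (d - 1)\<close>. As \<open>k \<ge> 1\<close>, this reaches the bound
  \<open>2 * (d - 1)\<close> required by \<open>pencil_quotient\<close>.\<close>

lemma good_matrix_exists:
  assumes F: "hmap d F" "d \<ge> 2" "dominant F" "reduced F" and \<phi>: "polyfun3 \<phi>" "\<exists>x. \<phi> x \<noteq> 0" and k: "k \<ge> 1"
  shows "\<exists>M. invertible M \<and> \<not> bad_matrix F \<phi> k M"
proof (rule ccontr)
  assume "\<not> ?thesis"
  then have bad: "\<And>M. invertible M \<Longrightarrow> bad_matrix F \<phi> k M" by blast
  have d1: "d \<ge> 1" using F(2) by simp
  have pF: "polyfun3 (\<lambda>x. F x $ i)" for i by (rule hmap_polyfun3[OF F(1)])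
  have "invertible (mat 1 :: complex^3^3)" by (simp add: invertible_det_nz)
  from bad[OF this] obtain w c where w: "hmap k w" "\<exists>x. w x \<noteq> 0"
    "\<And>x. pullback F w x = (c * \<phi> x) *s w x" unfolding bad_matrix_def by auto
  have c: "c \<noteq> 0"
  proof
    assume "c = 0"
    then have "w (F x) = 0" for x
      by (intro pullback_nonzero[OF pF dominant_jac_nonzero[OF F(1) d1 F(3)] hmap_polyfun3[OF w(1)]])
        (simp add: w(3))
    then have "w y $ i = 0" for y i
      using dominant_polyfun3_nonzero[OF F(1) d1 F(3) hmap_polyfun3[OF w(1)]] by simp
    then show False using w(2) by (simp add: vec_eq_iff)
  qed
  obtain i where i: "\<exists>x. w x $ i \<noteq> 0" using w(2) by (metis vec_eq_iff zero_index)
  have hom: "\<phi> (t *s x) = t ^ ((k + 1) * (d - 1)) * \<phi> x" if t: "t \<noteq> 0" for t x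
  proof -
    have "\<phi> (t *s x) - t ^ ((k + 1) * (d - 1)) * \<phi> x = 0" for x
    proof (rule polyfun3_zero_off[OF _ hmap_polyfun3[OF w(1)] i, where p="\<lambda>x. \<phi> (t *s x) - t ^ ((k + 1) * (d - 1)) * \<phi> x"])
      show "polyfun3 (\<lambda>x. \<phi> (t *s x) - t ^ ((k + 1) * (d - 1)) * \<phi> x)"
        by (intro polyfun3_intros \<phi> polyfun3_compose[OF \<phi>(1), of "\<lambda>x. t *s x"]) (simp, intro polyfun3_intros)
      fix x assume x: "w x $ i \<noteq> 0"
      have "t *s pullback F w (t *s x) = t ^ (d * k + d) *s pullback F w x"
        by (rule pullback_homogeneous[OF F(1) hmap_homogeneous[OF w(1)] t])
      then have "t * (c * \<phi> (t *s x) * (t ^ k * w x $ i)) = t ^ (d * k + d) * (c * \<phi> x * w x $ i)"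
        unfolding w(3) hmap_homogeneous[OF w(1)] by (metis vector_smult_component)
      moreover have "t ^ (d * k + d) = t * t ^ k * t ^ ((k + 1) * (d - 1))"
      proof -
        have "d * k + d = Suc (k + (k + 1) * (d - 1))" using d1 by (cases d) auto
        then show ?thesis by (simp add: power_add)
      qed
      ultimately have "(c * w x $ i * t * t ^ k) * \<phi> (t *s x) = (c * w x $ i * t * t ^ k) * (t ^ ((k + 1) * (d - 1)) * \<phi> x)"
        by (simp add: mult_ac)
      then show "\<phi> (t *s x) - t ^ ((k + 1) * (d - 1)) * \<phi> x = 0" using c x t by simp
    qed
    then show ?thesis by simp
  qed
  have D: "2 * (d - 1) \<le> (k + 1) * (d - 1)" using k by (intro mult_right_mono) auto
  have "axis 1 1 \<noteq> (0 :: complex^3)" by (simp add: axis_eq_0_iff)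
  from preserved_pencil[OF F(1) d1 F(3,4) \<phi> bad this]
  obtain b1 where b1: "b1 \<noteq> 0" "\<And>j. \<phi> pdvd (\<lambda>x. pullback F (crs3 b1) x $ j)" by blast
  \<comment> \<open>The second base point lies on a line that avoids \<open>b1\<close>, so the two
    base points differ.\<close>
  from preserved_pencil[OF F(1) d1 F(3,4) \<phi> bad b1(1)]
  obtain y b2 where b2: "b2 \<noteq> 0" "dot3 b2 y = 0" "dot3 y b1 \<noteq> 0" "\<And>j. \<phi> pdvd (\<lambda>x. pullback F (crs3 b2) x $ j)" by blast
  have "crs3 b1 b2 \<noteq> 0"
  proof
    assume "crs3 b1 b2 = 0"
    then obtain s where "b1 = s *s b2" using crs3_eq_0_imp b2(1) by blast
    then show False using b2(2,3) by (simp add: dot3_linear dot3_commute)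
  qed
  from two_preserved_pencils[OF F \<phi> hom D b1(2) b2(4) this] show False .
qed

theorem theoremB:
  fixes F :: "complex^3 \<Rightarrow> complex^3" and d :: nat
  assumes "ratmap d F" and "reduced F" and "dominant F"
    and "topdeg F = d" and "d \<ge> 2"
  shows "\<exists>P :: nat \<Rightarrow> (complex^3^3 \<Rightarrow> complex).
     (\<forall>k. (\<exists>m. mhpoly m (P k)) \<and> (\<exists>M. invertible M \<and> P k M \<noteq> 0)) \<and>
     (\<forall>M :: complex^3^3. invertible M \<and> (\<forall>k. P k M \<noteq> 0) \<longrightarrow>
        alg_stable (\<lambda>x. M *v F x) \<and>
        dyn_deg1 (\<lambda>x. M *v F x) = real (topdeg (\<lambda>x. M *v F x)) \<and>
        \<not> (\<exists>w. foliation_form w \<and> invariant_foliation (\<lambda>x. M *v F x) w))"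
proof -
  have F: "hmap d F" using assms(1) by (simp add: ratmap_hmap)
  have d1: "d \<ge> 1" using assms(5) by simp
  have J: "\<exists>x. jac F x \<noteq> 0" by (rule dominant_jac_nonzero[OF F d1 assms(3)])
  from contracted_points_finite[OF F assms(2) J] obtain B where B0: "finite B \<and> 0 \<notin> B \<and>
    (\<forall>p u. p \<noteq> 0 \<and> pprime u \<and> (\<forall>i. u pdvd (\<lambda>x. crs3 (F x) p $ i)) \<longrightarrow> (\<exists>b\<in>B. \<exists>t. t \<noteq> 0 \<and> p = t *s b))" ..
  have B: "finite B" "0 \<notin> B" using B0 by simp_all
  have contr: "\<exists>b\<in>B. \<exists>t. t \<noteq> 0 \<and> p = t *s b"
    if "p \<noteq> 0" "pprime u" "\<And>i. u pdvd (\<lambda>x. crs3 (F x) p $ i)" for p u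
    using conjunct2[OF conjunct2[OF B0], rule_format, of p u] that by simp
  from countable_divisor_classes[OF polyfun3_jac[OF hmap_polyfun3[OF F]] J]
  obtain D where "countable D \<and> (\<forall>\<psi>\<in>D. polyfun3 \<psi> \<and> (\<exists>x. \<psi> x \<noteq> 0)) \<and>
    (\<forall>\<phi>. polyfun3 \<phi> \<and> (\<exists>x. \<phi> x \<noteq> 0) \<and> (\<forall>u. pprime u \<and> u pdvd \<phi> \<longrightarrow> u pdvd jac F) \<longrightarrow>
      (\<exists>\<psi>\<in>D. \<exists>c. c \<noteq> 0 \<and> (\<forall>x. \<phi> x = c * \<psi> x)))" ..
  then have D: "countable D" "\<And>\<psi>. \<psi> \<in> D \<Longrightarrow> polyfun3 \<psi> \<and> (\<exists>x. \<psi> x \<noteq> 0)"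
    "\<And>\<phi>. polyfun3 \<phi> \<Longrightarrow> \<exists>x. \<phi> x \<noteq> 0 \<Longrightarrow> (\<And>u. pprime u \<Longrightarrow> u pdvd \<phi> \<Longrightarrow> u pdvd jac F) \<Longrightarrow>
       \<exists>\<psi>\<in>D. \<exists>c. c \<noteq> 0 \<and> (\<forall>x. \<phi> x = c * \<psi> x)"
    by simp_all
  define good where "good P \<longleftrightarrow> (\<exists>m. mhpoly m P) \<and> (\<exists>M. invertible M \<and> P M \<noteq> 0)" for P :: "complex^3^3 \<Rightarrow> complex"
  have "\<forall>bm\<in>B \<times> (UNIV :: nat set). \<exists>P. good P \<and> (\<forall>M. P M \<noteq> 0 \<longrightarrow> F (((\<lambda>x. M *v F x) ^^ snd bm) (M *v fst bm)) \<noteq> 0)"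
  proof
    fix bm assume "bm \<in> B \<times> (UNIV :: nat set)"
    then have "fst bm \<noteq> 0" using B(2) by auto
    from orbit_polynomial[OF F assms(2) this, of "snd bm"]
    obtain P k M where P: "mhpoly k P" "P M \<noteq> 0" "\<forall>M. P M \<noteq> 0 \<longrightarrow> F (((\<lambda>x. M *v F x) ^^ snd bm) (M *v fst bm)) \<noteq> 0"
      by (elim exE conjE)
    then show "\<exists>P. good P \<and> (\<forall>M. P M \<noteq> 0 \<longrightarrow> F (((\<lambda>x. M *v F x) ^^ snd bm) (M *v fst bm)) \<noteq> 0)"
      using mhpoly_invertible_nonzero[OF P(1,2)] unfolding good_def by blast
  qed
  from bchoice[OF this] obtain P1 where P1': "\<forall>bm\<in>B \<times> UNIV. good (P1 bm) \<and>
    (\<forall>M. P1 bm M \<noteq> 0 \<longrightarrow> F (((\<lambda>x. M *v F x) ^^ snd bm) (M *v fst bm)) \<noteq> 0)" ..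
  have P1: "\<And>b m. b \<in> B \<Longrightarrow> good (P1 (b, m))"
    "\<And>b m M. b \<in> B \<Longrightarrow> P1 (b, m) M \<noteq> 0 \<Longrightarrow> F (((\<lambda>x. M *v F x) ^^ m) (M *v b)) \<noteq> 0"
    using bspec[OF P1', of "(_, _)"] by simp_all
  \<comment> \<open>The degrees start at 1, as \<open>good_matrix_exists\<close> demands and
    \<open>foliation_form\<close> provides.\<close>
  have "\<forall>k\<psi>\<in>{1..} \<times> D. \<exists>P. good P \<and> (\<forall>M. bad_matrix F (snd k\<psi>) (fst k\<psi>) M \<longrightarrow> P M = 0)"
  proof
    fix k\<psi> assume k\<psi>: "k\<psi> \<in> {1::nat..} \<times> D"
    then have \<psi>: "polyfun3 (snd k\<psi>)" "\<exists>x. snd k\<psi> x \<noteq> 0" and k: "fst k\<psi> \<ge> 1" using D(2) by auto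
    obtain M0 where M0: "\<not> bad_matrix F (snd k\<psi>) (fst k\<psi>) M0"
      using good_matrix_exists[OF F assms(5,3,2) \<psi> k] by blast
    from bad_matrix_polynomial[OF F \<psi> M0]
    obtain P n where P: "mhpoly n P" "P M0 \<noteq> 0" "\<forall>M. bad_matrix F (snd k\<psi>) (fst k\<psi>) M \<longrightarrow> P M = 0"
      by (elim exE conjE)
    then show "\<exists>P. good P \<and> (\<forall>M. bad_matrix F (snd k\<psi>) (fst k\<psi>) M \<longrightarrow> P M = 0)"
      using mhpoly_invertible_nonzero[OF P(1,2)] unfolding good_def by blast
  qed
  from bchoice[OF this] obtain P2 where P2': "\<forall>k\<psi>\<in>{1..} \<times> D. good (P2 k\<psi>) \<and>
    (\<forall>M. bad_matrix F (snd k\<psi>) (fst k\<psi>) M \<longrightarrow> P2 k\<psi> M = 0)" ..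
  have P2: "\<And>k \<psi>. k \<ge> 1 \<Longrightarrow> \<psi> \<in> D \<Longrightarrow> good (P2 (k, \<psi>))"
    "\<And>k \<psi> M. k \<ge> 1 \<Longrightarrow> \<psi> \<in> D \<Longrightarrow> bad_matrix F \<psi> k M \<Longrightarrow> P2 (k, \<psi>) M = 0"
    using bspec[OF P2', of "(_, _)"] by simp_all
  \<comment> \<open>The constant 1 makes \<open>Q\<close> nonempty, so that
    \<open>from_nat_into\<close> enumerates exactly \<open>Q\<close>.\<close>
  define Q where "Q = insert (\<lambda>_. 1) (P1 ` (B \<times> UNIV) \<union> P2 ` ({1..} \<times> D))"
  have "good (\<lambda>_. 1)"
    unfolding good_def using mhpoly_const by (auto intro: exI[of _ "mat 1"] simp: invertible_det_nz)
  then have goodQ: "good P" if "P \<in> Q" for P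
    using that P1(1) P2(1) by (auto simp: Q_def)
  have "countable Q"
    unfolding Q_def using B(1) D(1) by (intro countable_insert countable_Un countable_image countable_SIGMA) (auto intro: countable_finite)
  moreover have "Q \<noteq> {}" by (simp add: Q_def)
  ultimately have range: "range (from_nat_into Q) = Q" by (rule range_from_nat_into[rotated])
  show ?thesis
  proof (rule exI[of _ "from_nat_into Q"], intro conjI allI impI)
    show "\<exists>m. mhpoly m (from_nat_into Q k)" "\<exists>M. invertible M \<and> from_nat_into Q k M \<noteq> 0" for k
      using goodQ[of "from_nat_into Q k"] range unfolding good_def by auto
  next
    fix M :: "complex^3^3" assume M: "invertible M \<and> (\<forall>k. from_nat_into Q k M \<noteq> 0)"
    have PM: "P M \<noteq> 0" if "P \<in> Q" for P
    proof -
      have "P \<in> range (from_nat_into Q)" unfolding range by (rule that)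
      then obtain k where k: "P = from_nat_into Q k" by (rule rangeE)
      show ?thesis unfolding k by (rule spec[OF conjunct2[OF M]])
    qed
    let ?f = "\<lambda>x. M *v F x"
    have orb: "F ((?f ^^ m) (M *v b)) \<noteq> 0" if "b \<in> B" for b m
      using P1(2)[OF that] PM[of "P1 (b, m)"] that by (auto simp: Q_def)
    have it: "hmap (d ^ n) (?f ^^ n)" "reduced (?f ^^ n)" for n
      using iterate_reduced[where M=M and n=n and B=B, OF F assms(2) d1 conjunct1[OF M]] contr orb by simp_all
    have deg: "alg_deg (?f ^^ n) = d ^ n" for n
      by (rule alg_deg_eq) (use it reduced_nonzero in \<open>auto simp: ratmap_hmap\<close>)
    have deg1: "alg_deg ?f = d" using deg[of 1] by simp
    show "alg_stable ?f" unfolding alg_stable_def deg deg1 by simp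
    \<comment> \<open>The sequence equals \<open>d\<close> for every \<open>n > 0\<close>; at
      \<open>n = 0\<close> the exponent \<open>1 / real n\<close> is 0.\<close>
    have "(\<lambda>n. real (alg_deg (?f ^^ n)) powr (1 / real n)) \<longlonglongrightarrow> real d"
    proof (rule tendsto_eventually)
      show "\<forall>\<^sub>F n in sequentially. real (alg_deg (?f ^^ n)) powr (1 / real n) = real d"
        using eventually_gt_at_top[of 0]
      proof eventually_elim
        case (elim n)
        have "real (alg_deg (?f ^^ n)) = real d powr real n" using d1 by (simp add: deg powr_realpow)
        then show ?case using elim d1 by (simp add: powr_powr)
      qed
    qed
    then show "dyn_deg1 ?f = real (topdeg ?f)"
      unfolding dyn_deg1_def using topdeg_matrix[of M F] M assms(4) by (simp add: limI)
    show "\<not> (\<exists>w. foliation_form w \<and> invariant_foliation ?f w)"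
    proof
      assume "\<exists>w. foliation_form w \<and> invariant_foliation ?f w"
      then obtain w k where w: "k \<ge> 1" "ratmap k w" "reduced w" "\<And>x. (\<Sum>i\<in>UNIV. x $ i * w x $ i) = 0"
        "invariant_foliation ?f w" unfolding foliation_form_def by blast
      have hw: "hmap k w" "\<exists>x. w x \<noteq> 0" using w(2) by (auto simp: ratmap_hmap)
      obtain \<phi> where \<phi>: "polyfun3 \<phi>" "\<exists>x. \<phi> x \<noteq> 0" "\<And>x. pullback ?f w x = \<phi> x *s w x"
        "\<And>u. pprime u \<Longrightarrow> u pdvd \<phi> \<Longrightarrow> u pdvd jac F"
        using invariant_cofactor[OF F conjunct1[OF M] hw(1) w(3,5)] by metis
      obtain \<psi> c where \<psi>: "\<psi> \<in> D" "\<And>x. \<phi> x = c * \<psi> x" using D(3)[OF \<phi>(1,2,4)] by blast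
      have "bad_matrix F \<psi> k M"
        unfolding bad_matrix_def using hw w(4) \<phi>(3) \<psi>(2) by (intro exI[of _ w] exI[of _ c]) (simp add: dot3_sum)
      then have "P2 (k, \<psi>) M = 0" by (rule P2(2)[OF w(1) \<psi>(1)])
      moreover have "P2 (k, \<psi>) \<in> Q" using w(1) \<psi>(1) by (auto simp: Q_def)
      ultimately show False using PM by blast
    qed
  qed
qed

end
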